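(* Let $H$ be a finite-dimensional Hopf algebra. The functor $$\mathfrak E'_R:\mathfrak{YD}^{rr}(H,\widehat H)\to\mathfrak{Alg}^{\mathcal T_R(H)},\qquad(X,\alpha,\beta)\mapsto(X,\gamma=(\alpha\otimes\mathrm{id})\beta),\qquad f\mapsto f,$$ is an equivalence of categories. Moreover, the following assignments, all acting as the identity on morphisms, form a commutative square of equivalences of categories: $\mathfrak{YD}^{rr}(H,\widehat H)\to\mathfrak{Alg}^{\mathcal T_R(H)}$, $(X,\alpha,\beta)\mapsto(X,\gamma)$; $\mathfrak{Alg}^{\mathcal T_R(H)}\to{}_{\mathcal D_R(H)}\mathfrak{Alg}$, $(X,\gamma)\mapsto(X,\rhd_\gamma)$; $\mathfrak{YD}^{rr}(H,\widehat H)\to{}_H\mathfrak{YD}^H$, $(X,\alpha,\beta)\mapsto(X,\rhd_\beta,\alpha)$; and ${}_H\mathfrak{YD}^H\to{}_{\mathcal D_R(H)}\mathfrak{Alg}$, $(X,\rhd,\alpha)\mapsto(X,\cdot)$ with $(\omega\bowtie h)\cdot x=y_{[0]}\,\mathbf p(y_{[1]},\omega)$, where $y=h\rhd x$ and $\alpha(y)=y_{[0]}\otimes y_{[1]}^{\mathrm{op}}$.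
   Context: $\Bbbk$ is a field, algebras are unital $\Bbbk$-algebras. $H$ has structure maps $\Delta,\varepsilon,S$ ($S$ bijective), with Sweedler notation; $\widehat H$ is the dual Hopf algebra (coproduct $\widehat\Delta$) and $\mathbf p(h,\theta)=\theta(h)$, with $\mathbf p(h,\theta\theta')=\mathbf p(h_{(1)},\theta)\mathbf p(h_{(2)},\theta')$, $\mathbf p(hh',\theta)=\mathbf p(h,\theta_{(1)})\mathbf p(h',\theta_{(2)})$. $H^{\mathrm{op}}$ is the Hopf algebra with opposite product (elements $h^{\mathrm{op}}$) and the same coproduct. For dual bases $(h_i)$, $(\widehat h_i)$, ${}^{\circ}U=\sum_ih_i^{\mathrm{op}}\otimes\widehat h_i\in H^{\mathrm{op}}\otimes\widehat H$, which is invertible. $\mathrm{Ad}(W)(z)=WzW^{-1}$; $\Sigma$ is the flip. Right coactions of a Hopf algebra $K$ on an algebra $X$ are coassociative and counital algebra homomorphisms $X\to X\otimes K$; left actions are left $K$-module algebra structures. ${}_K\mathfrak{Alg}$ is the category of left $K$-module algebras and $\mathfrak{Alg}^K$ that of right $K$-comodule algebras, with morphisms the algebra homomorphisms commuting with the (co)actions. Every right coaction $\gamma$ of $K$ induces the left action $\omega\rhd_\gamma x=(\mathrm{id}\otimes\omega)(\gamma(x))$ of the dual Hopf algebra of $K$. $\mathfrak{YD}^{rr}(H,\widehat H)$: objects are triples $(X,\alpha,\beta)$ with right coactions $\alpha:X\to X\otimes H^{\mathrm{op}}$ of $H^{\mathrm{op}}$ and $\beta:X\to X\otimes\widehat H$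 of $\widehat H$ such that $(\alpha\otimes\mathrm{id})\beta=(\mathrm{id}_X\otimes\mathrm{Ad}({}^{\circ}U)^{-1})(\mathrm{id}_X\otimes\Sigma)(\beta\otimes\mathrm{id})\alpha$; morphisms are algebra homomorphisms intertwining both coactions. ${}_H\mathfrak{YD}^H$: objects are triples $(X,\rhd,\alpha)$ with $\rhd$ a left action of $H$ and $\alpha:X\to X\otimes H^{\mathrm{op}}$, $\alpha(x)=x_{[0]}\otimes x_{[1]}^{\mathrm{op}}$, a right coaction of $H^{\mathrm{op}}$ such that $(h_{(1)}\rhd x_{[0]})\otimes h_{(2)}x_{[1]}=(h_{(2)}\rhd x)_{[0]}\otimes(h_{(2)}\rhd x)_{[1]}h_{(1)}$; morphisms are algebra homomorphisms intertwining action and coaction. $h\rhd_\beta x=(\mathrm{id}\otimes\mathbf p(h,\cdot))(\beta(x))$. $\mathcal T_R(H)=H^{\mathrm{op}}\otimes\widehat H$ (Drinfeld codouble) is the Hopf algebra with the tensor product algebra structure and coproduct $(\mathrm{id}\otimes\Sigma\,\mathrm{Ad}({}^{\circ}U)\otimes\mathrm{id})(\Delta_{H^{\mathrm{op}}}\otimes\widehat\Delta)$. $\mathcal D_R(H)=\widehat H^{\mathrm{co}}\bowtie H$ (Radford's form of the Drinfeld double) is its dual Hopf algebra, with underlying space $\widehat H\otimes H$ and pairing $(\omega\bowtie h,\ g^{\mathrm{op}}\otimes\theta)\mapsto\mathbf p(g,\omega)\mathbf p(h,\theta)$. *)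

theory Defs
  imports "HOL-Algebra.Module" "HOL-Algebra.Free_Abelian_Groups"
begin

section \<open>Tensor products over a field\<close>

text \<open>
  Vector spaces and algebras over a field \<open>K\<close> are HOL-Algebra modules; the ring part of a
  \<^typ>\<open>('k, 'a) module\<close> record is the multiplication of the algebra.

  \<open>V \<otimes> W\<close> is the free abelian group on \<open>V \<times> W\<close> modulo the balanced biadditivity relations, so its
  elements are cosets of formal integer combinations of pairs.
\<close>

type_synonym ('a, 'b) tens = "('a \<times> 'b \<Rightarrow>\<^sub>0 int) set"

definition tensor_rels ::
  "('k, 'l) ring_scheme \<Rightarrow> ('k, 'a, 'm) module_scheme \<Rightarrow> ('k, 'b, 'n) module_scheme \<Rightarrow> ('a, 'b) tens" where
  "tensor_rels K V W =
     {frag_of (x \<oplus>\<^bsub>V\<^esub> x', y) - frag_of (x, y) - frag_of (x', y) | x x' y.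
        x \<in> carrier V \<and> x' \<in> carrier V \<and> y \<in> carrier W} \<union>
     {frag_of (x, y \<oplus>\<^bsub>W\<^esub> y') - frag_of (x, y) - frag_of (x, y') | x y y'.
        x \<in> carrier V \<and> y \<in> carrier W \<and> y' \<in> carrier W} \<union>
     {frag_of (c \<odot>\<^bsub>V\<^esub> x, y) - frag_of (x, c \<odot>\<^bsub>W\<^esub> y) | c x y.
        c \<in> carrier K \<and> x \<in> carrier V \<and> y \<in> carrier W}"

abbreviation free_on ::
  "('k, 'a, 'm) module_scheme \<Rightarrow> ('k, 'b, 'n) module_scheme \<Rightarrow> ('a \<times> 'b \<Rightarrow>\<^sub>0 int) monoid" where
  "free_on V W \<equiv> free_Abelian_group (carrier V \<times> carrier W)"

definition tensor_null ::
  "('k, 'l) ring_scheme \<Rightarrow> ('k, 'a, 'm) module_scheme \<Rightarrow> ('k, 'b, 'n) module_scheme \<Rightarrow> ('a, 'b) tens" where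
  "tensor_null K V W = generate (free_on V W) (tensor_rels K V W)"

definition tensor_group ::
  "('k, 'l) ring_scheme \<Rightarrow> ('k, 'a, 'm) module_scheme \<Rightarrow> ('k, 'b, 'n) module_scheme
    \<Rightarrow> ('a, 'b) tens monoid" where
  "tensor_group K V W = free_on V W Mod tensor_null K V W"

definition pure ::
  "('k, 'l) ring_scheme \<Rightarrow> ('k, 'a, 'm) module_scheme \<Rightarrow> ('k, 'b, 'n) module_scheme
    \<Rightarrow> 'a \<Rightarrow> 'b \<Rightarrow> ('a, 'b) tens" where
  "pure K V W x y = tensor_null K V W #>\<^bsub>free_on V W\<^esub> frag_of (x, y)"

text \<open>
  The homomorphism \<open>V \<otimes> W \<rightarrow> G\<close> induced by \<open>f\<close>, evaluated on a representative of the coset. The value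
  is independent of the representative whenever \<open>f\<close> is biadditive and balanced, which is the case in
  every use below; \<open>tlift Z (\<lambda>x y. \<dots>) t\<close> is then Sweedler notation for \<open>\<Sum> \<dots>\<close> with \<open>t = \<Sum> x \<otimes> y\<close>.
\<close>

definition glift :: "('g, 'm) monoid_scheme \<Rightarrow> ('a \<Rightarrow> 'b \<Rightarrow> 'g) \<Rightarrow> ('a, 'b) tens \<Rightarrow> 'g" where
  "glift G f t = (let p = (SOME p. p \<in> t) in
     finprod G (\<lambda>z. f (fst z) (snd z) [^]\<^bsub>G\<^esub> Poly_Mapping.lookup p z) (Poly_Mapping.keys p))"

definition tlift :: "('z, 'm) ring_scheme \<Rightarrow> ('a \<Rightarrow> 'b \<Rightarrow> 'z) \<Rightarrow> ('a, 'b) tens \<Rightarrow> 'z" where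
  "tlift Z f t = glift (add_monoid Z) f t"

definition tensor ::
  "('k, 'l) ring_scheme \<Rightarrow> ('k, 'a, 'm) module_scheme \<Rightarrow> ('k, 'b, 'n) module_scheme
    \<Rightarrow> ('k, ('a, 'b) tens) module" where
  "tensor K V W =
     \<lparr> carrier = carrier (tensor_group K V W),
       monoid.mult = (\<lambda>s t. glift (tensor_group K V W) (\<lambda>x y.
                 glift (tensor_group K V W) (\<lambda>x' y'. pure K V W (x \<otimes>\<^bsub>V\<^esub> x') (y \<otimes>\<^bsub>W\<^esub> y')) t) s),
       monoid.one = pure K V W \<one>\<^bsub>V\<^esub> \<one>\<^bsub>W\<^esub>,
       ring.zero = \<one>\<^bsub>tensor_group K V W\<^esub>,
       ring.add = monoid.mult (tensor_group K V W),
       smult = (\<lambda>c t. glift (tensor_group K V W) (\<lambda>x y. pure K V W (c \<odot>\<^bsub>V\<^esub> x) y) t) \<rparr>"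

text \<open>\<open>f \<otimes> g\<close>, where \<open>V\<close> and \<open>W\<close> are the codomains of \<open>f\<close> and \<open>g\<close>.\<close>

definition tmap ::
  "('k, 'l) ring_scheme \<Rightarrow> ('k, 'c, 'm) module_scheme \<Rightarrow> ('k, 'd, 'n) module_scheme
    \<Rightarrow> ('a \<Rightarrow> 'c) \<Rightarrow> ('b \<Rightarrow> 'd) \<Rightarrow> ('a, 'b) tens \<Rightarrow> ('c, 'd) tens" where
  "tmap K V W f g t = tlift (tensor K V W) (\<lambda>x y. pure K V W (f x) (g y)) t"

text \<open>\<open>V \<otimes> W \<rightarrow> W \<otimes> V\<close>.\<close>

definition tflip ::
  "('k, 'l) ring_scheme \<Rightarrow> ('k, 'a, 'm) module_scheme \<Rightarrow> ('k, 'b, 'n) module_scheme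
    \<Rightarrow> ('a, 'b) tens \<Rightarrow> ('b, 'a) tens" where
  "tflip K V W t = tlift (tensor K W V) (\<lambda>x y. pure K W V y x) t"

text \<open>\<open>(U \<otimes> V) \<otimes> W \<rightarrow> U \<otimes> (V \<otimes> W)\<close>.\<close>

definition tassoc ::
  "('k, 'l) ring_scheme \<Rightarrow> ('k, 'a, 'm) module_scheme \<Rightarrow> ('k, 'b, 'n) module_scheme
    \<Rightarrow> ('k, 'c, 'p) module_scheme \<Rightarrow> (('a, 'b) tens, 'c) tens \<Rightarrow> ('a, ('b, 'c) tens) tens" where
  "tassoc K U V W t =
     tlift (tensor K U (tensor K V W)) (\<lambda>s z.
       tlift (tensor K U (tensor K V W)) (\<lambda>x y.
         pure K U (tensor K V W) x (pure K V W y z)) s) t"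

text \<open>
  For \<open>\<phi> : B \<otimes> C \<rightarrow> B' \<otimes> C'\<close>, this is the map \<open>id \<otimes> \<phi> \<otimes> id\<close>, bracketed as
  \<open>(A \<otimes> B) \<otimes> (C \<otimes> D) \<rightarrow> (A \<otimes> B') \<otimes> (C' \<otimes> D)\<close>.
\<close>

definition tmid ::
  "('k, 'l) ring_scheme \<Rightarrow> ('k, 'a, 'm1) module_scheme \<Rightarrow> ('k, 'b, 'm2) module_scheme
    \<Rightarrow> ('k, 'c, 'm3) module_scheme \<Rightarrow> ('k, 'd, 'm4) module_scheme
    \<Rightarrow> ('k, 'b1, 'm5) module_scheme \<Rightarrow> ('k, 'c1, 'm6) module_scheme
    \<Rightarrow> (('b, 'c) tens \<Rightarrow> ('b1, 'c1) tens)
    \<Rightarrow> (('a, 'b) tens, ('c, 'd) tens) tens \<Rightarrow> (('a, 'b1) tens, ('c1, 'd) tens) tens" where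
  "tmid K A B C D B' C' \<phi> w =
     (let Z = tensor K (tensor K A B') (tensor K C' D) in
      tlift Z (\<lambda>s t.
        tlift Z (\<lambda>a b. tlift Z (\<lambda>c d.
          tlift Z (\<lambda>b' c'. pure K (tensor K A B') (tensor K C' D) (pure K A B' a b') (pure K C' D c' d))
            (\<phi> (pure K B C b c))) t) s) w)"


section \<open>Algebras and Hopf algebras\<close>

locale unital_algebra = module K A + A?: ring A for K (structure) and A (structure) +
  assumes smult_mult_left:
    "\<lbrakk>c \<in> carrier K; x \<in> carrier A; y \<in> carrier A\<rbrakk> \<Longrightarrow> (c \<odot>\<^bsub>A\<^esub> x) \<otimes>\<^bsub>A\<^esub> y = c \<odot>\<^bsub>A\<^esub> (x \<otimes>\<^bsub>A\<^esub> y)"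
  and smult_mult_right:
    "\<lbrakk>c \<in> carrier K; x \<in> carrier A; y \<in> carrier A\<rbrakk> \<Longrightarrow> x \<otimes>\<^bsub>A\<^esub> (c \<odot>\<^bsub>A\<^esub> y) = c \<odot>\<^bsub>A\<^esub> (x \<otimes>\<^bsub>A\<^esub> y)"

definition linear_maps ::
  "('k, 'l) ring_scheme \<Rightarrow> ('k, 'a, 'm) module_scheme \<Rightarrow> ('k, 'b, 'n) module_scheme \<Rightarrow> ('a \<Rightarrow> 'b) set" where
  "linear_maps K V W = {f \<in> carrier V \<rightarrow> carrier W.
     (\<forall>x\<in>carrier V. \<forall>y\<in>carrier V. f (x \<oplus>\<^bsub>V\<^esub> y) = f x \<oplus>\<^bsub>W\<^esub> f y) \<and>
     (\<forall>c\<in>carrier K. \<forall>x\<in>carrier V. f (c \<odot>\<^bsub>V\<^esub> x) = c \<odot>\<^bsub>W\<^esub> f x)}"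

definition alg_hom ::
  "('k, 'l) ring_scheme \<Rightarrow> ('k, 'a, 'm) module_scheme \<Rightarrow> ('k, 'b, 'n) module_scheme \<Rightarrow> ('a \<Rightarrow> 'b) set" where
  "alg_hom K A B = ring_hom A B \<inter> linear_maps K A B"

text \<open>The field as an algebra over itself.\<close>

definition ground :: "('k, 'l) ring_scheme \<Rightarrow> ('k, 'k) module" where
  "ground K = \<lparr> carrier = carrier K, monoid.mult = monoid.mult K, monoid.one = monoid.one K, ring.zero = ring.zero K, ring.add = ring.add K,
                smult = monoid.mult K \<rparr>"

text \<open>
  The antipode of a bialgebra is unique when it exists, so it is not part of the record; it is a
  parameter of the locale \<open>hopf_algebra\<close>.
\<close>

record ('k, 'a) bialgebra = "('k, 'a) module" +
  comult :: "'a \<Rightarrow> ('a, 'a) tens"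
  counit :: "'a \<Rightarrow> 'k"

definition with_coalgebra ::
  "('k, 'a, 'm) module_scheme \<Rightarrow> ('a \<Rightarrow> ('a, 'a) tens) \<Rightarrow> ('a \<Rightarrow> 'k) \<Rightarrow> ('k, 'a) bialgebra" where
  "with_coalgebra A \<Delta> \<epsilon> =
     \<lparr> carrier = carrier A, monoid.mult = monoid.mult A, monoid.one = monoid.one A, ring.zero = ring.zero A, ring.add = ring.add A, smult = smult A,
       comult = \<Delta>, counit = \<epsilon> \<rparr>"

locale bialg = unital_algebra K H for K (structure) and H :: "('k, 'h, 'm) bialgebra_scheme" (structure) +
  assumes comult_hom: "comult H \<in> alg_hom K H (tensor K H H)"
    and counit_hom: "counit H \<in> alg_hom K H (ground K)"
    and coassociative: "h \<in> carrier H \<Longrightarrow>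
      tassoc K H H H (tmap K (tensor K H H) H (comult H) id (comult H h)) =
      tmap K H (tensor K H H) id (comult H) (comult H h)"
    and counital_left: "h \<in> carrier H \<Longrightarrow> tlift H (\<lambda>a b. counit H a \<odot>\<^bsub>H\<^esub> b) (comult H h) = h"
    and counital_right: "h \<in> carrier H \<Longrightarrow> tlift H (\<lambda>a b. counit H b \<odot>\<^bsub>H\<^esub> a) (comult H h) = h"

locale hopf_algebra = bialg K H for K (structure) and H :: "('k, 'h, 'm) bialgebra_scheme" (structure)
    and S :: "'h \<Rightarrow> 'h" +
  assumes antipode_linear: "S \<in> linear_maps K H H"
    and antipode_bij: "bij_betw S (carrier H) (carrier H)"
    and antipode_left: "h \<in> carrier H \<Longrightarrow>
      tlift H (\<lambda>a b. S a \<otimes>\<^bsub>H\<^esub> b) (comult H h) = counit H h \<odot>\<^bsub>H\<^esub> \<one>\<^bsub>H\<^esub>"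
    and antipode_right: "h \<in> carrier H \<Longrightarrow>
      tlift H (\<lambda>a b. a \<otimes>\<^bsub>H\<^esub> S b) (comult H h) = counit H h \<odot>\<^bsub>H\<^esub> \<one>\<^bsub>H\<^esub>"

definition is_basis ::
  "('k, 'l) ring_scheme \<Rightarrow> ('k, 'a, 'm) module_scheme \<Rightarrow> nat \<Rightarrow> (nat \<Rightarrow> 'a) \<Rightarrow> bool" where
  "is_basis K V n e \<longleftrightarrow> e \<in> {..<n} \<rightarrow> carrier V \<and>
     (\<forall>v\<in>carrier V. \<exists>!c. c \<in> {..<n} \<rightarrow>\<^sub>E carrier K \<and> v = (\<Oplus>\<^bsub>V\<^esub>i\<in>{..<n}. c i \<odot>\<^bsub>V\<^esub> e i))"

definition finite_dimensional ::
  "('k, 'l) ring_scheme \<Rightarrow> ('k, 'a, 'm) module_scheme \<Rightarrow> bool" where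
  "finite_dimensional K V \<longleftrightarrow> (\<exists>n e. is_basis K V n e)"

text \<open>\<open>H\<^sup>o\<^sup>p\<close> has the same elements as \<open>H\<close>: \<open>h\<^sup>o\<^sup>p\<close> is written \<open>h\<close>.\<close>

definition opp :: "('k, 'h) bialgebra \<Rightarrow> ('k, 'h) bialgebra" where
  "opp H = H\<lparr>monoid.mult := (\<lambda>x y. y \<otimes>\<^bsub>H\<^esub> x)\<rparr>"

text \<open>
  The dual Hopf algebra of a finite-dimensional Hopf algebra. Functionals are extensional, so that a
  functional is determined by its values on the carrier.
\<close>

definition dual_alg :: "('k, 'l) ring_scheme \<Rightarrow> ('k, 'h) bialgebra \<Rightarrow> ('k, 'h \<Rightarrow> 'k) module" where
  "dual_alg K H =
     \<lparr> carrier = linear_maps K H (ground K) \<inter> extensional (carrier H),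
       monoid.mult = (\<lambda>\<theta> \<theta>'. \<lambda>h\<in>carrier H. tlift K (\<lambda>h1 h2. \<theta> h1 \<otimes>\<^bsub>K\<^esub> \<theta>' h2) (comult H h)),
       monoid.one = (\<lambda>h\<in>carrier H. counit H h),
       ring.zero = (\<lambda>h\<in>carrier H. \<zero>\<^bsub>K\<^esub>),
       ring.add = (\<lambda>\<theta> \<theta>'. \<lambda>h\<in>carrier H. \<theta> h \<oplus>\<^bsub>K\<^esub> \<theta>' h),
       smult = (\<lambda>c \<theta>. \<lambda>h\<in>carrier H. c \<otimes>\<^bsub>K\<^esub> \<theta> h) \<rparr>"

definition dual :: "('k, 'l) ring_scheme \<Rightarrow> ('k, 'h) bialgebra \<Rightarrow> ('k, 'h \<Rightarrow> 'k) bialgebra" where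
  "dual K H = with_coalgebra (dual_alg K H)
     (\<lambda>\<theta>. THE t. t \<in> carrier (tensor K (dual_alg K H) (dual_alg K H)) \<and>
        (\<forall>h\<in>carrier H. \<forall>h'\<in>carrier H. \<theta> (h \<otimes>\<^bsub>H\<^esub> h') = tlift K (\<lambda>\<theta>1 \<theta>2. \<theta>1 h \<otimes>\<^bsub>K\<^esub> \<theta>2 h') t))
     (\<lambda>\<theta>. \<theta> \<one>\<^bsub>H\<^esub>)"


section \<open>Drinfeld codouble and double\<close>

abbreviation op_dual :: "('k, 'l) ring_scheme \<Rightarrow> ('k, 'h) bialgebra \<Rightarrow> ('k, ('h, 'h \<Rightarrow> 'k) tens) module" where
  "op_dual K H \<equiv> tensor K (opp H) (dual K H)"

definition dual_bases ::
  "('k, 'l) ring_scheme \<Rightarrow> ('k, 'h) bialgebra \<Rightarrow> nat \<Rightarrow> (nat \<Rightarrow> 'h) \<Rightarrow> (nat \<Rightarrow> 'h \<Rightarrow> 'k) \<Rightarrow> bool" where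
  "dual_bases K H n e d \<longleftrightarrow> is_basis K H n e \<and> d \<in> {..<n} \<rightarrow> carrier (dual K H) \<and>
     (\<forall>i<n. \<forall>j<n. d i (e j) = (if i = j then \<one>\<^bsub>K\<^esub> else \<zero>\<^bsub>K\<^esub>))"

text \<open>The canonical element \<open>\<^sup>\<circ>U\<close>; the sum is the same for all pairs of dual bases.\<close>

definition canU :: "('k, 'l) ring_scheme \<Rightarrow> ('k, 'h) bialgebra \<Rightarrow> ('h, 'h \<Rightarrow> 'k) tens" where
  "canU K H = (SOME u. \<exists>n e d. dual_bases K H n e d \<and>
     u = (\<Oplus>\<^bsub>op_dual K H\<^esub>i\<in>{..<n}. pure K (opp H) (dual K H) (e i) (d i)))"

definition Ad :: "('a, 'm) monoid_scheme \<Rightarrow> 'a \<Rightarrow> 'a \<Rightarrow> 'a" where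
  "Ad A W z = W \<otimes>\<^bsub>A\<^esub> z \<otimes>\<^bsub>A\<^esub> inv\<^bsub>A\<^esub> W"

definition Ad_inv :: "('a, 'm) monoid_scheme \<Rightarrow> 'a \<Rightarrow> 'a \<Rightarrow> 'a" where
  "Ad_inv A W z = inv\<^bsub>A\<^esub> W \<otimes>\<^bsub>A\<^esub> z \<otimes>\<^bsub>A\<^esub> W"

definition codouble ::
  "('k, 'l) ring_scheme \<Rightarrow> ('k, 'h) bialgebra \<Rightarrow> ('k, ('h, 'h \<Rightarrow> 'k) tens) bialgebra" where
  "codouble K H = with_coalgebra (op_dual K H)
     (\<lambda>t. tmid K (opp H) (opp H) (dual K H) (dual K H) (dual K H) (opp H)
        (\<lambda>z. tflip K (opp H) (dual K H) (Ad (op_dual K H) (canU K H) z))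
        (tmap K (tensor K (opp H) (opp H)) (tensor K (dual K H) (dual K H))
           (comult (opp H)) (comult (dual K H)) t))
     (tlift K (\<lambda>g \<theta>. counit (opp H) g \<otimes>\<^bsub>K\<^esub> counit (dual K H) \<theta>))"

text \<open>The pairing \<open>(\<omega> \<bowtie> h, g\<^sup>o\<^sup>p \<otimes> \<theta>) \<mapsto> p(g, \<omega>) p(h, \<theta>)\<close>.\<close>

definition pairing ::
  "('k, 'l) ring_scheme \<Rightarrow> ('h \<Rightarrow> 'k, 'h) tens \<Rightarrow> ('h, 'h \<Rightarrow> 'k) tens \<Rightarrow> 'k" where
  "pairing K u t = tlift K (\<lambda>\<omega> h. tlift K (\<lambda>g \<theta>. \<omega> g \<otimes>\<^bsub>K\<^esub> \<theta> h) t) u"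

text \<open>The dual Hopf algebra of the codouble, transported to \<open>dual H \<otimes> H\<close> along the pairing.\<close>

definition double ::
  "('k, 'l) ring_scheme \<Rightarrow> ('k, 'h) bialgebra \<Rightarrow> ('k, ('h \<Rightarrow> 'k, 'h) tens) bialgebra" where
  "double K H =
     (let V = tensor K (dual K H) H;
          T' = dual K (codouble K H);
          P = (\<lambda>u. \<lambda>t\<in>carrier (codouble K H). pairing K u t);
          Q = inv_into (carrier V) P
      in with_coalgebra
           (V\<lparr>monoid.mult := (\<lambda>u v. Q (P u \<otimes>\<^bsub>T'\<^esub> P v)), monoid.one := Q \<one>\<^bsub>T'\<^esub>\<rparr>)
           (\<lambda>u. tmap K V V Q Q (comult T' (P u)))
           (\<lambda>u. counit T' (P u)))"


section \<open>Actions and coactions\<close>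

text \<open>Actions and coactions are extensional, so that they are determined by their values on the carriers.\<close>

definition right_coaction ::
  "('k, 'l) ring_scheme \<Rightarrow> ('k, 'a) bialgebra \<Rightarrow> ('k, 'x) module \<Rightarrow> ('x \<Rightarrow> ('x, 'a) tens) \<Rightarrow> bool" where
  "right_coaction K A X \<gamma> \<longleftrightarrow>
     \<gamma> \<in> alg_hom K X (tensor K X A) \<inter> extensional (carrier X) \<and>
     (\<forall>x\<in>carrier X. tassoc K X A A (tmap K (tensor K X A) A \<gamma> id (\<gamma> x)) =
                     tmap K X (tensor K A A) id (comult A) (\<gamma> x)) \<and>
     (\<forall>x\<in>carrier X. tlift X (\<lambda>y a. counit A a \<odot>\<^bsub>X\<^esub> y) (\<gamma> x) = x)"

definition left_action ::
  "('k, 'l) ring_scheme \<Rightarrow> ('k, 'a) bialgebra \<Rightarrow> ('k, 'x) module \<Rightarrow> ('a \<Rightarrow> 'x \<Rightarrow> 'x) \<Rightarrow> bool" where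
  "left_action K A X act \<longleftrightarrow>
     act \<in> carrier A \<rightarrow>\<^sub>E (carrier X \<rightarrow>\<^sub>E carrier X) \<and>
     (\<forall>a\<in>carrier A. act a \<in> linear_maps K X X) \<and>
     (\<forall>x\<in>carrier X. (\<lambda>a. act a x) \<in> linear_maps K A X) \<and>
     (\<forall>x\<in>carrier X. act \<one>\<^bsub>A\<^esub> x = x) \<and>
     (\<forall>a\<in>carrier A. \<forall>b\<in>carrier A. \<forall>x\<in>carrier X. act (a \<otimes>\<^bsub>A\<^esub> b) x = act a (act b x)) \<and>
     (\<forall>a\<in>carrier A. \<forall>x\<in>carrier X. \<forall>y\<in>carrier X.
        act a (x \<otimes>\<^bsub>X\<^esub> y) = tlift X (\<lambda>a1 a2. act a1 x \<otimes>\<^bsub>X\<^esub> act a2 y) (comult A a)) \<and>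
     (\<forall>a\<in>carrier A. act a \<one>\<^bsub>X\<^esub> = counit A a \<odot>\<^bsub>X\<^esub> \<one>\<^bsub>X\<^esub>)"

text \<open>
  The action of \<open>D\<close> on \<open>X\<close> induced by a coaction \<open>\<gamma>\<close> of a bialgebra in duality with \<open>D\<close> via \<open>p\<close>.
\<close>

definition induced_action ::
  "('k, 'd) bialgebra \<Rightarrow> ('d \<Rightarrow> 'a \<Rightarrow> 'k) \<Rightarrow> ('k, 'x) module \<Rightarrow> ('x \<Rightarrow> ('x, 'a) tens) \<Rightarrow> 'd \<Rightarrow> 'x \<Rightarrow> 'x" where
  "induced_action D p X \<gamma> =
     (\<lambda>u\<in>carrier D. \<lambda>x\<in>carrier X. tlift X (\<lambda>y a. p u a \<odot>\<^bsub>X\<^esub> y) (\<gamma> x))"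

definition coaction_hom ::
  "('k, 'l) ring_scheme \<Rightarrow> ('k, 'a) bialgebra \<Rightarrow> ('k, 'x) module \<Rightarrow> ('x \<Rightarrow> ('x, 'a) tens)
    \<Rightarrow> ('k, 'y) module \<Rightarrow> ('y \<Rightarrow> ('y, 'a) tens) \<Rightarrow> ('x \<Rightarrow> 'y) \<Rightarrow> bool" where
  "coaction_hom K A X \<gamma> Y \<delta> f \<longleftrightarrow> (\<forall>x\<in>carrier X. \<delta> (f x) = tmap K Y A f id (\<gamma> x))"

definition action_hom ::
  "('k, 'a) bialgebra \<Rightarrow> ('k, 'x) module \<Rightarrow> ('a \<Rightarrow> 'x \<Rightarrow> 'x) \<Rightarrow> ('a \<Rightarrow> 'y \<Rightarrow> 'y) \<Rightarrow> ('x \<Rightarrow> 'y) \<Rightarrow> bool" where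
  "action_hom A X act act' f \<longleftrightarrow> (\<forall>a\<in>carrier A. \<forall>x\<in>carrier X. f (act a x) = act' a (f x))"


section \<open>Categories\<close>

text \<open>Hom-sets for different objects need not be disjoint, so composition takes its three objects as arguments.\<close>

record ('o, 'm) category =
  Ob :: "'o set"
  Mor :: "'o \<Rightarrow> 'o \<Rightarrow> 'm set"
  Ident :: "'o \<Rightarrow> 'm"
  Cmp :: "'o \<Rightarrow> 'o \<Rightarrow> 'o \<Rightarrow> 'm \<Rightarrow> 'm \<Rightarrow> 'm"

definition is_category :: "('o, 'm) category \<Rightarrow> bool" where
  "is_category C \<longleftrightarrow>
     (\<forall>A\<in>Ob C. Ident C A \<in> Mor C A A) \<and>
     (\<forall>A\<in>Ob C. \<forall>B\<in>Ob C. \<forall>D\<in>Ob C. \<forall>f\<in>Mor C A B. \<forall>g\<in>Mor C B D. Cmp C A B D g f \<in> Mor C A D) \<and>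
     (\<forall>A\<in>Ob C. \<forall>B\<in>Ob C. \<forall>f\<in>Mor C A B.
        Cmp C A A B f (Ident C A) = f \<and> Cmp C A B B (Ident C B) f = f) \<and>
     (\<forall>A\<in>Ob C. \<forall>B\<in>Ob C. \<forall>D\<in>Ob C. \<forall>E\<in>Ob C. \<forall>f\<in>Mor C A B. \<forall>g\<in>Mor C B D. \<forall>h\<in>Mor C D E.
        Cmp C A D E h (Cmp C A B D g f) = Cmp C A B E (Cmp C B D E h g) f)"

type_synonym ('o, 'm, 'p, 'n) funct = "('o \<Rightarrow> 'p) \<times> ('o \<Rightarrow> 'o \<Rightarrow> 'm \<Rightarrow> 'n)"

definition is_functor :: "('o, 'm) category \<Rightarrow> ('p, 'n) category \<Rightarrow> ('o, 'm, 'p, 'n) funct \<Rightarrow> bool" where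
  "is_functor C D F \<longleftrightarrow> is_category C \<and> is_category D \<and>
     (\<forall>A\<in>Ob C. fst F A \<in> Ob D) \<and>
     (\<forall>A\<in>Ob C. \<forall>B\<in>Ob C. \<forall>f\<in>Mor C A B. snd F A B f \<in> Mor D (fst F A) (fst F B)) \<and>
     (\<forall>A\<in>Ob C. snd F A A (Ident C A) = Ident D (fst F A)) \<and>
     (\<forall>A\<in>Ob C. \<forall>B\<in>Ob C. \<forall>E\<in>Ob C. \<forall>f\<in>Mor C A B. \<forall>g\<in>Mor C B E.
        snd F A E (Cmp C A B E g f) =
        Cmp D (fst F A) (fst F B) (fst F E) (snd F B E g) (snd F A B f))"

definition id_functor :: "('o, 'm, 'o, 'm) funct" where
  "id_functor = ((\<lambda>A. A), (\<lambda>A B f. f))"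

definition comp_functor ::
  "('p, 'n, 'q, 'r) funct \<Rightarrow> ('o, 'm, 'p, 'n) funct \<Rightarrow> ('o, 'm, 'q, 'r) funct" where
  "comp_functor G F = ((\<lambda>A. fst G (fst F A)), (\<lambda>A B f. snd G (fst F A) (fst F B) (snd F A B f)))"

definition equal_functors ::
  "('o, 'm) category \<Rightarrow> ('o, 'm, 'p, 'n) funct \<Rightarrow> ('o, 'm, 'p, 'n) funct \<Rightarrow> bool" where
  "equal_functors C F G \<longleftrightarrow> (\<forall>A\<in>Ob C. fst F A = fst G A) \<and>
     (\<forall>A\<in>Ob C. \<forall>B\<in>Ob C. \<forall>f\<in>Mor C A B. snd F A B f = snd G A B f)"

definition is_iso :: "('o, 'm) category \<Rightarrow> 'o \<Rightarrow> 'o \<Rightarrow> 'm \<Rightarrow> bool" where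
  "is_iso C A B f \<longleftrightarrow> f \<in> Mor C A B \<and>
     (\<exists>g\<in>Mor C B A. Cmp C A B A g f = Ident C A \<and> Cmp C B A B f g = Ident C B)"

definition naturally_isomorphic ::
  "('o, 'm) category \<Rightarrow> ('p, 'n) category \<Rightarrow> ('o, 'm, 'p, 'n) funct \<Rightarrow> ('o, 'm, 'p, 'n) funct \<Rightarrow> bool" where
  "naturally_isomorphic C D F G \<longleftrightarrow> (\<exists>\<eta>.
     (\<forall>A\<in>Ob C. is_iso D (fst F A) (fst G A) (\<eta> A)) \<and>
     (\<forall>A\<in>Ob C. \<forall>B\<in>Ob C. \<forall>f\<in>Mor C A B.
        Cmp D (fst F A) (fst F B) (fst G B) (\<eta> B) (snd F A B f) =
        Cmp D (fst F A) (fst G A) (fst G B) (snd G A B f) (\<eta> A)))"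

definition is_equivalence ::
  "('o, 'm) category \<Rightarrow> ('p, 'n) category \<Rightarrow> ('o, 'm, 'p, 'n) funct \<Rightarrow> bool" where
  "is_equivalence C D F \<longleftrightarrow> is_functor C D F \<and>
     (\<exists>G. is_functor D C G \<and>
          naturally_isomorphic C C (comp_functor G F) id_functor \<and>
          naturally_isomorphic D D (comp_functor F G) id_functor)"

text \<open>
  A category whose objects are tuples with first component an algebra, and whose morphisms are the
  algebra homomorphisms, as extensional functions, satisfying \<open>R\<close>.
\<close>

definition category_of_algebras ::
  "('k, 'l) ring_scheme \<Rightarrow> (('k, 'x) module \<times> 's) set
    \<Rightarrow> (('k, 'x) module \<times> 's \<Rightarrow> ('k, 'x) module \<times> 's \<Rightarrow> ('x \<Rightarrow> 'x) \<Rightarrow> bool)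
    \<Rightarrow> (('k, 'x) module \<times> 's, 'x \<Rightarrow> 'x) category" where
  "category_of_algebras K Obs R =
     \<lparr> Ob = {A \<in> Obs. unital_algebra K (fst A)},
       Mor = (\<lambda>A B. {f \<in> alg_hom K (fst A) (fst B) \<inter> extensional (carrier (fst A)). R A B f}),
       Ident = (\<lambda>A. \<lambda>x\<in>carrier (fst A). x),
       Cmp = (\<lambda>A B C g f. compose (carrier (fst A)) g f) \<rparr>"

type_synonym ('k, 'x, 'a) comod_alg = "('k, 'x) module \<times> ('x \<Rightarrow> ('x, 'a) tens)"
type_synonym ('k, 'x, 'a) mod_alg = "('k, 'x) module \<times> ('a \<Rightarrow> 'x \<Rightarrow> 'x)"
type_synonym ('k, 'x, 'h) yd_rr =
  "('k, 'x) module \<times> ('x \<Rightarrow> ('x, 'h) tens) \<times> ('x \<Rightarrow> ('x, 'h \<Rightarrow> 'k) tens)"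
type_synonym ('k, 'x, 'h) yd =
  "('k, 'x) module \<times> ('h \<Rightarrow> 'x \<Rightarrow> 'x) \<times> ('x \<Rightarrow> ('x, 'h) tens)"

definition Alg_comod ::
  "('k, 'l) ring_scheme \<Rightarrow> ('k, 'a) bialgebra \<Rightarrow> (('k, 'x, 'a) comod_alg, 'x \<Rightarrow> 'x) category" where
  "Alg_comod K A = category_of_algebras K
     {(X, \<gamma>). right_coaction K A X \<gamma>}
     (\<lambda>(X, \<gamma>) (Y, \<delta>) f. coaction_hom K A X \<gamma> Y \<delta> f)"

definition Alg_mod ::
  "('k, 'l) ring_scheme \<Rightarrow> ('k, 'a) bialgebra \<Rightarrow> (('k, 'x, 'a) mod_alg, 'x \<Rightarrow> 'x) category" where
  "Alg_mod K A = category_of_algebras K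
     {(X, act). left_action K A X act}
     (\<lambda>(X, act) (Y, act') f. action_hom A X act act' f)"

text \<open>\<open>(\<alpha> \<otimes> id)\<beta>\<close>, with values in \<open>X \<otimes> (H\<^sup>o\<^sup>p \<otimes> dual H)\<close>.\<close>

definition joint_coaction ::
  "('k, 'l) ring_scheme \<Rightarrow> ('k, 'h) bialgebra \<Rightarrow> ('k, 'x) module \<Rightarrow> ('x \<Rightarrow> ('x, 'h) tens)
    \<Rightarrow> ('x \<Rightarrow> ('x, 'h \<Rightarrow> 'k) tens) \<Rightarrow> 'x \<Rightarrow> ('x, ('h, 'h \<Rightarrow> 'k) tens) tens" where
  "joint_coaction K H X \<alpha> \<beta> = (\<lambda>x\<in>carrier X.
     tassoc K X (opp H) (dual K H) (tmap K (tensor K X (opp H)) (dual K H) \<alpha> id (\<beta> x)))"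

definition yd_rr_compatible ::
  "('k, 'l) ring_scheme \<Rightarrow> ('k, 'h) bialgebra \<Rightarrow> ('k, 'x) module \<Rightarrow> ('x \<Rightarrow> ('x, 'h) tens)
    \<Rightarrow> ('x \<Rightarrow> ('x, 'h \<Rightarrow> 'k) tens) \<Rightarrow> bool" where
  "yd_rr_compatible K H X \<alpha> \<beta> \<longleftrightarrow> (\<forall>x\<in>carrier X.
     joint_coaction K H X \<alpha> \<beta> x =
       tmap K X (op_dual K H) id (Ad_inv (op_dual K H) (canU K H))
         (tmap K X (op_dual K H) id (tflip K (dual K H) (opp H))
           (tassoc K X (dual K H) (opp H)
             (tmap K (tensor K X (dual K H)) (opp H) \<beta> id (\<alpha> x)))))"

definition YD_rr ::
  "('k, 'l) ring_scheme \<Rightarrow> ('k, 'h) bialgebra \<Rightarrow> (('k, 'x, 'h) yd_rr, 'x \<Rightarrow> 'x) category" where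
  "YD_rr K H = category_of_algebras K
     {(X, \<alpha>, \<beta>). right_coaction K (opp H) X \<alpha> \<and> right_coaction K (dual K H) X \<beta> \<and>
                  yd_rr_compatible K H X \<alpha> \<beta>}
     (\<lambda>(X, \<alpha>, \<beta>) (Y, \<alpha>', \<beta>') f.
        coaction_hom K (opp H) X \<alpha> Y \<alpha>' f \<and> coaction_hom K (dual K H) X \<beta> Y \<beta>' f)"

text \<open>\<open>(h\<^sub>(\<^sub>1\<^sub>) \<rhd> x\<^sub>[\<^sub>0\<^sub>]) \<otimes> h\<^sub>(\<^sub>2\<^sub>) x\<^sub>[\<^sub>1\<^sub>] = (h\<^sub>(\<^sub>2\<^sub>) \<rhd> x)\<^sub>[\<^sub>0\<^sub>] \<otimes> (h\<^sub>(\<^sub>2\<^sub>) \<rhd> x)\<^sub>[\<^sub>1\<^sub>] h\<^sub>(\<^sub>1\<^sub>)\<close>, with products in \<open>H\<close>.\<close>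

definition yd_compatible ::
  "('k, 'l) ring_scheme \<Rightarrow> ('k, 'h) bialgebra \<Rightarrow> ('k, 'x) module \<Rightarrow> ('h \<Rightarrow> 'x \<Rightarrow> 'x)
    \<Rightarrow> ('x \<Rightarrow> ('x, 'h) tens) \<Rightarrow> bool" where
  "yd_compatible K H X act \<alpha> \<longleftrightarrow> (\<forall>h\<in>carrier H. \<forall>x\<in>carrier X.
     tlift (tensor K X H) (\<lambda>h1 h2.
       tlift (tensor K X H) (\<lambda>x0 x1. pure K X H (act h1 x0) (h2 \<otimes>\<^bsub>H\<^esub> x1)) (\<alpha> x)) (comult H h) =
     tlift (tensor K X H) (\<lambda>h1 h2.
       tlift (tensor K X H) (\<lambda>y0 y1. pure K X H y0 (y1 \<otimes>\<^bsub>H\<^esub> h1)) (\<alpha> (act h2 x))) (comult H h))"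

definition YD ::
  "('k, 'l) ring_scheme \<Rightarrow> ('k, 'h) bialgebra \<Rightarrow> (('k, 'x, 'h) yd, 'x \<Rightarrow> 'x) category" where
  "YD K H = category_of_algebras K
     {(X, act, \<alpha>). left_action K H X act \<and> right_coaction K (opp H) X \<alpha> \<and> yd_compatible K H X act \<alpha>}
     (\<lambda>(X, act, \<alpha>) (Y, act', \<alpha>') f.
        action_hom H X act act' f \<and> coaction_hom K (opp H) X \<alpha> Y \<alpha>' f)"


section \<open>The four functors\<close>

definition functor_E ::
  "('k, 'l) ring_scheme \<Rightarrow> ('k, 'h) bialgebra
    \<Rightarrow> (('k, 'x, 'h) yd_rr, 'x \<Rightarrow> 'x, ('k, 'x, ('h, 'h \<Rightarrow> 'k) tens) comod_alg, 'x \<Rightarrow> 'x) funct" where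
  "functor_E K H = ((\<lambda>(X, \<alpha>, \<beta>). (X, joint_coaction K H X \<alpha> \<beta>)), (\<lambda>A B f. f))"

definition functor_comod_to_mod ::
  "('k, 'l) ring_scheme \<Rightarrow> ('k, 'h) bialgebra
    \<Rightarrow> (('k, 'x, ('h, 'h \<Rightarrow> 'k) tens) comod_alg, 'x \<Rightarrow> 'x,
        ('k, 'x, ('h \<Rightarrow> 'k, 'h) tens) mod_alg, 'x \<Rightarrow> 'x) funct" where
  "functor_comod_to_mod K H =
     ((\<lambda>(X, \<gamma>). (X, induced_action (double K H) (pairing K) X \<gamma>)), (\<lambda>A B f. f))"

definition functor_rr_to_YD ::
  "('k, 'h) bialgebra
    \<Rightarrow> (('k, 'x, 'h) yd_rr, 'x \<Rightarrow> 'x, ('k, 'x, 'h) yd, 'x \<Rightarrow> 'x) funct" where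
  "functor_rr_to_YD H =
     ((\<lambda>(X, \<alpha>, \<beta>). (X, induced_action H (\<lambda>h \<theta>. \<theta> h) X \<beta>, \<alpha>)), (\<lambda>A B f. f))"

definition functor_YD_to_mod ::
  "('k, 'l) ring_scheme \<Rightarrow> ('k, 'h) bialgebra
    \<Rightarrow> (('k, 'x, 'h) yd, 'x \<Rightarrow> 'x, ('k, 'x, ('h \<Rightarrow> 'k, 'h) tens) mod_alg, 'x \<Rightarrow> 'x) funct" where
  "functor_YD_to_mod K H =
     ((\<lambda>(X, act, \<alpha>). (X, \<lambda>u\<in>carrier (double K H). \<lambda>x\<in>carrier X.
         tlift X (\<lambda>\<omega> h. tlift X (\<lambda>y0 y1. \<omega> y1 \<odot>\<^bsub>X\<^esub> y0) (\<alpha> (act h x))) u)),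
      (\<lambda>A B f. f))"

end

theory Submission
  imports Defs
begin

text \<open>
  All four functors leave the morphisms alone, and each of them is a bijection on objects: the
  structures that it exchanges on an algebra \<open>X\<close> determine each other. Hence all four are isomorphisms of
  categories, and so equivalences (\<open>category_iso_equivalence\<close>).

  The bijections come from one duality. Let finite-dimensional bialgebras \<open>D\<close> and \<open>A\<close> be paired perfectly by
  \<open>p\<close>, such that product and coproduct, unit and counit are transposes of each other. A tensor
  \<open>t \<in> X \<otimes> A\<close> is determined by its slices \<open>(id \<otimes> p(u, -)) t\<close> for \<open>u \<in> D\<close>, and the slices of a linear map
  \<open>\<gamma> : X \<rightarrow> X \<otimes> A\<close> are the operators \<open>x \<mapsto> u \<rhd> x\<close>. Slicing turns the axioms of a right coaction of \<open>A\<close> one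
  by one into those of a left action of \<open>D\<close>; conversely an action comes from \<open>x \<mapsto> \<Sum> (d\<^sub>i \<rhd> x) \<otimes> e\<^sub>i\<close> with
  dual bases \<open>(e\<^sub>i)\<close> and \<open>(d\<^sub>i)\<close>. This is \<open>right_coaction_iff_left_action\<close> with \<open>coaction_exists\<close>,
  \<open>induced_action_inj\<close> and \<open>coaction_hom_iff\<close>. Applied to the double and the codouble, it is the second
  functor of the square; applied to \<open>H\<close> and its dual, it relates the data of the third.

  For the first functor, the duality turns \<open>\<gamma>\<close> into an action of the double. The double is
  \<open>dual H \<otimes> H\<close> with a product computed from the coproduct of the codouble (\<open>double_mult\<close>):
  \<open>(\<omega> \<bowtie> h)(\<omega>' \<bowtie> h') = \<Sum> \<omega>\<omega>\<^sub>1 \<bowtie> h\<^sub>1h'\<close>, where \<open>\<Sum> \<omega>\<^sub>1 \<otimes> h\<^sub>1\<close> represents the functional \<open>\<omega>' \<otimes> h\<close> composed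
  with \<open>Ad(U)\<close>. A counit applied to either leg of \<open>U\<close> gives \<open>1\<close>, so \<open>Ad(U)\<close> does not affect the elements
  \<open>\<omega>' \<bowtie> 1\<close> and \<open>1 \<bowtie> h\<close>; therefore \<open>dual H\<close> and \<open>H\<close> are subalgebras with \<open>\<omega> \<bowtie> h = (\<omega> \<bowtie> 1)(1 \<bowtie> h)\<close>, and the
  remaining relation is the rule that rewrites \<open>(1 \<bowtie> h)(\<omega> \<bowtie> 1)\<close>. An action of the double is thus an action of
  \<open>dual H\<close> together with an action of \<open>H\<close> that satisfy this exchange rule, that is, a coaction \<open>\<alpha>\<close> and a
  coaction \<open>\<beta>\<close>; and the exchange rule is the compatibility condition on \<open>(\<alpha>, \<beta>)\<close>, sliced by \<open>\<omega> \<otimes> h\<close>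
  (\<open>yd_rr_compatible_action\<close>). This gives \<open>joint_right_coaction\<close> and \<open>joint_coaction_surj\<close>.

  For the third functor it remains to compare the two compatibility conditions. Multiplying by \<open>U\<close> removes
  \<open>U\<^sup>-\<^sup>1\<close>; slicing the leg in \<open>dual H\<close> by \<open>h \<in> H\<close> turns \<open>U\<close> into \<open>h\<close>, and products in \<open>dual H\<close> into sums over
  the coproduct of \<open>h\<close>. What comes out is the Yetter-Drinfeld condition
  (\<open>yd_rr_compatible_iff_yd_compatible\<close>).

  Along both paths of the square \<open>\<omega> \<bowtie> h\<close> acts on \<open>x\<close> by first applying \<open>h\<close> via \<open>\<beta>\<close> and then \<open>\<omega>\<close> via \<open>\<alpha>\<close>
  (\<open>square_commutes\<close>), so the fourth functor inherits being an isomorphism from the other three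
  (\<open>category_iso_cancel\<close>).

  The canonical element \<open>U = \<Sum> h\<^sub>i \<otimes> \<theta>\<^sub>i\<close> is invertible with inverse \<open>\<Sum> S\<^sup>-\<^sup>1(h\<^sub>i) \<otimes> \<theta>\<^sub>i\<close>: sliced by \<open>h\<close>, this
  claim becomes the antipode identities for \<open>S\<^sup>-\<^sup>1\<close> and the opposite product, which follow from those of \<open>S\<close>
  because \<open>S\<close> reverses products.
\<close>

section \<open>The universal property of the tensor product\<close>

text \<open>
  Lifts see only the group part of the codomain. So lifts into a tensor product can be exchanged with lifts
  into its underlying group, and lifts into \<open>K\<close> with lifts into the module \<open>ground K\<close>.
\<close>

lemma glift_cong_group:
  assumes "carrier G = carrier G'" "monoid.mult G = monoid.mult G'" "monoid.one G = monoid.one G'"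
  shows "glift G f t = glift G' f t"
proof -
  have "pow G x n = pow G' x n" for x and n :: int
    using assms by (simp add: int_pow_def nat_pow_def m_inv_def Let_def)
  then show ?thesis
    using assms by (simp add: glift_def Let_def finprod_def)
qed

lemma tlift_cong_ring:
  assumes "carrier Z = carrier Z'" "ring.add Z = ring.add Z'" "ring.zero Z = ring.zero Z'"
  shows "tlift Z f t = tlift Z' f t"
  unfolding tlift_def by (rule glift_cong_group) (use assms in auto)

text \<open>
  The maps that factor through the tensor product, stated for an arbitrary group as codomain: \<open>pure\<close>
  must be shown to be balanced before the tensor product is known to be a module.
\<close>

definition balanced ::
  "('k, 'l) ring_scheme \<Rightarrow> ('k, 'a, 'm) module_scheme \<Rightarrow> ('k, 'b, 'n) module_scheme
    \<Rightarrow> ('g, 'p) monoid_scheme \<Rightarrow> ('a \<Rightarrow> 'b \<Rightarrow> 'g) \<Rightarrow> bool" where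
  "balanced K V W G f \<longleftrightarrow>
     (\<forall>x\<in>carrier V. \<forall>y\<in>carrier W. f x y \<in> carrier G) \<and>
     (\<forall>x\<in>carrier V. \<forall>x'\<in>carrier V. \<forall>y\<in>carrier W. f (x \<oplus>\<^bsub>V\<^esub> x') y = f x y \<otimes>\<^bsub>G\<^esub> f x' y) \<and>
     (\<forall>x\<in>carrier V. \<forall>y\<in>carrier W. \<forall>y'\<in>carrier W. f x (y \<oplus>\<^bsub>W\<^esub> y') = f x y \<otimes>\<^bsub>G\<^esub> f x y') \<and>
     (\<forall>c\<in>carrier K. \<forall>x\<in>carrier V. \<forall>y\<in>carrier W. f (c \<odot>\<^bsub>V\<^esub> x) y = f x (c \<odot>\<^bsub>W\<^esub> y))"

text \<open>
  This is the product formula by which \<open>glift\<close> evaluates a map on a representative.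
\<close>

lemma (in comm_group) hom_free_Abelian_group_eq_finprod:
  assumes h: "h \<in> hom (free_Abelian_group T) G" and p: "Poly_Mapping.keys p \<subseteq> T"
  shows "h p = finprod G (\<lambda>z. h (frag_of z) [^] Poly_Mapping.lookup p z) (Poly_Mapping.keys p)"
proof -
  interpret h: group_hom "free_Abelian_group T" G h
    using h by (simp add: group_hom_def group_hom_axioms_def)
  have *: "h (\<Sum>z\<in>A. frag_cmul (c z) (frag_of z)) = finprod G (\<lambda>z. h (frag_of z) [^] c z) A \<and>
     Poly_Mapping.keys (\<Sum>z\<in>A. frag_cmul (c z) (frag_of z)) \<subseteq> T" if "finite A" "A \<subseteq> T" for A and c :: "_ \<Rightarrow> int"
    using that
  proof (induction A)
    case empty
    then show ?case using h.hom_one by simp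
  next
    case (insert z A)
    have z: "frag_of z \<in> carrier (free_Abelian_group T)" using insert by simp
    have hz: "h (frag_cmul (c z) (frag_of z)) = h (frag_of z) [^] c z"
      using h.hom_int_pow[OF z, of "c z"] z insert.prems by (simp add: int_pow_free_Abelian_group)
    have k: "Poly_Mapping.keys (frag_cmul (c z) (frag_of z)) \<subseteq> T" using insert by (auto dest: keys_cmul[THEN subsetD])
    have cl: "(\<lambda>z. h (frag_of z) [^] c z) \<in> A \<rightarrow> carrier G" using insert.prems h.hom_closed by auto
    have "h (frag_cmul (c z) (frag_of z) + (\<Sum>z\<in>A. frag_cmul (c z) (frag_of z)))
      = h (frag_cmul (c z) (frag_of z)) \<otimes> h (\<Sum>z\<in>A. frag_cmul (c z) (frag_of z))"
      using h.hom_mult[of "frag_cmul (c z) (frag_of z)" "\<Sum>z\<in>A. frag_cmul (c z) (frag_of z)"] insert k by simp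
    moreover have "Poly_Mapping.keys (frag_cmul (c z) (frag_of z) + (\<Sum>z\<in>A. frag_cmul (c z) (frag_of z))) \<subseteq> T"
      using insert k keys_add[of "frag_cmul (c z) (frag_of z)"] by blast
    ultimately show ?case using insert hz cl z h.hom_closed[OF z] by (simp add: finprod_insert)
  qed
  have "p = (\<Sum>z\<in>Poly_Mapping.keys p. frag_cmul (Poly_Mapping.lookup p z) (frag_of z))"
    using frag_expansion[of p] unfolding frag_extend_def .
  then show ?thesis using *[OF finite_keys p, of "Poly_Mapping.lookup p"] by simp
qed

context
  fixes K :: "('k, 'l) ring_scheme" and V :: "('k, 'a, 'm) module_scheme" and W :: "('k, 'b, 'n) module_scheme"
  assumes V: "module K V" and W: "module K W"
begin

interpretation V: module K V by (rule V)
interpretation W: module K W by (rule W)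
interpretation F: comm_group "free_on V W" by (rule abelian_free_Abelian_group)

lemma tensor_rels_carrier: "tensor_rels K V W \<subseteq> carrier (free_on V W)"
  unfolding tensor_rels_def
  by (auto dest!: keys_diff[THEN subsetD])

lemma tensor_null_normal: "tensor_null K V W \<lhd> free_on V W"
  unfolding tensor_null_def
  by (rule F.subgroup_imp_normal) (rule F.generate_is_subgroup[OF tensor_rels_carrier])

interpretation N: normal "tensor_null K V W" "free_on V W" by (rule tensor_null_normal)

lemma tensor_group_comm: "comm_group (tensor_group K V W)"
  unfolding tensor_group_def
  using F.abelian_FactGroup[OF N.subgroup_axioms] .

text \<open>
  A balanced map extends to a homomorphism \<open>h\<close> on the free abelian group which kills the relations. So \<open>h\<close>
  is constant on cosets, and whichever representative \<open>glift\<close> picks, it computes \<open>h\<close>.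
\<close>

lemma glift_coset_hom:
  assumes G: "comm_group G" and f: "balanced K V W G f"
  obtains h where "h \<in> hom (free_on V W) G"
    "\<And>x y. \<lbrakk>x \<in> carrier V; y \<in> carrier W\<rbrakk> \<Longrightarrow> h (frag_of (x, y)) = f x y"
    "\<And>a. a \<in> carrier (free_on V W) \<Longrightarrow> glift G f (tensor_null K V W #>\<^bsub>free_on V W\<^esub> a) = h a"
proof -
  interpret G: comm_group G by (rule G)
  obtain h where h: "h \<in> hom (free_on V W) G"
    "\<And>z. z \<in> carrier V \<times> carrier W \<Longrightarrow> h (frag_of z) = (\<lambda>(x,y). f x y) z"
    by (rule G.free_Abelian_group_universal[of "\<lambda>(x,y). f x y" "carrier V \<times> carrier W"])
      (use f in \<open>auto simp: balanced_def\<close>)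
  interpret h: group_hom "free_on V W" G h
    using h by (simp add: group_hom_def group_hom_axioms_def)
  have hd: "h (a - b) = h a \<otimes>\<^bsub>G\<^esub> inv\<^bsub>G\<^esub> h b" if "a \<in> carrier (free_on V W)" "b \<in> carrier (free_on V W)" for a b
    using h.hom_mult[of a "-b"] h.hom_inv[of b] that by simp
  have hr: "h r = \<one>\<^bsub>G\<^esub>" if "r \<in> tensor_rels K V W" for r
  proof -
    have fc: "f x y \<in> carrier G" if "x \<in> carrier V" "y \<in> carrier W" for x y
      using that f by (auto simp: balanced_def)
    have kd: "Poly_Mapping.keys (frag_of a - frag_of b) \<subseteq> carrier V \<times> carrier W" 
       if "a \<in> carrier V \<times> carrier W" "b \<in> carrier V \<times> carrier W" for a b :: "'a \<times> 'b"
      using that by (auto dest!: keys_diff[THEN subsetD])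
    have comm: "a \<otimes>\<^bsub>G\<^esub> b \<otimes>\<^bsub>G\<^esub> inv\<^bsub>G\<^esub> a \<otimes>\<^bsub>G\<^esub> inv\<^bsub>G\<^esub> b = \<one>\<^bsub>G\<^esub>"
      if "a \<in> carrier G" "b \<in> carrier G" for a b
    proof -
      have "a \<otimes>\<^bsub>G\<^esub> b \<otimes>\<^bsub>G\<^esub> inv\<^bsub>G\<^esub> a = b"
        using that by (subst G.m_comm[of a b]) (simp_all add: G.m_assoc)
      then show ?thesis using that by simp
    qed
    from that show ?thesis
      unfolding tensor_rels_def
      apply (elim UnE CollectE exE conjE)
      using f by (simp_all add: hd h(2) kd fc balanced_def comm)
  qed
  have hn: "h n = \<one>\<^bsub>G\<^esub>" if "n \<in> tensor_null K V W" for n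
    using that unfolding tensor_null_def
  proof (induction n rule: generate.induct)
    case (inv r)
    then have "r \<in> carrier (free_on V W)" using tensor_rels_carrier by blast
    then show ?case using h.hom_inv[of r] hr[OF inv] G.inv_one by simp
  next
    case (eng a b)
    then show ?case using h.hom_mult[of a b] F.generate_in_carrier[OF tensor_rels_carrier] by simp
  qed (use hr h.hom_one in auto)
  have "glift G f (tensor_null K V W #>\<^bsub>free_on V W\<^esub> a) = h a" if a: "a \<in> carrier (free_on V W)" for a
  proof -
    let ?t = "tensor_null K V W #>\<^bsub>free_on V W\<^esub> a"
    define p where "p = (SOME p. p \<in> ?t)"
    have "a \<in> ?t" using F.rcos_self[OF a N.subgroup_axioms] .
    then have p: "p \<in> ?t" unfolding p_def by (rule someI)
    then obtain n where n: "n \<in> tensor_null K V W" "p = n + a"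
      by (auto simp: r_coset_def)
    have nc: "n \<in> carrier (free_on V W)" using n N.subset by (blast intro: subsetD)
    have pc: "p \<in> carrier (free_on V W)" using F.m_closed[OF nc a] n by simp
    have "h p = h a" using h.hom_mult[OF nc a] hn[OF n(1)] n(2) h.hom_closed[OF a] by simp
    moreover have "h p = finprod G (\<lambda>z. f (fst z) (snd z) [^]\<^bsub>G\<^esub> Poly_Mapping.lookup p z) (Poly_Mapping.keys p)"
    proof -
      have k: "Poly_Mapping.keys p \<subseteq> carrier V \<times> carrier W" using pc by simp
      have "finprod G (\<lambda>z. h (frag_of z) [^]\<^bsub>G\<^esub> Poly_Mapping.lookup p z) (Poly_Mapping.keys p)
        = finprod G (\<lambda>z. f (fst z) (snd z) [^]\<^bsub>G\<^esub> Poly_Mapping.lookup p z) (Poly_Mapping.keys p)"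
        by (rule G.finprod_cong') (use k f in \<open>auto simp: h(2) balanced_def\<close>)
      then show ?thesis using G.hom_free_Abelian_group_eq_finprod[OF h(1) k] by simp
    qed
    ultimately show ?thesis unfolding glift_def Let_def p_def[symmetric] by simp
  qed
  then show ?thesis using that[of h] h by auto
qed

lemma carrier_tensor_group:
  "carrier (tensor_group K V W) = (\<lambda>a. tensor_null K V W #>\<^bsub>free_on V W\<^esub> a) ` carrier (free_on V W)"
  unfolding tensor_group_def by (auto simp: FactGroup_def RCOSETS_def)

lemma tensor_group_mult:
  "\<lbrakk>a \<in> carrier (free_on V W); b \<in> carrier (free_on V W)\<rbrakk> \<Longrightarrow>
   (tensor_null K V W #>\<^bsub>free_on V W\<^esub> a) \<otimes>\<^bsub>tensor_group K V W\<^esub> (tensor_null K V W #>\<^bsub>free_on V W\<^esub> b)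
   = tensor_null K V W #>\<^bsub>free_on V W\<^esub> (a + b)"
  unfolding tensor_group_def using N.rcos_sum[of a b] by (simp add: FactGroup_def)

lemma glift_hom:
  assumes G: "comm_group G" and f: "balanced K V W G f"
  shows "glift G f \<in> hom (tensor_group K V W) G"
    and "\<lbrakk>x \<in> carrier V; y \<in> carrier W\<rbrakk> \<Longrightarrow> glift G f (pure K V W x y) = f x y"
proof -
  obtain h where h: "h \<in> hom (free_on V W) G"
    "\<And>x y. \<lbrakk>x \<in> carrier V; y \<in> carrier W\<rbrakk> \<Longrightarrow> h (frag_of (x, y)) = f x y"
    "\<And>a. a \<in> carrier (free_on V W) \<Longrightarrow> glift G f (tensor_null K V W #>\<^bsub>free_on V W\<^esub> a) = h a"
    using glift_coset_hom[OF G f] by blast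
  show "glift G f \<in> hom (tensor_group K V W) G"
  proof (rule homI)
    fix s assume "s \<in> carrier (tensor_group K V W)"
    then obtain a where a: "a \<in> carrier (free_on V W)" "s = tensor_null K V W #>\<^bsub>free_on V W\<^esub> a"
      unfolding carrier_tensor_group by auto
    show "glift G f s \<in> carrier G" using h(3) a hom_in_carrier[OF h(1)] by metis
    fix t assume "t \<in> carrier (tensor_group K V W)"
    then obtain b where b: "b \<in> carrier (free_on V W)" "t = tensor_null K V W #>\<^bsub>free_on V W\<^esub> b"
      unfolding carrier_tensor_group by auto
    have "glift G f (s \<otimes>\<^bsub>tensor_group K V W\<^esub> t) = h (a + b)"
      using a b tensor_group_mult[OF a(1) b(1)] h(3)[of "a+b"] F.m_closed[OF a(1) b(1)] by simp
    also have "\<dots> = h a \<otimes>\<^bsub>G\<^esub> h b" using hom_mult[OF h(1) a(1) b(1)] by simp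
    finally show "glift G f (s \<otimes>\<^bsub>tensor_group K V W\<^esub> t) = glift G f s \<otimes>\<^bsub>G\<^esub> glift G f t"
      using h(3) a b by metis
  qed
  show "glift G f (pure K V W x y) = f x y" if "x \<in> carrier V" "y \<in> carrier W"
    unfolding pure_def using h(2,3) that by simp
qed

lemma pure_carrier: "\<lbrakk>x \<in> carrier V; y \<in> carrier W\<rbrakk> \<Longrightarrow> pure K V W x y \<in> carrier (tensor_group K V W)"
  unfolding carrier_tensor_group pure_def by auto

lemma tensor_group_one: "\<one>\<^bsub>tensor_group K V W\<^esub> = tensor_null K V W #>\<^bsub>free_on V W\<^esub> 0"
proof -
  have "tensor_null K V W #>\<^bsub>free_on V W\<^esub> \<one>\<^bsub>free_on V W\<^esub> = tensor_null K V W"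
    using F.coset_join2[OF F.one_closed N.subgroup_axioms N.one_closed] .
  then show ?thesis by (simp add: tensor_group_def)
qed

lemma null_coset_eq:
  assumes "a \<in> carrier (free_on V W)" "b \<in> carrier (free_on V W)" "a - b \<in> tensor_null K V W"
  shows "tensor_null K V W #>\<^bsub>free_on V W\<^esub> a = tensor_null K V W #>\<^bsub>free_on V W\<^esub> b"
proof -
  have "a = (a - b) \<otimes>\<^bsub>free_on V W\<^esub> b" by simp
  then have "a \<in> tensor_null K V W #>\<^bsub>free_on V W\<^esub> b" using assms(3) unfolding r_coset_def by blast
  then show ?thesis using F.repr_independence[OF _ assms(2) N.subgroup_axioms] by simp
qed

lemma pure_balanced: "balanced K V W (tensor_group K V W) (pure K V W)"
proof -
  have r: "r \<in> tensor_null K V W" if "r \<in> tensor_rels K V W" for r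
    unfolding tensor_null_def using that by (rule generate.incl)
  have s: "frag_of z \<in> carrier (free_on V W)" "frag_of z + frag_of z' \<in> carrier (free_on V W)"
    if "z \<in> carrier V \<times> carrier W" "z' \<in> carrier V \<times> carrier W" for z z'
    using that keys_add[of "frag_of z" "frag_of z'"] by (auto simp: )
  show ?thesis
    unfolding balanced_def
  proof (intro conjI ballI, goal_cases)
    case (1 x y)
    then show ?case by (rule pure_carrier)
  next
    case (2 x x' y)
    have "frag_of (x \<oplus>\<^bsub>V\<^esub> x', y) - (frag_of (x, y) + frag_of (x', y)) \<in> tensor_rels K V W"
      unfolding tensor_rels_def diff_diff_add[symmetric] using 2 by blast
    then show ?case unfolding pure_def using 2 s
      by (simp add: tensor_group_mult) (intro null_coset_eq r; simp add: s)
  next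
    case (3 x y y')
    have "frag_of (x, y \<oplus>\<^bsub>W\<^esub> y') - (frag_of (x, y) + frag_of (x, y')) \<in> tensor_rels K V W"
      unfolding tensor_rels_def diff_diff_add[symmetric] using 3 by blast
    then show ?case unfolding pure_def using 3 s
      by (simp add: tensor_group_mult) (intro null_coset_eq r; simp add: s)
  next
    case (4 c x y)
    have "frag_of (c \<odot>\<^bsub>V\<^esub> x, y) - frag_of (x, c \<odot>\<^bsub>W\<^esub> y) \<in> tensor_rels K V W"
      unfolding tensor_rels_def using 4 by blast
    then show ?case unfolding pure_def using 4 s
      by (intro null_coset_eq r; simp add: s)
  qed
qed

text \<open>
  The free abelian group has an induction rule for differences and generators, whereas here only sums are
  wanted: the inverse of a pure tensor is again pure. Proving the property for \<open>a\<close> and \<open>-a\<close> simultaneously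
  makes the difference step go through.
\<close>

lemma tensor_group_induct:
  assumes t: "t \<in> carrier (tensor_group K V W)"
    and one: "P \<one>\<^bsub>tensor_group K V W\<^esub>"
    and pure: "\<And>x y. \<lbrakk>x \<in> carrier V; y \<in> carrier W\<rbrakk> \<Longrightarrow> P (pure K V W x y)"
    and mult: "\<And>s t. \<lbrakk>s \<in> carrier (tensor_group K V W); t \<in> carrier (tensor_group K V W); P s; P t\<rbrakk>
       \<Longrightarrow> P (s \<otimes>\<^bsub>tensor_group K V W\<^esub> t)"
  shows "P t"
proof -
  interpret T: comm_group "tensor_group K V W" by (rule tensor_group_comm)
  let ?c = "\<lambda>a. tensor_null K V W #>\<^bsub>free_on V W\<^esub> a"
  have inv_pure: "inv\<^bsub>tensor_group K V W\<^esub> (pure K V W x y) = pure K V W (\<ominus>\<^bsub>V\<^esub> x) y"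
    if xy: "x \<in> carrier V" "y \<in> carrier W" for x y
  proof -
    have b: "pure K V W (a \<oplus>\<^bsub>V\<^esub> b) y = pure K V W a y \<otimes>\<^bsub>tensor_group K V W\<^esub> pure K V W b y"
      if "a \<in> carrier V" "b \<in> carrier V" for a b
      using pure_balanced that xy unfolding balanced_def by blast
    have z: "pure K V W \<zero>\<^bsub>V\<^esub> y = \<one>\<^bsub>tensor_group K V W\<^esub>"
      using b[of "\<zero>\<^bsub>V\<^esub>" "\<zero>\<^bsub>V\<^esub>"] pure_carrier[OF V.zero_closed xy(2)] 
      by (metis T.l_cancel_one V.M.l_zero V.M.zero_closed)
    show ?thesis
      by (rule T.inv_equality) (use b[of "\<ominus>\<^bsub>V\<^esub> x" x] z xy pure_carrier in \<open>auto simp: V.M.l_neg\<close>)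
  qed
  have "Poly_Mapping.keys a \<subseteq> carrier V \<times> carrier W \<Longrightarrow> P (?c a) \<and> P (?c (- a))" for a
  proof (induction a rule: free_Abelian_group_induct[consumes 1, case_names zero diff gen])
    case zero
    then show ?case using one by (simp add: tensor_group_one)
  next
    case (diff a b)
    have "?c (a - b) = ?c a \<otimes>\<^bsub>tensor_group K V W\<^esub> ?c (- b)" "?c (- (a - b)) = ?c (- a) \<otimes>\<^bsub>tensor_group K V W\<^esub> ?c b"
      using tensor_group_mult[of a "-b"] tensor_group_mult[of "-a" b] diff by simp_all
    then show ?case using mult diff by (simp add: carrier_tensor_group)
  next
    case (gen z)
    then obtain x y where z: "z = (x, y)" "x \<in> carrier V" "y \<in> carrier W" by auto
    have c: "?c (frag_of z) = pure K V W x y" using z by (simp add: pure_def)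
    have "?c (- frag_of z) = inv\<^bsub>tensor_group K V W\<^esub> (?c (frag_of z))"
    proof (rule T.inv_equality[symmetric])
      show "?c (- frag_of z) \<otimes>\<^bsub>tensor_group K V W\<^esub> ?c (frag_of z) = \<one>\<^bsub>tensor_group K V W\<^esub>"
        using gen by (simp add: tensor_group_mult tensor_group_one)
    qed (use gen in \<open>simp_all add: carrier_tensor_group\<close>)
    then show ?case using c inv_pure[OF z(2,3)] pure z by simp
  qed
  then show ?thesis using t unfolding carrier_tensor_group by auto
qed

end

section \<open>Linear and bilinear maps\<close>

lemma linear_mapsI:
  assumes "\<And>x. x \<in> carrier V \<Longrightarrow> f x \<in> carrier W"
    and "\<And>x y. \<lbrakk>x \<in> carrier V; y \<in> carrier V\<rbrakk> \<Longrightarrow> f (x \<oplus>\<^bsub>V\<^esub> y) = f x \<oplus>\<^bsub>W\<^esub> f y"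
    and "\<And>c x. \<lbrakk>c \<in> carrier K; x \<in> carrier V\<rbrakk> \<Longrightarrow> f (c \<odot>\<^bsub>V\<^esub> x) = c \<odot>\<^bsub>W\<^esub> f x"
  shows "f \<in> linear_maps K V W"
  using assms by (auto simp: linear_maps_def)

lemma linear_mapsD:
  assumes "f \<in> linear_maps K V W"
  shows "x \<in> carrier V \<Longrightarrow> f x \<in> carrier W"
    and "\<lbrakk>x \<in> carrier V; y \<in> carrier V\<rbrakk> \<Longrightarrow> f (x \<oplus>\<^bsub>V\<^esub> y) = f x \<oplus>\<^bsub>W\<^esub> f y"
    and "\<lbrakk>c \<in> carrier K; x \<in> carrier V\<rbrakk> \<Longrightarrow> f (c \<odot>\<^bsub>V\<^esub> x) = c \<odot>\<^bsub>W\<^esub> f x"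
  using assms by (auto simp: linear_maps_def)

lemma linear_maps_zero:
  assumes f: "f \<in> linear_maps K V W" and "module K V" "module K W"
  shows "f \<zero>\<^bsub>V\<^esub> = \<zero>\<^bsub>W\<^esub>"
proof -
  interpret V: module K V by fact
  interpret W: module K W by fact
  have "f (\<zero>\<^bsub>K\<^esub> \<odot>\<^bsub>V\<^esub> \<zero>\<^bsub>V\<^esub>) = \<zero>\<^bsub>K\<^esub> \<odot>\<^bsub>W\<^esub> f \<zero>\<^bsub>V\<^esub>"
    by (rule linear_mapsD(3)[OF f V.R.zero_closed V.M.zero_closed])
  then show ?thesis using linear_mapsD(1)[OF f V.M.zero_closed] by simp
qed

lemma linear_maps_finsum:
  assumes f: "f \<in> linear_maps K V W" and V: "module K V" and W: "module K W"
    and "finite A" and "g \<in> A \<rightarrow> carrier V"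
  shows "f (\<Oplus>\<^bsub>V\<^esub>i\<in>A. g i) = (\<Oplus>\<^bsub>W\<^esub>i\<in>A. f (g i))"
proof -
  interpret V: module K V by fact
  interpret W: module K W by fact
  show ?thesis
    using assms(4,5)
  proof (induction A)
    case empty
    show ?case using linear_maps_zero[OF f V W] by simp
  next
    case (insert i A)
    have g: "g i \<in> carrier V" "g \<in> A \<rightarrow> carrier V" using insert.prems by auto
    then have fg: "(\<lambda>i. f (g i)) \<in> A \<rightarrow> carrier W" "f (g i) \<in> carrier W"
      using linear_mapsD(1)[OF f] by (auto simp: Pi_iff)
    show ?case
      using insert.hyps insert.IH[OF g(2)] g fg linear_mapsD(2)[OF f g(1) V.M.finsum_closed[OF g(2)]]
      by (simp add: V.M.finsum_insert W.M.finsum_insert)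
  qed
qed

definition bilin ::
  "('k, 'l) ring_scheme \<Rightarrow> ('k, 'a, 'm) module_scheme \<Rightarrow> ('k, 'b, 'n) module_scheme
    \<Rightarrow> ('k, 'c, 'p) module_scheme \<Rightarrow> ('a \<Rightarrow> 'b \<Rightarrow> 'c) \<Rightarrow> bool" where
  "bilin K V W Z f \<longleftrightarrow> (\<forall>y\<in>carrier W. (\<lambda>x. f x y) \<in> linear_maps K V Z) \<and>
     (\<forall>x\<in>carrier V. (\<lambda>y. f x y) \<in> linear_maps K W Z)"

lemma bilinI:
  assumes "\<And>y. y \<in> carrier W \<Longrightarrow> (\<lambda>x. f x y) \<in> linear_maps K V Z"
    and "\<And>x. x \<in> carrier V \<Longrightarrow> (\<lambda>y. f x y) \<in> linear_maps K W Z"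
  shows "bilin K V W Z f"
  using assms by (auto simp: bilin_def)

lemma bilinD:
  assumes "bilin K V W Z f"
  shows "y \<in> carrier W \<Longrightarrow> (\<lambda>x. f x y) \<in> linear_maps K V Z"
    and "x \<in> carrier V \<Longrightarrow> f x \<in> linear_maps K W Z"
    and "\<lbrakk>x \<in> carrier V; y \<in> carrier W\<rbrakk> \<Longrightarrow> f x y \<in> carrier Z"
  using assms unfolding bilin_def by (auto dest!: linear_mapsD(1))

lemma bilin_cong:
  assumes "\<And>x y. \<lbrakk>x \<in> carrier V; y \<in> carrier W\<rbrakk> \<Longrightarrow> f x y = g x y" and "module K V" and "module K W"
  shows "bilin K V W Z f \<longleftrightarrow> bilin K V W Z g"
proof -
  interpret V: module K V by fact
  interpret W: module K W by fact
  show ?thesis using assms(1) unfolding bilin_def linear_maps_def by (auto simp: Pi_iff)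
qed

text \<open>
  Linearity of a composite expression is derived by resolution with the rules collected here. Each is
  stated for an abstraction \<open>\<lambda>x. F (f x)\<close>, so that it removes the outermost operation \<open>F\<close>.
\<close>

named_theorems lin

lemma lin_id [lin]: "(\<lambda>x. x) \<in> linear_maps K V V"
  by (rule linear_mapsI) auto

lemma lin_comp: "\<lbrakk>\<phi> \<in> linear_maps K W Z; f \<in> linear_maps K V W\<rbrakk> \<Longrightarrow> (\<lambda>x. \<phi> (f x)) \<in> linear_maps K V Z"
  unfolding linear_maps_def by (auto simp: Pi_iff)

lemma linear_maps_cong:
  assumes "module K U" and "\<And>x. x \<in> carrier U \<Longrightarrow> f x = g x"
  shows "f \<in> linear_maps K U Z \<longleftrightarrow> g \<in> linear_maps K U Z"
proof -
  interpret U: module K U by fact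
  show ?thesis using assms(2) unfolding linear_maps_def by (auto simp: Pi_iff)
qed

lemma linear_maps_congI:
  assumes "g \<in> linear_maps K U Z" and "module K U" and "\<And>x. x \<in> carrier U \<Longrightarrow> f x = g x"
  shows "f \<in> linear_maps K U Z"
  by (rule iffD2[OF linear_maps_cong[OF assms(2)] assms(1)]) (rule assms(3))

lemma id_linear: "id \<in> linear_maps K V V"
  using lin_id[of K V] by (simp add: id_def)

section \<open>The tensor product as a module\<close>

lemma tensor_sel:
  "carrier (tensor K V W) = carrier (tensor_group K V W)"
  "ring.add (tensor K V W) = monoid.mult (tensor_group K V W)"
  "ring.zero (tensor K V W) = monoid.one (tensor_group K V W)"
  "monoid.one (tensor K V W) = pure K V W \<one>\<^bsub>V\<^esub> \<one>\<^bsub>W\<^esub>"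
  by (simp_all add: tensor_def)

lemma glift_tensor_group: "glift (tensor_group K V W) f t = tlift (tensor K V W) f t"
  unfolding tlift_def by (rule glift_cong_group) (simp_all add: tensor_sel)

lemma tensor_smult_eq: "c \<odot>\<^bsub>tensor K V W\<^esub> t = tlift (tensor K V W) (\<lambda>x y. pure K V W (c \<odot>\<^bsub>V\<^esub> x) y) t"
proof -
  have "c \<odot>\<^bsub>tensor K V W\<^esub> t = glift (tensor_group K V W) (\<lambda>x y. pure K V W (c \<odot>\<^bsub>V\<^esub> x) y) t"
    by (simp add: tensor_def)
  then show ?thesis by (simp only: glift_tensor_group)
qed

lemma tensor_mult_eq: "s \<otimes>\<^bsub>tensor K V W\<^esub> t = tlift (tensor K V W) (\<lambda>x y.
    tlift (tensor K V W) (\<lambda>x' y'. pure K V W (x \<otimes>\<^bsub>V\<^esub> x') (y \<otimes>\<^bsub>W\<^esub> y')) t) s"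
proof -
  have "s \<otimes>\<^bsub>tensor K V W\<^esub> t = glift (tensor_group K V W) (\<lambda>x y.
    glift (tensor_group K V W) (\<lambda>x' y'. pure K V W (x \<otimes>\<^bsub>V\<^esub> x') (y \<otimes>\<^bsub>W\<^esub> y')) t) s"
    by (simp add: tensor_def)
  then show ?thesis by (simp only: glift_tensor_group)
qed

lemma bilin_balanced:
  assumes "bilin K V W Z f" and V: "module K V" and W: "module K W"
  shows "balanced K V W (add_monoid Z) f"
  using assms(1) unfolding bilin_def linear_maps_def balanced_def by (auto simp: Pi_iff)

context
  fixes K :: "('k, 'l) ring_scheme" and V :: "('k, 'a, 'm) module_scheme" and W :: "('k, 'b, 'n) module_scheme"
  assumes V: "module K V" and W: "module K W"
begin

interpretation V: module K V by (rule V)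
interpretation W: module K W by (rule W)
interpretation T: comm_group "tensor_group K V W" by (rule tensor_group_comm[OF V W])

lemma tlift_hom:
  assumes f: "bilin K V W Z f" and Z: "module K Z"
  shows "tlift Z f \<in> hom (tensor_group K V W) (add_monoid Z)"
  unfolding tlift_def[abs_def]
  by (rule glift_hom[OF V W abelian_group.a_comm_group bilin_balanced[OF f V W]])
    (use Z in \<open>auto simp: module_def\<close>)

lemma tlift_pure:
  assumes "bilin K V W Z f" and Z: "module K Z" and "x \<in> carrier V" "y \<in> carrier W"
  shows "tlift Z f (pure K V W x y) = f x y"
  unfolding tlift_def
  by (rule glift_hom(2)[OF V W abelian_group.a_comm_group bilin_balanced])
    (use assms V W in \<open>auto simp: module_def\<close>)

lemma tensor_abelian_group: "abelian_group (tensor K V W)"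
  by (rule abelian_groupI) (auto simp: tensor_sel T.m_ac intro: T.l_inv_ex)

lemma pure_closed: "\<lbrakk>x \<in> carrier V; y \<in> carrier W\<rbrakk> \<Longrightarrow> pure K V W x y \<in> carrier (tensor K V W)"
  using pure_carrier[OF V W] by (simp add: tensor_sel)

lemma pure_add_left: "\<lbrakk>x \<in> carrier V; x' \<in> carrier V; y \<in> carrier W\<rbrakk> \<Longrightarrow>
    pure K V W (x \<oplus>\<^bsub>V\<^esub> x') y = pure K V W x y \<oplus>\<^bsub>tensor K V W\<^esub> pure K V W x' y"
  and pure_add_right: "\<lbrakk>x \<in> carrier V; y \<in> carrier W; y' \<in> carrier W\<rbrakk> \<Longrightarrow>
    pure K V W x (y \<oplus>\<^bsub>W\<^esub> y') = pure K V W x y \<oplus>\<^bsub>tensor K V W\<^esub> pure K V W x y'"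
  and pure_smult_middle: "\<lbrakk>c \<in> carrier K; x \<in> carrier V; y \<in> carrier W\<rbrakk> \<Longrightarrow>
    pure K V W (c \<odot>\<^bsub>V\<^esub> x) y = pure K V W x (c \<odot>\<^bsub>W\<^esub> y)"
  using pure_balanced[OF V W] by (auto simp: balanced_def tensor_sel)

lemma smult_hom:
  assumes c: "c \<in> carrier K"
  shows "(\<lambda>t. c \<odot>\<^bsub>tensor K V W\<^esub> t) \<in> hom (tensor_group K V W) (tensor_group K V W)"
    and "\<lbrakk>x \<in> carrier V; y \<in> carrier W\<rbrakk> \<Longrightarrow> c \<odot>\<^bsub>tensor K V W\<^esub> pure K V W x y = pure K V W (c \<odot>\<^bsub>V\<^esub> x) y"
proof -
  have b: "balanced K V W (tensor_group K V W) (\<lambda>x y. pure K V W (c \<odot>\<^bsub>V\<^esub> x) y)"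
  proof -
    have "pure K V W (c \<odot>\<^bsub>V\<^esub> (d \<odot>\<^bsub>V\<^esub> x)) y = pure K V W (c \<odot>\<^bsub>V\<^esub> x) (d \<odot>\<^bsub>W\<^esub> y)"
      if "d \<in> carrier K" "x \<in> carrier V" "y \<in> carrier W" for d x y
    proof -
      have "c \<odot>\<^bsub>V\<^esub> (d \<odot>\<^bsub>V\<^esub> x) = d \<odot>\<^bsub>V\<^esub> (c \<odot>\<^bsub>V\<^esub> x)"
        using V.smult_assoc1[of c d x] V.smult_assoc1[of d c x] V.R.m_comm[of c d] c that by simp
      then show ?thesis using pure_smult_middle[of d "c \<odot>\<^bsub>V\<^esub> x" y] c that by simp
    qed
    then show ?thesis
      unfolding balanced_def
      using c pure_add_left pure_add_right pure_closed
      by (auto simp: tensor_sel V.smult_r_distr)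
  qed
  show "(\<lambda>t. c \<odot>\<^bsub>tensor K V W\<^esub> t) \<in> hom (tensor_group K V W) (tensor_group K V W)"
    using glift_hom(1)[OF V W tensor_group_comm[OF V W] b]
    by (simp only: tensor_smult_eq glift_tensor_group[abs_def])
  show "\<lbrakk>x \<in> carrier V; y \<in> carrier W\<rbrakk> \<Longrightarrow> c \<odot>\<^bsub>tensor K V W\<^esub> pure K V W x y = pure K V W (c \<odot>\<^bsub>V\<^esub> x) y"
    using glift_hom(2)[OF V W tensor_group_comm[OF V W] b]
    by (simp only: tensor_smult_eq glift_tensor_group)
qed

lemma tensor_induct [consumes 1, case_names zero pure add]:
  assumes t: "t \<in> carrier (tensor K V W)"
    and one: "P \<zero>\<^bsub>tensor K V W\<^esub>"
    and pure: "\<And>x y. \<lbrakk>x \<in> carrier V; y \<in> carrier W\<rbrakk> \<Longrightarrow> P (pure K V W x y)"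
    and mult: "\<And>s t. \<lbrakk>s \<in> carrier (tensor K V W); t \<in> carrier (tensor K V W); P s; P t\<rbrakk>
       \<Longrightarrow> P (s \<oplus>\<^bsub>tensor K V W\<^esub> t)"
  shows "P t"
  using tensor_group_induct[OF V W, of t P] assms unfolding tensor_sel by blast

lemma tensor_module: "module K (tensor K V W)"
proof -
  interpret TA: abelian_group "tensor K V W" by (rule tensor_abelian_group)
  have sc: "c \<odot>\<^bsub>tensor K V W\<^esub> t \<in> carrier (tensor K V W)" if "c \<in> carrier K" "t \<in> carrier (tensor K V W)" for c t
    using hom_in_carrier[OF smult_hom(1)] that by (auto simp: tensor_sel)
  have sa: "c \<odot>\<^bsub>tensor K V W\<^esub> (s \<oplus>\<^bsub>tensor K V W\<^esub> t) = c \<odot>\<^bsub>tensor K V W\<^esub> s \<oplus>\<^bsub>tensor K V W\<^esub> c \<odot>\<^bsub>tensor K V W\<^esub> t"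
    if "c \<in> carrier K" "s \<in> carrier (tensor K V W)" "t \<in> carrier (tensor K V W)" for c s t
    using hom_mult[OF smult_hom(1)] that by (auto simp: tensor_sel)
  have sz: "c \<odot>\<^bsub>tensor K V W\<^esub> \<zero>\<^bsub>tensor K V W\<^esub> = \<zero>\<^bsub>tensor K V W\<^esub>" if "c \<in> carrier K" for c
    using hom_one[OF smult_hom(1)[OF that] T.group_axioms T.group_axioms] by (simp add: tensor_sel)
  show ?thesis
  proof (rule moduleI)
    fix a b t assume ab: "a \<in> carrier K" "b \<in> carrier K" and t: "t \<in> carrier (tensor K V W)"
    show "(a \<oplus>\<^bsub>K\<^esub> b) \<odot>\<^bsub>tensor K V W\<^esub> t = a \<odot>\<^bsub>tensor K V W\<^esub> t \<oplus>\<^bsub>tensor K V W\<^esub> b \<odot>\<^bsub>tensor K V W\<^esub> t"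
      using t by (induction t rule: tensor_induct)
        (use ab in \<open>auto simp: sz smult_hom(2) V.smult_l_distr pure_add_left sa sc TA.a_ac\<close>)
    show "a \<otimes>\<^bsub>K\<^esub> b \<odot>\<^bsub>tensor K V W\<^esub> t = a \<odot>\<^bsub>tensor K V W\<^esub> (b \<odot>\<^bsub>tensor K V W\<^esub> t)"
      using t by (induction t rule: tensor_induct)
        (use ab in \<open>auto simp: sz smult_hom(2) V.smult_assoc1 sa sc\<close>)
  next
    fix t assume t: "t \<in> carrier (tensor K V W)"
    show "\<one>\<^bsub>K\<^esub> \<odot>\<^bsub>tensor K V W\<^esub> t = t"
      using t by (induction t rule: tensor_induct) (auto simp: sz smult_hom(2) sa sc)
  qed (auto simp: sa sc V.R.is_cring TA.abelian_group_axioms)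
qed

interpretation TM: module K "tensor K V W" by (rule tensor_module)

lemma pure_smult_left: "\<lbrakk>c \<in> carrier K; x \<in> carrier V; y \<in> carrier W\<rbrakk> \<Longrightarrow>
    pure K V W (c \<odot>\<^bsub>V\<^esub> x) y = c \<odot>\<^bsub>tensor K V W\<^esub> pure K V W x y"
  and pure_smult_right: "\<lbrakk>c \<in> carrier K; x \<in> carrier V; y \<in> carrier W\<rbrakk> \<Longrightarrow>
    pure K V W x (c \<odot>\<^bsub>W\<^esub> y) = c \<odot>\<^bsub>tensor K V W\<^esub> pure K V W x y"
  by (simp_all add: smult_hom(2) pure_smult_middle)

lemma tlift_linear:
  assumes f: "bilin K V W Z f" and Z: "module K Z"
  shows "tlift Z f \<in> linear_maps K (tensor K V W) Z"
proof -
  interpret Z: module K Z by (rule Z)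
  note h = tlift_hom[OF f Z]
  have cl: "tlift Z f t \<in> carrier Z" if "t \<in> carrier (tensor K V W)" for t
    using hom_in_carrier[OF h] that by (simp add: tensor_sel)
  have ad: "tlift Z f (s \<oplus>\<^bsub>tensor K V W\<^esub> t) = tlift Z f s \<oplus>\<^bsub>Z\<^esub> tlift Z f t"
    if "s \<in> carrier (tensor K V W)" "t \<in> carrier (tensor K V W)" for s t
    using hom_mult[OF h] that by (simp add: tensor_sel)
  have ze: "tlift Z f \<zero>\<^bsub>tensor K V W\<^esub> = \<zero>\<^bsub>Z\<^esub>"
    using hom_one[OF h T.group_axioms Z.add.group_axioms] by (simp add: tensor_sel)
  show ?thesis
  proof (rule linear_mapsI)
    fix c t assume c: "c \<in> carrier K" and t: "t \<in> carrier (tensor K V W)"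
    show "tlift Z f (c \<odot>\<^bsub>tensor K V W\<^esub> t) = c \<odot>\<^bsub>Z\<^esub> tlift Z f t"
      using t
    proof (induction t rule: tensor_induct)
      case (pure x y)
      then show ?case using c linear_mapsD(3)[OF bilinD(1)[OF f]]
        by (simp add: tlift_pure[OF f Z] flip: pure_smult_left)
    qed (use c in \<open>auto simp: ad ze cl TM.smult_r_distr Z.smult_r_distr\<close>)
  qed (auto simp: cl ad)
qed

lemma tlift_closed: "\<lbrakk>bilin K V W Z f; module K Z; t \<in> carrier (tensor K V W)\<rbrakk> \<Longrightarrow> tlift Z f t \<in> carrier Z"
  using linear_mapsD(1)[OF tlift_linear] .

text \<open>
  The main tool for identities between elements of tensor products: only pure tensors need be compared.
\<close>

lemma linear_ext:
  assumes f: "f \<in> linear_maps K (tensor K V W) Z" and g: "g \<in> linear_maps K (tensor K V W) Z"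
    and Z: "module K Z" and t: "t \<in> carrier (tensor K V W)"
    and fg: "\<And>x y. \<lbrakk>x \<in> carrier V; y \<in> carrier W\<rbrakk> \<Longrightarrow> f (pure K V W x y) = g (pure K V W x y)"
  shows "f t = g t"
  using t by (induction t rule: tensor_induct)
    (auto simp: fg linear_maps_zero[OF f tensor_module Z] linear_maps_zero[OF g tensor_module Z]
       linear_mapsD(2)[OF f] linear_mapsD(2)[OF g])

text \<open>
  The rule by which antipodes, functionals and multiplications by constants pass through Sweedler sums.
\<close>

lemma tlift_comp:
  assumes \<phi>: "\<phi> \<in> linear_maps K Z Z'" and f: "bilin K V W Z f" and Z: "module K Z" and Z': "module K Z'"
    and t: "t \<in> carrier (tensor K V W)"
  shows "\<phi> (tlift Z f t) = tlift Z' (\<lambda>x y. \<phi> (f x y)) t"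
proof -
  have b: "bilin K V W Z' (\<lambda>x y. \<phi> (f x y))"
    by (intro bilinI lin_comp[OF \<phi>]) (auto intro: bilinD[OF f])
  show ?thesis
    by (rule linear_ext[OF lin_comp[OF \<phi> tlift_linear[OF f Z]] tlift_linear[OF b Z'] Z' t])
      (simp add: tlift_pure[OF f Z] tlift_pure[OF b Z'])
qed

lemma tlift_cong:
  assumes f: "bilin K V W Z f" and Z: "module K Z" and t: "t \<in> carrier (tensor K V W)"
    and fg: "\<And>x y. \<lbrakk>x \<in> carrier V; y \<in> carrier W\<rbrakk> \<Longrightarrow> f x y = g x y"
  shows "tlift Z f t = tlift Z g t"
proof -
  have b: "bilin K V W Z g" using bilin_cong[of V W f g K Z, OF _ V W] fg f by blast
  show ?thesis
    by (rule linear_ext[OF tlift_linear[OF f Z] tlift_linear[OF b Z] Z t])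
      (simp add: tlift_pure[OF f Z] tlift_pure[OF b Z] fg)
qed

lemma lin_pure1 [lin]: "\<lbrakk>f \<in> linear_maps K U V; y \<in> carrier W\<rbrakk> \<Longrightarrow> (\<lambda>x. pure K V W (f x) y) \<in> linear_maps K U (tensor K V W)"
  by (rule lin_comp[of "\<lambda>x. pure K V W x y"])
    (auto intro!: linear_mapsI simp: pure_closed pure_add_left pure_smult_left)

lemma lin_pure2 [lin]: "\<lbrakk>f \<in> linear_maps K U W; x \<in> carrier V\<rbrakk> \<Longrightarrow> (\<lambda>y. pure K V W x (f y)) \<in> linear_maps K U (tensor K V W)"
  by (rule lin_comp[of "\<lambda>y. pure K V W x y"])
    (auto intro!: linear_mapsI simp: pure_closed pure_add_right pure_smult_right)

text \<open>
  A Sweedler sum \<open>tlift Z f t\<close> is linear in the tensor \<open>t\<close>, and also in any parameter on which \<open>f\<close> depends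
  linearly (\<open>lin_tlift2\<close>); nested sums are linear by alternating the two.
\<close>

lemma lin_tlift1 [lin]:
  assumes "g \<in> linear_maps K U (tensor K V W)" "bilin K V W Z f" "module K Z"
  shows "(\<lambda>u. tlift Z f (g u)) \<in> linear_maps K U Z"
  by (rule lin_comp[OF tlift_linear]) (use assms in auto)

lemma lin_tlift2 [lin]:
  assumes t: "t \<in> carrier (tensor K V W)"
    and lin: "\<And>x y. \<lbrakk>x \<in> carrier V; y \<in> carrier W\<rbrakk> \<Longrightarrow> (\<lambda>u. f u x y) \<in> linear_maps K U Z"
    and b: "\<And>u. u \<in> carrier U \<Longrightarrow> bilin K V W Z (f u)" and Z: "module K Z" and U: "module K U"
  shows "(\<lambda>u. tlift Z (f u) t) \<in> linear_maps K U Z"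
proof (rule linear_mapsI)
  interpret Z: module K Z by (rule Z)
  interpret U: module K U by (rule U)
  show "tlift Z (f u) t \<in> carrier Z" if "u \<in> carrier U" for u
    using tlift_closed[OF b Z t] that .
  show "tlift Z (f (u \<oplus>\<^bsub>U\<^esub> v)) t = tlift Z (f u) t \<oplus>\<^bsub>Z\<^esub> tlift Z (f v) t" if uv: "u \<in> carrier U" "v \<in> carrier U" for u v
    using t
  proof (induction t rule: tensor_induct)
    case zero
    then show ?case using uv linear_maps_zero[OF tlift_linear[OF b Z] tensor_module Z] by simp
  next
    case (pure x y)
    then show ?case using uv linear_mapsD(2)[OF lin] by (simp add: tlift_pure[OF b Z])
  next
    case (add s t)
    have c: "tlift Z (f w) s \<in> carrier Z" "tlift Z (f w) t \<in> carrier Z" if "w \<in> carrier U" for w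
      using tlift_closed[OF b Z] add that by auto
    show ?case using add uv linear_mapsD(2)[OF tlift_linear[OF b Z]] c by (simp add: Z.M.a_ac)
  qed
  show "tlift Z (f (c \<odot>\<^bsub>U\<^esub> u)) t = c \<odot>\<^bsub>Z\<^esub> tlift Z (f u) t" if cu: "c \<in> carrier K" "u \<in> carrier U" for c u
    using t
  proof (induction t rule: tensor_induct)
    case zero
    then show ?case using cu linear_maps_zero[OF tlift_linear[OF b Z] tensor_module Z] by simp
  next
    case (pure x y)
    then show ?case using cu linear_mapsD(3)[OF lin] by (simp add: tlift_pure[OF b Z])
  next
    case (add s t)
    have c: "tlift Z (f w) s \<in> carrier Z" "tlift Z (f w) t \<in> carrier Z" if "w \<in> carrier U" for w
      using tlift_closed[OF b Z] add that by auto
    show ?case using add cu linear_mapsD(2)[OF tlift_linear[OF b Z]] c by (simp add: Z.smult_r_distr)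
  qed
qed

end

lemma lin_smult [lin]:
  assumes "module K Z" "c \<in> carrier K" "f \<in> linear_maps K U Z"
  shows "(\<lambda>x. c \<odot>\<^bsub>Z\<^esub> f x) \<in> linear_maps K U Z"
proof -
  interpret Z: module K Z by fact
  show ?thesis
    by (rule lin_comp[of "\<lambda>z. c \<odot>\<^bsub>Z\<^esub> z" _ Z, OF linear_mapsI assms(3)])
      (use assms(2) in \<open>auto simp: Z.smult_r_distr Z.R.m_comm simp flip: Z.smult_assoc1\<close>)
qed

lemma ground_sel [simp]:
  "carrier (ground K) = carrier K" "ring.add (ground K) = ring.add K" "ring.zero (ground K) = ring.zero K"
  "monoid.mult (ground K) = monoid.mult K" "monoid.one (ground K) = monoid.one K" "smult (ground K) = monoid.mult K"
  by (simp_all add: ground_def)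

text \<open>
  The codomain of a scalar-valued sum can be \<open>K\<close> or the module \<open>ground K\<close>. The two sides have the same shape,
  so rewriting with this equation is only safe with \<open>K\<close> instantiated.
\<close>

lemma tlift_ground: "tlift K f t = tlift (ground K) f t"
  by (rule tlift_cong_ring) simp_all

lemma lin_smult_scalar [lin]:
  assumes "module K Z" "z \<in> carrier Z" "f \<in> linear_maps K U (ground K)"
  shows "(\<lambda>x. f x \<odot>\<^bsub>Z\<^esub> z) \<in> linear_maps K U Z"
proof -
  interpret Z: module K Z by fact
  show ?thesis
    by (rule lin_comp[of "\<lambda>c. c \<odot>\<^bsub>Z\<^esub> z" _ "ground K", OF linear_mapsI assms(3)])
      (use assms(2) in \<open>auto simp: Z.smult_l_distr Z.smult_assoc1\<close>)
qed

lemma lin_ring_mult [lin]: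
  assumes "cring K" "f \<in> linear_maps K U (ground K)" "c \<in> carrier K"
  shows "(\<lambda>x. f x \<otimes>\<^bsub>K\<^esub> c) \<in> linear_maps K U (ground K)" "(\<lambda>x. c \<otimes>\<^bsub>K\<^esub> f x) \<in> linear_maps K U (ground K)"
proof -
  interpret cring K by fact
  show "(\<lambda>x. f x \<otimes>\<^bsub>K\<^esub> c) \<in> linear_maps K U (ground K)" "(\<lambda>x. c \<otimes>\<^bsub>K\<^esub> f x) \<in> linear_maps K U (ground K)"
    using assms(2,3) unfolding linear_maps_def by (auto simp: Pi_iff l_distr r_distr m_ac)
qed

lemma ground_module: "cring K \<Longrightarrow> module K (ground K)"
proof -
  assume "cring K"
  then interpret cring K .
  show ?thesis
    by (rule moduleI)
      (auto simp: l_distr r_distr m_ac is_cring a_ac intro!: abelian_groupI intro: l_neg)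
qed

lemma lin_mult [lin]:
  assumes "unital_algebra K A" "f \<in> linear_maps K U A" "a \<in> carrier A"
  shows "(\<lambda>x. f x \<otimes>\<^bsub>A\<^esub> a) \<in> linear_maps K U A" "(\<lambda>x. a \<otimes>\<^bsub>A\<^esub> f x) \<in> linear_maps K U A"
proof -
  interpret unital_algebra K A by fact
  show "(\<lambda>x. f x \<otimes>\<^bsub>A\<^esub> a) \<in> linear_maps K U A" "(\<lambda>x. a \<otimes>\<^bsub>A\<^esub> f x) \<in> linear_maps K U A"
    using assms(2,3) unfolding linear_maps_def by (auto simp: Pi_iff A.l_distr A.r_distr smult_mult_left smult_mult_right)
qed

section \<open>Maps between tensor products\<close>

declare tensor_module [simp] pure_closed [simp]

lemma lin_closed: "\<lbrakk>f \<in> linear_maps K V W; x \<in> carrier V\<rbrakk> \<Longrightarrow> f x \<in> carrier W"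
  by (rule linear_mapsD(1))

lemma module_cring: "module K V \<Longrightarrow> cring K"
  by (simp add: module_def)

lemma tmap_bilin:
  assumes [simp]: "module K V" "module K W" and f: "f \<in> linear_maps K A V" and g: "g \<in> linear_maps K B W"
  shows "bilin K A B (tensor K V W) (\<lambda>x y. pure K V W (f x) (g y))"
  by (rule bilinI) (rule lin | rule f g lin_closed[OF f] lin_closed[OF g] | assumption | (simp; fail))+

context
  fixes K :: "('k, 'l) ring_scheme" and A :: "('k, 'a, 'm1) module_scheme" and B :: "('k, 'b, 'm2) module_scheme"
  assumes A [simp]: "module K A" and B [simp]: "module K B"
begin

lemma tmap_linear:
  assumes [simp]: "module K V" "module K W" and f: "f \<in> linear_maps K A V" and g: "g \<in> linear_maps K B W"
  shows "tmap K V W f g \<in> linear_maps K (tensor K A B) (tensor K V W)"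
  unfolding tmap_def[abs_def]
  by (rule tlift_linear[OF A B tmap_bilin[OF _ _ f g]]) simp_all

lemma tmap_pure:
  assumes [simp]: "module K V" "module K W" and f: "f \<in> linear_maps K A V" and g: "g \<in> linear_maps K B W"
    and "x \<in> carrier A" "y \<in> carrier B"
  shows "tmap K V W f g (pure K A B x y) = pure K V W (f x) (g y)"
  unfolding tmap_def[abs_def]
  by (rule tlift_pure[OF A B tmap_bilin[OF _ _ f g]]) (simp_all add: assms)

lemma tlift_tmap:
  assumes V [simp]: "module K V" and W [simp]: "module K W" and f: "f \<in> linear_maps K A V" and g: "g \<in> linear_maps K B W"
    and F: "bilin K V W Z F" and Z: "module K Z" and t: "t \<in> carrier (tensor K A B)"
  shows "tlift Z F (tmap K V W f g t) = tlift Z (\<lambda>x y. F (f x) (g y)) t"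
  unfolding tmap_def
  by (subst tlift_comp[OF A B tlift_linear[OF V W F Z] tmap_bilin[OF _ _ f g] _ Z t])
    (auto intro!: tlift_cong[OF A B _ Z t, symmetric] bilinI lin_comp[OF bilinD(1)[OF F] f] lin_comp[OF bilinD(2)[OF F] g]
      simp: tlift_pure[OF V W F Z] lin_closed[OF f] lin_closed[OF g])

lemma flip_bilin: "bilin K A B (tensor K B A) (\<lambda>x y. pure K B A y x)"
  by (rule bilinI) (rule lin | assumption | (simp; fail))+

lemma tflip_linear: "tflip K A B \<in> linear_maps K (tensor K A B) (tensor K B A)"
  unfolding tflip_def[abs_def]
  by (rule tlift_linear[OF A B flip_bilin]) simp_all

lemma tflip_pure: "\<lbrakk>x \<in> carrier A; y \<in> carrier B\<rbrakk> \<Longrightarrow> tflip K A B (pure K A B x y) = pure K B A y x"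
  unfolding tflip_def[abs_def]
  by (rule tlift_pure[OF A B flip_bilin]) simp_all

lemma tlift_tflip:
  assumes F: "bilin K B A Z F" and Z: "module K Z" and t: "t \<in> carrier (tensor K A B)"
  shows "tlift Z F (tflip K A B t) = tlift Z (\<lambda>x y. F y x) t"
  unfolding tflip_def
  by (subst tlift_comp[OF A B tlift_linear[OF B A F Z] flip_bilin _ Z t])
    (auto intro!: tlift_cong[OF A B _ Z t, symmetric] bilinI bilinD[OF F] simp: tlift_pure[OF B A F Z])

end

lemma tmap_comp:
  assumes A: "module K A" and B: "module K B" and C: "module K C" and D: "module K D" and E: "module K E" and F: "module K F"
    and f: "f \<in> linear_maps K A C" and g: "g \<in> linear_maps K B D"
    and f': "f' \<in> linear_maps K C E" and g': "g' \<in> linear_maps K D F" and t: "t \<in> carrier (tensor K A B)"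
  shows "tmap K E F f' g' (tmap K C D f g t) = tmap K E F (\<lambda>x. f' (f x)) (\<lambda>y. g' (g y)) t"
  by (rule linear_ext[OF A B lin_comp[OF tmap_linear[OF C D E F f' g'] tmap_linear[OF A B C D f g]]
        tmap_linear[OF A B E F lin_comp[OF f' f] lin_comp[OF g' g]] tensor_module[OF E F] t])
    (simp add: tmap_pure[OF A B C D f g] tmap_pure[OF C D E F f' g'] tmap_pure[OF A B E F lin_comp[OF f' f] lin_comp[OF g' g]]
      lin_closed[OF f] lin_closed[OF g])

lemma tmap_cong:
  assumes A: "module K A" and B: "module K B" and C: "module K C" and D: "module K D"
    and f: "f \<in> linear_maps K A C" and g: "g \<in> linear_maps K B D" and t: "t \<in> carrier (tensor K A B)"
    and "\<And>x. x \<in> carrier A \<Longrightarrow> f x = f' x" and "\<And>y. y \<in> carrier B \<Longrightarrow> g y = g' y"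
  shows "tmap K C D f g t = tmap K C D f' g' t"
  unfolding tmap_def
  by (rule tlift_cong[OF A B tmap_bilin[OF C D f g] tensor_module[OF C D] t]) (simp add: assms)

lemma tmap_id:
  assumes A: "module K A" and B: "module K B" and t: "t \<in> carrier (tensor K A B)"
  shows "tmap K A B id (\<lambda>x. x) t = t"
  by (rule linear_ext[OF A B tmap_linear[OF A B A B id_linear lin_id] lin_id tensor_module[OF A B] t])
    (simp add: tmap_pure[OF A B A B id_linear lin_id])

definition trilin where
  "trilin K U V W Z G \<longleftrightarrow> (\<forall>x\<in>carrier U. bilin K V W Z (G x)) \<and>
     (\<forall>y\<in>carrier V. \<forall>z\<in>carrier W. (\<lambda>x. G x y z) \<in> linear_maps K U Z)"

lemma trilinI:
  assumes "\<And>y z. \<lbrakk>y \<in> carrier V; z \<in> carrier W\<rbrakk> \<Longrightarrow> (\<lambda>x. G x y z) \<in> linear_maps K U Z"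
    and "\<And>x z. \<lbrakk>x \<in> carrier U; z \<in> carrier W\<rbrakk> \<Longrightarrow> (\<lambda>y. G x y z) \<in> linear_maps K V Z"
    and "\<And>x y. \<lbrakk>x \<in> carrier U; y \<in> carrier V\<rbrakk> \<Longrightarrow> (\<lambda>z. G x y z) \<in> linear_maps K W Z"
  shows "trilin K U V W Z G"
  using assms by (auto simp: trilin_def bilin_def)

lemma trilinD:
  assumes "trilin K U V W Z G"
  shows "\<lbrakk>y \<in> carrier V; z \<in> carrier W\<rbrakk> \<Longrightarrow> (\<lambda>x. G x y z) \<in> linear_maps K U Z"
    and "\<lbrakk>x \<in> carrier U; z \<in> carrier W\<rbrakk> \<Longrightarrow> (\<lambda>y. G x y z) \<in> linear_maps K V Z"
    and "\<lbrakk>x \<in> carrier U; y \<in> carrier V\<rbrakk> \<Longrightarrow> (\<lambda>z. G x y z) \<in> linear_maps K W Z"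
    and "x \<in> carrier U \<Longrightarrow> bilin K V W Z (G x)"
    and "y \<in> carrier V \<Longrightarrow> bilin K U W Z (\<lambda>x. G x y)"
    and "z \<in> carrier W \<Longrightarrow> bilin K U V Z (\<lambda>x y. G x y z)"
  using assms by (auto simp: trilin_def bilin_def)

context
  fixes K :: "('k, 'l) ring_scheme" and U :: "('k, 'a, 'm1) module_scheme" and V :: "('k, 'b, 'm2) module_scheme"
    and W :: "('k, 'c, 'm3) module_scheme"
  assumes U [simp]: "module K U" and V [simp]: "module K V" and W [simp]: "module K W"
begin

lemma trilin_right:
  assumes G: "trilin K U V W Z G" and Z [simp]: "module K Z"
  shows "bilin K U (tensor K V W) Z (\<lambda>x. tlift Z (G x))"
  by (rule bilinI) (rule lin lin_tlift2[OF V W] tlift_linear[OF V W] trilinD[OF G] | assumption | (simp; fail))+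

lemma trilin_left:
  assumes G: "trilin K U V W Z G" and Z [simp]: "module K Z"
  shows "bilin K (tensor K U V) W Z (\<lambda>s z. tlift Z (\<lambda>x y. G x y z) s)"
  by (rule bilinI) (rule lin lin_tlift2[OF U V] tlift_linear[OF U V] trilinD[OF G] | assumption | (simp; fail))+

lemma assoc_trilin: "trilin K U V W (tensor K U (tensor K V W)) (\<lambda>x y z. pure K U (tensor K V W) x (pure K V W y z))"
  by (rule trilinI) (rule lin | assumption | (simp; fail))+

lemma tassoc_linear:
  "tassoc K U V W \<in> linear_maps K (tensor K (tensor K U V) W) (tensor K U (tensor K V W))"
  unfolding tassoc_def[abs_def]
  by (rule tlift_linear[OF _ _ trilin_left[OF assoc_trilin]]) simp_all

lemma tassoc_pure:
  "\<lbrakk>x \<in> carrier U; y \<in> carrier V; z \<in> carrier W\<rbrakk> \<Longrightarrow>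
   tassoc K U V W (pure K (tensor K U V) W (pure K U V x y) z) = pure K U (tensor K V W) x (pure K V W y z)"
  unfolding tassoc_def
  by (simp add: tlift_pure[OF _ _ trilin_left[OF assoc_trilin]] tlift_pure[OF _ _ trilinD(6)[OF assoc_trilin]])

lemma trilin_ext:
  assumes f: "f \<in> linear_maps K (tensor K (tensor K U V) W) Z" and g: "g \<in> linear_maps K (tensor K (tensor K U V) W) Z"
    and Z: "module K Z" and t: "t \<in> carrier (tensor K (tensor K U V) W)"
    and fg: "\<And>x y z. \<lbrakk>x \<in> carrier U; y \<in> carrier V; z \<in> carrier W\<rbrakk> \<Longrightarrow>
       f (pure K (tensor K U V) W (pure K U V x y) z) = g (pure K (tensor K U V) W (pure K U V x y) z)"
  shows "f t = g t"
proof (rule linear_ext[OF _ W f g Z t])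
  fix s z assume s: "s \<in> carrier (tensor K U V)" and z: "z \<in> carrier W"
  show "f (pure K (tensor K U V) W s z) = g (pure K (tensor K U V) W s z)"
    by (rule linear_ext[OF U V lin_comp[OF f] lin_comp[OF g] Z s, of "\<lambda>s. pure K (tensor K U V) W s z" "\<lambda>s. pure K (tensor K U V) W s z"])
      (auto intro!: lin_pure1 lin_id fg simp: z)
qed simp

text \<open>
  Sums over a triple tensor do not depend on the bracketing; this is how \<open>tassoc\<close> leaves a formula.
\<close>

lemma tlift_tassoc:
  assumes G: "trilin K U V W Z G" and Z [simp]: "module K Z" and t: "t \<in> carrier (tensor K (tensor K U V) W)"
  shows "tlift Z (\<lambda>x. tlift Z (G x)) (tassoc K U V W t) = tlift Z (\<lambda>s z. tlift Z (\<lambda>x y. G x y z) s) t"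
  by (rule trilin_ext[OF lin_comp[OF tlift_linear[OF _ _ trilin_right[OF G]] tassoc_linear]
      tlift_linear[OF _ _ trilin_left[OF G]] Z t])
    (simp_all add: tassoc_pure tlift_pure[OF _ _ trilin_right[OF G]] tlift_pure[OF _ _ trilin_left[OF G]]
      tlift_pure[OF _ _ trilinD(4)[OF G]] tlift_pure[OF _ _ trilinD(6)[OF G]])

end

text \<open>
  Fubini for Sweedler sums. Both sides are linear in \<open>s\<close>, and for a pure tensor \<open>s\<close> they agree.
\<close>

lemma tlift_swap:
  assumes A [simp]: "module K A" and B [simp]: "module K B" and C [simp]: "module K C" and D [simp]: "module K D" and Z [simp]: "module K Z"
    and s: "s \<in> carrier (tensor K A B)" and t: "t \<in> carrier (tensor K C D)"
    and 1: "\<And>c d. \<lbrakk>c \<in> carrier C; d \<in> carrier D\<rbrakk> \<Longrightarrow> bilin K A B Z (\<lambda>a b. F a b c d)"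
    and 2: "\<And>a b. \<lbrakk>a \<in> carrier A; b \<in> carrier B\<rbrakk> \<Longrightarrow> bilin K C D Z (F a b)"
  shows "tlift Z (\<lambda>a b. tlift Z (F a b) t) s = tlift Z (\<lambda>c d. tlift Z (\<lambda>a b. F a b c d) s) t"
proof -
  have L: "bilin K A B Z (\<lambda>a b. tlift Z (F a b) t)"
    by (rule bilinI) (rule lin lin_tlift2[OF C D t] bilinD(1,2)[OF 1] 2 | assumption | (simp; fail))+
  have R: "bilin K C D Z (\<lambda>c d. tlift Z (\<lambda>a b. F a b c d) s)"
    by (rule bilinI) (rule lin lin_tlift2[OF A B s] bilinD(1,2)[OF 2] 1 | assumption | (simp; fail))+
  have S: "(\<lambda>s. tlift Z (\<lambda>c d. tlift Z (\<lambda>a b. F a b c d) s) t) \<in> linear_maps K (tensor K A B) Z"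
  proof (rule lin_tlift2[OF C D t])
    show "(\<lambda>s. tlift Z (\<lambda>a b. F a b c d) s) \<in> linear_maps K (tensor K A B) Z" if "c \<in> carrier C" "d \<in> carrier D" for c d
      by (rule tlift_linear[OF A B 1 Z]) (use that in auto)
    show "bilin K C D Z (\<lambda>c d. tlift Z (\<lambda>a b. F a b c d) u)" if "u \<in> carrier (tensor K A B)" for u
      by (rule bilinI) (rule lin lin_tlift2[OF A B that] bilinD(1,2)[OF 2] 1 | assumption | (simp; fail))+
  qed simp_all
  show ?thesis
  proof (rule linear_ext[OF A B tlift_linear[OF A B L Z] S Z s])
    fix a b assume ab: "a \<in> carrier A" "b \<in> carrier B"
    show "tlift Z (\<lambda>a b. tlift Z (F a b) t) (pure K A B a b) = tlift Z (\<lambda>c d. tlift Z (\<lambda>a b. F a b c d) (pure K A B a b)) t"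
      unfolding tlift_pure[OF A B L Z ab]
      by (rule tlift_cong[OF C D 2 Z t]) (use ab in \<open>auto simp: tlift_pure[OF A B 1 Z]\<close>)
  qed
qed

section \<open>Tensor product of algebras\<close>

lemma unital_algebra_module [simp]: "unital_algebra K A \<Longrightarrow> module K A"
  by (simp add: unital_algebra_def)

lemma unital_algebra_ring: "unital_algebra K A \<Longrightarrow> ring A"
  by (simp add: unital_algebra_def)

lemma ua_mult_closed [simp]: "\<lbrakk>unital_algebra K A; x \<in> carrier A; y \<in> carrier A\<rbrakk> \<Longrightarrow> x \<otimes>\<^bsub>A\<^esub> y \<in> carrier A"
  using ring.ring_simprules(5)[OF unital_algebra_ring] .

lemma ua_one_closed [simp]: "unital_algebra K A \<Longrightarrow> \<one>\<^bsub>A\<^esub> \<in> carrier A"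
  using ring.ring_simprules(6)[OF unital_algebra_ring] .

context
  fixes K :: "('k, 'l) ring_scheme" and A :: "('k, 'a, 'm1) module_scheme" and B :: "('k, 'b, 'm2) module_scheme"
  assumes A [simp]: "unital_algebra K A" and B [simp]: "unital_algebra K B"
begin

interpretation A: unital_algebra K A by (rule A)
interpretation B: unital_algebra K B by (rule B)
interpretation TM: module K "tensor K A B" by simp

lemma mult_bilin_inner: "\<lbrakk>x \<in> carrier A; y \<in> carrier B\<rbrakk> \<Longrightarrow>
   bilin K A B (tensor K A B) (\<lambda>x' y'. pure K A B (x \<otimes>\<^bsub>A\<^esub> x') (y \<otimes>\<^bsub>B\<^esub> y'))"
  by (rule bilinI) (rule lin | assumption | (simp; fail))+

lemma mult_bilin_outer: "t \<in> carrier (tensor K A B) \<Longrightarrow>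
   bilin K A B (tensor K A B) (\<lambda>x y. tlift (tensor K A B) (\<lambda>x' y'. pure K A B (x \<otimes>\<^bsub>A\<^esub> x') (y \<otimes>\<^bsub>B\<^esub> y')) t)"
  by (rule bilinI) (rule lin_tlift2[of K A B] lin mult_bilin_inner | assumption | (simp; fail))+

lemma tensor_mult_bilin: "bilin K (tensor K A B) (tensor K A B) (tensor K A B) (\<lambda>s t. s \<otimes>\<^bsub>tensor K A B\<^esub> t)"
  unfolding tensor_mult_eq
  by (rule bilinI) (rule lin_tlift1[of K A B] lin_tlift2[of K A B] lin mult_bilin_inner mult_bilin_outer | assumption | (simp; fail))+

lemma tensor_mult_pure: "\<lbrakk>a \<in> carrier A; b \<in> carrier B; a' \<in> carrier A; b' \<in> carrier B\<rbrakk> \<Longrightarrow>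
    pure K A B a b \<otimes>\<^bsub>tensor K A B\<^esub> pure K A B a' b' = pure K A B (a \<otimes>\<^bsub>A\<^esub> a') (b \<otimes>\<^bsub>B\<^esub> b')"
  unfolding tensor_mult_eq
  by (simp add: tlift_pure[OF _ _ mult_bilin_outer] tlift_pure[OF _ _ mult_bilin_inner])

text \<open>
  To know a linear map on a product of two tensors, it suffices to know it on products of pure
  tensors. Associativity of the tensor product algebra is an instance.
\<close>

lemma bilin_mult_ext:
  assumes f: "f \<in> linear_maps K (tensor K A B) Z" and Z: "module K Z"
    and G: "bilin K (tensor K A B) (tensor K A B) Z G"
    and s: "s \<in> carrier (tensor K A B)" and t: "t \<in> carrier (tensor K A B)"
    and fg: "\<And>a b a' b'. \<lbrakk>a \<in> carrier A; b \<in> carrier B; a' \<in> carrier A; b' \<in> carrier B\<rbrakk> \<Longrightarrow>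
       f (pure K A B (a \<otimes>\<^bsub>A\<^esub> a') (b \<otimes>\<^bsub>B\<^esub> b')) = G (pure K A B a b) (pure K A B a' b')"
  shows "f (s \<otimes>\<^bsub>tensor K A B\<^esub> t) = G s t"
proof (rule linear_ext[OF _ _ lin_comp[OF f bilinD(1)[OF tensor_mult_bilin t]] bilinD(1)[OF G t] Z s])
  fix a b assume ab: "a \<in> carrier A" "b \<in> carrier B"
  show "f (pure K A B a b \<otimes>\<^bsub>tensor K A B\<^esub> t) = G (pure K A B a b) t"
    by (rule linear_ext[OF _ _ lin_comp[OF f bilinD(2)[OF tensor_mult_bilin]] bilinD(2)[OF G] Z t])
      (auto simp: ab tensor_mult_pure fg)
qed simp_all

lemma tensor_algebra: "unital_algebra K (tensor K A B)"
proof -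
  note mc = bilinD(3)[OF tensor_mult_bilin]
  note m1 = bilinD(1)[OF tensor_mult_bilin] and m2 = bilinD(2)[OF tensor_mult_bilin]
  have assoc: "(s \<otimes>\<^bsub>tensor K A B\<^esub> t) \<otimes>\<^bsub>tensor K A B\<^esub> u = s \<otimes>\<^bsub>tensor K A B\<^esub> (t \<otimes>\<^bsub>tensor K A B\<^esub> u)"
    if s: "s \<in> carrier (tensor K A B)" and t: "t \<in> carrier (tensor K A B)" and u: "u \<in> carrier (tensor K A B)" for s t u
  proof (rule bilin_mult_ext[OF m1[OF u] _ _ s t])
    show "bilin K (tensor K A B) (tensor K A B) (tensor K A B) (\<lambda>s t. s \<otimes>\<^bsub>tensor K A B\<^esub> (t \<otimes>\<^bsub>tensor K A B\<^esub> u))"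
      by (rule bilinI) (rule m1 lin_comp[OF m2 m1] | assumption | rule mc u)+
    fix a b a' b' assume ab: "a \<in> carrier A" "b \<in> carrier B" "a' \<in> carrier A" "b' \<in> carrier B"
    show "pure K A B (a \<otimes>\<^bsub>A\<^esub> a') (b \<otimes>\<^bsub>B\<^esub> b') \<otimes>\<^bsub>tensor K A B\<^esub> u =
        pure K A B a b \<otimes>\<^bsub>tensor K A B\<^esub> (pure K A B a' b' \<otimes>\<^bsub>tensor K A B\<^esub> u)"
      by (rule linear_ext[OF _ _ m2 lin_comp[OF m2 m2] _ u])
        (use ab in \<open>auto simp: tensor_mult_pure A.A.m_assoc B.A.m_assoc\<close>)
  qed simp
  have one: "\<one>\<^bsub>tensor K A B\<^esub> \<otimes>\<^bsub>tensor K A B\<^esub> t = t" "t \<otimes>\<^bsub>tensor K A B\<^esub> \<one>\<^bsub>tensor K A B\<^esub> = t"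
    if t: "t \<in> carrier (tensor K A B)" for t
    by (rule linear_ext[OF _ _ m2 lin_id _ t], simp_all add: tensor_sel(4) tensor_mult_pure)
      (rule linear_ext[OF _ _ m1 lin_id _ t], simp_all add: tensor_mult_pure)
  have r: "ring (tensor K A B)"
  proof (rule ringI)
    show "abelian_group (tensor K A B)" by (rule TM.M.abelian_group_axioms)
    show "Group.monoid (tensor K A B)"
      by (rule monoidI) (auto simp: mc assoc one, simp add: tensor_sel(4))
  qed (use linear_mapsD(2)[OF m1] linear_mapsD(2)[OF m2] in auto)
  show ?thesis
    by (intro unital_algebra.intro r unital_algebra_axioms.intro)
      (use linear_mapsD(3)[OF m1] linear_mapsD(3)[OF m2] in auto)
qed

lemma alg_hom_tensorI:
  assumes f: "f \<in> linear_maps K (tensor K A B) Z" and Z: "unital_algebra K Z"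
    and one: "f (pure K A B \<one>\<^bsub>A\<^esub> \<one>\<^bsub>B\<^esub>) = \<one>\<^bsub>Z\<^esub>"
    and fg: "\<And>a b a' b'. \<lbrakk>a \<in> carrier A; b \<in> carrier B; a' \<in> carrier A; b' \<in> carrier B\<rbrakk> \<Longrightarrow>
       f (pure K A B (a \<otimes>\<^bsub>A\<^esub> a') (b \<otimes>\<^bsub>B\<^esub> b')) = f (pure K A B a b) \<otimes>\<^bsub>Z\<^esub> f (pure K A B a' b')"
  shows "f \<in> alg_hom K (tensor K A B) Z"
proof -
  have b: "bilin K (tensor K A B) (tensor K A B) Z (\<lambda>s t. f s \<otimes>\<^bsub>Z\<^esub> f t)"
    by (rule bilinI) (rule lin_mult[OF Z] f lin_closed[OF f] | assumption)+
  show ?thesis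
    unfolding alg_hom_def ring_hom_def
    using bilin_mult_ext[OF f unital_algebra_module[OF Z] b _ _ fg] f linear_mapsD[OF f] one
    by (auto simp: tensor_sel(4))
qed

end

declare tensor_algebra [simp]

lemma alg_homD:
  assumes "f \<in> alg_hom K A B"
  shows "f \<in> linear_maps K A B" "\<lbrakk>x \<in> carrier A; y \<in> carrier A\<rbrakk> \<Longrightarrow> f (x \<otimes>\<^bsub>A\<^esub> y) = f x \<otimes>\<^bsub>B\<^esub> f y"
    "f \<one>\<^bsub>A\<^esub> = \<one>\<^bsub>B\<^esub>" "x \<in> carrier A \<Longrightarrow> f x \<in> carrier B"
  using assms by (auto simp: alg_hom_def ring_hom_def)

lemma alg_homI:
  assumes "f \<in> linear_maps K A B" "\<And>x y. \<lbrakk>x \<in> carrier A; y \<in> carrier A\<rbrakk> \<Longrightarrow> f (x \<otimes>\<^bsub>A\<^esub> y) = f x \<otimes>\<^bsub>B\<^esub> f y"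
    "f \<one>\<^bsub>A\<^esub> = \<one>\<^bsub>B\<^esub>"
  shows "f \<in> alg_hom K A B"
  using assms(2,3) linear_mapsD(1,2)[OF assms(1)] assms(1) unfolding alg_hom_def ring_hom_def by simp

lemma alg_hom_comp:
  assumes f: "f \<in> alg_hom K A B" and g: "g \<in> alg_hom K B C"
  shows "(\<lambda>x. g (f x)) \<in> alg_hom K A C"
  by (intro alg_homI lin_comp[OF alg_homD(1)[OF g] alg_homD(1)[OF f]])
    (simp_all add: alg_homD[OF f] alg_homD[OF g])

lemma id_alg_hom: "id \<in> alg_hom K A A"
  by (rule alg_homI[OF id_linear]) simp_all

lemma tmap_alg_hom:
  assumes A [simp]: "unital_algebra K A" and B [simp]: "unital_algebra K B"
    and C [simp]: "unital_algebra K C" and D [simp]: "unital_algebra K D"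
    and f: "f \<in> alg_hom K A C" and g: "g \<in> alg_hom K B D"
  shows "tmap K C D f g \<in> alg_hom K (tensor K A B) (tensor K C D)"
proof -
  note [simp] = ua_mult_closed[OF A] ua_mult_closed[OF B] ua_one_closed[OF A] ua_one_closed[OF B]
  show ?thesis
    using alg_homD[OF f] alg_homD[OF g]
    by (intro alg_hom_tensorI tmap_linear)
      (simp_all add: tmap_pure[where A=A and B=B] tensor_sel(4) tensor_mult_pure)
qed

lemma tassoc_alg_hom:
  assumes A [simp]: "unital_algebra K A" and B [simp]: "unital_algebra K B" and C [simp]: "unital_algebra K C"
  shows "tassoc K A B C \<in> alg_hom K (tensor K (tensor K A B) C) (tensor K A (tensor K B C))"
proof (rule alg_hom_tensorI)
  note [simp] = ua_mult_closed[OF A] ua_mult_closed[OF B] ua_mult_closed[OF C]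
    ua_one_closed[OF A] ua_one_closed[OF B] ua_one_closed[OF C]
  let ?T = "tensor K (tensor K A B) C" and ?R = "tensor K A (tensor K B C)"
  have l: "tassoc K A B C \<in> linear_maps K ?T ?R" by (rule tassoc_linear) simp_all
  fix s c s' c' assume s: "s \<in> carrier (tensor K A B)" and c: "c \<in> carrier C"
    and s': "s' \<in> carrier (tensor K A B)" and c': "c' \<in> carrier C"
  show "tassoc K A B C (pure K (tensor K A B) C (s \<otimes>\<^bsub>tensor K A B\<^esub> s') (c \<otimes>\<^bsub>C\<^esub> c')) =
     tassoc K A B C (pure K (tensor K A B) C s c) \<otimes>\<^bsub>?R\<^esub> tassoc K A B C (pure K (tensor K A B) C s' c')"
  proof (rule bilin_mult_ext[OF _ _ _ _ _ s s'])
    show "(\<lambda>u. tassoc K A B C (pure K (tensor K A B) C u (c \<otimes>\<^bsub>C\<^esub> c'))) \<in> linear_maps K (tensor K A B) ?R"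
      by (rule lin_comp[OF l]) (rule lin | (simp add: c c'; fail))+
    have k: "(\<lambda>s. tassoc K A B C (pure K (tensor K A B) C s d)) \<in> linear_maps K (tensor K A B) ?R" if "d \<in> carrier C" for d
      by (rule lin_comp[OF l]) (rule lin | (simp add: that; fail))+
    show "bilin K (tensor K A B) (tensor K A B) ?R (\<lambda>s s'. tassoc K A B C (pure K (tensor K A B) C s c) \<otimes>\<^bsub>?R\<^esub>
       tassoc K A B C (pure K (tensor K A B) C s' c'))"
      by (rule bilinI) (rule lin_mult k c c' lin_closed[OF k] | assumption | (simp; fail))+
  qed (use c c' in \<open>simp_all add: tassoc_pure tensor_mult_pure\<close>)
qed (use ua_one_closed[OF A] ua_one_closed[OF B] ua_one_closed[OF C] in \<open>simp_all add: tassoc_linear tensor_sel(4) tassoc_pure\<close>)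

section \<open>Frames and slices\<close>

lemma (in abelian_monoid) finsum_Times:
  assumes "finite I" "finite J" "\<And>i j. \<lbrakk>i \<in> I; j \<in> J\<rbrakk> \<Longrightarrow> f i j \<in> carrier G"
  shows "(\<Oplus>i\<in>I. \<Oplus>j\<in>J. f i j) = (\<Oplus>p\<in>I \<times> J. f (fst p) (snd p))"
  using assms(1,3)
proof (induction I)
  case empty
  then show ?case by simp
next
  case (insert i I)
  have "(\<Oplus>p\<in>{i} \<times> J. f (fst p) (snd p)) = (\<Oplus>j\<in>J. f i j)"
  proof -
    have "{i} \<times> J = Pair i ` J" by auto
    then show ?thesis
      using insert.prems by (simp add: finsum_reindex inj_on_def Pi_iff)
  qed
  moreover have "(\<Oplus>p\<in>{i} \<times> J \<union> I \<times> J. f (fst p) (snd p)) =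
     (\<Oplus>p\<in>{i} \<times> J. f (fst p) (snd p)) \<oplus> (\<Oplus>p\<in>I \<times> J. f (fst p) (snd p))"
    using insert assms(2) by (intro finsum_Un_disjoint) auto
  moreover have "insert i I \<times> J = {i} \<times> J \<union> I \<times> J" by auto
  moreover have "(\<Oplus>j\<in>J. f i j) \<in> carrier G" "(\<lambda>i. \<Oplus>j\<in>J. f i j) \<in> I \<rightarrow> carrier G"
    using insert.prems by (auto intro!: finsum_closed)
  ultimately show ?case using insert by simp
qed

lemma lin_finsum [lin]:
  assumes Z: "module K Z" and U: "module K U" and "\<And>i. i \<in> I \<Longrightarrow> f i \<in> linear_maps K U Z"
  shows "(\<lambda>x. \<Oplus>\<^bsub>Z\<^esub>i\<in>I. f i x) \<in> linear_maps K U Z"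
proof (cases "finite I")
  interpret Z: module K Z by (rule Z)
  case True
  then show ?thesis using assms(3)
  proof (induction I)
    case empty
    then show ?case by (intro linear_mapsI) auto
  next
    case (insert i I)
    have c: "f j x \<in> carrier Z" if "j \<in> insert i I" "x \<in> carrier U" for j x
      using insert.prems that by (auto intro: lin_closed)
    have e: "(\<Oplus>\<^bsub>Z\<^esub>j\<in>insert i I. f j x) = f i x \<oplus>\<^bsub>Z\<^esub> (\<Oplus>\<^bsub>Z\<^esub>j\<in>I. f j x)" if "x \<in> carrier U" for x
      using insert c that by (intro Z.M.finsum_insert) auto
    have I: "(\<lambda>x. \<Oplus>\<^bsub>Z\<^esub>j\<in>I. f j x) \<in> linear_maps K U Z" and i: "f i \<in> linear_maps K U Z" using insert by auto
    have "(\<lambda>x. f i x \<oplus>\<^bsub>Z\<^esub> (\<Oplus>\<^bsub>Z\<^esub>j\<in>I. f j x)) \<in> linear_maps K U Z"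
      using lin_closed[OF I] lin_closed[OF i] linear_mapsD(2,3)[OF I] linear_mapsD(2,3)[OF i]
      by (intro linear_mapsI) (simp_all add: Z.smult_r_distr Z.M.a_ac)
    then show ?case
      by (rule iffD2[OF linear_maps_cong[OF U], rotated -1]) (rule e)
  qed
next
  interpret Z: module K Z by (rule Z)
  case False
  then show ?thesis by (auto intro!: linear_mapsI)
qed

text \<open>
  Vectors \<open>e\<^sub>i\<close> with functionals \<open>f\<^sub>i\<close> such that \<open>a = \<Sum> f\<^sub>i(a) e\<^sub>i\<close>: dual bases without linear independence.
  All uses of dual bases are through this expansion, and in this form it passes to
  tensor products and can be restated for a dual without counting dimensions.
\<close>

definition frame where
  "frame K A I f e \<longleftrightarrow> finite I \<and> e \<in> I \<rightarrow> carrier A \<and> (\<forall>i\<in>I. f i \<in> linear_maps K A (ground K)) \<and>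
     (\<forall>a\<in>carrier A. (\<Oplus>\<^bsub>A\<^esub>i\<in>I. f i a \<odot>\<^bsub>A\<^esub> e i) = a)"

text \<open>
  The map \<open>id \<otimes> \<phi> : X \<otimes> A \<rightarrow> X\<close> for a functional \<open>\<phi>\<close> on \<open>A\<close>.
\<close>

abbreviation slice where
  "slice X \<phi> t \<equiv> tlift X (\<lambda>x a. \<phi> a \<odot>\<^bsub>X\<^esub> x) t"

lemma slice_bilin:
  assumes X: "module K X" and \<phi>: "\<phi> \<in> linear_maps K A (ground K)"
  shows "bilin K X A X (\<lambda>x a. \<phi> a \<odot>\<^bsub>X\<^esub> x)"
proof -
  have "\<phi> a \<in> carrier K" if "a \<in> carrier A" for a using lin_closed[OF \<phi> that] by simp
  then show ?thesis
    by (intro bilinI lin \<phi> X) auto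
qed

text \<open>
  Over a frame of \<open>A\<close> a tensor in \<open>X \<otimes> A\<close> is recovered from its slices, so the slices by the frame
  functionals separate tensors (\<open>frame_sep\<close>).
\<close>

lemma frame_expand:
  assumes F: "frame K A I f e" and A: "module K A" and X: "module K X" and t: "t \<in> carrier (tensor K X A)"
  shows "t = (\<Oplus>\<^bsub>tensor K X A\<^esub>i\<in>I. pure K X A (slice X (f i) t) (e i))"
proof -
  have f: "f i \<in> linear_maps K A (ground K)" and e: "e i \<in> carrier A" if "i \<in> I" for i using F that by (auto simp: frame_def)
  interpret A: module K A by (rule A)
  interpret X: module K X by (rule X)
  interpret T: module K "tensor K X A" using A X by simp
  show ?thesis
  proof (rule linear_ext[OF X A lin_id lin_finsum[OF T.module_axioms T.module_axioms] T.module_axioms t])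
    show "(\<lambda>t. pure K X A (slice X (f i) t) (e i)) \<in> linear_maps K (tensor K X A) (tensor K X A)" if "i \<in> I" for i
      by (rule lin_pure1[OF X A tlift_linear[OF X A slice_bilin[OF X f] X] e]) (use that in auto)
    fix x a assume xa: "x \<in> carrier X" "a \<in> carrier A"
    have c: "f i a \<in> carrier K" if "i \<in> I" for i using lin_closed[OF f xa(2)] that by auto
    have "pure K X A x a = pure K X A x (\<Oplus>\<^bsub>A\<^esub>i\<in>I. f i a \<odot>\<^bsub>A\<^esub> e i)" using F xa by (simp add: frame_def)
    also have "\<dots> = (\<Oplus>\<^bsub>tensor K X A\<^esub>i\<in>I. pure K X A x (f i a \<odot>\<^bsub>A\<^esub> e i))"
      by (rule linear_maps_finsum[OF lin_pure2[OF X A lin_id xa(1)] A T.module_axioms]) (use F c e in \<open>auto simp: frame_def\<close>)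
    also have "\<dots> = (\<Oplus>\<^bsub>tensor K X A\<^esub>i\<in>I. pure K X A (slice X (f i) (pure K X A x a)) (e i))"
      by (rule T.M.finsum_cong') (use c e xa f A X in \<open>auto simp: tlift_pure[OF X A slice_bilin[OF X f] X xa] pure_smult_middle intro!: pure_closed\<close>)
    finally show "pure K X A x a = \<dots>" .
  qed
qed

lemma frame_sep:
  assumes F: "frame K A I f e" and A: "module K A" and X: "module K X"
    and t: "t \<in> carrier (tensor K X A)" and t': "t' \<in> carrier (tensor K X A)"
    and eq: "\<And>i. i \<in> I \<Longrightarrow> slice X (f i) t = slice X (f i) t'"
  shows "t = t'"
proof -
  interpret T: module K "tensor K X A" using A X by simp
  have f: "f i \<in> linear_maps K A (ground K)" and e: "e i \<in> carrier A" if "i \<in> I" for i using F that by (auto simp: frame_def)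
  have c: "pure K X A (slice X (f i) t') (e i) \<in> carrier (tensor K X A)" if "i \<in> I" for i
    using lin_closed[OF tlift_linear[OF X A slice_bilin[OF X f[OF that]] X] t'] e[OF that] A X by simp
  have "t = (\<Oplus>\<^bsub>tensor K X A\<^esub>i\<in>I. pure K X A (slice X (f i) t) (e i))"
    by (rule frame_expand[OF F A X t])
  also have "\<dots> = (\<Oplus>\<^bsub>tensor K X A\<^esub>i\<in>I. pure K X A (slice X (f i) t') (e i))"
    by (rule T.M.finsum_cong') (use c eq in auto)
  also have "\<dots> = t'"
    by (rule frame_expand[OF F A X t', symmetric])
  finally show ?thesis .
qed

lemma tensor_functional:
  assumes [simp]: "module K A" "module K B" and f: "f \<in> linear_maps K A (ground K)" and g: "g \<in> linear_maps K B (ground K)"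
  shows "bilin K A B (ground K) (\<lambda>a b. f a \<otimes>\<^bsub>K\<^esub> g b)"
proof -
  have [simp]: "cring K" using module_cring assms(1) .
  have [simp]: "f a \<in> carrier K" if "a \<in> carrier A" for a using lin_closed[OF f that] by simp
  have [simp]: "g a \<in> carrier K" if "a \<in> carrier B" for a using lin_closed[OF g that] by simp
  show ?thesis by (rule bilinI) (rule lin f g | (simp; fail))+
qed

lemma frame_tensor:
  assumes F: "frame K A I f e" and G: "frame K B J g d" and A: "module K A" and B: "module K B"
  shows "frame K (tensor K A B) (I \<times> J) (\<lambda>p. tlift K (\<lambda>a b. f (fst p) a \<otimes>\<^bsub>K\<^esub> g (snd p) b)) (\<lambda>p. pure K A B (e (fst p)) (d (snd p)))"
proof -
  have f: "f i \<in> linear_maps K A (ground K)" and e: "e i \<in> carrier A" if "i \<in> I" for i using F that by (auto simp: frame_def)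
  have g: "g i \<in> linear_maps K B (ground K)" and d: "d i \<in> carrier B" if "i \<in> J" for i using G that by (auto simp: frame_def)
  have gr: "module K (ground K)" using ground_module module_cring A by blast
  interpret A: module K A by (rule A)
  interpret B: module K B by (rule B)
  interpret T: module K "tensor K A B" using A B by simp
  have fin: "finite I" "finite J" using F G by (auto simp: frame_def)
  have fg: "tlift K (\<lambda>a b. f i a \<otimes>\<^bsub>K\<^esub> g j b) \<in> linear_maps K (tensor K A B) (ground K)" if "i \<in> I" "j \<in> J" for i j
    unfolding tlift_ground[of K, abs_def] using tlift_linear[OF A B tensor_functional[OF A B f g] gr] that by blast
  have "(\<Oplus>\<^bsub>tensor K A B\<^esub>p\<in>I \<times> J. tlift K (\<lambda>a b. f (fst p) a \<otimes>\<^bsub>K\<^esub> g (snd p) b) t \<odot>\<^bsub>tensor K A B\<^esub> pure K A B (e (fst p)) (d (snd p))) = t"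
    if t: "t \<in> carrier (tensor K A B)" for t
  proof (rule linear_ext[OF A B lin_finsum[OF T.module_axioms T.module_axioms] lin_id T.module_axioms t])
    show "(\<lambda>t. tlift K (\<lambda>a b. f (fst p) a \<otimes>\<^bsub>K\<^esub> g (snd p) b) t \<odot>\<^bsub>tensor K A B\<^esub> pure K A B (e (fst p)) (d (snd p)))
       \<in> linear_maps K (tensor K A B) (tensor K A B)" if "p \<in> I \<times> J" for p
      by (rule lin_smult_scalar[OF T.module_axioms _ fg]) (use that e d A B in auto)
    fix a b assume ab: "a \<in> carrier A" "b \<in> carrier B"
    have fc: "f i a \<in> carrier K" if "i \<in> I" for i using lin_closed[OF f ab(1)] that by auto
    have gc: "g j b \<in> carrier K" if "j \<in> J" for j using lin_closed[OF g ab(2)] that by auto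
    have sm: "pure K A B (f i a \<odot>\<^bsub>A\<^esub> e i) (g j b \<odot>\<^bsub>B\<^esub> d j) = (f i a \<otimes>\<^bsub>K\<^esub> g j b) \<odot>\<^bsub>tensor K A B\<^esub> pure K A B (e i) (d j)"
      if "i \<in> I" "j \<in> J" for i j
      using fc[OF that(1)] gc[OF that(2)] e[OF that(1)] d[OF that(2)]
      by (subst pure_smult_left[OF A B]) (simp_all add: pure_smult_right[OF A B] T.smult_assoc1 A B)
    have "pure K A B a b = pure K A B (\<Oplus>\<^bsub>A\<^esub>i\<in>I. f i a \<odot>\<^bsub>A\<^esub> e i) (\<Oplus>\<^bsub>B\<^esub>j\<in>J. g j b \<odot>\<^bsub>B\<^esub> d j)"
      using F G ab by (simp add: frame_def)
    also have "\<dots> = (\<Oplus>\<^bsub>tensor K A B\<^esub>i\<in>I. pure K A B (f i a \<odot>\<^bsub>A\<^esub> e i) (\<Oplus>\<^bsub>B\<^esub>j\<in>J. g j b \<odot>\<^bsub>B\<^esub> d j))"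
      by (rule linear_maps_finsum[OF lin_pure1[OF A B lin_id] A T.module_axioms]) (use fin fc gc e d in \<open>auto intro!: B.M.finsum_closed\<close>)
    also have "\<dots> = (\<Oplus>\<^bsub>tensor K A B\<^esub>i\<in>I. \<Oplus>\<^bsub>tensor K A B\<^esub>j\<in>J. pure K A B (f i a \<odot>\<^bsub>A\<^esub> e i) (g j b \<odot>\<^bsub>B\<^esub> d j))"
      by (intro T.M.finsum_cong' refl linear_maps_finsum[OF lin_pure2[OF A B lin_id] B T.module_axioms])
        (use fin fc gc e d A B in \<open>auto intro!: T.M.finsum_closed pure_closed\<close>)
    also have "\<dots> = (\<Oplus>\<^bsub>tensor K A B\<^esub>p\<in>I \<times> J. pure K A B (f (fst p) a \<odot>\<^bsub>A\<^esub> e (fst p)) (g (snd p) b \<odot>\<^bsub>B\<^esub> d (snd p)))"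
      by (rule T.M.finsum_Times[OF fin]) (use fc gc e d A B in \<open>auto intro!: pure_closed\<close>)
    also have "\<dots> = (\<Oplus>\<^bsub>tensor K A B\<^esub>p\<in>I \<times> J. tlift K (\<lambda>a b. f (fst p) a \<otimes>\<^bsub>K\<^esub> g (snd p) b) (pure K A B a b)
         \<odot>\<^bsub>tensor K A B\<^esub> pure K A B (e (fst p)) (d (snd p)))"
      by (rule T.M.finsum_cong')
        (use fc gc e d A B f g in \<open>auto simp: tlift_ground[of K] tlift_pure[OF A B tensor_functional[OF A B f g] gr ab] sm\<close>)
    finally show "(\<Oplus>\<^bsub>tensor K A B\<^esub>p\<in>I \<times> J. tlift K (\<lambda>a b. f (fst p) a \<otimes>\<^bsub>K\<^esub> g (snd p) b) (pure K A B a b)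
         \<odot>\<^bsub>tensor K A B\<^esub> pure K A B (e (fst p)) (d (snd p))) = pure K A B a b" by (rule sym)
  qed
  then show ?thesis
    unfolding frame_def using fin e d A B fg by (intro conjI ballI) (simp_all add: Pi_iff mem_Times_iff)
qed

abbreviation tens_fun where
  "tens_fun K f g \<equiv> tlift K (\<lambda>a b. f a \<otimes>\<^bsub>K\<^esub> g b)"

lemma functional_closed: "\<lbrakk>f \<in> linear_maps K A (ground K); a \<in> carrier A\<rbrakk> \<Longrightarrow> f a \<in> carrier K"
  using lin_closed[of f K A "ground K" a] by simp

lemma module_ground: "module K V \<Longrightarrow> module K (ground K)"
  by (simp add: ground_module module_cring)

lemma tens_fun_linear:
  assumes "module K A" "module K B" "f \<in> linear_maps K A (ground K)" "g \<in> linear_maps K B (ground K)"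
  shows "tens_fun K f g \<in> linear_maps K (tensor K A B) (ground K)"
  unfolding tlift_ground[of K, abs_def]
  by (rule tlift_linear[OF assms(1,2) tensor_functional[OF assms] module_ground[OF assms(1)]])

lemma tens_fun_pure:
  assumes "module K A" "module K B" "f \<in> linear_maps K A (ground K)" "g \<in> linear_maps K B (ground K)"
    "a \<in> carrier A" "b \<in> carrier B"
  shows "tens_fun K f g (pure K A B a b) = f a \<otimes>\<^bsub>K\<^esub> g b"
  unfolding tlift_ground[of K]
  by (rule tlift_pure[OF assms(1,2) tensor_functional[OF assms(1-4)] module_ground[OF assms(1)] assms(5,6)])

lemma slice_linear:
  assumes "module K X" "module K A" "\<phi> \<in> linear_maps K A (ground K)"
  shows "(\<lambda>t. slice X \<phi> t) \<in> linear_maps K (tensor K X A) X"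
  using tlift_linear[OF assms(1,2) slice_bilin[OF assms(1,3)] assms(1)] .

lemma slice_pure:
  assumes "module K X" "module K A" "\<phi> \<in> linear_maps K A (ground K)" "x \<in> carrier X" "a \<in> carrier A"
  shows "slice X \<phi> (pure K X A x a) = \<phi> a \<odot>\<^bsub>X\<^esub> x"
  using tlift_pure[OF assms(1,2) slice_bilin[OF assms(1,3)] assms(1,4,5)] .

lemma slice_cong:
  assumes X: "module K X" and A: "module K A" and f: "f \<in> linear_maps K A (ground K)" and t: "t \<in> carrier (tensor K X A)"
    and "\<And>a. a \<in> carrier A \<Longrightarrow> f a = g a"
  shows "slice X f t = slice X g t"
  by (rule tlift_cong[OF X A slice_bilin[OF X f] X t]) (simp add: assms)

lemma slice_tmap:
  assumes X: "module K X" and A: "module K A" and Y: "module K Y" and B: "module K B"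
    and f: "f \<in> linear_maps K X Y" and \<Delta>: "\<Delta> \<in> linear_maps K A B"
    and \<phi>: "\<phi> \<in> linear_maps K B (ground K)" and t: "t \<in> carrier (tensor K X A)"
  shows "slice Y \<phi> (tmap K Y B f \<Delta> t) = f (slice X (\<lambda>a. \<phi> (\<Delta> a)) t)"
proof (rule linear_ext[OF X A lin_comp[OF slice_linear[OF Y B \<phi>] tmap_linear[OF X A Y B f \<Delta>]]
    lin_comp[OF f slice_linear[OF X A lin_comp[OF \<phi> \<Delta>]]] Y t])
  fix x a assume xa: "x \<in> carrier X" "a \<in> carrier A"
  then show "slice Y \<phi> (tmap K Y B f \<Delta> (pure K X A x a)) = f (slice X (\<lambda>a. \<phi> (\<Delta> a)) (pure K X A x a))"
    using lin_closed[OF f] lin_closed[OF \<Delta>] functional_closed[OF \<phi>] linear_mapsD(3)[OF f]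
    by (simp add: tmap_pure[OF X A Y B f \<Delta>] slice_pure[OF X A lin_comp[OF \<phi> \<Delta>]] slice_pure[OF Y B \<phi>])
qed

text \<open>
  Slicing \<open>(\<alpha> \<otimes> id) t\<close> by \<open>f \<otimes> g\<close> is slicing first by \<open>g\<close> and then by \<open>f\<close>. Iterated coactions become
  composites of operators through this rule.
\<close>

lemma slice_assoc:
  assumes X: "module K X" and Y: "module K Y" and A: "module K A" and B: "module K B"
    and \<alpha>: "\<alpha> \<in> linear_maps K X (tensor K Y A)"
    and f: "f \<in> linear_maps K A (ground K)" and g: "g \<in> linear_maps K B (ground K)"
    and t: "t \<in> carrier (tensor K X B)"
  shows "slice Y (tens_fun K f g) (tassoc K Y A B (tmap K (tensor K Y A) B \<alpha> id t)) = slice Y f (\<alpha> (slice X g t))"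
proof -
  have YA: "module K (tensor K Y A)" and AB: "module K (tensor K A B)" using A B Y by simp_all
  interpret Y: module K Y by (rule Y)
  note tl = tmap_linear[OF X B YA B \<alpha> id_linear]
  note fg = tens_fun_linear[OF A B f g]
  have key: "slice Y (tens_fun K f g) (tassoc K Y A B (pure K (tensor K Y A) B s b)) = slice Y f (g b \<odot>\<^bsub>tensor K Y A\<^esub> s)"
    if s: "s \<in> carrier (tensor K Y A)" and b: "b \<in> carrier B" for s b
  proof (rule linear_ext[OF Y A _ _ Y s])
    note gb = functional_closed[OF g b]
    show "(\<lambda>s. slice Y (tens_fun K f g) (tassoc K Y A B (pure K (tensor K Y A) B s b))) \<in> linear_maps K (tensor K Y A) Y"
      by (rule lin_comp[OF slice_linear[OF Y AB fg] lin_comp[OF tassoc_linear[OF Y A B] lin_pure1[OF YA B lin_id b]]])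
    show "(\<lambda>s. slice Y f (g b \<odot>\<^bsub>tensor K Y A\<^esub> s)) \<in> linear_maps K (tensor K Y A) Y"
      by (rule lin_comp[OF slice_linear[OF Y A f] lin_smult[OF YA gb lin_id]])
    fix y a assume ya: "y \<in> carrier Y" "a \<in> carrier A"
    then show "slice Y (tens_fun K f g) (tassoc K Y A B (pure K (tensor K Y A) B (pure K Y A y a) b)) =
       slice Y f (g b \<odot>\<^bsub>tensor K Y A\<^esub> pure K Y A y a)"
      using b gb functional_closed[OF f ya(2)] Y A B
      by (simp add: tassoc_pure slice_pure[OF Y AB fg] tens_fun_pure[OF A B f g] slice_pure[OF Y A f] Y.smult_assoc1
         flip: pure_smult_left)
  qed
  show ?thesis
  proof (rule linear_ext[OF X B lin_comp[OF slice_linear[OF Y AB fg] lin_comp[OF tassoc_linear[OF Y A B] tl]]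
      lin_comp[OF slice_linear[OF Y A f] lin_comp[OF \<alpha> slice_linear[OF X B g]]] Y t])
    fix x b assume xb: "x \<in> carrier X" "b \<in> carrier B"
    then show "slice Y (tens_fun K f g) (tassoc K Y A B (tmap K (tensor K Y A) B \<alpha> id (pure K X B x b))) =
      slice Y f (\<alpha> (slice X g (pure K X B x b)))"
      using key[OF lin_closed[OF \<alpha> xb(1)] xb(2)] linear_mapsD(3)[OF \<alpha> functional_closed[OF g xb(2)] xb(1)]
      by (simp add: tmap_pure[OF X B YA B \<alpha> id_linear] slice_pure[OF X B g])
  qed
qed

section \<open>Perfect pairings\<close>

text \<open>
  The frames are parameters, with one index set for both sides: \<open>d\<^sub>i\<close> provides the functionals for \<open>e\<^sub>i\<close> and
  conversely. This makes the notion symmetric and gives non-degeneracy and representability of functionals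
  on either side.
\<close>

locale perfect_pairing =
  fixes K :: "('k, 'l) ring_scheme" and D :: "('k, 'd, 'm1) module_scheme" and A :: "('k, 'a, 'm2) module_scheme"
    and p :: "'d \<Rightarrow> 'a \<Rightarrow> 'k" and I :: "'i set" and e :: "'i \<Rightarrow> 'a" and d :: "'i \<Rightarrow> 'd"
  assumes modD: "module K D" and modA: "module K A" and p_bilin: "bilin K D A (ground K) p"
    and frame_A: "frame K A I (\<lambda>i. p (d i)) e"
    and frame_D: "frame K D I (\<lambda>i u. p u (e i)) d"
begin

lemma p_lin: "u \<in> carrier D \<Longrightarrow> p u \<in> linear_maps K A (ground K)"
  and p_lin1: "a \<in> carrier A \<Longrightarrow> (\<lambda>u. p u a) \<in> linear_maps K D (ground K)"
  and p_closed: "\<lbrakk>u \<in> carrier D; a \<in> carrier A\<rbrakk> \<Longrightarrow> p u a \<in> carrier K"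
  using p_bilin bilinD(3)[OF p_bilin] by (auto simp: bilin_def)

lemma d_in: "i \<in> I \<Longrightarrow> d i \<in> carrier D" and e_in: "i \<in> I \<Longrightarrow> e i \<in> carrier A" and fin: "finite I"
  using frame_A frame_D by (auto simp: frame_def)

lemma D_sep:
  assumes u: "u \<in> carrier D" "v \<in> carrier D" and eq: "\<And>a. a \<in> carrier A \<Longrightarrow> p u a = p v a"
  shows "u = v"
proof -
  interpret D: module K D by (rule modD)
  have "(\<Oplus>\<^bsub>D\<^esub>i\<in>I. p u (e i) \<odot>\<^bsub>D\<^esub> d i) = (\<Oplus>\<^bsub>D\<^esub>i\<in>I. p v (e i) \<odot>\<^bsub>D\<^esub> d i)"
    by (rule D.M.finsum_cong') (use u eq e_in d_in p_closed in auto)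
  then show ?thesis using frame_D u by (simp add: frame_def)
qed

text \<open>
  By non-degeneracy, linearity of a map into \<open>D\<close> can be tested after pairing with \<open>A\<close>.
\<close>

lemma linear_into_D:
  assumes U: "module K U" and f: "\<And>u. u \<in> carrier U \<Longrightarrow> f u \<in> carrier D"
    and lin: "\<And>a. a \<in> carrier A \<Longrightarrow> (\<lambda>u. p (f u) a) \<in> linear_maps K U (ground K)"
  shows "f \<in> linear_maps K U D"
proof (rule linear_mapsI)
  interpret D: module K D by (rule modD)
  interpret U: module K U by (rule U)
  show "f (u \<oplus>\<^bsub>U\<^esub> v) = f u \<oplus>\<^bsub>D\<^esub> f v" if "u \<in> carrier U" "v \<in> carrier U" for u v
    by (rule D_sep) (use that f linear_mapsD(2)[OF lin] linear_mapsD(2)[OF p_lin1] in auto)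
  show "f (c \<odot>\<^bsub>U\<^esub> u) = c \<odot>\<^bsub>D\<^esub> f u" if "c \<in> carrier K" "u \<in> carrier U" for c u
    by (rule D_sep) (use that f linear_mapsD(3)[OF lin] linear_mapsD(3)[OF p_lin1] in auto)
qed (rule f)

lemma slice_sep:
  assumes X: "module K X" and t: "t \<in> carrier (tensor K X A)" "t' \<in> carrier (tensor K X A)"
    and eq: "\<And>u. u \<in> carrier D \<Longrightarrow> slice X (p u) t = slice X (p u) t'"
  shows "t = t'"
  by (rule frame_sep[OF frame_A modA X t]) (use eq d_in in auto)

lemma slice_sep2:
  assumes X: "module K X" and t: "t \<in> carrier (tensor K X (tensor K A A))" "t' \<in> carrier (tensor K X (tensor K A A))"
    and eq: "\<And>u v. \<lbrakk>u \<in> carrier D; v \<in> carrier D\<rbrakk> \<Longrightarrow> slice X (tens_fun K (p u) (p v)) t = slice X (tens_fun K (p u) (p v)) t'"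
  shows "t = t'"
  by (rule frame_sep[OF frame_tensor[OF frame_A frame_A modA modA] tensor_module[OF modA modA] X t]) (use eq d_in in auto)

text \<open>
  The element representing \<open>f\<close> is \<open>\<Sum> f(e\<^sub>i) d\<^sub>i\<close>.
\<close>

lemma functional_representable:
  assumes f: "f \<in> linear_maps K A (ground K)"
  obtains u where "u \<in> carrier D" "\<And>a. a \<in> carrier A \<Longrightarrow> p u a = f a"
proof
  interpret D: module K D by (rule modD)
  interpret A: module K A by (rule modA)
  let ?u = "\<Oplus>\<^bsub>D\<^esub>i\<in>I. f (e i) \<odot>\<^bsub>D\<^esub> d i"
  have c: "f (e i) \<in> carrier K" if "i \<in> I" for i using functional_closed[OF f] e_in that by blast
  show "?u \<in> carrier D" by (rule D.M.finsum_closed) (use c d_in in auto)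
  fix a assume a: "a \<in> carrier A"
  note g = module_ground[OF modA]
  interpret G: module K "ground K" by (rule g)
  have "p ?u a = (\<Oplus>\<^bsub>ground K\<^esub>i\<in>I. p (f (e i) \<odot>\<^bsub>D\<^esub> d i) a)"
    by (rule linear_maps_finsum[OF p_lin1[OF a] modD g fin]) (use c d_in in auto)
  also have "\<dots> = (\<Oplus>\<^bsub>ground K\<^esub>i\<in>I. f (p (d i) a \<odot>\<^bsub>A\<^esub> e i))"
    by (rule G.M.finsum_cong')
      (use linear_mapsD(3)[OF p_lin1[OF a]] linear_mapsD(3)[OF f] c d_in e_in p_closed[OF _ a] in \<open>auto simp: D.R.m_comm\<close>)
  also have "\<dots> = f (\<Oplus>\<^bsub>A\<^esub>i\<in>I. p (d i) a \<odot>\<^bsub>A\<^esub> e i)"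
    by (rule linear_maps_finsum[OF f modA g fin, symmetric]) (use p_closed[OF _ a] d_in e_in in auto)
  also have "\<dots> = f a" using frame_A a by (simp add: frame_def)
  finally show "p ?u a = f a" .
qed

text \<open>
  The map inducing a given family of operators is \<open>x \<mapsto> \<Sum> (d\<^sub>i \<rhd> x) \<otimes> e\<^sub>i\<close>.
\<close>

lemma linear_coaction_exists:
  assumes X: "module K X"
    and act1: "\<And>x. x \<in> carrier X \<Longrightarrow> (\<lambda>u. act u x) \<in> linear_maps K D X"
    and act2: "\<And>u. u \<in> carrier D \<Longrightarrow> act u \<in> linear_maps K X X"
  obtains \<gamma> where "\<gamma> \<in> linear_maps K X (tensor K X A)" "\<gamma> \<in> extensional (carrier X)"
    "\<And>u x. \<lbrakk>u \<in> carrier D; x \<in> carrier X\<rbrakk> \<Longrightarrow> slice X (p u) (\<gamma> x) = act u x"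
proof
  interpret D: module K D by (rule modD)
  interpret X: module K X by (rule X)
  have T: "module K (tensor K X A)" using X modA by simp
  define \<gamma>' where "\<gamma>' = (\<lambda>x. \<Oplus>\<^bsub>tensor K X A\<^esub>i\<in>I. pure K X A (act (d i) x) (e i))"
  define \<gamma> where "\<gamma> = restrict \<gamma>' (carrier X)"
  have "\<gamma>' \<in> linear_maps K X (tensor K X A)"
    unfolding \<gamma>'_def by (intro lin_finsum T X lin_pure1 modA act2 d_in e_in)
  then show "\<gamma> \<in> linear_maps K X (tensor K X A)"
    by (rule linear_maps_congI[OF _ X]) (simp add: \<gamma>_def)
  show "\<gamma> \<in> extensional (carrier X)" by (simp add: \<gamma>_def)
  fix u x assume u: "u \<in> carrier D" and x: "x \<in> carrier X"
  have ac: "act v x \<in> carrier X" if "v \<in> carrier D" for v using lin_closed[OF act1[OF x] that] .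
  have "slice X (p u) (\<gamma> x) = (\<Oplus>\<^bsub>X\<^esub>i\<in>I. slice X (p u) (pure K X A (act (d i) x) (e i)))"
    using x unfolding \<gamma>_def \<gamma>'_def
    by (simp add: linear_maps_finsum[OF slice_linear[OF X modA p_lin[OF u]] T X fin] Pi_iff ac d_in e_in X modA)
  also have "\<dots> = (\<Oplus>\<^bsub>X\<^esub>i\<in>I. act (p u (e i) \<odot>\<^bsub>D\<^esub> d i) x)"
    by (rule X.M.finsum_cong')
      (use linear_mapsD(3)[OF act1[OF x]] in \<open>auto simp: slice_pure[OF X modA p_lin[OF u]] ac d_in e_in p_closed u\<close>)
  also have "\<dots> = act (\<Oplus>\<^bsub>D\<^esub>i\<in>I. p u (e i) \<odot>\<^bsub>D\<^esub> d i) x"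
    by (rule linear_maps_finsum[OF act1[OF x] modD X fin, symmetric]) (use d_in e_in p_closed u in auto)
  also have "\<dots> = act u x" using frame_D u by (simp add: frame_def)
  finally show "slice X (p u) (\<gamma> x) = act u x" .
qed

end

section \<open>Right coactions as left actions of the dual\<close>

text \<open>
  On \<open>D\<close> only closure of the operations is assumed. Their algebraic laws are transposes of those of \<open>A\<close>, and
  the locale is used to derive them (\<open>D_unital_algebra\<close>).
\<close>

locale bialgebra_pairing = perfect_pairing K D A p I e d
  for K :: "('k, 'l) ring_scheme" and D :: "('k, 'd) bialgebra" and A :: "('k, 'a) bialgebra"
    and p I and e :: "'i \<Rightarrow> 'a" and d +
  assumes algA: "unital_algebra K A"
    and comult_A: "comult A \<in> linear_maps K A (tensor K A A)"
    and comult_D: "u \<in> carrier D \<Longrightarrow> comult D u \<in> carrier (tensor K D D)"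
    and mult_D: "\<lbrakk>u \<in> carrier D; v \<in> carrier D\<rbrakk> \<Longrightarrow> u \<otimes>\<^bsub>D\<^esub> v \<in> carrier D"
    and one_D: "\<one>\<^bsub>D\<^esub> \<in> carrier D"
    and p_mult: "\<lbrakk>u \<in> carrier D; v \<in> carrier D; a \<in> carrier A\<rbrakk> \<Longrightarrow>
       p (u \<otimes>\<^bsub>D\<^esub> v) a = tens_fun K (p u) (p v) (comult A a)"
    and p_comult: "\<lbrakk>u \<in> carrier D; a \<in> carrier A; b \<in> carrier A\<rbrakk> \<Longrightarrow>
       p u (a \<otimes>\<^bsub>A\<^esub> b) = tens_fun K (\<lambda>v. p v a) (\<lambda>v. p v b) (comult D u)"
    and p_one: "a \<in> carrier A \<Longrightarrow> p \<one>\<^bsub>D\<^esub> a = counit A a"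
    and p_counit: "u \<in> carrier D \<Longrightarrow> p u \<one>\<^bsub>A\<^esub> = counit D u"
begin

text \<open>
  The product on \<open>A\<close> is transposed to the coproduct of \<open>D\<close>. Hence multiplicativity of a coaction is the
  module algebra rule for the induced action.
\<close>

lemma slice_mult:
  assumes X: "unital_algebra K X" and u: "u \<in> carrier D"
    and s: "s \<in> carrier (tensor K X A)" and t: "t \<in> carrier (tensor K X A)"
  shows "slice X (p u) (s \<otimes>\<^bsub>tensor K X A\<^esub> t) =
    tlift X (\<lambda>u1 u2. slice X (p u1) s \<otimes>\<^bsub>X\<^esub> slice X (p u2) t) (comult D u)"
proof -
  note mX = unital_algebra_module[OF X]
  interpret X: unital_algebra K X by (rule X)
  have sl: "(\<lambda>v. slice X (p v) r) \<in> linear_maps K D X" if r: "r \<in> carrier (tensor K X A)" for r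
    by (rule lin_tlift2[OF mX modA r _ _ mX modD])
      (auto intro!: lin_smult_scalar[OF mX] p_lin1 slice_bilin[OF mX] p_lin)
  have slc: "slice X (p v) r \<in> carrier X" if "v \<in> carrier D" "r \<in> carrier (tensor K X A)" for v r
    by (rule lin_closed[OF sl]) (rule that)+
  note sl2 = slice_linear[OF mX modA p_lin]
  have inner: "bilin K D D X (\<lambda>u1 u2. slice X (p u1) s \<otimes>\<^bsub>X\<^esub> slice X (p u2) t)"
    if "s \<in> carrier (tensor K X A)" "t \<in> carrier (tensor K X A)" for s t
    by (intro bilinI lin_mult[OF X] sl slc that)
  show ?thesis
  proof (rule bilin_mult_ext[OF X algA sl2[OF u] mX _ s t])
    show "bilin K (tensor K X A) (tensor K X A) X
       (\<lambda>s t. tlift X (\<lambda>u1 u2. slice X (p u1) s \<otimes>\<^bsub>X\<^esub> slice X (p u2) t) (comult D u))"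
      by (intro bilinI lin_tlift2[OF modD modD comult_D[OF u]] lin_mult[OF X] sl2 slc inner mX tensor_module modA)
    fix x a x' a' assume x: "x \<in> carrier X" "a \<in> carrier A" "x' \<in> carrier X" "a' \<in> carrier A"
    interpret AA: unital_algebra K A by (rule algA)
    have "tlift X (\<lambda>u1 u2. slice X (p u1) (pure K X A x a) \<otimes>\<^bsub>X\<^esub> slice X (p u2) (pure K X A x' a')) (comult D u) =
      tlift X (\<lambda>u1 u2. (p u1 a \<otimes>\<^bsub>K\<^esub> p u2 a') \<odot>\<^bsub>X\<^esub> (x \<otimes>\<^bsub>X\<^esub> x')) (comult D u)"
    proof (rule tlift_cong[OF modD modD inner mX comult_D[OF u]])
      fix u1 u2 assume v: "u1 \<in> carrier D" "u2 \<in> carrier D"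
      show "slice X (p u1) (pure K X A x a) \<otimes>\<^bsub>X\<^esub> slice X (p u2) (pure K X A x' a') =
         (p u1 a \<otimes>\<^bsub>K\<^esub> p u2 a') \<odot>\<^bsub>X\<^esub> (x \<otimes>\<^bsub>X\<^esub> x')"
        using v x p_closed
        by (simp add: slice_pure[OF mX modA p_lin] X.smult_mult_left X.smult_mult_right flip: X.smult_assoc1)
          (simp add: X.R.m_comm)
    qed (use x mX modA in auto)
    also have "\<dots> = tlift (ground K) (\<lambda>u1 u2. p u1 a \<otimes>\<^bsub>K\<^esub> p u2 a') (comult D u) \<odot>\<^bsub>X\<^esub> (x \<otimes>\<^bsub>X\<^esub> x')"
      by (rule tlift_comp[OF modD modD lin_smult_scalar[OF mX _ lin_id] tensor_functional[OF modD modD p_lin1 p_lin1]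
          module_ground[OF mX] mX comult_D[OF u], symmetric]) (use x in auto)
    finally show "slice X (p u) (pure K X A (x \<otimes>\<^bsub>X\<^esub> x') (a \<otimes>\<^bsub>A\<^esub> a')) =
      tlift X (\<lambda>u1 u2. slice X (p u1) (pure K X A x a) \<otimes>\<^bsub>X\<^esub> slice X (p u2) (pure K X A x' a')) (comult D u)"
      using x u by (simp add: slice_pure[OF mX modA p_lin] p_comult tlift_ground[of K])
  qed
qed

lemma induced_action_app:
  "\<lbrakk>u \<in> carrier D; x \<in> carrier X\<rbrakk> \<Longrightarrow> induced_action D p X \<gamma> u x = slice X (p u) (\<gamma> x)"
  by (simp add: induced_action_def)

lemma induced_action_linear:
  assumes X: "module K X" and \<gamma>: "\<gamma> \<in> linear_maps K X (tensor K X A)" and u: "u \<in> carrier D"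
  shows "induced_action D p X \<gamma> u \<in> linear_maps K X X"
  by (rule linear_maps_congI[OF lin_comp[OF slice_linear[OF X modA p_lin[OF u]] \<gamma>] X]) (simp add: induced_action_app u)

lemma induced_action_linear1:
  assumes X: "module K X" and \<gamma>: "\<gamma> \<in> linear_maps K X (tensor K X A)" and x: "x \<in> carrier X"
  shows "(\<lambda>u. induced_action D p X \<gamma> u x) \<in> linear_maps K D X"
proof -
  have "(\<lambda>u. slice X (p u) (\<gamma> x)) \<in> linear_maps K D X"
    by (rule lin_tlift2[OF X modA lin_closed[OF \<gamma> x] _ _ X modD])
      (auto intro!: lin_smult_scalar[OF X] p_lin1 slice_bilin[OF X] p_lin)
  then show ?thesis
    by (rule linear_maps_congI[OF _ modD]) (simp add: induced_action_app x)
qed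

text \<open>
  Both sides of coassociativity lie in \<open>X \<otimes> (A \<otimes> A)\<close>. Sliced by \<open>u \<otimes> v\<close>, one becomes \<open>u \<rhd> (v \<rhd> x)\<close>, since
  slicing commutes with the inner coaction, and the other \<open>uv \<rhd> x\<close>, since the coproduct of \<open>A\<close> is
  transposed to the product of \<open>D\<close>. The statement is for linear \<open>\<gamma>\<close>, since it is also applied to maps
  that are not yet known to be coactions.
\<close>

lemma coassociative_iff_action_mult:
  assumes mX: "module K X" and \<gamma>: "\<gamma> \<in> linear_maps K X (tensor K X A)"
  shows "(\<forall>x\<in>carrier X. tassoc K X A A (tmap K (tensor K X A) A \<gamma> id (\<gamma> x)) = tmap K X (tensor K A A) id (comult A) (\<gamma> x))
     \<longleftrightarrow> (\<forall>u\<in>carrier D. \<forall>v\<in>carrier D. \<forall>x\<in>carrier X. induced_action D p X \<gamma> (u \<otimes>\<^bsub>D\<^esub> v) x =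
       induced_action D p X \<gamma> u (induced_action D p X \<gamma> v x))" (is "?L \<longleftrightarrow> ?R")
proof -
  let ?act = "induced_action D p X \<gamma>"
  note \<gamma>c = lin_closed[OF \<gamma>]
  have AA: "module K (tensor K A A)" using modA by simp
  have l: "slice X (tens_fun K (p u) (p v)) (tassoc K X A A (tmap K (tensor K X A) A \<gamma> id (\<gamma> x))) = ?act u (?act v x)"
    if "u \<in> carrier D" "v \<in> carrier D" "x \<in> carrier X" for u v x
    using that slice_assoc[OF mX mX modA modA \<gamma> p_lin p_lin \<gamma>c] lin_closed[OF induced_action_linear[OF mX \<gamma>]]
    by (simp add: induced_action_app)
  have r: "slice X (tens_fun K (p u) (p v)) (tmap K X (tensor K A A) id (comult A) (\<gamma> x)) = ?act (u \<otimes>\<^bsub>D\<^esub> v) x"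
    if "u \<in> carrier D" "v \<in> carrier D" "x \<in> carrier X" for u v x
  proof -
    have "slice X (tens_fun K (p u) (p v)) (tmap K X (tensor K A A) id (comult A) (\<gamma> x)) =
      slice X (\<lambda>a. tens_fun K (p u) (p v) (comult A a)) (\<gamma> x)"
      by (subst slice_tmap[OF mX modA mX AA id_linear comult_A tens_fun_linear[OF modA modA p_lin p_lin]])
        (use that \<gamma>c in auto)
    also have "\<dots> = slice X (p (u \<otimes>\<^bsub>D\<^esub> v)) (\<gamma> x)"
      by (rule tlift_cong[OF mX modA slice_bilin[OF mX lin_comp[OF tens_fun_linear[OF modA modA p_lin p_lin] comult_A]] mX])
        (use that \<gamma>c p_mult in auto)
    finally show ?thesis using that mult_D by (simp add: induced_action_app)
  qed
  have cl: "tassoc K X A A (tmap K (tensor K X A) A \<gamma> id (\<gamma> x)) \<in> carrier (tensor K X (tensor K A A))"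
    "tmap K X (tensor K A A) id (comult A) (\<gamma> x) \<in> carrier (tensor K X (tensor K A A))" if "x \<in> carrier X" for x
    using lin_closed[OF tassoc_linear[OF mX modA modA] lin_closed[OF tmap_linear[OF mX modA _ modA \<gamma> id_linear] \<gamma>c[OF that]]]
      lin_closed[OF tmap_linear[OF mX modA mX AA id_linear comult_A] \<gamma>c[OF that]] mX modA by simp_all
  show ?thesis
  proof
    assume ?L
    then show ?R using l r by fastforce
  next
    assume R: ?R
    show ?L
    proof (intro ballI)
      fix x assume x: "x \<in> carrier X"
      show "tassoc K X A A (tmap K (tensor K X A) A \<gamma> id (\<gamma> x)) = tmap K X (tensor K A A) id (comult A) (\<gamma> x)"
        by (rule slice_sep2[OF mX cl[OF x]]) (use l r R x in auto)
    qed
  qed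
qed

text \<open>
  Every axiom on the left corresponds to one axiom on the right, by slicing with all \<open>u \<in> D\<close>; the two
  linearity axioms of an action hold for any linear \<open>\<gamma>\<close>.
\<close>

theorem right_coaction_iff_left_action:
  assumes X: "unital_algebra K X" and \<gamma>: "\<gamma> \<in> linear_maps K X (tensor K X A)" and ext: "\<gamma> \<in> extensional (carrier X)"
  shows "right_coaction K A X \<gamma> \<longleftrightarrow> left_action K D X (induced_action D p X \<gamma>)"
proof -
  let ?act = "induced_action D p X \<gamma>"
  note mX = unital_algebra_module[OF X]
  interpret X: unital_algebra K X by (rule X)
  interpret AA: unital_algebra K A by (rule algA)
  have T: "unital_algebra K (tensor K X A)" using X algA by simp
  interpret T: unital_algebra K "tensor K X A" by (rule T)
  note \<gamma>c = lin_closed[OF \<gamma>]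
  have AA: "module K (tensor K A A)" using modA by simp
  have c1: "act \<in> carrier D \<rightarrow>\<^sub>E (carrier X \<rightarrow>\<^sub>E carrier X)" if "act = ?act" for act
    using that lin_closed[OF induced_action_linear[OF mX \<gamma>]] by (auto simp: induced_action_def PiE_def extensional_def)
  have mult: "(\<forall>x\<in>carrier X. \<forall>y\<in>carrier X. \<gamma> (x \<otimes>\<^bsub>X\<^esub> y) = \<gamma> x \<otimes>\<^bsub>tensor K X A\<^esub> \<gamma> y) \<longleftrightarrow>
     (\<forall>u\<in>carrier D. \<forall>x\<in>carrier X. \<forall>y\<in>carrier X.
        ?act u (x \<otimes>\<^bsub>X\<^esub> y) = tlift X (\<lambda>u1 u2. ?act u1 x \<otimes>\<^bsub>X\<^esub> ?act u2 y) (comult D u))" (is "?L \<longleftrightarrow> ?R")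
  proof -
    have e: "slice X (p u) (\<gamma> x \<otimes>\<^bsub>tensor K X A\<^esub> \<gamma> y) = tlift X (\<lambda>u1 u2. ?act u1 x \<otimes>\<^bsub>X\<^esub> ?act u2 y) (comult D u)"
      if u: "u \<in> carrier D" and x: "x \<in> carrier X" and y: "y \<in> carrier X" for u x y
    proof -
      have "bilin K D D X (\<lambda>u1 u2. ?act u1 x \<otimes>\<^bsub>X\<^esub> ?act u2 y)"
        by (intro bilinI lin_mult[OF X] induced_action_linear1[OF mX \<gamma>] x y
          lin_closed[OF induced_action_linear1[OF mX \<gamma> x]] lin_closed[OF induced_action_linear1[OF mX \<gamma> y]])
      then show ?thesis
        unfolding slice_mult[OF X u \<gamma>c[OF x] \<gamma>c[OF y]]
        by (intro tlift_cong[OF modD modD _ mX comult_D[OF u], symmetric]) (use x y in \<open>simp_all add: induced_action_app\<close>)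
    qed
    show ?thesis
    proof
      assume ?L
      then show ?R using e by (auto simp: induced_action_app)
    next
      assume R: ?R
      show ?L
      proof (intro ballI)
        fix x y assume xy: "x \<in> carrier X" "y \<in> carrier X"
        show "\<gamma> (x \<otimes>\<^bsub>X\<^esub> y) = \<gamma> x \<otimes>\<^bsub>tensor K X A\<^esub> \<gamma> y"
          by (rule slice_sep[OF mX]) (use R xy \<gamma>c e in \<open>auto simp flip: induced_action_app\<close>)
      qed
    qed
  qed
  have one: "\<gamma> \<one>\<^bsub>X\<^esub> = \<one>\<^bsub>tensor K X A\<^esub> \<longleftrightarrow> (\<forall>u\<in>carrier D. ?act u \<one>\<^bsub>X\<^esub> = counit D u \<odot>\<^bsub>X\<^esub> \<one>\<^bsub>X\<^esub>)"
  proof -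
    have e: "slice X (p u) \<one>\<^bsub>tensor K X A\<^esub> = counit D u \<odot>\<^bsub>X\<^esub> \<one>\<^bsub>X\<^esub>" if "u \<in> carrier D" for u
      using that by (simp add: tensor_sel(4) slice_pure[OF mX modA p_lin] p_counit)
    show ?thesis
      using e slice_sep[OF mX \<gamma>c[OF X.A.one_closed] T.A.one_closed] by (auto simp: induced_action_app)
  qed
  note coassoc = coassociative_iff_action_mult[OF mX \<gamma>]
  have counit: "(\<forall>x\<in>carrier X. slice X (counit A) (\<gamma> x) = x) \<longleftrightarrow> (\<forall>x\<in>carrier X. ?act \<one>\<^bsub>D\<^esub> x = x)"
  proof -
    have "slice X (counit A) (\<gamma> x) = ?act \<one>\<^bsub>D\<^esub> x" if "x \<in> carrier X" for x
      unfolding induced_action_app[OF one_D that]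
      by (rule tlift_cong[OF mX modA slice_bilin[OF mX p_lin[OF one_D]] mX \<gamma>c[OF that], symmetric]) (simp add: p_one)
    then show ?thesis by simp
  qed
  have hom: "\<gamma> \<in> alg_hom K X (tensor K X A) \<longleftrightarrow>
     (\<forall>x\<in>carrier X. \<forall>y\<in>carrier X. \<gamma> (x \<otimes>\<^bsub>X\<^esub> y) = \<gamma> x \<otimes>\<^bsub>tensor K X A\<^esub> \<gamma> y) \<and> \<gamma> \<one>\<^bsub>X\<^esub> = \<one>\<^bsub>tensor K X A\<^esub>"
    using alg_homI[OF \<gamma>] alg_homD(2,3)[of \<gamma> K X "tensor K X A"] by blast
  have lins: "\<forall>u\<in>carrier D. ?act u \<in> linear_maps K X X" "\<forall>x\<in>carrier X. (\<lambda>u. ?act u x) \<in> linear_maps K D X"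
    using induced_action_linear[OF mX \<gamma>] induced_action_linear1[OF mX \<gamma>] by blast+
  show ?thesis
    unfolding right_coaction_def left_action_def Int_iff hom mult one coassoc counit
    using c1[OF refl] ext lins by blast
qed

lemma induced_action_inj:
  assumes X: "module K X" and \<gamma>: "\<gamma> \<in> linear_maps K X (tensor K X A)" "\<gamma> \<in> extensional (carrier X)"
    and \<delta>: "\<delta> \<in> linear_maps K X (tensor K X A)" "\<delta> \<in> extensional (carrier X)"
    and eq: "induced_action D p X \<gamma> = induced_action D p X \<delta>"
  shows "\<gamma> = \<delta>"
proof (rule extensionalityI[OF \<gamma>(2) \<delta>(2)])
  fix x assume x: "x \<in> carrier X"
  show "\<gamma> x = \<delta> x"
    by (rule slice_sep[OF X lin_closed[OF \<gamma>(1) x] lin_closed[OF \<delta>(1) x]])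
      (use eq x in \<open>simp flip: induced_action_app\<close>)
qed

lemma coaction_exists:
  assumes X: "unital_algebra K X" and act: "left_action K D X act"
  obtains \<gamma> where "right_coaction K A X \<gamma>" "induced_action D p X \<gamma> = act"
proof -
  obtain \<gamma> where \<gamma>: "\<gamma> \<in> linear_maps K X (tensor K X A)" "\<gamma> \<in> extensional (carrier X)"
    "\<And>u x. \<lbrakk>u \<in> carrier D; x \<in> carrier X\<rbrakk> \<Longrightarrow> slice X (p u) (\<gamma> x) = act u x"
    using linear_coaction_exists[of X act] act X by (auto simp: left_action_def)
  have "act \<in> carrier D \<rightarrow>\<^sub>E (carrier X \<rightarrow>\<^sub>E carrier X)" using act by (simp add: left_action_def)
  then have e: "induced_action D p X \<gamma> = act"
    by (intro ext) (auto simp: induced_action_def \<gamma>(3) restrict_def PiE_iff extensional_def)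
  then show ?thesis using that right_coaction_iff_left_action[OF X \<gamma>(1,2)] act by simp
qed

lemma coaction_hom_iff:
  assumes X: "module K X" and Y: "module K Y" and \<gamma>: "\<gamma> \<in> linear_maps K X (tensor K X A)"
    and \<delta>: "\<delta> \<in> linear_maps K Y (tensor K Y A)" and f: "f \<in> linear_maps K X Y"
  shows "coaction_hom K A X \<gamma> Y \<delta> f \<longleftrightarrow> action_hom D X (induced_action D p X \<gamma>) (induced_action D p Y \<delta>) f"
proof -
  note fc = lin_closed[OF f]
  have e: "slice Y (p u) (tmap K Y A f id (\<gamma> x)) = f (induced_action D p X \<gamma> u x)"
    "slice Y (p u) (\<delta> (f x)) = induced_action D p Y \<delta> u (f x)" if "u \<in> carrier D" "x \<in> carrier X" for u x
    using that fc slice_tmap[OF X modA Y modA f id_linear p_lin lin_closed[OF \<gamma>]]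
    by (simp_all add: induced_action_app)
  have "tmap K Y A f id (\<gamma> x) \<in> carrier (tensor K Y A)" "\<delta> (f x) \<in> carrier (tensor K Y A)" if "x \<in> carrier X" for x
    using lin_closed[OF tmap_linear[OF X modA Y modA f id_linear] lin_closed[OF \<gamma> that]]
      lin_closed[OF \<delta> fc[OF that]] by simp_all
  then have "\<delta> (f x) = tmap K Y A f id (\<gamma> x) \<longleftrightarrow>
     (\<forall>u\<in>carrier D. slice Y (p u) (tmap K Y A f id (\<gamma> x)) = slice Y (p u) (\<delta> (f x)))" if "x \<in> carrier X" for x
    using slice_sep[OF Y, of "tmap K Y A f id (\<gamma> x)" "\<delta> (f x)"] that by auto
  then have "\<delta> (f x) = tmap K Y A f id (\<gamma> x) \<longleftrightarrow>
     (\<forall>u\<in>carrier D. f (induced_action D p X \<gamma> u x) = induced_action D p Y \<delta> u (f x))" if "x \<in> carrier X" for x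
    using that by (simp add: e)
  then show ?thesis by (auto simp: coaction_hom_def action_hom_def)
qed

end

section \<open>Independence of the ring structure\<close>

text \<open>
  The tensor product \<open>V \<otimes> W\<close> as a module, its pure tensors and linear maps depend only on the module parts
  of \<open>V\<close> and \<open>W\<close>. So \<open>H\<close> may be exchanged for \<open>opp H\<close>, \<open>dual_alg K H\<close> for \<open>dual K H\<close>, and the codouble
  and the double for the tensor products that underlie them.
\<close>

lemma tensor_null_cong:
  assumes "carrier V = carrier V'" "ring.add V = ring.add V'" "smult V = smult V'"
    "carrier W = carrier W'" "ring.add W = ring.add W'" "smult W = smult W'"
  shows "tensor_null K V W = tensor_null K V' W'"
  using assms unfolding tensor_null_def tensor_rels_def by simp

lemma pure_cong:
  assumes "carrier V = carrier V'" "ring.add V = ring.add V'" "smult V = smult V'"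
    "carrier W = carrier W'" "ring.add W = ring.add W'" "smult W = smult W'"
  shows "pure K V W = pure K V' W'"
  using assms tensor_null_cong[OF assms, of K] unfolding pure_def by simp

lemma tensor_group_cong:
  assumes "carrier V = carrier V'" "ring.add V = ring.add V'" "smult V = smult V'"
    "carrier W = carrier W'" "ring.add W = ring.add W'" "smult W = smult W'"
  shows "tensor_group K V W = tensor_group K V' W'"
  using assms tensor_null_cong[OF assms, of K] unfolding tensor_group_def by simp

lemma linear_maps_same:
  assumes "carrier V = carrier V'" "ring.add V = ring.add V'" "smult V = smult V'"
    "carrier W = carrier W'" "ring.add W = ring.add W'" "smult W = smult W'"
  shows "linear_maps K V W = linear_maps K V' W'"
  using assms unfolding linear_maps_def by simp

lemma tensor_cong_module:
  assumes "carrier V = carrier V'" "ring.add V = ring.add V'" "smult V = smult V'"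
    "carrier W = carrier W'" "ring.add W = ring.add W'" "smult W = smult W'"
  shows "carrier (tensor K V W) = carrier (tensor K V' W')" "ring.add (tensor K V W) = ring.add (tensor K V' W')"
    "ring.zero (tensor K V W) = ring.zero (tensor K V' W')" "smult (tensor K V W) = smult (tensor K V' W')"
  using assms tensor_group_cong[OF assms, of K] pure_cong[OF assms, of K] unfolding tensor_def by simp_all

lemma with_coalgebra_sel [simp]:
  "carrier (with_coalgebra A \<Delta> \<epsilon>) = carrier A" "monoid.mult (with_coalgebra A \<Delta> \<epsilon>) = monoid.mult A"
  "monoid.one (with_coalgebra A \<Delta> \<epsilon>) = monoid.one A" "ring.zero (with_coalgebra A \<Delta> \<epsilon>) = ring.zero A"
  "ring.add (with_coalgebra A \<Delta> \<epsilon>) = ring.add A" "smult (with_coalgebra A \<Delta> \<epsilon>) = smult A"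
  "comult (with_coalgebra A \<Delta> \<epsilon>) = \<Delta>" "counit (with_coalgebra A \<Delta> \<epsilon>) = \<epsilon>"
  by (simp_all add: with_coalgebra_def)

lemma with_coalgebra_tensor [simp]:
  "pure K (with_coalgebra A \<Delta> \<epsilon>) W = pure K A W" "pure K V (with_coalgebra A \<Delta> \<epsilon>) = pure K V A"
  "tensor_group K (with_coalgebra A \<Delta> \<epsilon>) W = tensor_group K A W" "tensor_group K V (with_coalgebra A \<Delta> \<epsilon>) = tensor_group K V A"
  "linear_maps K (with_coalgebra A \<Delta> \<epsilon>) W = linear_maps K A W" "linear_maps K V (with_coalgebra A \<Delta> \<epsilon>) = linear_maps K V A"
  by (intro pure_cong tensor_group_cong linear_maps_same; simp)+

lemma with_coalgebra_tensor_eq [simp]: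
  "tensor K (with_coalgebra A \<Delta> \<epsilon>) W = tensor K A W" "tensor K V (with_coalgebra A \<Delta> \<epsilon>) = tensor K V A"
  unfolding tensor_def with_coalgebra_tensor by simp_all

lemma module_same:
  assumes M: "module K V" and e: "carrier V = carrier V'" "ring.add V = ring.add V'" "ring.zero V = ring.zero V'" "smult V = smult V'"
  shows "module K V'"
proof -
  interpret module K V by (rule M)
  have a: "abelian_group V'"
    by (rule abelian_groupI) (use M.a_assoc M.a_comm M.l_neg M.a_inv_closed in \<open>auto simp flip: e\<close>)
  show ?thesis
    by (rule moduleI[OF _ a]) (simp_all add: R.is_cring smult_l_distr smult_r_distr smult_assoc1 flip: e)
qed

lemma module_with_coalgebra [simp]: "module K A \<Longrightarrow> module K (with_coalgebra A \<Delta> \<epsilon>)"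
  by (erule module_same) simp_all

section \<open>Tensor products of pairings\<close>

definition tensor_pairing where
  "tensor_pairing K p q s t = tlift K (\<lambda>u v. tlift K (\<lambda>a b. p u a \<otimes>\<^bsub>K\<^esub> q v b) t) s"

lemma frame_cong:
  assumes "frame K A I f e" and "module K A" and "\<And>i a. \<lbrakk>i \<in> I; a \<in> carrier A\<rbrakk> \<Longrightarrow> f' i a = f i a"
  shows "frame K A I f' e"
proof -
  interpret A: module K A by fact
  have f: "f i \<in> linear_maps K A (ground K)" if "i \<in> I" for i using assms(1) that by (simp add: frame_def)
  have "f' i \<in> linear_maps K A (ground K)" if "i \<in> I" for i
    by (rule linear_maps_congI[OF f[OF that] assms(2) assms(3)[OF that]])
  moreover have "(\<Oplus>\<^bsub>A\<^esub>i\<in>I. f' i a \<odot>\<^bsub>A\<^esub> e i) = a" if a: "a \<in> carrier A" for a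
  proof -
    have "(\<Oplus>\<^bsub>A\<^esub>i\<in>I. f' i a \<odot>\<^bsub>A\<^esub> e i) = (\<Oplus>\<^bsub>A\<^esub>i\<in>I. f i a \<odot>\<^bsub>A\<^esub> e i)"
      by (rule A.M.finsum_cong') (use assms(1,3) functional_closed[OF f a] a in \<open>auto simp: frame_def\<close>)
    then show ?thesis using assms(1) a by (simp add: frame_def)
  qed
  ultimately show ?thesis using assms(1) by (simp add: frame_def)
qed

lemma finsum_same:
  assumes "carrier V = carrier V'" "ring.add V = ring.add V'" "ring.zero V = ring.zero V'"
  shows "finsum V f J = finsum V' f J"
  unfolding finsum_def finprod_def using assms by simp

lemma frame_same:
  assumes "carrier V = carrier V'" "ring.add V = ring.add V'" "ring.zero V = ring.zero V'" "smult V = smult V'"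
  shows "frame K V J f e = frame K V' J f e"
  unfolding frame_def linear_maps_same[OF assms(1,2,4) refl refl refl] finsum_same[OF assms(1-3)] assms(1,4) ..

locale two_pairings = P: perfect_pairing K D A p I e d + Q: perfect_pairing K D' A' q J e' d'
  for K :: "('k, 'l) ring_scheme" and D :: "('k, 'd, 'm1) module_scheme" and A :: "('k, 'a, 'm2) module_scheme"
    and p and I :: "'i set" and e d and D' :: "('k, 'd2, 'm3) module_scheme" and A' :: "('k, 'a2, 'm4) module_scheme"
    and q and J :: "'j set" and e' d'
begin

abbreviation "tp \<equiv> tensor_pairing K p q"

lemma tp_right_bilin: "\<lbrakk>u \<in> carrier D; v \<in> carrier D'\<rbrakk> \<Longrightarrow> bilin K A A' (ground K) (\<lambda>a b. p u a \<otimes>\<^bsub>K\<^esub> q v b)"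
  by (rule tensor_functional[OF P.modA Q.modA P.p_lin Q.p_lin])

lemma tp_left_bilin:
  assumes t: "t \<in> carrier (tensor K A A')"
  shows "bilin K D D' (ground K) (\<lambda>u v. tlift (ground K) (\<lambda>a b. p u a \<otimes>\<^bsub>K\<^esub> q v b) t)"
proof -
  note g = module_ground[OF P.modA] and c = module_cring[OF P.modA]
  show ?thesis
    by (intro bilinI lin_tlift2[OF P.modA Q.modA t] lin_ring_mult[OF c] tp_right_bilin g P.modD Q.modD
       P.p_lin1 Q.p_lin1 P.p_closed Q.p_closed)
qed

lemma tp_pure:
  "\<lbrakk>u \<in> carrier D; v \<in> carrier D'; t \<in> carrier (tensor K A A')\<rbrakk> \<Longrightarrow>
    tp (pure K D D' u v) t = tens_fun K (p u) (q v) t"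
  unfolding tensor_pairing_def tlift_ground[of K]
  by (rule tlift_pure[OF P.modD Q.modD tp_left_bilin module_ground[OF P.modA]])

lemma tp_pure_right:
  assumes s: "s \<in> carrier (tensor K D D')" and a: "a \<in> carrier A" "b \<in> carrier A'"
  shows "tp s (pure K A A' a b) = tens_fun K (\<lambda>u. p u a) (\<lambda>v. q v b) s"
  unfolding tensor_pairing_def tlift_ground[of K]
  by (rule tlift_cong[OF P.modD Q.modD tp_left_bilin module_ground[OF P.modA] s])
    (simp_all add: tlift_pure[OF P.modA Q.modA tp_right_bilin module_ground[OF P.modA]] a P.modA Q.modA)

lemma tp_bilin: "bilin K (tensor K D D') (tensor K A A') (ground K) tp"
  unfolding tensor_pairing_def[abs_def] tlift_ground[of K]
  by (intro bilinI tlift_linear[OF P.modD Q.modD tp_left_bilin] lin_tlift2[OF P.modD Q.modD]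
     tlift_linear[OF P.modA Q.modA tp_right_bilin] tp_left_bilin module_ground[OF P.modA] tensor_module P.modA Q.modA)

sublocale T: perfect_pairing K "tensor K D D'" "tensor K A A'" tp "I \<times> J"
  "\<lambda>x. pure K A A' (e (fst x)) (e' (snd x))" "\<lambda>x. pure K D D' (d (fst x)) (d' (snd x))"
proof (rule perfect_pairing.intro)
  show "frame K (tensor K A A') (I \<times> J) (\<lambda>x. tp (pure K D D' (d (fst x)) (d' (snd x))))
     (\<lambda>x. pure K A A' (e (fst x)) (e' (snd x)))"
    by (rule frame_cong[OF frame_tensor[OF P.frame_A Q.frame_A P.modA Q.modA]])
      (auto simp: tp_pure P.d_in Q.d_in P.modA Q.modA)
  show "frame K (tensor K D D') (I \<times> J) (\<lambda>x u. tp u (pure K A A' (e (fst x)) (e' (snd x))))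
     (\<lambda>x. pure K D D' (d (fst x)) (d' (snd x)))"
    by (rule frame_cong[OF frame_tensor[OF P.frame_D Q.frame_D P.modD Q.modD]])
      (auto simp: tp_pure_right P.e_in Q.e_in P.modD Q.modD)
qed (simp_all add: P.modA Q.modA P.modD Q.modD tp_bilin)

text \<open>
  Tensors in \<open>D \<otimes> D'\<close> are separated by pure tensors of \<open>A \<otimes> A'\<close>. The uniqueness part of the definition of
  the coproduct on a dual is of this kind.
\<close>

lemma tp_sep:
  assumes s: "s \<in> carrier (tensor K D D')" "s' \<in> carrier (tensor K D D')"
    and eq: "\<And>a b. \<lbrakk>a \<in> carrier A; b \<in> carrier A'\<rbrakk> \<Longrightarrow>
      tens_fun K (\<lambda>u. p u a) (\<lambda>v. q v b) s = tens_fun K (\<lambda>u. p u a) (\<lambda>v. q v b) s'"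
  shows "s = s'"
proof (rule T.D_sep[OF s])
  fix t assume t: "t \<in> carrier (tensor K A A')"
  show "tp s t = tp s' t"
    by (rule linear_ext[OF P.modA Q.modA bilinD(2)[OF tp_bilin s(1)] bilinD(2)[OF tp_bilin s(2)] module_ground[OF P.modA] t])
      (simp add: tp_pure_right s eq)
qed

end

section \<open>The dual of a finite-dimensional bialgebra\<close>

lemma dual_alg_sel:
  "carrier (dual_alg K H) = linear_maps K H (ground K) \<inter> extensional (carrier H)"
  "monoid.mult (dual_alg K H) = (\<lambda>\<theta> \<theta>'. \<lambda>h\<in>carrier H. tens_fun K \<theta> \<theta>' (comult H h))"
  "monoid.one (dual_alg K H) = (\<lambda>h\<in>carrier H. counit H h)"
  "ring.zero (dual_alg K H) = (\<lambda>h\<in>carrier H. \<zero>\<^bsub>K\<^esub>)"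
  "ring.add (dual_alg K H) = (\<lambda>\<theta> \<theta>'. \<lambda>h\<in>carrier H. \<theta> h \<oplus>\<^bsub>K\<^esub> \<theta>' h)"
  "smult (dual_alg K H) = (\<lambda>c \<theta>. \<lambda>h\<in>carrier H. c \<otimes>\<^bsub>K\<^esub> \<theta> h)"
  by (simp_all add: dual_alg_def)

lemma dual_sel [simp]:
  "carrier (dual K H) = carrier (dual_alg K H)" "monoid.mult (dual K H) = monoid.mult (dual_alg K H)"
  "monoid.one (dual K H) = monoid.one (dual_alg K H)" "ring.zero (dual K H) = ring.zero (dual_alg K H)"
  "ring.add (dual K H) = ring.add (dual_alg K H)" "smult (dual K H) = smult (dual_alg K H)"
  "counit (dual K H) = (\<lambda>\<theta>. \<theta> \<one>\<^bsub>H\<^esub>)"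
  by (simp_all add: dual_def)

lemma dual_tensor:
  "tensor K (dual K H) W = tensor K (dual_alg K H) W" "tensor K V (dual K H) = tensor K V (dual_alg K H)"
  "pure K (dual K H) W = pure K (dual_alg K H) W" "pure K V (dual K H) = pure K V (dual_alg K H)"
  "linear_maps K (dual K H) W = linear_maps K (dual_alg K H) W" "linear_maps K V (dual K H) = linear_maps K V (dual_alg K H)"
  by (simp_all add: dual_def)

lemma dual_alg_module:
  assumes H: "module K H"
  shows "module K (dual_alg K H)"
proof -
  interpret H: module K H by (rule H)
  note cl = functional_closed
  have neg: "(\<lambda>h\<in>carrier H. \<ominus>\<^bsub>K\<^esub> \<theta> h) \<in> carrier (dual_alg K H)" if \<theta>: "\<theta> \<in> carrier (dual_alg K H)" for \<theta>
    using \<theta> unfolding dual_alg_sel linear_maps_def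
    by (auto simp: Pi_iff H.R.minus_add H.R.r_minus)
  have ag: "abelian_group (dual_alg K H)"
  proof (rule abelian_groupI)
    fix \<theta> assume \<theta>: "\<theta> \<in> carrier (dual_alg K H)"
    show "\<exists>y\<in>carrier (dual_alg K H). y \<oplus>\<^bsub>dual_alg K H\<^esub> \<theta> = \<zero>\<^bsub>dual_alg K H\<^esub>"
      by (rule bexI[OF _ neg[OF \<theta>]])
        (use \<theta> in \<open>auto simp: dual_alg_sel linear_maps_def Pi_iff H.R.l_neg fun_eq_iff\<close>)
  qed (auto simp: dual_alg_sel linear_maps_def Pi_iff H.R.a_ac H.R.r_distr fun_eq_iff extensional_def)
  show ?thesis
    by (rule moduleI[OF H.R.is_cring ag])
      (auto simp: dual_alg_sel linear_maps_def Pi_iff H.R.l_distr H.R.r_distr H.R.m_ac fun_eq_iff extensional_def)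
qed

lemma dual_evaluation_linear: "h \<in> carrier H \<Longrightarrow> (\<lambda>\<theta>. \<theta> h) \<in> linear_maps K (dual_alg K H) (ground K)"
  by (rule linear_mapsI) (auto simp: dual_alg_sel linear_maps_def)

lemma dual_finsum:
  assumes H: "module K H" and "finite I" and \<theta>: "\<theta> \<in> I \<rightarrow> carrier (dual_alg K H)" and h: "h \<in> carrier H"
  shows "(\<Oplus>\<^bsub>dual_alg K H\<^esub>i\<in>I. \<theta> i) h = (\<Oplus>\<^bsub>ground K\<^esub>i\<in>I. \<theta> i h)"
  by (rule linear_maps_finsum[OF dual_evaluation_linear[OF h] dual_alg_module[OF H] module_ground[OF H] assms(2) \<theta>])

lemma dual_eqI:
  assumes "\<theta> \<in> carrier (dual_alg K H)" "\<theta>' \<in> carrier (dual_alg K H)" "\<And>h. h \<in> carrier H \<Longrightarrow> \<theta> h = \<theta>' h"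
  shows "\<theta> = \<theta>'"
  using assms by (auto simp: dual_alg_sel intro: extensionalityI)

text \<open>
  The dual frame expands a functional by its values on the vectors: \<open>\<theta> = \<Sum> \<theta>(e\<^sub>i) d\<^sub>i\<close>.
\<close>

lemma evaluation_pairing:
  assumes H: "module K H" and F: "frame K H I d e" and d: "\<And>i. i \<in> I \<Longrightarrow> d i \<in> carrier (dual_alg K H)"
  shows "perfect_pairing K (dual_alg K H) H (\<lambda>\<theta> h. \<theta> h) I e d"
proof (rule perfect_pairing.intro)
  interpret H: module K H by (rule H)
  note g = module_ground[OF H] and m = dual_alg_module[OF H]
  interpret D: module K "dual_alg K H" by (rule m)
  interpret G: module K "ground K" by (rule g)
  have e: "e i \<in> carrier H" and fin: "finite I" if "i \<in> I" for i using F that by (auto simp: frame_def)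
  have fin: "finite I" using F by (simp add: frame_def)
  show "bilin K (dual_alg K H) H (ground K) (\<lambda>\<theta> h. \<theta> h)"
    by (intro bilinI dual_evaluation_linear) (simp_all add: dual_alg_sel)
  show "frame K (dual_alg K H) I (\<lambda>i \<theta>. \<theta> (e i)) d"
    unfolding frame_def
  proof (intro conjI ballI fin)
    show "d \<in> I \<rightarrow> carrier (dual_alg K H)" using d by auto
    show "(\<lambda>\<theta>. \<theta> (e i)) \<in> linear_maps K (dual_alg K H) (ground K)" if "i \<in> I" for i
      by (rule dual_evaluation_linear[OF e[OF that]])
    fix \<theta> assume \<theta>: "\<theta> \<in> carrier (dual_alg K H)"
    then have \<theta>l: "\<theta> \<in> linear_maps K H (ground K)" by (simp add: dual_alg_sel)
    note c = functional_closed[OF \<theta>l e]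
    have dc: "d i h \<in> carrier K" if "i \<in> I" "h \<in> carrier H" for i h
      using functional_closed[of "d i" K H h] d[OF that(1)] that(2) by (simp add: dual_alg_sel)
    show "(\<Oplus>\<^bsub>dual_alg K H\<^esub>i\<in>I. \<theta> (e i) \<odot>\<^bsub>dual_alg K H\<^esub> d i) = \<theta>"
    proof (rule dual_eqI[OF _ \<theta>])
      show "(\<Oplus>\<^bsub>dual_alg K H\<^esub>i\<in>I. \<theta> (e i) \<odot>\<^bsub>dual_alg K H\<^esub> d i) \<in> carrier (dual_alg K H)"
        by (rule D.M.finsum_closed) (use c d in auto)
      fix h assume h: "h \<in> carrier H"
      have "(\<Oplus>\<^bsub>dual_alg K H\<^esub>i\<in>I. \<theta> (e i) \<odot>\<^bsub>dual_alg K H\<^esub> d i) h = (\<Oplus>\<^bsub>ground K\<^esub>i\<in>I. (\<theta> (e i) \<odot>\<^bsub>dual_alg K H\<^esub> d i) h)"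
        by (rule dual_finsum[OF H fin _ h]) (use c d in auto)
      also have "\<dots> = (\<Oplus>\<^bsub>ground K\<^esub>i\<in>I. \<theta> (d i h \<odot>\<^bsub>H\<^esub> e i))"
        by (rule G.M.finsum_cong') (use h e c dc linear_mapsD(3)[OF \<theta>l] in \<open>auto simp: dual_alg_sel(6) H.R.m_comm\<close>)
      also have "\<dots> = \<theta> (\<Oplus>\<^bsub>H\<^esub>i\<in>I. d i h \<odot>\<^bsub>H\<^esub> e i)"
        by (rule linear_maps_finsum[OF \<theta>l H g fin, symmetric]) (use dc h e in auto)
      also have "\<dots> = \<theta> h" using F h by (simp add: frame_def)
      finally show "(\<Oplus>\<^bsub>dual_alg K H\<^esub>i\<in>I. \<theta> (e i) \<odot>\<^bsub>dual_alg K H\<^esub> d i) h = \<theta> h" .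
    qed
  qed
qed (use H F in \<open>simp_all add: dual_alg_module\<close>)

text \<open>
  An algebra with linear structure maps \<open>comult\<close> and \<open>counit\<close> suffices for the dual to be in duality with it.
  The codouble is such an algebra by construction.
\<close>

locale finite_coproduct_algebra =
  fixes K :: "('k, 'l) ring_scheme" and A :: "('k, 'a) bialgebra" and I :: "'i set" and d e
  assumes algA: "unital_algebra K A"
    and comult_A: "comult A \<in> linear_maps K A (tensor K A A)"
    and counit_A: "counit A \<in> linear_maps K A (ground K)"
    and frame_A: "frame K A I d e" and d_dual: "i \<in> I \<Longrightarrow> d i \<in> carrier (dual_alg K A)"
begin

abbreviation "D \<equiv> dual_alg K A"

lemma modA [simp]: "module K A" by (rule unital_algebra_module[OF algA])

sublocale ev: perfect_pairing K D A "\<lambda>\<theta> h. \<theta> h" I e d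
  by (rule evaluation_pairing[OF modA frame_A d_dual])

sublocale ev2: two_pairings K D A "\<lambda>\<theta> h. \<theta> h" I e d D A "\<lambda>\<theta> h. \<theta> h" I e d
  by unfold_locales

interpretation A: unital_algebra K A by (rule algA)

lemma conv_linear: "\<lbrakk>\<theta> \<in> carrier D; \<theta>' \<in> carrier D\<rbrakk> \<Longrightarrow> (\<lambda>h. tens_fun K \<theta> \<theta>' (comult A h)) \<in> linear_maps K A (ground K)"
  by (rule lin_comp[OF tens_fun_linear[OF modA modA] comult_A]) (simp_all add: dual_alg_sel)

lemma dual_mult_closed: "\<lbrakk>\<theta> \<in> carrier D; \<theta>' \<in> carrier D\<rbrakk> \<Longrightarrow> \<theta> \<otimes>\<^bsub>D\<^esub> \<theta>' \<in> carrier D"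
  using linear_maps_congI[OF conv_linear modA, of \<theta> \<theta>' "\<theta> \<otimes>\<^bsub>D\<^esub> \<theta>'"] by (simp add: dual_alg_sel(1,2))

lemma dual_one_closed: "\<one>\<^bsub>D\<^esub> \<in> carrier D"
  using linear_maps_congI[OF counit_A modA, of "\<one>\<^bsub>D\<^esub>"] by (simp add: dual_alg_sel(1,3))

text \<open>
  The condition under the definite description in \<open>dual\<close>.
\<close>

definition is_dual_comult where
  "is_dual_comult \<theta> t \<longleftrightarrow> t \<in> carrier (tensor K D D) \<and>
     (\<forall>h\<in>carrier A. \<forall>h'\<in>carrier A. \<theta> (h \<otimes>\<^bsub>A\<^esub> h') = tens_fun K (\<lambda>\<theta>. \<theta> h) (\<lambda>\<theta>. \<theta> h') t)"

lemma dual_comult_unique: "\<lbrakk>is_dual_comult \<theta> t; is_dual_comult \<theta> t'\<rbrakk> \<Longrightarrow> t = t'"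
  by (rule ev2.tp_sep) (auto simp: is_dual_comult_def)

text \<open>
  The functional \<open>h \<otimes> h' \<mapsto> \<theta>(hh')\<close> on \<open>A \<otimes> A\<close> is represented by a tensor in \<open>dual A \<otimes> dual A\<close>, because
  the tensor product of two perfect pairings is perfect.
\<close>

lemma dual_comult_exists:
  assumes \<theta>: "\<theta> \<in> carrier D"
  shows "\<exists>t. is_dual_comult \<theta> t"
proof -
  have m: "bilin K A A A (\<lambda>x y. x \<otimes>\<^bsub>A\<^esub> y)"
    by (intro bilinI lin_mult[OF algA] lin_id)
  have \<theta>l: "\<theta> \<in> linear_maps K A (ground K)" using \<theta> by (simp add: dual_alg_sel)
  obtain t where t: "t \<in> carrier (tensor K D D)"
    "\<And>s. s \<in> carrier (tensor K A A) \<Longrightarrow> tensor_pairing K (\<lambda>\<theta> h. \<theta> h) (\<lambda>\<theta> h. \<theta> h) t s = \<theta> (tlift A (\<lambda>x y. x \<otimes>\<^bsub>A\<^esub> y) s)"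
    by (rule ev2.T.functional_representable[OF lin_comp[OF \<theta>l tlift_linear[OF modA modA m modA]]]) blast
  have "\<theta> (h \<otimes>\<^bsub>A\<^esub> h') = tens_fun K (\<lambda>\<theta>. \<theta> h) (\<lambda>\<theta>. \<theta> h') t" if "h \<in> carrier A" "h' \<in> carrier A" for h h'
    using t(2)[of "pure K A A h h'"] that by (simp add: tlift_pure[OF modA modA m modA] ev2.tp_pure_right[OF t(1)])
  then show ?thesis using t by (auto simp: is_dual_comult_def)
qed

lemma comult_dual_spec: "\<theta> \<in> carrier D \<Longrightarrow> is_dual_comult \<theta> (comult (dual K A) \<theta>)"
proof -
  assume "\<theta> \<in> carrier D"
  then have "\<exists>!t. is_dual_comult \<theta> t" using dual_comult_exists dual_comult_unique by blast
  then have "is_dual_comult \<theta> (THE t. is_dual_comult \<theta> t)" by (rule theI')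
  moreover have "comult (dual K A) \<theta> = (THE t. is_dual_comult \<theta> t)"
    unfolding dual_def is_dual_comult_def by simp
  ultimately show ?thesis by simp
qed

lemma comult_dual_closed: "\<theta> \<in> carrier D \<Longrightarrow> comult (dual K A) \<theta> \<in> carrier (tensor K D D)"
  and comult_dual_eval: "\<lbrakk>\<theta> \<in> carrier D; h \<in> carrier A; h' \<in> carrier A\<rbrakk> \<Longrightarrow>
    tens_fun K (\<lambda>\<theta>. \<theta> h) (\<lambda>\<theta>. \<theta> h') (comult (dual K A) \<theta>) = \<theta> (h \<otimes>\<^bsub>A\<^esub> h')"
  using comult_dual_spec unfolding is_dual_comult_def by auto

lemma comult_dual_linear: "comult (dual K A) \<in> linear_maps K D (tensor K D D)"
proof -
  interpret D: module K D by (rule ev.modD)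
  interpret DD: module K "tensor K D D" using ev.modD by simp
  have tl: "tens_fun K (\<lambda>\<theta>. \<theta> h) (\<lambda>\<theta>. \<theta> h') \<in> linear_maps K (tensor K D D) (ground K)" if "h \<in> carrier A" "h' \<in> carrier A" for h h'
    by (rule tens_fun_linear[OF ev.modD ev.modD]) (rule dual_evaluation_linear that)+
  show ?thesis
  proof (rule linear_mapsI)
    fix \<theta> \<theta>' assume \<theta>: "\<theta> \<in> carrier D" "\<theta>' \<in> carrier D"
    show "comult (dual K A) (\<theta> \<oplus>\<^bsub>D\<^esub> \<theta>') = comult (dual K A) \<theta> \<oplus>\<^bsub>tensor K D D\<^esub> comult (dual K A) \<theta>'"
      by (rule ev2.tp_sep)
        (use \<theta> linear_mapsD(2)[OF tl] in \<open>simp_all add: comult_dual_closed comult_dual_eval\<close>, simp add: dual_alg_sel(5))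
  next
    fix c \<theta> assume \<theta>: "c \<in> carrier K" "\<theta> \<in> carrier D"
    show "comult (dual K A) (c \<odot>\<^bsub>D\<^esub> \<theta>) = c \<odot>\<^bsub>tensor K D D\<^esub> comult (dual K A) \<theta>"
      by (rule ev2.tp_sep)
        (use \<theta> linear_mapsD(3)[OF tl] in \<open>simp_all add: comult_dual_closed comult_dual_eval\<close>, simp add: dual_alg_sel(6))
  qed (rule comult_dual_closed)
qed

lemma dual_pairing: "bialgebra_pairing K (dual K A) A (\<lambda>\<theta> h. \<theta> h) I e d"
proof (rule bialgebra_pairing.intro)
  show "perfect_pairing K (dual K A) A (\<lambda>\<theta> h. \<theta> h) I e d"
  proof (rule perfect_pairing.intro)
    show "module K (dual K A)" using ev.modD unfolding dual_def by simp
    show "bilin K (dual K A) A (ground K) (\<lambda>\<theta> h. \<theta> h)"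
      using ev.p_bilin unfolding dual_def bilin_def by simp
    show "frame K (dual K A) I (\<lambda>i \<theta>. \<theta> (e i)) d"
      by (simp add: frame_same[of "dual K A" D] ev.frame_D)
  qed (rule modA, rule frame_A)
  show "bialgebra_pairing_axioms K (dual K A) A (\<lambda>\<theta> h. \<theta> h)"
    by (rule bialgebra_pairing_axioms.intro[OF algA comult_A])
      (use dual_mult_closed dual_one_closed comult_dual_closed comult_dual_eval in
        \<open>simp_all add: dual_alg_sel(2,3) dual_tensor\<close>)
qed

end

section \<open>Sweedler calculus\<close>

lemma tlift_tassoc_tmap:
  assumes X: "module K X" and Y: "module K Y" and A: "module K A" and B: "module K B" and Z: "module K Z"
    and \<alpha>: "\<alpha> \<in> linear_maps K X (tensor K Y A)" and G: "trilin K Y A B Z G" and t: "t \<in> carrier (tensor K X B)"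
  shows "tlift Z (\<lambda>x. tlift Z (G x)) (tassoc K Y A B (tmap K (tensor K Y A) B \<alpha> id t)) =
    tlift Z (\<lambda>x b. tlift Z (\<lambda>y a. G y a b) (\<alpha> x)) t"
proof -
  have YA: "module K (tensor K Y A)" using A Y by simp
  have "tlift Z (\<lambda>x. tlift Z (G x)) (tassoc K Y A B (tmap K (tensor K Y A) B \<alpha> id t)) =
    tlift Z (\<lambda>s b. tlift Z (\<lambda>y a. G y a b) s) (tmap K (tensor K Y A) B \<alpha> id t)"
    by (rule tlift_tassoc[OF Y A B G Z lin_closed[OF tmap_linear[OF X B YA B \<alpha> id_linear] t]])
  also have "\<dots> = tlift Z (\<lambda>x b. tlift Z (\<lambda>y a. G y a b) (\<alpha> x)) t"
    using tlift_tmap[OF X B YA B \<alpha> id_linear trilin_left[OF Y A B G Z] Z t] by simp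
  finally show ?thesis .
qed

lemma tlift_tmap_right:
  assumes X: "module K X" and A: "module K A" and B: "module K B" and C: "module K C" and Z: "module K Z"
    and \<Delta>: "\<Delta> \<in> linear_maps K C (tensor K A B)" and G: "trilin K X A B Z G" and t: "t \<in> carrier (tensor K X C)"
  shows "tlift Z (\<lambda>x. tlift Z (G x)) (tmap K X (tensor K A B) id \<Delta> t) = tlift Z (\<lambda>x c. tlift Z (G x) (\<Delta> c)) t"
  using tlift_tmap[OF X C X tensor_module[OF A B] id_linear \<Delta> trilin_right[OF X A B G Z] Z t] by simp

text \<open>
  The form in which coassociativity is used: \<open>\<Sum> G a\<^sub>(\<^sub>1\<^sub>)\<^sub>(\<^sub>1\<^sub>) a\<^sub>(\<^sub>1\<^sub>)\<^sub>(\<^sub>2\<^sub>) a\<^sub>(\<^sub>2\<^sub>) = \<Sum> G a\<^sub>(\<^sub>1\<^sub>) a\<^sub>(\<^sub>2\<^sub>)\<^sub>(\<^sub>1\<^sub>) a\<^sub>(\<^sub>2\<^sub>)\<^sub>(\<^sub>2\<^sub>)\<close>.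
\<close>

lemma tlift_coassoc:
  assumes A: "module K A" and Z: "module K Z" and \<Delta>: "\<Delta> \<in> linear_maps K A (tensor K A A)"
    and coassoc: "tassoc K A A A (tmap K (tensor K A A) A \<Delta> id (\<Delta> a)) = tmap K A (tensor K A A) id \<Delta> (\<Delta> a)"
    and G: "trilin K A A A Z G" and a: "a \<in> carrier A"
  shows "tlift Z (\<lambda>x c. tlift Z (\<lambda>a b. G a b c) (\<Delta> x)) (\<Delta> a) = tlift Z (\<lambda>x c. tlift Z (G x) (\<Delta> c)) (\<Delta> a)"
  using tlift_tassoc_tmap[OF A A A A Z \<Delta> G lin_closed[OF \<Delta> a]] tlift_tmap_right[OF A A A A Z \<Delta> G lin_closed[OF \<Delta> a]]
  unfolding coassoc by simp

lemma (in perfect_pairing) flipped: "perfect_pairing K A D (\<lambda>a u. p u a) I d e"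
  by (rule perfect_pairing.intro) (use modA modD frame_A frame_D p_bilin in \<open>simp_all add: bilin_def\<close>)

context bialgebra_pairing
begin

lemma conv_linear1:
  assumes v: "v \<in> carrier D" and t: "t \<in> carrier (tensor K A A)"
  shows "(\<lambda>u. tens_fun K (p u) (p v) t) \<in> linear_maps K D (ground K)"
    and "(\<lambda>u. tens_fun K (p v) (p u) t) \<in> linear_maps K D (ground K)"
proof -
  note g = module_ground[OF modA] and c = module_cring[OF modA]
  have "(\<lambda>u. tlift (ground K) (\<lambda>a b. p u a \<otimes>\<^bsub>K\<^esub> p v b) t) \<in> linear_maps K D (ground K)"
    by (rule lin_tlift2[OF modA modA t lin_ring_mult(1)[OF c p_lin1 p_closed[OF v]] tensor_functional[OF modA modA p_lin p_lin[OF v]] g modD])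
  moreover have "(\<lambda>u. tlift (ground K) (\<lambda>a b. p v a \<otimes>\<^bsub>K\<^esub> p u b) t) \<in> linear_maps K D (ground K)"
    by (rule lin_tlift2[OF modA modA t lin_ring_mult(2)[OF c p_lin1 p_closed[OF v]] tensor_functional[OF modA modA p_lin[OF v] p_lin] g modD])
  ultimately show "(\<lambda>u. tens_fun K (p u) (p v) t) \<in> linear_maps K D (ground K)"
    "(\<lambda>u. tens_fun K (p v) (p u) t) \<in> linear_maps K D (ground K)"
    by (simp_all add: tlift_ground[of K])
qed

lemma mult_D_linear:
  assumes v: "v \<in> carrier D"
  shows "(\<lambda>u. u \<otimes>\<^bsub>D\<^esub> v) \<in> linear_maps K D D" and "(\<lambda>u. v \<otimes>\<^bsub>D\<^esub> u) \<in> linear_maps K D D"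
  by (rule linear_into_D[OF modD]; (rule linear_maps_congI[OF conv_linear1(1)[OF v lin_closed[OF comult_A]] modD]
      linear_maps_congI[OF conv_linear1(2)[OF v lin_closed[OF comult_A]] modD])?; simp add: mult_D p_mult v)+

text \<open>
  The dual of a coalgebra is an algebra: each law is verified after pairing with \<open>a \<in> A\<close>, where it becomes
  coassociativity or a counit law of \<open>A\<close>.
\<close>

lemma D_unital_algebra:
  assumes coassoc: "\<And>a. a \<in> carrier A \<Longrightarrow> tassoc K A A A (tmap K (tensor K A A) A (comult A) id (comult A a)) =
      tmap K A (tensor K A A) id (comult A) (comult A a)"
    and counit: "counit A \<in> linear_maps K A (ground K)"
    and left: "\<And>a. a \<in> carrier A \<Longrightarrow> tlift A (\<lambda>a b. counit A a \<odot>\<^bsub>A\<^esub> b) (comult A a) = a"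
    and right: "\<And>a. a \<in> carrier A \<Longrightarrow> tlift A (\<lambda>a b. counit A b \<odot>\<^bsub>A\<^esub> a) (comult A a) = a"
  shows "unital_algebra K D"
proof -
  interpret D: module K D by (rule modD)
  interpret A: module K A by (rule modA)
  note g = module_ground[OF modA] and cK = module_cring[OF modA]
  note cA = lin_closed[OF comult_A]
  note pp = tensor_functional[OF modA modA p_lin p_lin]
  have assoc: "(u \<otimes>\<^bsub>D\<^esub> v) \<otimes>\<^bsub>D\<^esub> w = u \<otimes>\<^bsub>D\<^esub> (v \<otimes>\<^bsub>D\<^esub> w)" if u: "u \<in> carrier D" "v \<in> carrier D" "w \<in> carrier D" for u v w
  proof (rule D_sep)
    fix a assume a: "a \<in> carrier A"
    define G where "G = (\<lambda>x y z. (p u x \<otimes>\<^bsub>K\<^esub> p v y) \<otimes>\<^bsub>K\<^esub> p w z)"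
    have tri: "trilin K A A A (ground K) G"
      unfolding G_def by (intro trilinI lin_ring_mult[OF cK] p_lin u) (auto simp: p_closed u)
    have "p ((u \<otimes>\<^bsub>D\<^esub> v) \<otimes>\<^bsub>D\<^esub> w) a = tlift (ground K) (\<lambda>x c. p (u \<otimes>\<^bsub>D\<^esub> v) x \<otimes>\<^bsub>K\<^esub> p w c) (comult A a)"
      using u a mult_D by (simp add: p_mult tlift_ground[of K])
    also have "\<dots> = tlift (ground K) (\<lambda>x c. tlift (ground K) (\<lambda>y z. G y z c) (comult A x)) (comult A a)"
    proof (rule tlift_cong[OF modA modA pp g cA[OF a]])
      fix x c assume x: "x \<in> carrier A" "c \<in> carrier A"
      have "p (u \<otimes>\<^bsub>D\<^esub> v) x \<otimes>\<^bsub>K\<^esub> p w c = tlift (ground K) (\<lambda>y z. p u y \<otimes>\<^bsub>K\<^esub> p v z) (comult A x) \<otimes>\<^bsub>K\<^esub> p w c"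
        using u x by (simp add: p_mult tlift_ground[of K])
      also have "\<dots> = tlift (ground K) (\<lambda>y z. G y z c) (comult A x)"
        unfolding G_def
        by (rule tlift_comp[OF modA modA lin_ring_mult(1)[OF cK lin_id] pp g g cA[OF x(1)]]) (use u x p_closed in auto)
      finally show "p (u \<otimes>\<^bsub>D\<^esub> v) x \<otimes>\<^bsub>K\<^esub> p w c = tlift (ground K) (\<lambda>y z. G y z c) (comult A x)" .
    qed (use u mult_D in auto)
    also have "\<dots> = tlift (ground K) (\<lambda>x c. tlift (ground K) (G x) (comult A c)) (comult A a)"
      by (rule tlift_coassoc[OF modA g comult_A coassoc[OF a] tri a])
    also have "\<dots> = tlift (ground K) (\<lambda>x c. p u x \<otimes>\<^bsub>K\<^esub> p (v \<otimes>\<^bsub>D\<^esub> w) c) (comult A a)"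
    proof (rule tlift_cong[OF modA modA pp g cA[OF a], symmetric])
      fix x c assume x: "x \<in> carrier A" "c \<in> carrier A"
      have "p u x \<otimes>\<^bsub>K\<^esub> p (v \<otimes>\<^bsub>D\<^esub> w) c = p u x \<otimes>\<^bsub>K\<^esub> tlift (ground K) (\<lambda>y z. p v y \<otimes>\<^bsub>K\<^esub> p w z) (comult A c)"
        using u x by (simp add: p_mult tlift_ground[of K])
      also have "\<dots> = tlift (ground K) (\<lambda>y z. p u x \<otimes>\<^bsub>K\<^esub> (p v y \<otimes>\<^bsub>K\<^esub> p w z)) (comult A c)"
        by (rule tlift_comp[OF modA modA lin_ring_mult(2)[OF cK lin_id] pp g g cA[OF x(2)]]) (use u x p_closed in auto)
      also have "\<dots> = tlift (ground K) (G x) (comult A c)"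
        unfolding G_def
        by (rule tlift_cong[OF modA modA bilinI g cA[OF x(2)]])
          (use u x p_closed in \<open>auto intro!: lin_ring_mult[OF cK] p_lin D.R.m_closed simp: D.R.m_assoc\<close>)
      finally show "p u x \<otimes>\<^bsub>K\<^esub> p (v \<otimes>\<^bsub>D\<^esub> w) c = tlift (ground K) (G x) (comult A c)" .
    qed (use u mult_D in auto)
    also have "\<dots> = p (u \<otimes>\<^bsub>D\<^esub> (v \<otimes>\<^bsub>D\<^esub> w)) a"
      using u a mult_D by (simp add: p_mult tlift_ground[of K])
    finally show "p ((u \<otimes>\<^bsub>D\<^esub> v) \<otimes>\<^bsub>D\<^esub> w) a = p (u \<otimes>\<^bsub>D\<^esub> (v \<otimes>\<^bsub>D\<^esub> w)) a" .
  qed (use u mult_D in auto)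
  note \<epsilon>c = functional_closed[OF counit]
  have one: "\<one>\<^bsub>D\<^esub> \<otimes>\<^bsub>D\<^esub> u = u" "u \<otimes>\<^bsub>D\<^esub> \<one>\<^bsub>D\<^esub> = u" if u: "u \<in> carrier D" for u
  proof -
    show "\<one>\<^bsub>D\<^esub> \<otimes>\<^bsub>D\<^esub> u = u"
    proof (rule D_sep)
      fix a assume a: "a \<in> carrier A"
      have b: "bilin K A A A (\<lambda>a b. counit A a \<odot>\<^bsub>A\<^esub> b)"
        by (intro bilinI lin_smult[OF modA] lin_smult_scalar[OF modA] counit lin_id \<epsilon>c)
      have "p u a = p u (tlift A (\<lambda>a b. counit A a \<odot>\<^bsub>A\<^esub> b) (comult A a))" using left[OF a] by simp
      also have "\<dots> = tlift (ground K) (\<lambda>a b. p u (counit A a \<odot>\<^bsub>A\<^esub> b)) (comult A a)"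
        by (rule tlift_comp[OF modA modA p_lin[OF u] b modA g cA[OF a]])
      also have "\<dots> = tlift (ground K) (\<lambda>a b. p \<one>\<^bsub>D\<^esub> a \<otimes>\<^bsub>K\<^esub> p u b) (comult A a)"
        by (rule tlift_cong[OF modA modA pp g cA[OF a], symmetric]) (use u one_D p_one linear_mapsD(3)[OF p_lin[OF u]] \<epsilon>c in auto)
      finally show "p (\<one>\<^bsub>D\<^esub> \<otimes>\<^bsub>D\<^esub> u) a = p u a" using u a one_D by (simp add: p_mult tlift_ground[of K])
    qed (use u one_D mult_D in auto)
    show "u \<otimes>\<^bsub>D\<^esub> \<one>\<^bsub>D\<^esub> = u"
    proof (rule D_sep)
      fix a assume a: "a \<in> carrier A"
      have b: "bilin K A A A (\<lambda>a b. counit A b \<odot>\<^bsub>A\<^esub> a)"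
        by (intro bilinI lin_smult[OF modA] lin_smult_scalar[OF modA] counit lin_id \<epsilon>c)
      have "p u a = p u (tlift A (\<lambda>a b. counit A b \<odot>\<^bsub>A\<^esub> a) (comult A a))" using right[OF a] by simp
      also have "\<dots> = tlift (ground K) (\<lambda>a b. p u (counit A b \<odot>\<^bsub>A\<^esub> a)) (comult A a)"
        by (rule tlift_comp[OF modA modA p_lin[OF u] b modA g cA[OF a]])
      also have "\<dots> = tlift (ground K) (\<lambda>a b. p u a \<otimes>\<^bsub>K\<^esub> p \<one>\<^bsub>D\<^esub> b) (comult A a)"
        by (rule tlift_cong[OF modA modA pp g cA[OF a], symmetric])
          (use u one_D p_one linear_mapsD(3)[OF p_lin[OF u]] \<epsilon>c p_closed in \<open>auto simp: D.R.m_comm\<close>)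
      finally show "p (u \<otimes>\<^bsub>D\<^esub> \<one>\<^bsub>D\<^esub>) a = p u a" using u a one_D by (simp add: p_mult tlift_ground[of K])
    qed (use u one_D mult_D in auto)
  qed
  have "ring D"
    by (rule ringI[OF D.M.abelian_group_axioms monoidI])
      (use linear_mapsD(2)[OF mult_D_linear(1)] linear_mapsD(2)[OF mult_D_linear(2)] in \<open>auto simp: assoc one one_D mult_D\<close>)
  then show ?thesis
    by (intro unital_algebra.intro modD unital_algebra_axioms.intro)
      (use linear_mapsD(3)[OF mult_D_linear(1)] linear_mapsD(3)[OF mult_D_linear(2)] in auto)
qed

end

section \<open>Dual bases\<close>

text \<open>
  Applying \<open>d\<^sub>j\<close> to the expansion of \<open>v\<close> in the basis shows that its coefficients are \<open>d\<^sub>j(v)\<close>.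
\<close>

lemma dual_bases_frame:
  assumes H: "module K H" and b: "dual_bases K H n e d"
  shows "frame K H {..<n} d e"
proof -
  interpret H: module K H by (rule H)
  note g = module_ground[OF H]
  interpret G: module K "ground K" by (rule g)
  have e: "e i \<in> carrier H" and dl: "d i \<in> linear_maps K H (ground K)" if "i < n" for i
    using b that by (auto simp: dual_bases_def is_basis_def dual_alg_sel Pi_iff)
  have \<delta>: "d i (e j) = (if i = j then \<one>\<^bsub>K\<^esub> else \<zero>\<^bsub>K\<^esub>)" if "i < n" "j < n" for i j
    using b that by (auto simp: dual_bases_def)
  have "(\<Oplus>\<^bsub>H\<^esub>i\<in>{..<n}. d i v \<odot>\<^bsub>H\<^esub> e i) = v" if v: "v \<in> carrier H" for v
  proof -
    obtain c where c: "c \<in> {..<n} \<rightarrow>\<^sub>E carrier K" "v = (\<Oplus>\<^bsub>H\<^esub>i\<in>{..<n}. c i \<odot>\<^bsub>H\<^esub> e i)"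
      using b v unfolding dual_bases_def is_basis_def by blast
    have cc: "c i \<in> carrier K" if "i < n" for i using c that by auto
    have "d j v = c j" if j: "j < n" for j
    proof -
      have "d j v = (\<Oplus>\<^bsub>ground K\<^esub>i\<in>{..<n}. d j (c i \<odot>\<^bsub>H\<^esub> e i))"
        unfolding c(2) by (rule linear_maps_finsum[OF dl[OF j] H g]) (use cc e in auto)
      also have "\<dots> = (\<Oplus>\<^bsub>ground K\<^esub>i\<in>{..<n}. if j = i then c i else \<zero>\<^bsub>ground K\<^esub>)"
        by (rule G.M.finsum_cong') (use cc e j linear_mapsD(3)[OF dl[OF j]] \<delta> in auto)
      also have "\<dots> = c j"
        by (rule G.M.finsum_singleton) (use j cc in auto)
      finally show ?thesis .
    qed
    then show ?thesis
      unfolding c(2) by (intro H.M.finsum_cong') (use cc e c in auto)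
  qed
  then show ?thesis using e dl by (auto simp: frame_def)
qed

text \<open>
  The dual basis consists of the coordinate functions; they are linear because coordinates are unique.
\<close>

lemma dual_bases_exist:
  assumes H: "module K H" and b: "is_basis K H n e"
  obtains d where "dual_bases K H n e d"
proof -
  interpret H: module K H by (rule H)
  have e: "e i \<in> carrier H" if "i < n" for i using b that by (auto simp: is_basis_def)
  define P where "P v c \<longleftrightarrow> c \<in> {..<n} \<rightarrow>\<^sub>E carrier K \<and> v = (\<Oplus>\<^bsub>H\<^esub>i\<in>{..<n}. c i \<odot>\<^bsub>H\<^esub> e i)" for v c
  define C where "C v = (THE c. P v c)" for v
  have ex1: "\<exists>!c. P v c" if "v \<in> carrier H" for v using b that unfolding is_basis_def P_def by blast
  have C: "P v (C v)" if "v \<in> carrier H" for v unfolding C_def by (rule theI'[OF ex1[OF that]])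
  have C_eq: "C v = c" if "v \<in> carrier H" "P v c" for v c using ex1[OF that(1)] C[OF that(1)] that(2) by blast
  have Cc: "C v i \<in> carrier K" if "v \<in> carrier H" "i < n" for v i using C[OF that(1)] that(2) by (auto simp: P_def)
  define d where "d i = (\<lambda>v\<in>carrier H. C v i)" for i
  have add: "C (v \<oplus>\<^bsub>H\<^esub> w) = (\<lambda>i\<in>{..<n}. C v i \<oplus>\<^bsub>K\<^esub> C w i)" if v: "v \<in> carrier H" "w \<in> carrier H" for v w
  proof (rule C_eq)
    have "v \<oplus>\<^bsub>H\<^esub> w = (\<Oplus>\<^bsub>H\<^esub>i\<in>{..<n}. C v i \<odot>\<^bsub>H\<^esub> e i) \<oplus>\<^bsub>H\<^esub> (\<Oplus>\<^bsub>H\<^esub>i\<in>{..<n}. C w i \<odot>\<^bsub>H\<^esub> e i)"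
      using C[OF v(1)] C[OF v(2)] by (simp add: P_def)
    also have "\<dots> = (\<Oplus>\<^bsub>H\<^esub>i\<in>{..<n}. C v i \<odot>\<^bsub>H\<^esub> e i \<oplus>\<^bsub>H\<^esub> C w i \<odot>\<^bsub>H\<^esub> e i)"
      by (rule H.M.finsum_addf[symmetric]) (use Cc e v in auto)
    also have "\<dots> = (\<Oplus>\<^bsub>H\<^esub>i\<in>{..<n}. (\<lambda>i\<in>{..<n}. C v i \<oplus>\<^bsub>K\<^esub> C w i) i \<odot>\<^bsub>H\<^esub> e i)"
      by (rule H.M.finsum_cong') (use Cc e v in \<open>auto simp: H.smult_l_distr\<close>)
    finally show "P (v \<oplus>\<^bsub>H\<^esub> w) (\<lambda>i\<in>{..<n}. C v i \<oplus>\<^bsub>K\<^esub> C w i)" using Cc v by (auto simp: P_def)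
  qed (use v in auto)
  have smult: "C (a \<odot>\<^bsub>H\<^esub> v) = (\<lambda>i\<in>{..<n}. a \<otimes>\<^bsub>K\<^esub> C v i)" if v: "a \<in> carrier K" "v \<in> carrier H" for a v
  proof (rule C_eq)
    have "a \<odot>\<^bsub>H\<^esub> v = a \<odot>\<^bsub>H\<^esub> (\<Oplus>\<^bsub>H\<^esub>i\<in>{..<n}. C v i \<odot>\<^bsub>H\<^esub> e i)"
      using C[OF v(2)] by (simp add: P_def)
    also have "\<dots> = (\<Oplus>\<^bsub>H\<^esub>i\<in>{..<n}. a \<odot>\<^bsub>H\<^esub> (C v i \<odot>\<^bsub>H\<^esub> e i))"
      by (rule H.finsum_smult_ldistr) (use Cc e v in auto)
    also have "\<dots> = (\<Oplus>\<^bsub>H\<^esub>i\<in>{..<n}. (\<lambda>i\<in>{..<n}. a \<otimes>\<^bsub>K\<^esub> C v i) i \<odot>\<^bsub>H\<^esub> e i)"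
      by (rule H.M.finsum_cong') (use Cc e v in \<open>auto simp: H.smult_assoc1\<close>)
    finally show "P (a \<odot>\<^bsub>H\<^esub> v) (\<lambda>i\<in>{..<n}. a \<otimes>\<^bsub>K\<^esub> C v i)" using Cc v by (auto simp: P_def)
  qed (use v in auto)
  have basis: "C (e j) = (\<lambda>i\<in>{..<n}. if i = j then \<one>\<^bsub>K\<^esub> else \<zero>\<^bsub>K\<^esub>)" if j: "j < n" for j
  proof (rule C_eq)
    have "e j = (\<Oplus>\<^bsub>H\<^esub>i\<in>{..<n}. if j = i then e i else \<zero>\<^bsub>H\<^esub>)"
      by (rule H.M.finsum_singleton[symmetric]) (use e j in auto)
    also have "\<dots> = (\<Oplus>\<^bsub>H\<^esub>i\<in>{..<n}. (\<lambda>i\<in>{..<n}. if i = j then \<one>\<^bsub>K\<^esub> else \<zero>\<^bsub>K\<^esub>) i \<odot>\<^bsub>H\<^esub> e i)"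
      by (rule H.M.finsum_cong') (use e in auto)
    finally show "P (e j) (\<lambda>i\<in>{..<n}. if i = j then \<one>\<^bsub>K\<^esub> else \<zero>\<^bsub>K\<^esub>)" by (auto simp: P_def)
  qed (use e j in auto)
  have "dual_bases K H n e d"
    unfolding dual_bases_def
  proof (intro conjI allI impI b)
    have "d i \<in> linear_maps K H (ground K)" if "i < n" for i
      by (rule linear_mapsI) (use that Cc in \<open>auto simp: d_def add smult\<close>)
    then show "d \<in> {..<n} \<rightarrow> carrier (dual K H)"
      by (auto simp: dual_alg_sel d_def)
    show "d i (e j) = (if i = j then \<one>\<^bsub>K\<^esub> else \<zero>\<^bsub>K\<^esub>)" if "i < n" "j < n" for i j
      using that e by (simp add: d_def basis)
  qed
  then show ?thesis by (rule that)
qed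

section \<open>The opposite Hopf algebra and the canonical element\<close>

lemma opp_sel [simp]:
  "carrier (opp H) = carrier H" "ring.add (opp H) = ring.add H" "ring.zero (opp H) = ring.zero H"
  "monoid.one (opp H) = monoid.one H" "comult (opp H) = comult H" "counit (opp H) = counit H"
  "x \<otimes>\<^bsub>opp H\<^esub> y = y \<otimes>\<^bsub>H\<^esub> x"
  by (simp_all add: opp_def)

lemma opp_smult: "smult (opp H) = smult H"
  by (simp add: opp_def)

text \<open>
  From here on membership is mostly stated for \<open>dual K H\<close> itself; unfolding it to \<open>dual_alg K H\<close>, or the
  scalar multiplication of \<open>opp H\<close> to that of \<open>H\<close>, would take terms out of the form in which closure
  and linearity rules are stated.
\<close>

declare dual_sel [simp del] dual_sel(7) [simp]

lemma linear_maps_opp [simp]: "linear_maps K (opp H) W = linear_maps K H W" "linear_maps K V (opp H) = linear_maps K V H"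
  by (rule linear_maps_same; simp add: opp_smult)+

lemma pure_opp: "pure K (opp H) W = pure K H W" "pure K V (opp H) = pure K V H"
  by (rule pure_cong; simp add: opp_smult)+

lemma tensor_opp_sel:
  "carrier (tensor K V (opp H)) = carrier (tensor K V H)" "ring.add (tensor K V (opp H)) = ring.add (tensor K V H)"
  "ring.zero (tensor K V (opp H)) = ring.zero (tensor K V H)" "smult (tensor K V (opp H)) = smult (tensor K V H)"
  by (rule tensor_cong_module; simp add: opp_smult)+

lemma linear_maps_tensor_opp:
  "linear_maps K U (tensor K V (opp H)) = linear_maps K U (tensor K V H)"
  "linear_maps K (tensor K V (opp H)) U = linear_maps K (tensor K V H) U"
  by (rule linear_maps_same; simp add: tensor_opp_sel)+

lemma linear_maps_tensor_opp_opp: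
  "linear_maps K U (tensor K (opp H) (opp H)) = linear_maps K U (tensor K H H)"
  by (rule linear_maps_same; (rule refl | rule tensor_cong_module; simp add: opp_smult))

lemma tlift_opp: "tlift (opp H) f t = tlift H f t"
  by (rule tlift_cong_ring) simp_all

lemma module_opp: "module K H \<Longrightarrow> module K (opp H)"
  by (erule module_same) (simp_all add: opp_smult)

lemma dual_alg_opp: "dual_alg K (opp H) = dual_alg K H"
  by (simp add: dual_alg_def)

lemma opp_algebra:
  assumes H: "unital_algebra K H"
  shows "unital_algebra K (opp H)"
proof -
  interpret H: unital_algebra K H by (rule H)
  have m: "module K (opp H)" by (rule module_opp[OF H.module_axioms])
  interpret O: module K "opp H" by (rule m)
  have "ring (opp H)"
    by (rule ringI[OF O.M.abelian_group_axioms monoidI]) (simp_all add: H.A.m_assoc H.A.l_distr H.A.r_distr)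
  then show ?thesis
    by (intro unital_algebra.intro m unital_algebra_axioms.intro) (simp_all add: opp_smult H.smult_mult_left H.smult_mult_right)
qed

text \<open>
  The dual bases are fixed as those which the choice in \<open>canU\<close> picked, so that \<open>canU\<close> becomes an explicit
  sum.
\<close>

locale finite_hopf = hopf_algebra K H S for K :: "('k, 'l) ring_scheme" and H :: "('k, 'h) bialgebra" and S +
  fixes n :: nat and e :: "nat \<Rightarrow> 'h" and d :: "nat \<Rightarrow> 'h \<Rightarrow> 'k"
  assumes dual_bases: "dual_bases K H n e d"
    and canU_eq: "canU K H = (\<Oplus>\<^bsub>op_dual K H\<^esub>i\<in>{..<n}. pure K (opp H) (dual K H) (e i) (d i))"
begin

abbreviation "Hd \<equiv> dual K H"
abbreviation "Hop \<equiv> opp H"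
abbreviation "\<Delta> \<equiv> comult H"
abbreviation "\<epsilon> \<equiv> counit H"

lemma algH: "unital_algebra K H" by (rule unital_algebra_axioms)
lemma algHop: "unital_algebra K Hop" by (rule opp_algebra[OF algH])
lemma modH [simp]: "module K H" by (rule unital_algebra_module[OF algH])
lemma modHop [simp]: "module K Hop" by (rule unital_algebra_module[OF algHop])
lemma cK: "cring K" by (rule module_cring[OF modH])
lemma modK [simp]: "module K (ground K)" by (rule ground_module[OF cK])

lemma \<Delta>_lin: "\<Delta> \<in> linear_maps K H (tensor K H H)" by (rule alg_homD(1)[OF comult_hom])
lemma \<epsilon>_lin: "\<epsilon> \<in> linear_maps K H (ground K)" by (rule alg_homD(1)[OF counit_hom])
lemmas S_lin = antipode_linear
lemmas \<Delta>_closed = lin_closed[OF \<Delta>_lin]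
lemmas S_closed = lin_closed[OF S_lin]
lemmas \<epsilon>_closed [simp] = functional_closed[OF \<epsilon>_lin]

lemma \<epsilon>_one: "\<epsilon> \<one>\<^bsub>H\<^esub> = \<one>\<^bsub>K\<^esub>" using alg_homD(3)[OF counit_hom] by simp
lemma \<epsilon>_mult: "\<lbrakk>x \<in> carrier H; y \<in> carrier H\<rbrakk> \<Longrightarrow> \<epsilon> (x \<otimes>\<^bsub>H\<^esub> y) = \<epsilon> x \<otimes>\<^bsub>K\<^esub> \<epsilon> y" using alg_homD(2)[OF counit_hom] by simp
lemma \<Delta>_one: "\<Delta> \<one>\<^bsub>H\<^esub> = pure K H H \<one>\<^bsub>H\<^esub> \<one>\<^bsub>H\<^esub>" using alg_homD(3)[OF comult_hom] by (simp add: tensor_sel(4))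

lemma frame_H: "frame K H {..<n} d e" by (rule dual_bases_frame[OF modH dual_bases])

lemma d_dual: "i \<in> {..<n} \<Longrightarrow> d i \<in> carrier (dual_alg K H)"
  using dual_bases by (auto simp: dual_bases_def dual_sel)

sublocale HA: finite_coproduct_algebra K H "{..<n}" d e
  by (rule finite_coproduct_algebra.intro[OF algH \<Delta>_lin \<epsilon>_lin frame_H d_dual])

sublocale OA: finite_coproduct_algebra K Hop "{..<n}" d e
  by (rule finite_coproduct_algebra.intro[OF algHop])
    (use \<Delta>_lin \<epsilon>_lin frame_H d_dual in \<open>simp_all add: linear_maps_tensor_opp_opp dual_alg_opp frame_same[of Hop H] opp_smult\<close>)

lemma algHd: "unital_algebra K Hd"
  by (rule bialgebra_pairing.D_unital_algebra[OF HA.dual_pairing])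
    (simp_all add: coassociative counital_left counital_right \<epsilon>_lin)

lemma modHd [simp]: "module K Hd" by (rule unital_algebra_module[OF algHd])

lemma dual_eval_lin: "h \<in> carrier H \<Longrightarrow> (\<lambda>\<theta>. \<theta> h) \<in> linear_maps K Hd (ground K)"
  using dual_evaluation_linear[of h H K] by (simp add: dual_tensor)

lemma Hd_functional: "\<theta> \<in> carrier Hd \<Longrightarrow> \<theta> \<in> linear_maps K H (ground K)"
  by (simp add: dual_sel dual_alg_sel)

lemma Hd_eval_closed [simp]: "\<lbrakk>\<theta> \<in> carrier Hd; h \<in> carrier H\<rbrakk> \<Longrightarrow> \<theta> h \<in> carrier K"
  using functional_closed[OF Hd_functional] .

lemma Hd_mult_eval: "h \<in> carrier H \<Longrightarrow> (\<theta> \<otimes>\<^bsub>Hd\<^esub> \<theta>') h = tens_fun K \<theta> \<theta>' (\<Delta> h)"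
  by (simp add: dual_sel dual_alg_sel(2))

lemma Hd_one_eval: "h \<in> carrier H \<Longrightarrow> \<one>\<^bsub>Hd\<^esub> h = \<epsilon> h"
  by (simp add: dual_sel dual_alg_sel(3))

sublocale HD: bialgebra_pairing K H Hd "\<lambda>h \<theta>. \<theta> h" "{..<n}" d e
proof (rule bialgebra_pairing.intro)
  show "perfect_pairing K H Hd (\<lambda>h \<theta>. \<theta> h) {..<n} d e"
    by (rule perfect_pairing.flipped) (rule bialgebra_pairing.axioms(1)[OF HA.dual_pairing])
  show "bialgebra_pairing_axioms K H Hd (\<lambda>h \<theta>. \<theta> h)"
    by (rule bialgebra_pairing_axioms.intro[OF algHd])
      (use HA.comult_dual_linear HA.comult_dual_eval \<Delta>_closed in \<open>auto simp: dual_tensor Hd_mult_eval Hd_one_eval dual_sel(1)\<close>)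
qed

section \<open>The antipode\<close>

lemma tlift_tensor_mult:
  assumes Z: "module K Z" and F: "bilin K H H Z F" and s: "s \<in> carrier (tensor K H H)" and t: "t \<in> carrier (tensor K H H)"
  shows "tlift Z F (s \<otimes>\<^bsub>tensor K H H\<^esub> t) =
     tlift Z (\<lambda>a b. tlift Z (\<lambda>a' b'. F (a \<otimes>\<^bsub>H\<^esub> a') (b \<otimes>\<^bsub>H\<^esub> b')) t) s"
proof -
  have inner: "bilin K H H Z (\<lambda>a' b'. F (a \<otimes>\<^bsub>H\<^esub> a') (b \<otimes>\<^bsub>H\<^esub> b'))" if "a \<in> carrier H" "b \<in> carrier H" for a b
    by (rule bilinI; rule lin_comp[OF bilinD(1)[OF F]] lin_comp[OF bilinD(2)[OF F]]; (rule lin_mult[OF algH lin_id])?) (use that in auto)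
  have l: "tlift Z F (tlift (tensor K H H) (\<lambda>a' b'. pure K H H (a \<otimes>\<^bsub>H\<^esub> a') (b \<otimes>\<^bsub>H\<^esub> b')) t) =
     tlift Z (\<lambda>a' b'. F (a \<otimes>\<^bsub>H\<^esub> a') (b \<otimes>\<^bsub>H\<^esub> b')) t" if ab: "a \<in> carrier H" "b \<in> carrier H" for a b
    by (subst tlift_comp[OF modH modH tlift_linear[OF modH modH F Z] mult_bilin_inner[OF algH algH ab] _ Z t], simp)
      (rule tlift_cong[OF modH modH inner[OF ab] Z t, symmetric], use ab in \<open>simp add: tlift_pure[OF modH modH F Z]\<close>)
  have outer: "bilin K H H Z (\<lambda>a b. tlift Z (\<lambda>a' b'. F (a \<otimes>\<^bsub>H\<^esub> a') (b \<otimes>\<^bsub>H\<^esub> b')) t)"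
    by (rule bilinI; rule lin_tlift2[OF modH modH t _ inner Z modH];
        (rule lin_comp[OF bilinD(1)[OF F] lin_mult(1)[OF algH lin_id]] lin_comp[OF bilinD(2)[OF F] lin_mult(1)[OF algH lin_id]])?) auto
  show ?thesis
    unfolding tensor_mult_eq
    by (subst tlift_comp[OF modH modH tlift_linear[OF modH modH F Z] mult_bilin_outer[OF algH algH t] _ Z s], simp)
      (rule tlift_cong[OF modH modH outer Z s, symmetric], simp add: l)
qed

text \<open>
  A left convolution inverse of the identity is the antipode, here up to a constant \<open>c\<close>: evaluate
  \<open>R(h\<^sub>(\<^sub>1\<^sub>)) h\<^sub>(\<^sub>2\<^sub>) S(h\<^sub>(\<^sub>3\<^sub>))\<close> in two ways by coassociativity. The constant permits
  applying this with one argument of a two-variable identity fixed.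
\<close>

lemma convolution_inverse_unique:
  assumes R: "R \<in> linear_maps K H H" and c: "c \<in> carrier H" and h: "h \<in> carrier H"
    and inv: "\<And>h. h \<in> carrier H \<Longrightarrow> tlift H (\<lambda>a b. R a \<otimes>\<^bsub>H\<^esub> b) (\<Delta> h) = \<epsilon> h \<odot>\<^bsub>H\<^esub> c"
  shows "R h = c \<otimes>\<^bsub>H\<^esub> S h"
proof -
  note Rc = lin_closed[OF R]
  define G where "G = (\<lambda>x y z. (R x \<otimes>\<^bsub>H\<^esub> y) \<otimes>\<^bsub>H\<^esub> S z)"
  have tri: "trilin K H H H H G"
    unfolding G_def by (intro trilinI lin_mult[OF algH] R S_lin lin_id) (simp_all add: Rc S_closed)
  have b1: "bilin K H H H (\<lambda>a b. R a \<otimes>\<^bsub>H\<^esub> b)"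
    by (intro bilinI lin_mult[OF algH] R lin_id) (simp_all add: Rc)
  have b2: "bilin K H H H (\<lambda>a b. a \<otimes>\<^bsub>H\<^esub> S b)"
    by (intro bilinI lin_mult[OF algH] S_lin lin_id) (simp_all add: S_closed)
  have e1: "bilin K H H H (\<lambda>a b. \<epsilon> a \<odot>\<^bsub>H\<^esub> b)"
    by (intro bilinI lin_smult[OF modH] lin_smult_scalar[OF modH] \<epsilon>_lin lin_id \<epsilon>_closed)
  have e2: "bilin K H H H (\<lambda>a b. \<epsilon> b \<odot>\<^bsub>H\<^esub> a)"
    by (intro bilinI lin_smult[OF modH] lin_smult_scalar[OF modH] \<epsilon>_lin lin_id \<epsilon>_closed)
  (* Contracting the first two factors by the hypothesis on R. *)
  have L: "tlift H (\<lambda>x z. tlift H (\<lambda>a b. G a b z) (\<Delta> x)) (\<Delta> h) = c \<otimes>\<^bsub>H\<^esub> S h"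
  proof -
    have "tlift H (\<lambda>x z. tlift H (\<lambda>a b. G a b z) (\<Delta> x)) (\<Delta> h) = tlift H (\<lambda>x z. c \<otimes>\<^bsub>H\<^esub> S (\<epsilon> x \<odot>\<^bsub>H\<^esub> z)) (\<Delta> h)"
    proof (rule tlift_cong[OF modH modH _ modH \<Delta>_closed[OF h], symmetric])
      show "bilin K H H H (\<lambda>x z. c \<otimes>\<^bsub>H\<^esub> S (\<epsilon> x \<odot>\<^bsub>H\<^esub> z))"
        by (rule bilinI; rule lin_mult[OF algH lin_comp[OF S_lin] c]; rule bilinD[OF e1])
      fix x z assume xz: "x \<in> carrier H" "z \<in> carrier H"
      have "tlift H (\<lambda>a b. G a b z) (\<Delta> x) = tlift H (\<lambda>a b. R a \<otimes>\<^bsub>H\<^esub> b) (\<Delta> x) \<otimes>\<^bsub>H\<^esub> S z"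
        unfolding G_def by (rule tlift_comp[OF modH modH lin_mult(1)[OF algH lin_id S_closed[OF xz(2)]] b1 modH modH \<Delta>_closed[OF xz(1)], symmetric])
      also have "\<dots> = c \<otimes>\<^bsub>H\<^esub> S (\<epsilon> x \<odot>\<^bsub>H\<^esub> z)"
        using xz c S_closed linear_mapsD(3)[OF S_lin] by (simp add: inv smult_mult_left smult_mult_right)
      finally show "c \<otimes>\<^bsub>H\<^esub> S (\<epsilon> x \<odot>\<^bsub>H\<^esub> z) = tlift H (\<lambda>a b. G a b z) (\<Delta> x)" by simp
    qed
    also have "\<dots> = c \<otimes>\<^bsub>H\<^esub> S (tlift H (\<lambda>a b. \<epsilon> a \<odot>\<^bsub>H\<^esub> b) (\<Delta> h))"
      by (rule tlift_comp[OF modH modH lin_mult(2)[OF algH S_lin c] e1 modH modH \<Delta>_closed[OF h], symmetric])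
    finally show ?thesis using counital_left[OF h] by simp
  qed
  (* Contracting the last two factors by the antipode axiom. *)
  have "tlift H (\<lambda>x z. tlift H (G x) (\<Delta> z)) (\<Delta> h) = R h"
  proof -
    have "tlift H (\<lambda>x z. tlift H (G x) (\<Delta> z)) (\<Delta> h) = tlift H (\<lambda>x z. R (\<epsilon> z \<odot>\<^bsub>H\<^esub> x)) (\<Delta> h)"
    proof (rule tlift_cong[OF modH modH _ modH \<Delta>_closed[OF h], symmetric])
      show "bilin K H H H (\<lambda>x z. R (\<epsilon> z \<odot>\<^bsub>H\<^esub> x))"
        by (rule bilinI; rule lin_comp[OF R]; rule bilinD[OF e2])
      fix x z assume xz: "x \<in> carrier H" "z \<in> carrier H"
      have "tlift H (G x) (\<Delta> z) = tlift H (\<lambda>a b. R x \<otimes>\<^bsub>H\<^esub> (a \<otimes>\<^bsub>H\<^esub> S b)) (\<Delta> z)"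
        by (rule tlift_cong[OF modH modH trilinD(4)[OF tri xz(1)] modH \<Delta>_closed[OF xz(2)]])
          (use xz Rc S_closed in \<open>simp add: G_def A.m_assoc\<close>)
      also have "\<dots> = R x \<otimes>\<^bsub>H\<^esub> tlift H (\<lambda>a b. a \<otimes>\<^bsub>H\<^esub> S b) (\<Delta> z)"
        by (rule tlift_comp[OF modH modH lin_mult(2)[OF algH lin_id Rc[OF xz(1)]] b2 modH modH \<Delta>_closed[OF xz(2)], symmetric])
      also have "\<dots> = R (\<epsilon> z \<odot>\<^bsub>H\<^esub> x)"
        using xz Rc linear_mapsD(3)[OF R] by (simp add: antipode_right smult_mult_right)
      finally show "R (\<epsilon> z \<odot>\<^bsub>H\<^esub> x) = tlift H (G x) (\<Delta> z)" by simp
    qed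
    also have "\<dots> = R (tlift H (\<lambda>a b. \<epsilon> b \<odot>\<^bsub>H\<^esub> a) (\<Delta> h))"
      by (rule tlift_comp[OF modH modH R e2 modH modH \<Delta>_closed[OF h], symmetric])
    finally show ?thesis using counital_right[OF h] by simp
  qed
  then show ?thesis
    using L tlift_coassoc[OF modH modH \<Delta>_lin coassociative[OF h] tri h] by simp
qed

text \<open>
  The map \<open>x \<otimes> y \<mapsto> S(xy)\<close> is a convolution inverse of the multiplication, and so is
  \<open>x \<otimes> y \<mapsto> S(y) S(x)\<close>. Uniqueness of inverses on \<open>H \<otimes> H\<close> is replaced by two
  applications of uniqueness on \<open>H\<close>, one for each variable.
\<close>

lemma S_antimult:
  assumes x: "x \<in> carrier H" and y: "y \<in> carrier H"
  shows "S (x \<otimes>\<^bsub>H\<^esub> y) = S y \<otimes>\<^bsub>H\<^esub> S x"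
proof -
  have Sx: "(\<lambda>a. S (a \<otimes>\<^bsub>H\<^esub> y)) \<in> linear_maps K H H" "(\<lambda>a. S (y \<otimes>\<^bsub>H\<^esub> a)) \<in> linear_maps K H H" if "y \<in> carrier H" for y
    by (rule lin_comp[OF S_lin] lin_mult[OF algH lin_id that])+
  have b: "bilin K H H H (\<lambda>x1 x2. S (x1 \<otimes>\<^bsub>H\<^esub> y) \<otimes>\<^bsub>H\<^esub> (x2 \<otimes>\<^bsub>H\<^esub> z))" if "y \<in> carrier H" "z \<in> carrier H" for y z
    by (intro bilinI lin_mult[OF algH] Sx lin_id) (use that S_closed in auto)
  have b': "bilin K H H H (\<lambda>x1 x2. S (x1 \<otimes>\<^bsub>H\<^esub> y) \<otimes>\<^bsub>H\<^esub> x2)" if "y \<in> carrier H" for y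
    by (intro bilinI lin_mult[OF algH] Sx lin_id) (use that S_closed in auto)
  have c: "bilin K H H H (\<lambda>y1 y2. S (x1 \<otimes>\<^bsub>H\<^esub> y1) \<otimes>\<^bsub>H\<^esub> (x2 \<otimes>\<^bsub>H\<^esub> y2))" if "x1 \<in> carrier H" "x2 \<in> carrier H" for x1 x2
    by (intro bilinI lin_mult[OF algH] Sx lin_id) (use that S_closed in auto)
  have a: "bilin K H H H (\<lambda>a b. S a \<otimes>\<^bsub>H\<^esub> b)"
    by (intro bilinI lin_mult[OF algH] S_lin lin_id) (use S_closed in auto)
  (* First in y, with x fixed: the map ?R below inverts the identity up to the constant counit(x). *)
  have inner: "tlift H (\<lambda>x1 x2. S (x1 \<otimes>\<^bsub>H\<^esub> y) \<otimes>\<^bsub>H\<^esub> x2) (\<Delta> x) = \<epsilon> x \<odot>\<^bsub>H\<^esub> S y" if x: "x \<in> carrier H" and y: "y \<in> carrier H" for x y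
  proof -
    let ?R = "\<lambda>y. tlift H (\<lambda>x1 x2. S (x1 \<otimes>\<^bsub>H\<^esub> y) \<otimes>\<^bsub>H\<^esub> x2) (\<Delta> x)"
    have R: "?R \<in> linear_maps K H H"
      by (rule lin_tlift2[OF modH modH \<Delta>_closed[OF x] _ b' modH modH]) (rule lin_mult[OF algH Sx(2)], assumption+)
    have "?R y = (\<epsilon> x \<odot>\<^bsub>H\<^esub> \<one>\<^bsub>H\<^esub>) \<otimes>\<^bsub>H\<^esub> S y"
    proof (rule convolution_inverse_unique[OF R _ y])
      fix h assume h: "h \<in> carrier H"
      have "tlift H (\<lambda>y1 y2. ?R y1 \<otimes>\<^bsub>H\<^esub> y2) (\<Delta> h) =
        tlift H (\<lambda>y1 y2. tlift H (\<lambda>x1 x2. S (x1 \<otimes>\<^bsub>H\<^esub> y1) \<otimes>\<^bsub>H\<^esub> (x2 \<otimes>\<^bsub>H\<^esub> y2)) (\<Delta> x)) (\<Delta> h)"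
      proof (rule tlift_cong[OF modH modH _ modH \<Delta>_closed[OF h]])
        show "bilin K H H H (\<lambda>y1 y2. ?R y1 \<otimes>\<^bsub>H\<^esub> y2)"
          by (intro bilinI lin_mult[OF algH] R lin_id) (simp_all add: lin_closed[OF R])
        fix y1 y2 assume yy: "y1 \<in> carrier H" "y2 \<in> carrier H"
        have "?R y1 \<otimes>\<^bsub>H\<^esub> y2 = tlift H (\<lambda>x1 x2. S (x1 \<otimes>\<^bsub>H\<^esub> y1) \<otimes>\<^bsub>H\<^esub> x2 \<otimes>\<^bsub>H\<^esub> y2) (\<Delta> x)"
          by (rule tlift_comp[OF modH modH lin_mult(1)[OF algH lin_id yy(2)] b'[OF yy(1)] modH modH \<Delta>_closed[OF x]])
        also have "\<dots> = tlift H (\<lambda>x1 x2. S (x1 \<otimes>\<^bsub>H\<^esub> y1) \<otimes>\<^bsub>H\<^esub> (x2 \<otimes>\<^bsub>H\<^esub> y2)) (\<Delta> x)"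
          by (rule tlift_cong[OF modH modH b[OF yy] modH \<Delta>_closed[OF x], symmetric]) (use yy S_closed in \<open>simp add: A.m_assoc\<close>)
        finally show "?R y1 \<otimes>\<^bsub>H\<^esub> y2 = tlift H (\<lambda>x1 x2. S (x1 \<otimes>\<^bsub>H\<^esub> y1) \<otimes>\<^bsub>H\<^esub> (x2 \<otimes>\<^bsub>H\<^esub> y2)) (\<Delta> x)" .
      qed
      also have "\<dots> = tlift H (\<lambda>x1 x2. tlift H (\<lambda>y1 y2. S (x1 \<otimes>\<^bsub>H\<^esub> y1) \<otimes>\<^bsub>H\<^esub> (x2 \<otimes>\<^bsub>H\<^esub> y2)) (\<Delta> h)) (\<Delta> x)"
        by (rule tlift_swap[OF modH modH modH modH modH \<Delta>_closed[OF h] \<Delta>_closed[OF x] c b])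
      also have "\<dots> = tlift H (\<lambda>a b. S a \<otimes>\<^bsub>H\<^esub> b) (\<Delta> x \<otimes>\<^bsub>tensor K H H\<^esub> \<Delta> h)"
        by (rule tlift_tensor_mult[OF modH a \<Delta>_closed[OF x] \<Delta>_closed[OF h], symmetric])
      also have "\<dots> = \<epsilon> (x \<otimes>\<^bsub>H\<^esub> h) \<odot>\<^bsub>H\<^esub> \<one>\<^bsub>H\<^esub>"
        using antipode_left[of "x \<otimes>\<^bsub>H\<^esub> h"] x h by (simp add: alg_homD(2)[OF comult_hom])
      also have "\<dots> = \<epsilon> h \<odot>\<^bsub>H\<^esub> (\<epsilon> x \<odot>\<^bsub>H\<^esub> \<one>\<^bsub>H\<^esub>)"
        using x h by (simp add: \<epsilon>_mult R.m_comm flip: smult_assoc1)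
      finally show "tlift H (\<lambda>y1 y2. ?R y1 \<otimes>\<^bsub>H\<^esub> y2) (\<Delta> h) = \<epsilon> h \<odot>\<^bsub>H\<^esub> (\<epsilon> x \<odot>\<^bsub>H\<^esub> \<one>\<^bsub>H\<^esub>)" .
    qed (use x in auto)
    then show ?thesis using x y S_closed by (simp add: smult_mult_left)
  qed
  show ?thesis
    by (rule convolution_inverse_unique[OF Sx(1)[OF y] S_closed[OF y] x]) (use inner y in auto)
qed

lemma S_one: "S \<one>\<^bsub>H\<^esub> = \<one>\<^bsub>H\<^esub>"
proof -
  have a: "bilin K H H H (\<lambda>a b. S a \<otimes>\<^bsub>H\<^esub> b)"
    by (intro bilinI lin_mult[OF algH] S_lin lin_id) (use S_closed in auto)
  show ?thesis
    using antipode_left[OF A.one_closed] S_closed by (simp add: \<Delta>_one tlift_pure[OF modH modH a modH] \<epsilon>_one)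
qed

definition "Sinv = inv_into (carrier H) S"

lemma Sinv_closed: "h \<in> carrier H \<Longrightarrow> Sinv h \<in> carrier H"
  and S_Sinv: "h \<in> carrier H \<Longrightarrow> S (Sinv h) = h"
  and Sinv_S: "h \<in> carrier H \<Longrightarrow> Sinv (S h) = h"
  using antipode_bij unfolding Sinv_def
  by (auto simp: bij_betw_def inv_into_into f_inv_into_f)

lemma S_inj: "\<lbrakk>S x = S y; x \<in> carrier H; y \<in> carrier H\<rbrakk> \<Longrightarrow> x = y"
  using Sinv_S by metis

lemma Sinv_lin: "Sinv \<in> linear_maps K H H"
proof (rule linear_mapsI)
  show "Sinv (x \<oplus>\<^bsub>H\<^esub> y) = Sinv x \<oplus>\<^bsub>H\<^esub> Sinv y" if "x \<in> carrier H" "y \<in> carrier H" for x y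
    by (rule S_inj) (use that in \<open>simp_all add: Sinv_closed S_Sinv linear_mapsD(2)[OF S_lin]\<close>)
  show "Sinv (c \<odot>\<^bsub>H\<^esub> x) = c \<odot>\<^bsub>H\<^esub> Sinv x" if "c \<in> carrier K" "x \<in> carrier H" for c x
    by (rule S_inj) (use that in \<open>simp_all add: Sinv_closed S_Sinv linear_mapsD(3)[OF S_lin]\<close>)
qed (rule Sinv_closed)

lemma Sinv_one: "Sinv \<one>\<^bsub>H\<^esub> = \<one>\<^bsub>H\<^esub>"
  using Sinv_S[OF A.one_closed] by (simp add: S_one)

text \<open>
  The antipode identities for the inverse of \<open>S\<close>: apply the injective antimultiplicative map \<open>S\<close> to them.
\<close>

lemma skew_antipode:
  assumes h: "h \<in> carrier H"
  shows "tlift H (\<lambda>a b. Sinv b \<otimes>\<^bsub>H\<^esub> a) (\<Delta> h) = \<epsilon> h \<odot>\<^bsub>H\<^esub> \<one>\<^bsub>H\<^esub>"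
    and "tlift H (\<lambda>a b. b \<otimes>\<^bsub>H\<^esub> Sinv a) (\<Delta> h) = \<epsilon> h \<odot>\<^bsub>H\<^esub> \<one>\<^bsub>H\<^esub>"
proof -
  have b1: "bilin K H H H (\<lambda>a b. Sinv b \<otimes>\<^bsub>H\<^esub> a)" and b2: "bilin K H H H (\<lambda>a b. b \<otimes>\<^bsub>H\<^esub> Sinv a)"
    by (intro bilinI lin_mult[OF algH] Sinv_lin lin_id; simp add: Sinv_closed)+
  have c1: "bilin K H H H (\<lambda>a b. S a \<otimes>\<^bsub>H\<^esub> b)" and c2: "bilin K H H H (\<lambda>a b. a \<otimes>\<^bsub>H\<^esub> S b)"
    by (intro bilinI lin_mult[OF algH] S_lin lin_id; simp add: S_closed)+
  have u: "S (\<epsilon> h \<odot>\<^bsub>H\<^esub> \<one>\<^bsub>H\<^esub>) = \<epsilon> h \<odot>\<^bsub>H\<^esub> \<one>\<^bsub>H\<^esub>"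
    using h linear_mapsD(3)[OF S_lin] by (simp add: S_one)
  have "S (tlift H (\<lambda>a b. Sinv b \<otimes>\<^bsub>H\<^esub> a) (\<Delta> h)) = tlift H (\<lambda>a b. S (Sinv b \<otimes>\<^bsub>H\<^esub> a)) (\<Delta> h)"
    by (rule tlift_comp[OF modH modH S_lin b1 modH modH \<Delta>_closed[OF h]])
  also have "\<dots> = tlift H (\<lambda>a b. S a \<otimes>\<^bsub>H\<^esub> b) (\<Delta> h)"
    by (rule tlift_cong[OF modH modH c1 modH \<Delta>_closed[OF h], symmetric]) (simp add: S_antimult Sinv_closed S_Sinv)
  finally show "tlift H (\<lambda>a b. Sinv b \<otimes>\<^bsub>H\<^esub> a) (\<Delta> h) = \<epsilon> h \<odot>\<^bsub>H\<^esub> \<one>\<^bsub>H\<^esub>"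
    using S_inj[OF _ tlift_closed[OF modH modH b1 modH \<Delta>_closed[OF h]]] h u by (simp add: antipode_left)
  have "S (tlift H (\<lambda>a b. b \<otimes>\<^bsub>H\<^esub> Sinv a) (\<Delta> h)) = tlift H (\<lambda>a b. S (b \<otimes>\<^bsub>H\<^esub> Sinv a)) (\<Delta> h)"
    by (rule tlift_comp[OF modH modH S_lin b2 modH modH \<Delta>_closed[OF h]])
  also have "\<dots> = tlift H (\<lambda>a b. a \<otimes>\<^bsub>H\<^esub> S b) (\<Delta> h)"
    by (rule tlift_cong[OF modH modH c2 modH \<Delta>_closed[OF h], symmetric]) (simp add: S_antimult Sinv_closed S_Sinv)
  finally show "tlift H (\<lambda>a b. b \<otimes>\<^bsub>H\<^esub> Sinv a) (\<Delta> h) = \<epsilon> h \<odot>\<^bsub>H\<^esub> \<one>\<^bsub>H\<^esub>"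
    using S_inj[OF _ tlift_closed[OF modH modH b2 modH \<Delta>_closed[OF h]]] h u by (simp add: antipode_right)
qed

section \<open>Conjugation by the canonical element\<close>

abbreviation "T \<equiv> op_dual K H"
abbreviation "U \<equiv> canU K H"

lemma algT: "unital_algebra K T" by (rule tensor_algebra[OF algHop algHd])
lemma modT [simp]: "module K T" by (rule unital_algebra_module[OF algT])

interpretation T: unital_algebra K T by (rule algT)
interpretation Hd: unital_algebra K Hd by (rule algHd)

lemma e_closed: "i < n \<Longrightarrow> e i \<in> carrier H" and d_closed: "i < n \<Longrightarrow> d i \<in> carrier Hd"
  using HD.e_in[of i] HD.d_in[of i] by auto

lemma U_closed: "U \<in> carrier T"
  unfolding canU_eq by (rule T.M.finsum_closed) (use e_closed d_closed modHop modHd in \<open>auto\<close>)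

text \<open>
  The inverse of \<open>U\<close>, as \<open>inv_U\<close> shows.
\<close>

definition "W = (\<Oplus>\<^bsub>T\<^esub>i\<in>{..<n}. pure K Hop Hd (Sinv (e i)) (d i))"

lemma W_closed: "W \<in> carrier T"
  unfolding W_def by (rule T.M.finsum_closed) (use e_closed d_closed Sinv_closed modHop modHd in \<open>auto\<close>)

lemma slice_T_pure:
  "\<lbrakk>g \<in> carrier H; \<theta> \<in> carrier Hd; h \<in> carrier H\<rbrakk> \<Longrightarrow>
    slice Hop (\<lambda>\<theta>. \<theta> h) (pure K Hop Hd g \<theta>) = \<theta> h \<odot>\<^bsub>H\<^esub> g"
  using slice_pure[OF modHop modHd dual_eval_lin, of h g \<theta>] by (simp add: opp_smult)

text \<open>
  The tensor \<open>\<Sum> f(e\<^sub>i) \<otimes> d\<^sub>i\<close> corresponds to the linear map \<open>f\<close> under \<open>H \<otimes> dual H = End H\<close>. Thus \<open>U\<close>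
  corresponds to the identity and \<open>W\<close> to the inverse of the antipode.
\<close>

lemma slice_canonical:
  assumes f: "f \<in> linear_maps K H H" and h: "h \<in> carrier H"
  shows "slice Hop (\<lambda>\<theta>. \<theta> h) (\<Oplus>\<^bsub>T\<^esub>i\<in>{..<n}. pure K Hop Hd (f (e i)) (d i)) = f h"
proof -
  note fc = lin_closed[OF f]
  interpret O: module K Hop by (rule modHop)
  have "slice Hop (\<lambda>\<theta>. \<theta> h) (\<Oplus>\<^bsub>T\<^esub>i\<in>{..<n}. pure K Hop Hd (f (e i)) (d i)) =
    (\<Oplus>\<^bsub>Hop\<^esub>i\<in>{..<n}. slice Hop (\<lambda>\<theta>. \<theta> h) (pure K Hop Hd (f (e i)) (d i)))"
    by (rule linear_maps_finsum[OF slice_linear[OF modHop modHd dual_eval_lin[OF h]] modT modHop])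
      (use e_closed d_closed fc in \<open>auto\<close>)
  also have "\<dots> = (\<Oplus>\<^bsub>Hop\<^esub>i\<in>{..<n}. f (d i h \<odot>\<^bsub>H\<^esub> e i))"
    by (rule O.M.finsum_cong')
      (use e_closed d_closed fc h linear_mapsD(3)[OF f] in \<open>auto simp: slice_T_pure\<close>)
  also have "\<dots> = f (\<Oplus>\<^bsub>H\<^esub>i\<in>{..<n}. d i h \<odot>\<^bsub>H\<^esub> e i)"
    by (rule linear_maps_finsum[OF _ modH modHop, symmetric]) (use f e_closed d_closed h in auto)
  also have "\<dots> = f h" using frame_H h by (simp add: frame_def)
  finally show ?thesis .
qed

lemma slice_U: "h \<in> carrier H \<Longrightarrow> slice Hop (\<lambda>\<theta>. \<theta> h) U = h"
  using slice_canonical[OF lin_id] unfolding canU_eq .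

lemma slice_W: "h \<in> carrier H \<Longrightarrow> slice Hop (\<lambda>\<theta>. \<theta> h) W = Sinv h"
  using slice_canonical[OF Sinv_lin] unfolding W_def .

lemma slice_T_closed: "\<lbrakk>h \<in> carrier H; t \<in> carrier T\<rbrakk> \<Longrightarrow> slice Hop (\<lambda>\<theta>. \<theta> h) t \<in> carrier H"
  using lin_closed[OF slice_linear[OF modHop modHd dual_eval_lin]] by simp

lemma slice_T_lin: "h \<in> carrier H \<Longrightarrow> (\<lambda>t. slice Hop (\<lambda>\<theta>. \<theta> h) t) \<in> linear_maps K T Hop"
  by (rule slice_linear[OF modHop modHd dual_eval_lin])

lemma slice_T_lin1: "t \<in> carrier T \<Longrightarrow> (\<lambda>h. slice Hop (\<lambda>\<theta>. \<theta> h) t) \<in> linear_maps K H H"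
  using lin_tlift2[OF modHop modHd _ lin_smult_scalar[OF modHop] slice_bilin[OF modHop dual_eval_lin] modHop modH, of t]
  by (simp add: Hd_functional)

text \<open>
  Under \<open>T = End H\<close> the product of \<open>T\<close> is convolution. The factors appear in reversed order on the
  right because the first leg of \<open>T\<close> carries the opposite product.
\<close>

lemma slice_T_mult:
  assumes h: "h \<in> carrier H" and s: "s \<in> carrier T" and t: "t \<in> carrier T"
  shows "slice Hop (\<lambda>\<theta>. \<theta> h) (s \<otimes>\<^bsub>T\<^esub> t) =
    tlift H (\<lambda>a b. slice Hop (\<lambda>\<theta>. \<theta> b) t \<otimes>\<^bsub>H\<^esub> slice Hop (\<lambda>\<theta>. \<theta> a) s) (\<Delta> h)"
  using HD.slice_mult[OF algHop h s t] by (simp add: tlift_opp[of H])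

lemma slice_T_one: "h \<in> carrier H \<Longrightarrow> slice Hop (\<lambda>\<theta>. \<theta> h) \<one>\<^bsub>T\<^esub> = \<epsilon> h \<odot>\<^bsub>H\<^esub> \<one>\<^bsub>H\<^esub>"
  using slice_pure[OF modHop modHd dual_eval_lin, of h "\<one>\<^bsub>Hop\<^esub>" "\<one>\<^bsub>Hd\<^esub>"] Hd.A.one_closed
  by (simp add: tensor_sel(4) Hd_one_eval opp_smult)

lemma U_W: "U \<otimes>\<^bsub>T\<^esub> W = \<one>\<^bsub>T\<^esub>" and W_U: "W \<otimes>\<^bsub>T\<^esub> U = \<one>\<^bsub>T\<^esub>"
proof -
  note bi = bilinI lin_mult[OF algH] slice_T_lin1 U_closed W_closed slice_T_closed
  have "slice Hop (\<lambda>\<theta>. \<theta> h) (U \<otimes>\<^bsub>T\<^esub> W) = slice Hop (\<lambda>\<theta>. \<theta> h) \<one>\<^bsub>T\<^esub>" if h: "h \<in> carrier H" for h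
  proof -
    have "slice Hop (\<lambda>\<theta>. \<theta> h) (U \<otimes>\<^bsub>T\<^esub> W) = tlift H (\<lambda>a b. Sinv b \<otimes>\<^bsub>H\<^esub> a) (\<Delta> h)"
      unfolding slice_T_mult[OF h U_closed W_closed]
      by (rule tlift_cong[OF modH modH _ modH \<Delta>_closed[OF h]]) (intro bi, simp_all add: slice_U slice_W)
    then show ?thesis by (simp add: skew_antipode slice_T_one h)
  qed
  then show "U \<otimes>\<^bsub>T\<^esub> W = \<one>\<^bsub>T\<^esub>"
    by (intro HD.slice_sep[OF modHop]) (use U_closed W_closed in auto)
  have "slice Hop (\<lambda>\<theta>. \<theta> h) (W \<otimes>\<^bsub>T\<^esub> U) = slice Hop (\<lambda>\<theta>. \<theta> h) \<one>\<^bsub>T\<^esub>" if h: "h \<in> carrier H" for h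
  proof -
    have "slice Hop (\<lambda>\<theta>. \<theta> h) (W \<otimes>\<^bsub>T\<^esub> U) = tlift H (\<lambda>a b. b \<otimes>\<^bsub>H\<^esub> Sinv a) (\<Delta> h)"
      unfolding slice_T_mult[OF h W_closed U_closed]
      by (rule tlift_cong[OF modH modH _ modH \<Delta>_closed[OF h]]) (intro bi, simp_all add: slice_U slice_W)
    then show ?thesis by (simp add: skew_antipode slice_T_one h)
  qed
  then show "W \<otimes>\<^bsub>T\<^esub> U = \<one>\<^bsub>T\<^esub>"
    by (intro HD.slice_sep[OF modHop]) (use U_closed W_closed in auto)
qed

lemma inv_U: "inv\<^bsub>T\<^esub> U = W"
  by (rule T.A.inv_char[OF U_closed W_closed U_W W_U])

abbreviation "AdU \<equiv> Ad T U"
abbreviation "AdU' \<equiv> Ad_inv T U"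

lemma AdU_lin: "AdU \<in> linear_maps K T T" and AdU'_lin: "AdU' \<in> linear_maps K T T"
  unfolding Ad_def[abs_def] Ad_inv_def[abs_def] inv_U
  by (intro lin_mult[OF algT] lin_id U_closed W_closed)+

lemma AdU_AdU': "z \<in> carrier T \<Longrightarrow> AdU (AdU' z) = z" and AdU'_AdU: "z \<in> carrier T \<Longrightarrow> AdU' (AdU z) = z"
proof -
  assume z: "z \<in> carrier T"
  have "x \<otimes>\<^bsub>T\<^esub> (y \<otimes>\<^bsub>T\<^esub> z \<otimes>\<^bsub>T\<^esub> x) \<otimes>\<^bsub>T\<^esub> y = (x \<otimes>\<^bsub>T\<^esub> y) \<otimes>\<^bsub>T\<^esub> z \<otimes>\<^bsub>T\<^esub> (x \<otimes>\<^bsub>T\<^esub> y)"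
    if "x \<in> carrier T" "y \<in> carrier T" for x y
    using that z by (simp add: T.A.m_assoc)
  from this[OF U_closed W_closed] this[OF W_closed U_closed]
  show "AdU (AdU' z) = z" "AdU' (AdU z) = z"
    using z unfolding Ad_def Ad_inv_def inv_U by (simp_all add: U_W W_U)
qed

text \<open>
  Slicing by \<open>1 \<in> H\<close> is \<open>id \<otimes> counit\<close>, as the counit of the dual is evaluation at \<open>1\<close>.
\<close>

lemma slice_one_hom: "(\<lambda>t. slice Hop (\<lambda>\<theta>. \<theta> \<one>\<^bsub>H\<^esub>) t) \<in> alg_hom K T Hop"
proof (rule alg_homI[OF slice_T_lin[OF A.one_closed]])
  fix s t assume st: "s \<in> carrier T" "t \<in> carrier T"
  have b: "bilin K H H H (\<lambda>a b. slice Hop (\<lambda>\<theta>. \<theta> b) t \<otimes>\<^bsub>H\<^esub> slice Hop (\<lambda>\<theta>. \<theta> a) s)"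
    by (intro bilinI lin_mult[OF algH] slice_T_lin1 slice_T_closed st)
  show "slice Hop (\<lambda>\<theta>. \<theta> \<one>\<^bsub>H\<^esub>) (s \<otimes>\<^bsub>T\<^esub> t) = slice Hop (\<lambda>\<theta>. \<theta> \<one>\<^bsub>H\<^esub>) s \<otimes>\<^bsub>Hop\<^esub> slice Hop (\<lambda>\<theta>. \<theta> \<one>\<^bsub>H\<^esub>) t"
    by (simp add: slice_T_mult[OF _ st] \<Delta>_one tlift_pure[OF modH modH b modH])
qed (simp add: slice_T_one \<epsilon>_one)

text \<open>
  An algebra homomorphism that sends \<open>U\<close> to \<open>1\<close> does not see conjugation by \<open>U\<close>. For \<open>id \<otimes> counit\<close> the value
  at \<open>U\<close> is its slice by \<open>1\<close>.
\<close>

lemma slice_one_AdU: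
  assumes z: "z \<in> carrier T"
  shows "slice Hop (\<lambda>\<theta>. \<theta> \<one>\<^bsub>H\<^esub>) (AdU z) = slice Hop (\<lambda>\<theta>. \<theta> \<one>\<^bsub>H\<^esub>) z"
  unfolding Ad_def inv_U using z U_closed W_closed slice_T_closed[OF A.one_closed z]
  by (simp add: alg_homD(2)[OF slice_one_hom] slice_U slice_W Sinv_one)

text \<open>
  The map \<open>counit \<otimes> id\<close> from \<open>T\<close> to \<open>dual H\<close>; it does not see conjugation by \<open>U\<close> either.
\<close>

abbreviation "eps1 z \<equiv> tlift Hd (\<lambda>g \<theta>. \<epsilon> g \<odot>\<^bsub>Hd\<^esub> \<theta>) z"

lemma eps1_bilin: "bilin K Hop Hd Hd (\<lambda>g \<theta>. \<epsilon> g \<odot>\<^bsub>Hd\<^esub> \<theta>)"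
  by (intro bilinI lin_smult[OF modHd] lin_smult_scalar[OF modHd] lin_id) (simp_all add: \<epsilon>_lin)

lemma eps1_lin: "(\<lambda>z. eps1 z) \<in> linear_maps K T Hd"
  by (rule tlift_linear[OF modHop modHd eps1_bilin modHd])

lemma eps1_pure: "\<lbrakk>g \<in> carrier H; \<theta> \<in> carrier Hd\<rbrakk> \<Longrightarrow> eps1 (pure K Hop Hd g \<theta>) = \<epsilon> g \<odot>\<^bsub>Hd\<^esub> \<theta>"
  using tlift_pure[OF modHop modHd eps1_bilin modHd] by simp

lemma eps1_hom: "(\<lambda>z. eps1 z) \<in> alg_hom K T Hd"
proof (rule alg_hom_tensorI[OF algHop algHd eps1_lin algHd])
  show "eps1 (pure K Hop Hd \<one>\<^bsub>Hop\<^esub> \<one>\<^bsub>Hd\<^esub>) = \<one>\<^bsub>Hd\<^esub>"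
    using eps1_pure[of "\<one>\<^bsub>H\<^esub>" "\<one>\<^bsub>Hd\<^esub>"] Hd.A.one_closed by (simp add: \<epsilon>_one)
  fix a b a' b' assume x: "a \<in> carrier Hop" "b \<in> carrier Hd" "a' \<in> carrier Hop" "b' \<in> carrier Hd"
  have "eps1 (pure K Hop Hd (a \<otimes>\<^bsub>Hop\<^esub> a') (b \<otimes>\<^bsub>Hd\<^esub> b')) = \<epsilon> (a' \<otimes>\<^bsub>H\<^esub> a) \<odot>\<^bsub>Hd\<^esub> (b \<otimes>\<^bsub>Hd\<^esub> b')"
    using x Hd.A.m_closed by (subst eps1_pure) simp_all
  also have "\<dots> = (\<epsilon> a \<odot>\<^bsub>Hd\<^esub> b) \<otimes>\<^bsub>Hd\<^esub> (\<epsilon> a' \<odot>\<^bsub>Hd\<^esub> b')"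
    using x by (simp add: \<epsilon>_mult Hd.smult_mult_left Hd.smult_mult_right Hd.smult_assoc1)
  also have "\<dots> = eps1 (pure K Hop Hd a b) \<otimes>\<^bsub>Hd\<^esub> eps1 (pure K Hop Hd a' b')"
    using x by (simp add: eps1_pure)
  finally show "eps1 (pure K Hop Hd (a \<otimes>\<^bsub>Hop\<^esub> a') (b \<otimes>\<^bsub>Hd\<^esub> b')) =
     eps1 (pure K Hop Hd a b) \<otimes>\<^bsub>Hd\<^esub> eps1 (pure K Hop Hd a' b')" .
qed

text \<open>
  The sum \<open>\<Sum> \<epsilon>(e\<^sub>i) d\<^sub>i\<close> is the expansion of the unit \<open>\<epsilon>\<close> of \<open>dual H\<close>.
\<close>

lemma eps1_U: "eps1 U = \<one>\<^bsub>Hd\<^esub>"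
proof -
  have "eps1 U = (\<Oplus>\<^bsub>Hd\<^esub>i\<in>{..<n}. eps1 (pure K Hop Hd (e i) (d i)))"
    unfolding canU_eq by (rule linear_maps_finsum[OF eps1_lin modT modHd]) (use e_closed d_closed in \<open>auto\<close>)
  also have "\<dots> = (\<Oplus>\<^bsub>Hd\<^esub>i\<in>{..<n}. \<one>\<^bsub>Hd\<^esub> (e i) \<odot>\<^bsub>Hd\<^esub> d i)"
    by (rule Hd.M.finsum_cong') (use e_closed d_closed in \<open>auto simp: eps1_pure Hd_one_eval\<close>)
  also have "\<dots> = \<one>\<^bsub>Hd\<^esub>" using HD.frame_A Hd.A.one_closed unfolding frame_def by blast
  finally show ?thesis .
qed

lemma eps1_AdU:
  assumes z: "z \<in> carrier T"
  shows "eps1 (AdU z) = eps1 z"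
proof -
  note m = alg_homD(2)[OF eps1_hom] and c = alg_homD(4)[OF eps1_hom]
  have "eps1 W = eps1 U \<otimes>\<^bsub>Hd\<^esub> eps1 W" using c[OF W_closed] by (simp add: eps1_U)
  also have "\<dots> = \<one>\<^bsub>Hd\<^esub>" using m[OF U_closed W_closed] alg_homD(3)[OF eps1_hom] by (simp add: U_W)
  finally have "eps1 W = \<one>\<^bsub>Hd\<^esub>" .
  then show ?thesis
    unfolding Ad_def inv_U using m z U_closed W_closed c[OF z] by (simp add: eps1_U)
qed

end

section \<open>The codouble and the double\<close>

context
  fixes K :: "('k, 'l) ring_scheme" and A :: "('k, 'a, 'm1) module_scheme" and B :: "('k, 'b, 'm2) module_scheme"
    and C :: "('k, 'c, 'm3) module_scheme" and D :: "('k, 'd, 'm4) module_scheme"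
    and B' :: "('k, 'b1, 'm5) module_scheme" and C' :: "('k, 'c1, 'm6) module_scheme" and \<phi>
  assumes A: "module K A" and B: "module K B" and C: "module K C" and D: "module K D"
    and B': "module K B'" and C': "module K C'" and \<phi>: "\<phi> \<in> linear_maps K (tensor K B C) (tensor K B' C')"
begin

abbreviation (input) "tmid_codomain \<equiv> tensor K (tensor K A B') (tensor K C' D)"

abbreviation (input) "tmid_kernel a b c d \<equiv> tlift tmid_codomain
  (\<lambda>b' c'. pure K (tensor K A B') (tensor K C' D) (pure K A B' a b') (pure K C' D c' d)) (\<phi> (pure K B C b c))"

lemma tmid_codomain_module: "module K tmid_codomain" and AB': "module K (tensor K A B')" and CD': "module K (tensor K C' D)"
  using A B' C' D by simp_all

lemma tmid_inner_bilin:
  assumes "a \<in> carrier A" "d \<in> carrier D"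
  shows "bilin K B' C' tmid_codomain (\<lambda>b' c'. pure K (tensor K A B') (tensor K C' D) (pure K A B' a b') (pure K C' D c' d))"
  by (intro bilinI lin_pure1[OF AB' CD'] lin_pure2[OF AB' CD'] lin_pure1[OF C' D] lin_pure2[OF A B'] lin_id assms
      pure_closed A B' C' D)

lemma tmid_kernel_lin:
  "\<lbrakk>b \<in> carrier B; c \<in> carrier C; d \<in> carrier D\<rbrakk> \<Longrightarrow> (\<lambda>a. tmid_kernel a b c d) \<in> linear_maps K A tmid_codomain"
  "\<lbrakk>a \<in> carrier A; c \<in> carrier C; d \<in> carrier D\<rbrakk> \<Longrightarrow> (\<lambda>b. tmid_kernel a b c d) \<in> linear_maps K B tmid_codomain"
  "\<lbrakk>a \<in> carrier A; b \<in> carrier B; d \<in> carrier D\<rbrakk> \<Longrightarrow> (\<lambda>c. tmid_kernel a b c d) \<in> linear_maps K C tmid_codomain"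
  "\<lbrakk>a \<in> carrier A; b \<in> carrier B; c \<in> carrier C\<rbrakk> \<Longrightarrow> (\<lambda>d. tmid_kernel a b c d) \<in> linear_maps K D tmid_codomain"
proof -
  have \<phi>c: "\<phi> (pure K B C b c) \<in> carrier (tensor K B' C')" if "b \<in> carrier B" "c \<in> carrier C" for b c
    by (rule lin_closed[OF \<phi> pure_closed[OF B C that]])
  show "\<lbrakk>b \<in> carrier B; c \<in> carrier C; d \<in> carrier D\<rbrakk> \<Longrightarrow> (\<lambda>a. tmid_kernel a b c d) \<in> linear_maps K A tmid_codomain"
    by (rule lin_tlift2[OF B' C' \<phi>c _ tmid_inner_bilin tmid_codomain_module A])
      (auto intro!: lin_pure1[OF AB' CD'] lin_pure1[OF A B'] lin_id pure_closed[OF C' D])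
  show "\<lbrakk>a \<in> carrier A; b \<in> carrier B; c \<in> carrier C\<rbrakk> \<Longrightarrow> (\<lambda>d. tmid_kernel a b c d) \<in> linear_maps K D tmid_codomain"
    by (rule lin_tlift2[OF B' C' \<phi>c _ tmid_inner_bilin tmid_codomain_module D])
      (auto intro!: lin_pure2[OF AB' CD'] lin_pure2[OF C' D] lin_id pure_closed[OF A B'])
  show "\<lbrakk>a \<in> carrier A; c \<in> carrier C; d \<in> carrier D\<rbrakk> \<Longrightarrow> (\<lambda>b. tmid_kernel a b c d) \<in> linear_maps K B tmid_codomain"
    by (rule lin_tlift1[OF B' C' lin_comp[OF \<phi> lin_pure1[OF B C lin_id]] tmid_inner_bilin tmid_codomain_module])
  show "\<lbrakk>a \<in> carrier A; b \<in> carrier B; d \<in> carrier D\<rbrakk> \<Longrightarrow> (\<lambda>c. tmid_kernel a b c d) \<in> linear_maps K C tmid_codomain"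
    by (rule lin_tlift1[OF B' C' lin_comp[OF \<phi> lin_pure2[OF B C lin_id]] tmid_inner_bilin tmid_codomain_module])
qed

lemma tmid_bilin:
  "bilin K (tensor K A B) (tensor K C D) tmid_codomain
     (\<lambda>s t. tlift tmid_codomain (\<lambda>a b. tlift tmid_codomain (\<lambda>c d. tmid_kernel a b c d) t) s)"
proof -
  note Z = tmid_codomain_module
  have cd: "bilin K C D tmid_codomain (\<lambda>c d. tmid_kernel a b c d)" if "a \<in> carrier A" "b \<in> carrier B" for a b
    by (rule bilinI; rule tmid_kernel_lin) (use that in auto)
  have ab: "bilin K A B tmid_codomain (\<lambda>a b. tlift tmid_codomain (\<lambda>c d. tmid_kernel a b c d) t)"
    if t: "t \<in> carrier (tensor K C D)" for t
    by (rule bilinI; rule lin_tlift2[OF C D t _ cd Z]) (auto intro!: tmid_kernel_lin A B)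
  show ?thesis
  proof (rule bilinI)
    show "(\<lambda>s. tlift tmid_codomain (\<lambda>a b. tlift tmid_codomain (\<lambda>c d. tmid_kernel a b c d) t) s)
       \<in> linear_maps K (tensor K A B) tmid_codomain" if "t \<in> carrier (tensor K C D)" for t
      by (rule tlift_linear[OF A B ab[OF that] Z])
    show "(\<lambda>t. tlift tmid_codomain (\<lambda>a b. tlift tmid_codomain (\<lambda>c d. tmid_kernel a b c d) t) s)
       \<in> linear_maps K (tensor K C D) tmid_codomain" if "s \<in> carrier (tensor K A B)" for s
      by (rule lin_tlift2[OF A B that tlift_linear[OF C D cd Z] ab Z tensor_module[OF C D]])
  qed
qed

lemma tmid_linear:
  "tmid K A B C D B' C' \<phi> \<in> linear_maps K (tensor K (tensor K A B) (tensor K C D)) tmid_codomain"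
  unfolding tmid_def[abs_def] Let_def
  by (rule tlift_linear[OF tensor_module[OF A B] tensor_module[OF C D] tmid_bilin tmid_codomain_module])

text \<open>
  Values of \<open>tmid\<close> are four nested sums in a fourfold tensor product. In computations with the coproduct of
  the codouble they are seen through a pairing \<open>F\<close>, which turns the innermost terms into scalars once it is
  moved inside all the sums.
\<close>

lemma tmid_pure:
  assumes s: "s \<in> carrier (tensor K A B)" and t: "t \<in> carrier (tensor K C D)" and Z: "module K Z"
    and F: "F \<in> linear_maps K tmid_codomain Z"
  shows "F (tmid K A B C D B' C' \<phi> (pure K (tensor K A B) (tensor K C D) s t)) =
    tlift Z (\<lambda>a b. tlift Z (\<lambda>c d. tlift Z (\<lambda>b' c'. F (pure K (tensor K A B') (tensor K C' D)
      (pure K A B' a b') (pure K C' D c' d))) (\<phi> (pure K B C b c))) t) s"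
proof -
  note Y = tmid_codomain_module
  have cd: "bilin K C D tmid_codomain (\<lambda>c d. tmid_kernel a b c d)" if "a \<in> carrier A" "b \<in> carrier B" for a b
    by (rule bilinI; rule tmid_kernel_lin) (use that in auto)
  have ab: "bilin K A B tmid_codomain (\<lambda>a b. tlift tmid_codomain (\<lambda>c d. tmid_kernel a b c d) t)"
    by (rule bilinI; rule lin_tlift2[OF C D t _ cd Y]) (auto intro!: tmid_kernel_lin A B)
  have cd': "bilin K C D Z (\<lambda>c d. F (tmid_kernel a b c d))" if "a \<in> carrier A" "b \<in> carrier B" for a b
    by (rule bilinI; rule lin_comp[OF F]; rule tmid_kernel_lin) (use that in auto)
  have ab': "bilin K A B Z (\<lambda>a b. F (tlift tmid_codomain (\<lambda>c d. tmid_kernel a b c d) t))"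
    by (rule bilinI; rule lin_comp[OF F]; rule bilinD[OF ab])
  have \<phi>c: "\<phi> (pure K B C b c) \<in> carrier (tensor K B' C')" if "b \<in> carrier B" "c \<in> carrier C" for b c
    by (rule lin_closed[OF \<phi> pure_closed[OF B C that]])
  have 1: "tlift Z (\<lambda>c d. tlift Z (\<lambda>b' c'. F (pure K (tensor K A B') (tensor K C' D)
      (pure K A B' a b') (pure K C' D c' d))) (\<phi> (pure K B C b c))) t = F (tlift tmid_codomain (\<lambda>c d. tmid_kernel a b c d) t)"
    if "a \<in> carrier A" "b \<in> carrier B" for a b
    by (subst tlift_comp[OF C D F cd[OF that] Y Z t])
      (rule tlift_cong[OF C D cd'[OF that] Z t, symmetric],
       rule tlift_comp[OF B' C' F tmid_inner_bilin Y Z \<phi>c], use that in auto)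
  show ?thesis
    unfolding tmid_def Let_def tlift_pure[OF tensor_module[OF A B] tensor_module[OF C D] tmid_bilin Y s t]
      tlift_comp[OF A B F ab Y Z s]
    by (rule tlift_cong[OF A B ab' Z s]) (simp add: 1)
qed

end

lemma unital_algebra_same:
  assumes A: "unital_algebra K A" and e: "carrier A = carrier A'" "ring.add A = ring.add A'" "ring.zero A = ring.zero A'"
    "smult A = smult A'" "monoid.mult A = monoid.mult A'" "monoid.one A = monoid.one A'"
  shows "unital_algebra K A'"
proof -
  interpret A: unital_algebra K A by (rule A)
  have m: "module K A'" by (rule module_same[OF A.module_axioms e(1-4)])
  interpret M: module K A' by (rule m)
  have "ring A'"
    by (rule ringI[OF M.M.abelian_group_axioms monoidI]) (simp_all add: A.A.m_assoc A.A.l_distr A.A.r_distr flip: e)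
  then show ?thesis
    by (intro unital_algebra.intro m unital_algebra_axioms.intro)
      (simp_all add: A.smult_mult_left A.smult_mult_right flip: e)
qed

lemma tens_fun_prod:
  assumes A: "module K A" and B: "module K B" and C: "module K C" and D: "module K D"
    and f: "bilin K A B (ground K) f" and k: "bilin K C D (ground K) k"
    and s: "s \<in> carrier (tensor K A B)" and t: "t \<in> carrier (tensor K C D)"
  shows "tlift (ground K) (\<lambda>a b. tlift (ground K) (\<lambda>c d. f a b \<otimes>\<^bsub>K\<^esub> k c d) t) s =
    tlift (ground K) f s \<otimes>\<^bsub>K\<^esub> tlift (ground K) k t"
proof -
  note G = module_ground[OF A] and c = module_cring[OF A]
  interpret cring K by (rule c)
  have fc: "f a b \<in> carrier K" if "a \<in> carrier A" "b \<in> carrier B" for a b using bilinD(3)[OF f that] by simp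
  have kt: "tlift (ground K) k t \<in> carrier K" using tlift_closed[OF C D k G t] by simp
  have b: "bilin K A B (ground K) (\<lambda>a b. f a b \<otimes>\<^bsub>K\<^esub> tlift (ground K) k t)"
    by (intro bilinI lin_ring_mult(1)[OF c] bilinD[OF f] kt)
  have "tlift (ground K) f s \<otimes>\<^bsub>K\<^esub> tlift (ground K) k t = tlift (ground K) (\<lambda>a b. f a b \<otimes>\<^bsub>K\<^esub> tlift (ground K) k t) s"
    by (rule tlift_comp[OF A B lin_ring_mult(1)[OF c lin_id kt] f G G s])
  also have "\<dots> = tlift (ground K) (\<lambda>a b. tlift (ground K) (\<lambda>c d. f a b \<otimes>\<^bsub>K\<^esub> k c d) t) s"
    by (rule tlift_cong[OF A B b G s], rule tlift_comp[OF C D lin_ring_mult(2)[OF c lin_id fc] k G G t])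
  finally show ?thesis by simp
qed

context finite_hopf
begin

interpretation Hd: unital_algebra K Hd by (rule algHd)

abbreviation "Co \<equiv> codouble K H"
abbreviation "V \<equiv> tensor K Hd H"

text \<open>
  The pairing of \<open>V = dual H \<otimes> H\<close> with \<open>T\<close> is the tensor product of the evaluation pairing of \<open>dual H\<close> with
  \<open>H\<^sup>o\<^sup>p\<close> and the flipped one of \<open>H\<close> with \<open>dual H\<close>; hence it is perfect.
\<close>

lemma pairing_Hd_Hop: "perfect_pairing K Hd Hop (\<lambda>\<omega> g. \<omega> g) {..<n} e d"
proof (rule perfect_pairing.intro)
  show "bilin K Hd Hop (ground K) (\<lambda>\<omega> g. \<omega> g)"
    by (intro bilinI) (simp_all add: dual_eval_lin Hd_functional)
  show "frame K Hop {..<n} d e" using frame_H by (simp add: frame_same[of Hop H] opp_smult)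
  show "frame K Hd {..<n} (\<lambda>i u. u (e i)) d" using HD.frame_A by simp
qed simp_all

sublocale TP: two_pairings K Hd Hop "\<lambda>\<omega> g. \<omega> g" "{..<n}" e d H Hd "\<lambda>h \<theta>. \<theta> h" "{..<n}" d e
  by (intro two_pairings.intro pairing_Hd_Hop HD.perfect_pairing_axioms)

lemma pairing_eq: "pairing K = tensor_pairing K (\<lambda>\<omega> g. \<omega> g) (\<lambda>h \<theta>. \<theta> h)"
  by (simp add: fun_eq_iff pairing_def tensor_pairing_def)

lemma pairing_bilin: "bilin K V T (ground K) (pairing K)"
  unfolding pairing_eq by (rule TP.tp_bilin)

lemma pairing_pure:
  "\<lbrakk>\<omega> \<in> carrier Hd; h \<in> carrier H; t \<in> carrier T\<rbrakk> \<Longrightarrow> pairing K (pure K Hd H \<omega> h) t = tens_fun K \<omega> (\<lambda>\<theta>. \<theta> h) t"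
  unfolding pairing_eq by (rule TP.tp_pure)

lemma pairing_pure_pure:
  "\<lbrakk>\<omega> \<in> carrier Hd; h \<in> carrier H; g \<in> carrier H; \<theta> \<in> carrier Hd\<rbrakk> \<Longrightarrow>
   pairing K (pure K Hd H \<omega> h) (pure K Hop Hd g \<theta>) = \<omega> g \<otimes>\<^bsub>K\<^esub> \<theta> h"
  using pairing_pure[of \<omega> h "pure K Hop Hd g \<theta>"] pure_closed[OF modHop modHd, of g \<theta>]
    tens_fun_pure[OF modHop modHd, of \<omega> "\<lambda>\<theta>. \<theta> h" g \<theta>] dual_eval_lin Hd_functional by simp

lemma pairing_lin: "u \<in> carrier V \<Longrightarrow> pairing K u \<in> linear_maps K T (ground K)"
  and pairing_lin1: "t \<in> carrier T \<Longrightarrow> (\<lambda>u. pairing K u t) \<in> linear_maps K V (ground K)"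
  and pairing_closed: "\<lbrakk>u \<in> carrier V; t \<in> carrier T\<rbrakk> \<Longrightarrow> pairing K u t \<in> carrier K"
  using bilinD[OF pairing_bilin] by auto

lemma modV [simp]: "module K V" by simp

lemma Co_sel [simp]:
  "carrier Co = carrier T" "ring.add Co = ring.add T" "ring.zero Co = ring.zero T" "smult Co = smult T"
  "monoid.mult Co = monoid.mult T" "monoid.one Co = monoid.one T"
  by (simp_all add: codouble_def)

lemma Co_tensor [simp]: "tensor K Co Y = tensor K T Y" "tensor K X Co = tensor K X T" "pure K Co Y = pure K T Y"
  "pure K X Co = pure K X T" "linear_maps K Co Y = linear_maps K T Y" "linear_maps K X Co = linear_maps K X T"
  by (simp_all add: codouble_def)

lemma algCo: "unital_algebra K Co"
  by (rule unital_algebra_same[OF algT]) simp_all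

lemma counit_Co: "counit Co = tlift K (\<lambda>g \<theta>. \<epsilon> g \<otimes>\<^bsub>K\<^esub> \<theta> \<one>\<^bsub>H\<^esub>)"
  by (simp add: codouble_def)

lemma counit_Co_lin: "counit Co \<in> linear_maps K T (ground K)"
  unfolding counit_Co using tens_fun_linear[OF modHop modHd, of \<epsilon> "\<lambda>\<theta>. \<theta> \<one>\<^bsub>H\<^esub>"] \<epsilon>_lin dual_eval_lin by simp

text \<open>
  The middle map in the coproduct of the codouble.
\<close>

definition "flipAd z = tflip K Hop Hd (AdU z)"

lemma flipAd_lin: "flipAd \<in> linear_maps K (tensor K Hop Hd) (tensor K Hd Hop)"
  unfolding flipAd_def[abs_def] by (rule lin_comp[OF tflip_linear[OF modHop modHd] AdU_lin])

lemma comult_Co: "comult Co t = tmid K Hop Hop Hd Hd Hd Hop flipAd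
    (tmap K (tensor K Hop Hop) (tensor K Hd Hd) \<Delta> (comult Hd) t)"
  unfolding codouble_def flipAd_def[abs_def] by simp

lemma \<Delta>_Hop_lin: "\<Delta> \<in> linear_maps K Hop (tensor K Hop Hop)"
  using \<Delta>_lin by (simp add: linear_maps_tensor_opp_opp)

lemma comult_Hd_lin: "comult Hd \<in> linear_maps K Hd (tensor K Hd Hd)"
  by (rule HD.comult_A)

lemma modHH: "module K (tensor K Hop Hop)" "module K (tensor K Hd Hd)" by simp_all

lemma comult_Co_lin: "comult Co \<in> linear_maps K T (tensor K T (tensor K Hop Hd))"
proof -
  have "(\<lambda>t. comult Co t) \<in> linear_maps K T (tensor K (tensor K Hop Hd) (tensor K Hop Hd))"
    unfolding comult_Co
    by (rule lin_comp[OF tmid_linear[OF modHop modHop modHd modHd modHd modHop flipAd_lin]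
      tmap_linear[OF modHop modHd modHH \<Delta>_Hop_lin comult_Hd_lin]])
  then show ?thesis by simp
qed

text \<open>
  The operator \<open>\<omega>\<^sub>1 \<otimes> h\<^sub>1 \<mapsto> \<omega>\<omega>\<^sub>1 \<otimes> h\<^sub>1h'\<close>. It is the part of the product
  \<open>(\<omega> \<bowtie> h)(\<omega>' \<bowtie> h')\<close> that is independent of how \<open>h\<close> and \<open>\<omega>'\<close> are exchanged.
\<close>

definition "outer_mult \<omega> h' = tmap K Hd H (\<lambda>\<omega>1. \<omega> \<otimes>\<^bsub>Hd\<^esub> \<omega>1) (\<lambda>h1. h1 \<otimes>\<^bsub>H\<^esub> h')"

lemma outer_mult_lin: "\<lbrakk>\<omega> \<in> carrier Hd; h' \<in> carrier H\<rbrakk> \<Longrightarrow> outer_mult \<omega> h' \<in> linear_maps K V V"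
  unfolding outer_mult_def
  by (intro tmap_linear modHd modH lin_mult(2)[OF algHd lin_id] lin_mult(1)[OF algH lin_id])

lemma outer_mult_pure: "\<lbrakk>\<omega> \<in> carrier Hd; h' \<in> carrier H; \<omega>1 \<in> carrier Hd; h1 \<in> carrier H\<rbrakk> \<Longrightarrow>
    outer_mult \<omega> h' (pure K Hd H \<omega>1 h1) = pure K Hd H (\<omega> \<otimes>\<^bsub>Hd\<^esub> \<omega>1) (h1 \<otimes>\<^bsub>H\<^esub> h')"
  unfolding outer_mult_def
  by (rule tmap_pure[OF modHd modH modHd modH lin_mult(2)[OF algHd lin_id] lin_mult(1)[OF algH lin_id]])

text \<open>
  Bilinearity of the summands of \<open>\<Sum> \<omega>(g\<^sub>(\<^sub>1\<^sub>)) p(w, g\<^sub>(\<^sub>2\<^sub>) \<otimes> \<theta>\<^sub>(\<^sub>1\<^sub>)) \<theta>\<^sub>(\<^sub>2\<^sub>)(h')\<close>, the common value of the two computations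
  that follow.
\<close>

lemma sweedler_bilin:
  assumes \<omega>: "\<omega> \<in> carrier Hd" and h': "h' \<in> carrier H" and w: "w \<in> carrier V"
  shows "\<lbrakk>g1 \<in> carrier H; g2 \<in> carrier H\<rbrakk> \<Longrightarrow> bilin K Hd Hd (ground K)
      (\<lambda>\<theta>1 \<theta>2. (\<omega> g1 \<otimes>\<^bsub>K\<^esub> pairing K w (pure K Hop Hd g2 \<theta>1)) \<otimes>\<^bsub>K\<^esub> \<theta>2 h')"
    and "\<theta> \<in> carrier Hd \<Longrightarrow> bilin K H H (ground K) (\<lambda>g1 g2. tlift (ground K) (\<lambda>\<theta>1 \<theta>2.
      (\<omega> g1 \<otimes>\<^bsub>K\<^esub> pairing K w (pure K Hop Hd g2 \<theta>1)) \<otimes>\<^bsub>K\<^esub> \<theta>2 h') (comult Hd \<theta>))"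
proof -
  have pc: "pure K Hop Hd g \<theta> \<in> carrier T" if "g \<in> carrier H" "\<theta> \<in> carrier Hd" for g \<theta>
    using pure_closed[OF modHop modHd] that by simp
  have pl1: "(\<lambda>g. pairing K w (pure K Hop Hd g \<theta>)) \<in> linear_maps K H (ground K)" if "\<theta> \<in> carrier Hd" for \<theta>
    using lin_comp[OF pairing_lin[OF w] lin_pure1[OF modHop modHd lin_id that]] by simp
  have pl2: "(\<lambda>\<theta>. pairing K w (pure K Hop Hd g \<theta>)) \<in> linear_maps K Hd (ground K)" if "g \<in> carrier H" for g
    using lin_comp[OF pairing_lin[OF w] lin_pure2[OF modHop modHd lin_id, of g]] that by simp
  have inner: "bilin K Hd Hd (ground K) (\<lambda>\<theta>1 \<theta>2. (\<omega> g1 \<otimes>\<^bsub>K\<^esub> pairing K w (pure K Hop Hd g2 \<theta>1)) \<otimes>\<^bsub>K\<^esub> \<theta>2 h')"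
    if "g1 \<in> carrier H" "g2 \<in> carrier H" for g1 g2
    by (intro bilinI lin_ring_mult[OF cK] pl2 dual_eval_lin h' R.m_closed Hd_eval_closed \<omega> that pairing_closed w pc)
  then show "\<lbrakk>g1 \<in> carrier H; g2 \<in> carrier H\<rbrakk> \<Longrightarrow> bilin K Hd Hd (ground K)
      (\<lambda>\<theta>1 \<theta>2. (\<omega> g1 \<otimes>\<^bsub>K\<^esub> pairing K w (pure K Hop Hd g2 \<theta>1)) \<otimes>\<^bsub>K\<^esub> \<theta>2 h')" .
  show "bilin K H H (ground K) (\<lambda>g1 g2. tlift (ground K) (\<lambda>\<theta>1 \<theta>2.
      (\<omega> g1 \<otimes>\<^bsub>K\<^esub> pairing K w (pure K Hop Hd g2 \<theta>1)) \<otimes>\<^bsub>K\<^esub> \<theta>2 h') (comult Hd \<theta>))" if "\<theta> \<in> carrier Hd"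
    by (intro bilinI lin_tlift2[OF modHd modHd lin_closed[OF comult_Hd_lin that]] inner lin_ring_mult[OF cK] pl1 h' w
        Hd_functional[OF \<omega>] pairing_closed pc Hd_eval_closed \<omega> modK modH)
qed

text \<open>
  For pure \<open>w = \<omega>\<^sub>1 \<otimes> h\<^sub>1\<close> the sum factors into the value of \<open>\<omega>\<omega>\<^sub>1\<close> at \<open>g\<close> and that of \<open>\<theta>\<close> at \<open>h\<^sub>1h'\<close>.
\<close>

lemma pairing_outer_mult:
  assumes \<omega>: "\<omega> \<in> carrier Hd" and h': "h' \<in> carrier H" and w: "w \<in> carrier V" and g: "g \<in> carrier H" and \<theta>: "\<theta> \<in> carrier Hd"
  shows "pairing K (outer_mult \<omega> h' w) (pure K Hop Hd g \<theta>) =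
    tlift (ground K) (\<lambda>g1 g2. tlift (ground K) (\<lambda>\<theta>1 \<theta>2.
      (\<omega> g1 \<otimes>\<^bsub>K\<^esub> pairing K w (pure K Hop Hd g2 \<theta>1)) \<otimes>\<^bsub>K\<^esub> \<theta>2 h') (comult Hd \<theta>)) (\<Delta> g)" (is "_ = ?R w")
proof -
  have pc: "pure K Hop Hd g \<theta> \<in> carrier T" if "g \<in> carrier H" "\<theta> \<in> carrier Hd" for g \<theta>
    using pure_closed[OF modHop modHd] that by simp
  note dc = lin_closed[OF comult_Hd_lin \<theta>] and \<Delta>c = \<Delta>_closed[OF g]
  note inner = sweedler_bilin(1)[OF \<omega> h'] and outer = sweedler_bilin(2)[OF \<omega> h' _ \<theta>]
  have R_lin: "?R \<in> linear_maps K V (ground K)"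
    by (intro lin_tlift2[OF modH modH \<Delta>c] lin_tlift2[OF modHd modHd dc] inner outer lin_ring_mult[OF cK] pairing_lin1 pc
        Hd_eval_closed \<omega> h' modK modV)
  show ?thesis
  proof (rule linear_ext[OF modHd modH lin_comp[OF pairing_lin1[OF pc[OF g \<theta>]] outer_mult_lin[OF \<omega> h']] R_lin modK w])
    fix \<omega>1 h1 assume x: "\<omega>1 \<in> carrier Hd" "h1 \<in> carrier H"
    have b1: "bilin K H H (ground K) (\<lambda>g1 g2. \<omega> g1 \<otimes>\<^bsub>K\<^esub> \<omega>1 g2)"
      by (rule tensor_functional[OF modH modH Hd_functional Hd_functional]) (use \<omega> x in auto)
    have b2: "bilin K Hd Hd (ground K) (\<lambda>\<theta>1 \<theta>2. \<theta>1 h1 \<otimes>\<^bsub>K\<^esub> \<theta>2 h')"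
      by (rule tensor_functional[OF modHd modHd dual_eval_lin dual_eval_lin]) (use h' x in auto)
    have "?R (pure K Hd H \<omega>1 h1) = tlift (ground K) (\<lambda>g1 g2. tlift (ground K) (\<lambda>\<theta>1 \<theta>2.
      (\<omega> g1 \<otimes>\<^bsub>K\<^esub> \<omega>1 g2) \<otimes>\<^bsub>K\<^esub> (\<theta>1 h1 \<otimes>\<^bsub>K\<^esub> \<theta>2 h')) (comult Hd \<theta>)) (\<Delta> g)"
    proof (rule tlift_cong[OF modH modH outer modK \<Delta>c])
      fix g1 g2 assume gg: "g1 \<in> carrier H" "g2 \<in> carrier H"
      show "tlift (ground K) (\<lambda>\<theta>1 \<theta>2. (\<omega> g1 \<otimes>\<^bsub>K\<^esub> pairing K (pure K Hd H \<omega>1 h1) (pure K Hop Hd g2 \<theta>1)) \<otimes>\<^bsub>K\<^esub> \<theta>2 h') (comult Hd \<theta>) =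
        tlift (ground K) (\<lambda>\<theta>1 \<theta>2. (\<omega> g1 \<otimes>\<^bsub>K\<^esub> \<omega>1 g2) \<otimes>\<^bsub>K\<^esub> (\<theta>1 h1 \<otimes>\<^bsub>K\<^esub> \<theta>2 h')) (comult Hd \<theta>)"
        by (rule tlift_cong[OF modHd modHd inner modK dc])
          (use x gg \<omega> h' in \<open>simp_all add: pairing_pure_pure R.m_assoc\<close>)
    qed (use x in simp)
    also have "\<dots> = tlift (ground K) (\<lambda>g1 g2. \<omega> g1 \<otimes>\<^bsub>K\<^esub> \<omega>1 g2) (\<Delta> g) \<otimes>\<^bsub>K\<^esub>
        tlift (ground K) (\<lambda>\<theta>1 \<theta>2. \<theta>1 h1 \<otimes>\<^bsub>K\<^esub> \<theta>2 h') (comult Hd \<theta>)"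
      by (rule tens_fun_prod[OF modH modH modHd modHd b1 b2 \<Delta>c dc])
    also have "\<dots> = (\<omega> \<otimes>\<^bsub>Hd\<^esub> \<omega>1) g \<otimes>\<^bsub>K\<^esub> \<theta> (h1 \<otimes>\<^bsub>H\<^esub> h')"
      using g \<theta> x h' HD.p_mult[of h1 h' \<theta>] by (simp add: Hd_mult_eval tlift_ground[of K])
    also have "\<dots> = pairing K (outer_mult \<omega> h' (pure K Hd H \<omega>1 h1)) (pure K Hop Hd g \<theta>)"
      using g \<theta> x h' \<omega> by (simp add: outer_mult_pure pairing_pure_pure)
    finally show "pairing K (outer_mult \<omega> h' (pure K Hd H \<omega>1 h1)) (pure K Hop Hd g \<theta>) = ?R (pure K Hd H \<omega>1 h1)" by simp
  qed
qed

text \<open>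
  In the coproduct of \<open>g \<otimes> \<theta>\<close> the outer legs \<open>g\<^sub>(\<^sub>1\<^sub>)\<close> and \<open>\<theta>\<^sub>(\<^sub>2\<^sub>)\<close> are paired with \<open>\<omega>\<close> and \<open>h'\<close>, whereas the
  inner part \<open>Ad(U)(g\<^sub>(\<^sub>2\<^sub>) \<otimes> \<theta>\<^sub>(\<^sub>1\<^sub>))\<close> is flipped and paired with \<open>h\<close> and \<open>\<omega>'\<close>. So the inner part
  contributes \<open>p(w, g\<^sub>(\<^sub>2\<^sub>) \<otimes> \<theta>\<^sub>(\<^sub>1\<^sub>))\<close> with \<open>w\<close> representing \<open>\<omega>' \<otimes> h\<close> after \<open>Ad(U)\<close>.
\<close>

lemma pairing_comult_Co:
  assumes \<omega>: "\<omega> \<in> carrier Hd" and h: "h \<in> carrier H" and \<omega>': "\<omega>' \<in> carrier Hd" and h': "h' \<in> carrier H"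
    and w: "w \<in> carrier V" and wAd: "\<And>t. t \<in> carrier T \<Longrightarrow> pairing K w t = pairing K (pure K Hd H \<omega>' h) (AdU t)"
    and t: "t \<in> carrier T"
  shows "tens_fun K (pairing K (pure K Hd H \<omega> h)) (pairing K (pure K Hd H \<omega>' h')) (comult Co t) =
    pairing K (outer_mult \<omega> h' w) t"
proof -
  let ?u = "pure K Hd H \<omega> h" and ?v = "pure K Hd H \<omega>' h'"
  have uv: "?u \<in> carrier V" "?v \<in> carrier V" and \<omega>h: "pure K Hd H \<omega>' h \<in> carrier V" using \<omega> h \<omega>' h' by simp_all
  define F where "F = tens_fun K (pairing K ?u) (pairing K ?v)"
  have F: "F \<in> linear_maps K (tensor K T T) (ground K)"
    unfolding F_def by (rule tens_fun_linear[OF modT modT pairing_lin pairing_lin]) (use uv in auto)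
  have pc: "pure K Hop Hd g \<theta> \<in> carrier T" if "g \<in> carrier H" "\<theta> \<in> carrier Hd" for g \<theta>
    using pure_closed[OF modHop modHd] that by simp
  have "F (comult Co t) = pairing K (outer_mult \<omega> h' w) t"
  proof (rule linear_ext[OF modHop modHd lin_comp[OF F comult_Co_lin] pairing_lin[OF lin_closed[OF outer_mult_lin[OF \<omega> h'] w]] modK t])
    fix g \<theta> assume "g \<in> carrier Hop" and \<theta>: "\<theta> \<in> carrier Hd"
    then have g: "g \<in> carrier H" by simp
    note dc = lin_closed[OF comult_Hd_lin \<theta>] and \<Delta>c = \<Delta>_closed[OF g]
    have \<Delta>c': "\<Delta> g \<in> carrier (tensor K Hop Hop)" using lin_closed[OF \<Delta>_Hop_lin] g by simp
    have inner: "bilin K Hd Hd (ground K) (\<lambda>\<theta>1 \<theta>2. (\<omega> g1 \<otimes>\<^bsub>K\<^esub> pairing K w (pure K Hop Hd g2 \<theta>1)) \<otimes>\<^bsub>K\<^esub> \<theta>2 h')"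
      if "g1 \<in> carrier Hop" "g2 \<in> carrier Hop" for g1 g2
      using sweedler_bilin(1)[OF \<omega> h' w] that by simp
    have outer: "bilin K Hop Hop (ground K) (\<lambda>g1 g2. tlift (ground K) (\<lambda>\<theta>1 \<theta>2.
      (\<omega> g1 \<otimes>\<^bsub>K\<^esub> pairing K w (pure K Hop Hd g2 \<theta>1)) \<otimes>\<^bsub>K\<^esub> \<theta>2 h') (comult Hd \<theta>))"
      using sweedler_bilin(2)[OF \<omega> h' w \<theta>] by (simp add: bilin_def)
    have "F (comult Co (pure K Hop Hd g \<theta>)) = tlift (ground K) (\<lambda>g1 g2. tlift (ground K) (\<lambda>\<theta>1 \<theta>2.
       tlift (ground K) (\<lambda>b c. F (pure K T T (pure K Hop Hd g1 b) (pure K Hop Hd c \<theta>2)))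
          (flipAd (pure K Hop Hd g2 \<theta>1))) (comult Hd \<theta>)) (\<Delta> g)"
      unfolding comult_Co tmap_pure[OF modHop modHd modHH \<Delta>_Hop_lin comult_Hd_lin \<open>g \<in> carrier Hop\<close> \<theta>]
      by (rule tmid_pure[OF modHop modHop modHd modHd modHd modHop flipAd_lin \<Delta>c' dc modK F])
    also have "\<dots> = tlift (ground K) (\<lambda>g1 g2. tlift (ground K) (\<lambda>\<theta>1 \<theta>2.
      (\<omega> g1 \<otimes>\<^bsub>K\<^esub> pairing K w (pure K Hop Hd g2 \<theta>1)) \<otimes>\<^bsub>K\<^esub> \<theta>2 h') (comult Hd \<theta>)) (\<Delta> g)"
    proof (rule tlift_cong[OF modHop modHop outer modK \<Delta>c', symmetric], rule tlift_cong[OF modHd modHd inner modK dc])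
      fix g1 g2 \<theta>1 \<theta>2 assume "g1 \<in> carrier Hop" "g2 \<in> carrier Hop" and \<theta>\<theta>: "\<theta>1 \<in> carrier Hd" "\<theta>2 \<in> carrier Hd"
      then have gg: "g1 \<in> carrier H" "g2 \<in> carrier H" by simp_all
      (* The inner legs for fixed outer ones; both sides agree already before summation. *)
      let ?z = "AdU (pure K Hop Hd g2 \<theta>1)"
      have z: "?z \<in> carrier T" by (rule lin_closed[OF AdU_lin pc[OF gg(2) \<theta>\<theta>(1)]])
      have k: "\<omega> g1 \<in> carrier K" "\<theta>2 h' \<in> carrier K" using \<omega> \<theta>\<theta> gg h' by auto
      have b: "bilin K Hop Hd (ground K) (\<lambda>c b. \<omega>' c \<otimes>\<^bsub>K\<^esub> b h)"
        by (rule tensor_functional[OF modHop modHd]) (use \<omega>' h in \<open>auto simp: Hd_functional dual_eval_lin\<close>)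
      have b2: "bilin K Hd Hop (ground K) (\<lambda>b c. F (pure K T T (pure K Hop Hd g1 b) (pure K Hop Hd c \<theta>2)))"
        by (intro bilinI lin_comp[OF F] lin_pure1[OF modT modT] lin_pure2[OF modT modT] lin_pure1[OF modHop modHd]
            lin_pure2[OF modHop modHd] lin_id pc) (use gg \<theta>\<theta> in auto)
      have b3: "bilin K Hop Hd (ground K) (\<lambda>c b. F (pure K T T (pure K Hop Hd g1 b) (pure K Hop Hd c \<theta>2)))"
        using b2 unfolding bilin_def by auto
      have scal: "(\<lambda>k. (\<omega> g1 \<otimes>\<^bsub>K\<^esub> k) \<otimes>\<^bsub>K\<^esub> \<theta>2 h') \<in> linear_maps K (ground K) (ground K)"
        by (intro lin_ring_mult[OF cK] lin_id k)
      have "(\<omega> g1 \<otimes>\<^bsub>K\<^esub> pairing K w (pure K Hop Hd g2 \<theta>1)) \<otimes>\<^bsub>K\<^esub> \<theta>2 h' =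
        (\<omega> g1 \<otimes>\<^bsub>K\<^esub> tlift (ground K) (\<lambda>c b. \<omega>' c \<otimes>\<^bsub>K\<^esub> b h) ?z) \<otimes>\<^bsub>K\<^esub> \<theta>2 h'"
        using wAd[OF pc[OF gg(2) \<theta>\<theta>(1)]] pairing_pure[OF \<omega>' h z] by (simp add: tlift_ground[of K])
      also have "\<dots> = tlift (ground K) (\<lambda>c b. (\<omega> g1 \<otimes>\<^bsub>K\<^esub> (\<omega>' c \<otimes>\<^bsub>K\<^esub> b h)) \<otimes>\<^bsub>K\<^esub> \<theta>2 h') ?z"
        by (rule tlift_comp[OF modHop modHd scal b modK modK z])
      also have "\<dots> = tlift (ground K) (\<lambda>c b. F (pure K T T (pure K Hop Hd g1 b) (pure K Hop Hd c \<theta>2))) ?z"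
      proof (rule tlift_cong[OF modHop modHd b3 modK z, symmetric])
        fix c b assume "c \<in> carrier Hop" and b: "b \<in> carrier Hd"
        then have c: "c \<in> carrier H" by simp
        show "F (pure K T T (pure K Hop Hd g1 b) (pure K Hop Hd c \<theta>2)) = (\<omega> g1 \<otimes>\<^bsub>K\<^esub> (\<omega>' c \<otimes>\<^bsub>K\<^esub> b h)) \<otimes>\<^bsub>K\<^esub> \<theta>2 h'"
          unfolding F_def using gg \<theta>\<theta> b c \<omega> \<omega>' h h'
          by (simp add: tens_fun_pure[OF modT modT pairing_lin[OF uv(1)] pairing_lin[OF uv(2)]] pc pairing_pure_pure R.m_ac)
      qed
      also have "\<dots> = tlift (ground K) (\<lambda>b c. F (pure K T T (pure K Hop Hd g1 b) (pure K Hop Hd c \<theta>2))) (flipAd (pure K Hop Hd g2 \<theta>1))"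
        unfolding flipAd_def by (rule tlift_tflip[OF modHop modHd b2 modK z, symmetric])
      finally show "(\<omega> g1 \<otimes>\<^bsub>K\<^esub> pairing K w (pure K Hop Hd g2 \<theta>1)) \<otimes>\<^bsub>K\<^esub> \<theta>2 h' =
        tlift (ground K) (\<lambda>b c. F (pure K T T (pure K Hop Hd g1 b) (pure K Hop Hd c \<theta>2))) (flipAd (pure K Hop Hd g2 \<theta>1))" .
    qed simp_all
    also have "\<dots> = pairing K (outer_mult \<omega> h' w) (pure K Hop Hd g \<theta>)"
      by (rule pairing_outer_mult[OF \<omega> h' w g \<theta>, symmetric])
    finally show "F (comult Co (pure K Hop Hd g \<theta>)) = pairing K (outer_mult \<omega> h' w) (pure K Hop Hd g \<theta>)" .
  qed
  then show ?thesis by (simp add: F_def)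
qed

text \<open>
  The identification \<open>P\<close> of \<open>V\<close> with the functionals on the codouble, and its inverse \<open>Q\<close>, as they occur in
  the definition of the double.
\<close>

definition "P u = (\<lambda>t\<in>carrier T. pairing K u t)"
definition "Q = inv_into (carrier V) P"

sublocale CoA: finite_coproduct_algebra K Co "{..<n} \<times> {..<n}"
  "\<lambda>x. P (pure K Hd H (d (fst x)) (e (snd x)))" "\<lambda>x. pure K Hop Hd (e (fst x)) (d (snd x))"
proof (rule finite_coproduct_algebra.intro[OF algCo])
  have c: "pure K Hd H (d (fst x)) (e (snd x)) \<in> carrier V" if "x \<in> {..<n} \<times> {..<n}" for x
    using that e_closed d_closed by auto
  show "comult Co \<in> linear_maps K Co (tensor K Co Co)" using comult_Co_lin by simp
  show "counit Co \<in> linear_maps K Co (ground K)" using counit_Co_lin by simp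
  show "frame K Co ({..<n} \<times> {..<n}) (\<lambda>x. P (pure K Hd H (d (fst x)) (e (snd x)))) (\<lambda>x. pure K Hop Hd (e (fst x)) (d (snd x)))"
    using frame_cong[OF TP.T.frame_A modT, of "\<lambda>x. P (pure K Hd H (d (fst x)) (e (snd x)))"]
    by (simp add: frame_same[of Co T] P_def pairing_eq)
  show "P (pure K Hd H (d (fst x)) (e (snd x))) \<in> carrier (dual_alg K Co)" if "x \<in> {..<n} \<times> {..<n}" for x
    using linear_maps_congI[OF pairing_lin[OF c[OF that]] modT, of "P (pure K Hd H (d (fst x)) (e (snd x)))"]
    by (simp add: dual_alg_sel P_def)
qed

abbreviation "Db \<equiv> double K H"

lemma P_closed: "u \<in> carrier V \<Longrightarrow> P u \<in> carrier (dual_alg K Co)"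
  using linear_maps_congI[OF pairing_lin modT, of u "P u"] by (simp add: dual_alg_sel P_def)

lemma P_surj: "f \<in> carrier (dual_alg K Co) \<Longrightarrow> \<exists>u\<in>carrier V. P u = f"
proof -
  assume f: "f \<in> carrier (dual_alg K Co)"
  then have "f \<in> linear_maps K T (ground K)" by (simp add: dual_alg_sel)
  then obtain u where u: "u \<in> carrier V" "\<And>t. t \<in> carrier T \<Longrightarrow> pairing K u t = f t"
    using TP.T.functional_representable unfolding pairing_eq by blast
  then have "P u = f" by (intro dual_eqI[OF P_closed f]) (simp_all add: P_def)
  then show ?thesis using u by blast
qed

lemma Q_closed: "f \<in> carrier (dual_alg K Co) \<Longrightarrow> Q f \<in> carrier V"
  and P_Q: "f \<in> carrier (dual_alg K Co) \<Longrightarrow> P (Q f) = f"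
  unfolding Q_def using P_surj by (auto intro: inv_into_into f_inv_into_f)

lemma pairing_Q: "\<lbrakk>f \<in> carrier (dual_alg K Co); t \<in> carrier T\<rbrakk> \<Longrightarrow> pairing K (Q f) t = f t"
  using fun_cong[OF P_Q, of f t] by (simp add: P_def)

lemma Q_lin: "Q \<in> linear_maps K (dual_alg K Co) V"
proof (rule TP.T.linear_into_D[OF CoA.ev.modD Q_closed])
  fix t assume t: "t \<in> carrier T"
  show "(\<lambda>f. tensor_pairing K (\<lambda>\<omega> g. \<omega> g) (\<lambda>h \<theta>. \<theta> h) (Q f) t) \<in> linear_maps K (dual_alg K Co) (ground K)"
    by (rule linear_maps_congI[OF dual_evaluation_linear[of t] CoA.ev.modD]) (use t in \<open>simp_all add: pairing_Q flip: pairing_eq\<close>)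
qed

lemma double_sel:
  "carrier Db = carrier V" "ring.add Db = ring.add V" "ring.zero Db = ring.zero V" "smult Db = smult V"
  "monoid.mult Db = (\<lambda>u v. Q (P u \<otimes>\<^bsub>dual_alg K Co\<^esub> P v))" "monoid.one Db = Q \<one>\<^bsub>dual_alg K Co\<^esub>"
  "comult Db = (\<lambda>u. tmap K V V Q Q (comult (dual K Co) (P u)))" "counit Db = (\<lambda>u. counit (dual K Co) (P u))"
  by (simp_all add: double_def Let_def Q_def P_def[abs_def] dual_sel)

lemma Db_tensor: "carrier (tensor K Db Db) = carrier (tensor K V V)" "linear_maps K Db Y = linear_maps K V Y"
  "linear_maps K X Db = linear_maps K X V"
  by (rule tensor_cong_module linear_maps_same; simp add: double_sel)+

text \<open>
  The double is the dual of the codouble transported along \<open>P\<close>, and \<open>pairing K u t\<close> is evaluation of \<open>P u\<close>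
  at \<open>t\<close>. So duality between double and codouble is inherited from that between the codouble and its dual.
\<close>

sublocale DC: bialgebra_pairing K Db Co "pairing K" "{..<n} \<times> {..<n}"
  "\<lambda>x. pure K Hop Hd (e (fst x)) (d (snd x))" "\<lambda>x. pure K Hd H (d (fst x)) (e (snd x))"
proof (rule bialgebra_pairing.intro)
  have modDb: "module K Db" by (rule module_same[OF modV]) (simp_all add: double_sel)
  show "perfect_pairing K Db Co (pairing K) ({..<n} \<times> {..<n})
    (\<lambda>x. pure K Hop Hd (e (fst x)) (d (snd x))) (\<lambda>x. pure K Hd H (d (fst x)) (e (snd x)))"
  proof (rule perfect_pairing.intro[OF modDb CoA.modA])
    show "bilin K Db Co (ground K) (pairing K)"
      using pairing_bilin by (simp add: bilin_def Db_tensor double_sel)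
    show "frame K Co ({..<n} \<times> {..<n}) (\<lambda>i. pairing K (pure K Hd H (d (fst i)) (e (snd i)))) (\<lambda>x. pure K Hop Hd (e (fst x)) (d (snd x)))"
      using TP.T.frame_A by (simp add: frame_same[of Co T] pairing_eq)
    show "frame K Db ({..<n} \<times> {..<n}) (\<lambda>i u. pairing K u (pure K Hop Hd (e (fst i)) (d (snd i)))) (\<lambda>x. pure K Hd H (d (fst x)) (e (snd x)))"
      using TP.T.frame_D by (simp add: frame_same[of Db V] double_sel pairing_eq)
  qed
  note modD' = CoA.ev.modD
  have comult_Db: "comult Db u \<in> carrier (tensor K V V)" if "u \<in> carrier V" for u
    unfolding double_sel
    by (rule lin_closed[OF tmap_linear[OF modD' modD' modV modV Q_lin Q_lin] CoA.comult_dual_closed[OF P_closed[OF that]]])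
  show "bialgebra_pairing_axioms K Db Co (pairing K)"
  proof (rule bialgebra_pairing_axioms.intro[OF algCo CoA.comult_A])
    fix u assume "u \<in> carrier Db"
    then have u: "u \<in> carrier V" by (simp add: double_sel)
    show "comult Db u \<in> carrier (tensor K Db Db)" using comult_Db[OF u] by (simp add: Db_tensor)
    show "pairing K u \<one>\<^bsub>Co\<^esub> = counit Db u"
      using u unital_algebra_ring[OF algT] by (simp add: double_sel dual_sel P_def ring.ring_simprules)
    fix v assume "v \<in> carrier Db"
    then have v: "v \<in> carrier V" by (simp add: double_sel)
    show "u \<otimes>\<^bsub>Db\<^esub> v \<in> carrier Db"
      by (simp add: double_sel Q_closed CoA.dual_mult_closed P_closed u v)
    fix t assume "t \<in> carrier Co"
    then have t: "t \<in> carrier T" by simp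
    note tc = lin_closed[OF comult_Co_lin t]
    have "pairing K (u \<otimes>\<^bsub>Db\<^esub> v) t = (P u \<otimes>\<^bsub>dual_alg K Co\<^esub> P v) t"
      unfolding double_sel by (rule pairing_Q[OF CoA.dual_mult_closed[OF P_closed[OF u] P_closed[OF v]] t])
    also have "\<dots> = tens_fun K (P u) (P v) (comult Co t)" using t by (simp add: dual_alg_sel(2))
    also have "\<dots> = tens_fun K (pairing K u) (pairing K v) (comult Co t)"
      unfolding tlift_ground[of K]
      by (rule tlift_cong[OF modT modT tensor_functional[OF modT modT pairing_lin[OF u] pairing_lin[OF v]] modK tc, symmetric])
        (simp add: P_def)
    finally show "pairing K (u \<otimes>\<^bsub>Db\<^esub> v) t = tens_fun K (pairing K u) (pairing K v) (comult Co t)" .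
  next
    show "\<one>\<^bsub>Db\<^esub> \<in> carrier Db" by (simp add: double_sel Q_closed CoA.dual_one_closed)
    show "pairing K \<one>\<^bsub>Db\<^esub> t = counit Co t" if "t \<in> carrier Co" for t
      using that pairing_Q[OF CoA.dual_one_closed, of t] by (simp add: double_sel dual_alg_sel(3))
  next
    fix u s t assume "u \<in> carrier Db" "s \<in> carrier Co" "t \<in> carrier Co"
    then have u: "u \<in> carrier V" and s: "s \<in> carrier T" and t: "t \<in> carrier T" by (simp_all add: double_sel)
    let ?c = "comult (dual K Co) (P u)"
    have cc: "?c \<in> carrier (tensor K (dual_alg K Co) (dual_alg K Co))" by (rule CoA.comult_dual_closed[OF P_closed[OF u]])
    have ev: "(\<lambda>f. f x) \<in> linear_maps K (dual_alg K Co) (ground K)" if "x \<in> carrier T" for x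
      by (rule dual_evaluation_linear) (simp add: that)
    have "tens_fun K (\<lambda>v. pairing K v s) (\<lambda>v. pairing K v t) (comult Db u) =
      tlift (ground K) (\<lambda>f g. pairing K (Q f) s \<otimes>\<^bsub>K\<^esub> pairing K (Q g) t) ?c"
      unfolding double_sel tlift_ground[of K]
      by (rule tlift_tmap[OF modD' modD' modV modV Q_lin Q_lin
         tensor_functional[OF modV modV pairing_lin1[OF s] pairing_lin1[OF t]] modK cc])
    also have "\<dots> = tlift (ground K) (\<lambda>f g. f s \<otimes>\<^bsub>K\<^esub> g t) ?c"
      by (rule tlift_cong[OF modD' modD' tensor_functional[OF modD' modD' ev[OF s] ev[OF t]] modK cc, symmetric])
        (simp add: pairing_Q s t)
    also have "\<dots> = P u (s \<otimes>\<^bsub>Co\<^esub> t)"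
      using CoA.comult_dual_eval[OF P_closed[OF u], of s t] s t by (simp add: tlift_ground[of K])
    also have "\<dots> = pairing K u (s \<otimes>\<^bsub>Co\<^esub> t)"
      using s t unital_algebra_ring[OF algT] by (simp add: P_def ring.ring_simprules)
    finally show "pairing K u (s \<otimes>\<^bsub>Co\<^esub> t) = tens_fun K (\<lambda>v. pairing K v s) (\<lambda>v. pairing K v t) (comult Db u)" by simp
  qed
qed

text \<open>
  Functionals on the codouble multiply through its coproduct, which the pairing with \<open>outer_mult \<omega> h' w\<close>
  reproduces.
\<close>

lemma double_mult:
  assumes "\<omega> \<in> carrier Hd" "h \<in> carrier H" "\<omega>' \<in> carrier Hd" "h' \<in> carrier H"
    and w: "w \<in> carrier V" and wAd: "\<And>t. t \<in> carrier T \<Longrightarrow> pairing K w t = pairing K (pure K Hd H \<omega>' h) (AdU t)"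
  shows "pure K Hd H \<omega> h \<otimes>\<^bsub>Db\<^esub> pure K Hd H \<omega>' h' = outer_mult \<omega> h' w"
proof (rule DC.D_sep)
  have uv: "pure K Hd H \<omega> h \<in> carrier Db" "pure K Hd H \<omega>' h' \<in> carrier Db" using assms by (simp_all add: double_sel)
  show "pure K Hd H \<omega> h \<otimes>\<^bsub>Db\<^esub> pure K Hd H \<omega>' h' \<in> carrier Db" by (rule DC.mult_D[OF uv])
  show "outer_mult \<omega> h' w \<in> carrier Db" using lin_closed[OF outer_mult_lin w] assms by (simp add: double_sel)
  fix t assume t: "t \<in> carrier Co"
  show "pairing K (pure K Hd H \<omega> h \<otimes>\<^bsub>Db\<^esub> pure K Hd H \<omega>' h') t = pairing K (outer_mult \<omega> h' w) t"
    unfolding DC.p_mult[OF uv t] by (rule pairing_comult_Co) (use assms t in auto)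
qed

text \<open>
  These two formulas show which elements of the double cannot see \<open>Ad(U)\<close>: \<open>\<omega> \<otimes> 1\<close> pairs through
  \<open>id \<otimes> counit\<close> and \<open>1 \<otimes> h\<close> through \<open>counit \<otimes> id\<close>.
\<close>

lemma pairing_pure_eq_slice:
  assumes \<omega>: "\<omega> \<in> carrier Hd" and h: "h \<in> carrier H" and t: "t \<in> carrier T"
  shows "pairing K (pure K Hd H \<omega> h) t = \<omega> (slice Hop (\<lambda>\<theta>. \<theta> h) t)"
proof -
  have \<omega>l: "\<omega> \<in> linear_maps K Hop (ground K)" using Hd_functional[OF \<omega>] by simp
  show ?thesis
  proof (rule linear_ext[OF modHop modHd pairing_lin lin_comp[OF \<omega>l slice_T_lin[OF h]] modK t])
    fix g \<theta> assume "g \<in> carrier Hop" "\<theta> \<in> carrier Hd"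
    then show "pairing K (pure K Hd H \<omega> h) (pure K Hop Hd g \<theta>) = \<omega> (slice Hop (\<lambda>\<theta>. \<theta> h) (pure K Hop Hd g \<theta>))"
      using \<omega> h linear_mapsD(3)[OF Hd_functional[OF \<omega>]] by (simp add: pairing_pure_pure slice_T_pure R.m_comm)
  qed (use \<omega> h in auto)
qed

lemma pairing_one_eq_eps1:
  assumes h: "h \<in> carrier H" and t: "t \<in> carrier T"
  shows "pairing K (pure K Hd H \<one>\<^bsub>Hd\<^esub> h) t = (eps1 t) h"
proof (rule linear_ext[OF modHop modHd pairing_lin lin_comp[OF dual_eval_lin[OF h] eps1_lin] modK t])
  fix g \<theta> assume "g \<in> carrier Hop" "\<theta> \<in> carrier Hd"
  then show "pairing K (pure K Hd H \<one>\<^bsub>Hd\<^esub> h) (pure K Hop Hd g \<theta>) = (eps1 (pure K Hop Hd g \<theta>)) h"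
    using h linear_mapsD(3)[OF dual_eval_lin[OF h]] by (simp add: pairing_pure_pure eps1_pure Hd_one_eval)
qed (use h in auto)

text \<open>
  The element exchanged with \<open>\<omega>'\<close> is \<open>1\<close>, so \<open>w = \<omega>' \<otimes> 1\<close> represents the functional composed with \<open>Ad(U)\<close>.
\<close>

lemma double_mult_left:
  assumes \<omega>: "\<omega> \<in> carrier Hd" "\<omega>' \<in> carrier Hd" and h': "h' \<in> carrier H"
  shows "pure K Hd H \<omega> \<one>\<^bsub>H\<^esub> \<otimes>\<^bsub>Db\<^esub> pure K Hd H \<omega>' h' = pure K Hd H (\<omega> \<otimes>\<^bsub>Hd\<^esub> \<omega>') h'"
proof -
  have "pure K Hd H \<omega> \<one>\<^bsub>H\<^esub> \<otimes>\<^bsub>Db\<^esub> pure K Hd H \<omega>' h' = outer_mult \<omega> h' (pure K Hd H \<omega>' \<one>\<^bsub>H\<^esub>)"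
    by (rule double_mult) (use \<omega> h' lin_closed[OF AdU_lin] in \<open>auto simp: pairing_pure_eq_slice slice_one_AdU\<close>)
  then show ?thesis using \<omega> h' by (simp add: outer_mult_pure)
qed

text \<open>
  The element exchanged with \<open>h\<close> is \<open>1\<close>, so \<open>w = 1 \<otimes> h\<close> represents the functional composed with \<open>Ad(U)\<close>.
\<close>

lemma double_mult_right:
  assumes \<omega>: "\<omega> \<in> carrier Hd" and h: "h \<in> carrier H" "h' \<in> carrier H"
  shows "pure K Hd H \<omega> h \<otimes>\<^bsub>Db\<^esub> pure K Hd H \<one>\<^bsub>Hd\<^esub> h' = pure K Hd H \<omega> (h \<otimes>\<^bsub>H\<^esub> h')"
proof -
  have "pure K Hd H \<omega> h \<otimes>\<^bsub>Db\<^esub> pure K Hd H \<one>\<^bsub>Hd\<^esub> h' = outer_mult \<omega> h' (pure K Hd H \<one>\<^bsub>Hd\<^esub> h)"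
    by (rule double_mult) (use \<omega> h lin_closed[OF AdU_lin] in \<open>auto simp: pairing_one_eq_eps1 eps1_AdU\<close>)
  then show ?thesis using \<omega> h by (simp add: outer_mult_pure)
qed

text \<open>
  The exchange rule. Together with \<open>double_mult_left\<close> and \<open>double_mult_right\<close> it determines the product of
  the double.
\<close>

lemma double_mult_swapped:
  assumes \<omega>: "\<omega> \<in> carrier Hd" and h: "h \<in> carrier H"
    and w: "w \<in> carrier V" and wAd: "\<And>t. t \<in> carrier T \<Longrightarrow> pairing K w t = pairing K (pure K Hd H \<omega> h) (AdU t)"
  shows "pure K Hd H \<one>\<^bsub>Hd\<^esub> h \<otimes>\<^bsub>Db\<^esub> pure K Hd H \<omega> \<one>\<^bsub>H\<^esub> = w"
proof -
  have "outer_mult \<one>\<^bsub>Hd\<^esub> \<one>\<^bsub>H\<^esub> w = w"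
    by (rule linear_ext[OF modHd modH outer_mult_lin lin_id modV w]) (simp_all add: outer_mult_pure)
  then show ?thesis using double_mult[of "\<one>\<^bsub>Hd\<^esub>" h \<omega> "\<one>\<^bsub>H\<^esub>" w] assms by simp
qed

lemma AdU_representable:
  assumes "u \<in> carrier V"
  obtains w where "w \<in> carrier V" "\<And>t. t \<in> carrier T \<Longrightarrow> pairing K w t = pairing K u (AdU t)"
  using TP.T.functional_representable[OF lin_comp[OF pairing_lin[OF assms] AdU_lin]] unfolding pairing_eq by blast

lemma counit_Co_pairing: "t \<in> carrier T \<Longrightarrow> counit Co t = pairing K (pure K Hd H \<one>\<^bsub>Hd\<^esub> \<one>\<^bsub>H\<^esub>) t"
  unfolding counit_Co tlift_ground[of K]
  by (subst pairing_pure, simp_all add: tlift_ground[of K],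
      rule tlift_cong[OF modHop modHd tensor_functional[OF modHop modHd] modK])
    (use \<epsilon>_lin dual_eval_lin in \<open>simp_all add: Hd_one_eval\<close>)

end

section \<open>Isomorphisms of categories\<close>

text \<open>
  An isomorphism of categories which is literally the identity on morphisms. For such functors all
  conditions concern objects and equality of hom-sets, and identities and compositions are transported for
  free.
\<close>

definition category_iso :: "('o, 'm) category \<Rightarrow> ('p, 'm) category \<Rightarrow> ('o \<Rightarrow> 'p) \<Rightarrow> bool" where
  "category_iso C D F \<longleftrightarrow> bij_betw F (Ob C) (Ob D) \<and>
     (\<forall>A\<in>Ob C. \<forall>B\<in>Ob C. Mor D (F A) (F B) = Mor C A B) \<and>
     (\<forall>A\<in>Ob C. Ident D (F A) = Ident C A) \<and>
     (\<forall>A\<in>Ob C. \<forall>B\<in>Ob C. \<forall>E\<in>Ob C. Cmp D (F A) (F B) (F E) = Cmp C A B E)"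

text \<open>
  The category laws need be checked for one vertex of the square only; the others follow.
\<close>

lemma category_iso_category: "category_iso C D F \<Longrightarrow> is_category C \<longleftrightarrow> is_category D"
proof -
  assume i: "category_iso C D F"
  then have "Ob D = F ` Ob C" by (simp add: category_iso_def bij_betw_def)
  then show ?thesis using i unfolding is_category_def category_iso_def by simp
qed

lemma category_iso_inverse:
  assumes i: "category_iso C D F"
  shows "category_iso D C (inv_into (Ob C) F)"
proof -
  let ?G = "inv_into (Ob C) F"
  have b: "bij_betw ?G (Ob D) (Ob C)" using i by (simp add: category_iso_def bij_betw_inv_into)
  then have G: "?G A \<in> Ob C" if "A \<in> Ob D" for A using that by (auto simp: bij_betw_def)
  have FG: "F (?G A) = A" if "A \<in> Ob D" for A
    using i that unfolding category_iso_def by (blast intro: bij_betw_inv_into_right)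
  show ?thesis
    using i b G FG unfolding category_iso_def by (metis (no_types, lifting))
qed

lemma category_iso_functor:
  assumes i: "category_iso C D F" and C: "is_category C"
  shows "is_functor C D (F, \<lambda>A B f. f)"
proof -
  have "F A \<in> Ob D" if "A \<in> Ob C" for A using i that by (auto simp: category_iso_def bij_betw_def)
  then show ?thesis
    using i C category_iso_category[OF i] unfolding is_functor_def category_iso_def by simp
qed

lemma identity_naturally_isomorphic:
  assumes C: "is_category C" and F: "\<And>A. A \<in> Ob C \<Longrightarrow> fst F A = A" "\<And>A B f. \<lbrakk>A \<in> Ob C; B \<in> Ob C\<rbrakk> \<Longrightarrow> snd F A B f = f"
  shows "naturally_isomorphic C C F id_functor"
  unfolding naturally_isomorphic_def
proof (intro exI[of _ "Ident C"] conjI ballI)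
  fix A assume A: "A \<in> Ob C"
  have I: "Ident C A \<in> Mor C A A" using C A unfolding is_category_def by blast
  moreover have "Cmp C A A A (Ident C A) (Ident C A) = Ident C A" using C A I unfolding is_category_def by blast
  ultimately show "is_iso C (fst F A) (fst id_functor A) (Ident C A)"
    using A by (auto simp: is_iso_def F id_functor_def)
  fix B f assume B: "B \<in> Ob C" and f: "f \<in> Mor C A B"
  have "Cmp C A A B f (Ident C A) = f \<and> Cmp C A B B (Ident C B) f = f"
    using C A B f unfolding is_category_def by blast
  then show "Cmp C (fst F A) (fst F B) (fst id_functor B) (Ident C B) (snd F A B f) =
      Cmp C (fst F A) (fst id_functor A) (fst id_functor B) (snd id_functor A B f) (Ident C A)"
    using A B by (simp add: F id_functor_def)
qed

lemma category_iso_equivalence: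
  assumes i: "category_iso C D F" and C: "is_category C"
  shows "is_equivalence C D (F, \<lambda>A B f. f)"
proof -
  let ?G = "(inv_into (Ob C) F, \<lambda>A B f. f)"
  have D: "is_category D" using category_iso_category[OF i] C by simp
  have b: "bij_betw F (Ob C) (Ob D)" using i by (simp add: category_iso_def)
  have "naturally_isomorphic C C (comp_functor ?G (F, \<lambda>A B f. f)) id_functor"
    by (rule identity_naturally_isomorphic[OF C]) (simp_all add: comp_functor_def bij_betw_inv_into_left[OF b])
  moreover have "naturally_isomorphic D D (comp_functor (F, \<lambda>A B f. f) ?G) id_functor"
    by (rule identity_naturally_isomorphic[OF D]) (simp_all add: comp_functor_def bij_betw_inv_into_right[OF b])
  ultimately show ?thesis
    unfolding is_equivalence_def
    using category_iso_functor[OF i C] category_iso_functor[OF category_iso_inverse[OF i] D] by blast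
qed

lemma category_iso_comp:
  assumes F: "category_iso B C F" and G: "category_iso C D G"
  shows "category_iso B D (\<lambda>A. G (F A))"
proof -
  have "F A \<in> Ob C" if "A \<in> Ob B" for A using F that by (auto simp: category_iso_def bij_betw_def)
  then show ?thesis
    using F G bij_betw_trans[of F "Ob B" "Ob C" G "Ob D"] unfolding category_iso_def comp_def by simp
qed

text \<open>
  If \<open>F\<close> and \<open>E \<circ> F\<close> are isomorphisms, so is \<open>E\<close>. This yields the last side of a commuting square.
\<close>

lemma category_iso_cancel:
  assumes F: "category_iso B C F" and G: "category_iso B D G" and E: "\<And>A. A \<in> Ob B \<Longrightarrow> E (F A) = G A"
  shows "category_iso C D E"
proof -
  have C: "Ob C = F ` Ob B" using F by (simp add: category_iso_def bij_betw_def)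
  have "bij_betw (E \<circ> F) (Ob B) (Ob D)"
    using G E unfolding category_iso_def by (auto intro: iffD2[OF bij_betw_cong])
  then have "bij_betw E (Ob C) (Ob D)"
    using F bij_betw_comp_iff unfolding category_iso_def by blast
  then show ?thesis
    using F G E unfolding category_iso_def C by simp
qed

lemma category_of_algebras_sel:
  "Ob (category_of_algebras K Obs R) = {A \<in> Obs. unital_algebra K (fst A)}"
  "Mor (category_of_algebras K Obs R) A B = {f \<in> alg_hom K (fst A) (fst B) \<inter> extensional (carrier (fst A)). R A B f}"
  "Ident (category_of_algebras K Obs R) A = (\<lambda>x\<in>carrier (fst A). x)"
  "Cmp (category_of_algebras K Obs R) A B C = (\<lambda>g f. compose (carrier (fst A)) g f)"
  by (simp_all add: category_of_algebras_def)

text \<open>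
  The underlying algebra being kept, the hom-sets agree as soon as the same algebra homomorphisms preserve
  the extra structure.
\<close>

lemma category_of_algebras_iso:
  assumes "bij_betw F {A \<in> Obs. unital_algebra K (fst A)} {A \<in> Obs'. unital_algebra K (fst A)}"
    and "\<And>A. \<lbrakk>A \<in> Obs; unital_algebra K (fst A)\<rbrakk> \<Longrightarrow> fst (F A) = fst A"
    and "\<And>A B f. \<lbrakk>A \<in> Obs; unital_algebra K (fst A); B \<in> Obs; unital_algebra K (fst B); f \<in> alg_hom K (fst A) (fst B)\<rbrakk>
       \<Longrightarrow> R A B f \<longleftrightarrow> R' (F A) (F B) f"
  shows "category_iso (category_of_algebras K Obs R) (category_of_algebras K Obs' R') F"
  using assms unfolding category_iso_def category_of_algebras_sel by (auto simp: fun_eq_iff)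

lemma Alg_mod_category: "is_category (Alg_mod K A)"
proof -
  have id: "(\<lambda>x\<in>carrier X. x) \<in> alg_hom K X X" if "unital_algebra K X" for X
  proof -
    interpret X: unital_algebra K X by (rule that)
    show ?thesis by (rule alg_homI[OF linear_mapsI]) auto
  qed
  have comp: "compose (carrier X) g f \<in> alg_hom K X Z"
    if f: "f \<in> alg_hom K X Y" and g: "g \<in> alg_hom K Y Z" and X: "unital_algebra K X" for X Y Z f g
  proof -
    interpret X: unital_algebra K X by (rule X)
    note h = alg_hom_comp[OF f g]
    show ?thesis
      by (rule alg_homI[OF linear_maps_congI[OF alg_homD(1)[OF h] X.module_axioms]])
        (use alg_homD[OF h] in \<open>auto simp: compose_def\<close>)
  qed
  have act: "act a x \<in> carrier X" if "left_action K A X act" "a \<in> carrier A" "x \<in> carrier X" for X act a x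
    using that unfolding left_action_def linear_maps_def by blast
  show ?thesis
    unfolding is_category_def Alg_mod_def category_of_algebras_sel
  proof (intro conjI ballI, goal_cases)
    case (1 A)
    then show ?case by (auto simp: id action_hom_def act)
  next
    case (2 A B D f g)
    then show ?case by (auto simp: action_hom_def act compose_eq alg_homD(4) intro: comp split: prod.splits)
  next
    case (3 A B f)
    then show ?case by (auto simp: compose_def fun_eq_iff extensional_def alg_homD(4))
  next
    case (4 A B f)
    then show ?case by (auto simp: compose_def fun_eq_iff extensional_def alg_homD(4))
  next
    case (5 A B D E f g h)
    then show ?case by (auto simp: compose_def fun_eq_iff alg_homD(4))
  qed
qed

lemma right_coactionD:
  assumes "right_coaction K A X \<gamma>"
  shows "\<gamma> \<in> linear_maps K X (tensor K X A)" "\<gamma> \<in> extensional (carrier X)" "\<gamma> \<in> alg_hom K X (tensor K X A)"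
    "\<forall>x\<in>carrier X. tassoc K X A A (tmap K (tensor K X A) A \<gamma> id (\<gamma> x)) = tmap K X (tensor K A A) id (comult A) (\<gamma> x)"
    "x \<in> carrier X \<Longrightarrow> tlift X (\<lambda>y a. counit A a \<odot>\<^bsub>X\<^esub> y) (\<gamma> x) = x"
  using assms by (auto simp: right_coaction_def alg_hom_def)

text \<open>
  For the codouble and the double this is the second functor of the square.
\<close>

lemma (in bialgebra_pairing) comod_mod_iso:
  "category_iso (Alg_comod K A :: (('k, 'x, 'a) comod_alg, 'x \<Rightarrow> 'x) category)
     (Alg_mod K D :: (('k, 'x, 'd) mod_alg, 'x \<Rightarrow> 'x) category)
     (\<lambda>(X, \<gamma>). (X, induced_action D p X \<gamma>))"
  unfolding Alg_comod_def Alg_mod_def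
proof (rule category_of_algebras_iso)
  let ?F = "(\<lambda>(X, \<gamma>). (X, induced_action D p X \<gamma>)) :: ('k, 'x, 'a) comod_alg \<Rightarrow> ('k, 'x, 'd) mod_alg"
  show "bij_betw ?F {A' \<in> {(X, \<gamma>). right_coaction K A X \<gamma>}. unital_algebra K (fst A')}
     {A \<in> {(X, act). left_action K D X act}. unital_algebra K (fst A)}" (is "bij_betw _ ?O1 ?O2")
    unfolding bij_betw_def
  proof (intro conjI inj_onI equalityI subsetI)
    fix a b assume "a \<in> ?O1" "b \<in> ?O1" "?F a = ?F b"
    then show "a = b"
      by (auto intro!: induced_action_inj dest: right_coactionD)
  next
    fix a assume "a \<in> ?F ` ?O1"
    then show "a \<in> ?O2" using right_coaction_iff_left_action right_coactionD(1,2) by fastforce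
  next
    fix a assume "a \<in> ?O2"
    then obtain X act where a: "a = (X, act)" "unital_algebra K X" "left_action K D X act" by (cases a) auto
    then obtain \<gamma> where "right_coaction K A X \<gamma>" "induced_action D p X \<gamma> = act" using coaction_exists by blast
    then show "a \<in> ?F ` ?O1" using a by (auto intro!: image_eqI[of _ _ "(X, \<gamma>)"])
  qed
qed (auto simp: coaction_hom_iff right_coactionD alg_homD(1))

section \<open>Pairs of coactions and their compatibility\<close>

context finite_hopf
begin

interpretation Hd: unital_algebra K Hd by (rule algHd)

text \<open>
  A coaction \<open>\<alpha>\<close> of \<open>H\<^sup>o\<^sup>p\<close> is an action of the dual of \<open>H\<^sup>o\<^sup>p\<close>, which has the same algebra structure as the
  dual of \<open>H\<close>; only its coproduct is opposite. So for questions about products the elements of \<open>dual H\<close> may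
  be used.
\<close>

abbreviation "Dop \<equiv> dual K Hop"

lemma Dop_sel: "carrier Dop = carrier Hd" "monoid.mult Dop = monoid.mult Hd" "monoid.one Dop = monoid.one Hd"
  by (simp_all add: dual_sel dual_alg_opp)

interpretation OD: bialgebra_pairing K Dop Hop "\<lambda>\<theta> h. \<theta> h" "{..<n}" e d
  by (rule OA.dual_pairing)

text \<open>
  The actions induced by a coaction of \<open>H\<^sup>o\<^sup>p\<close>, of \<open>dual H\<close> and of the codouble.
\<close>

abbreviation "actA X \<alpha> \<equiv> induced_action Dop (\<lambda>\<theta> h. \<theta> h) X \<alpha>"
abbreviation "actB X \<beta> \<equiv> induced_action H (\<lambda>h \<theta>. \<theta> h) X \<beta>"
abbreviation "actD X \<gamma> \<equiv> induced_action Db (pairing K) X \<gamma>"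

lemma actA_app: "\<lbrakk>\<omega> \<in> carrier Hd; x \<in> carrier X\<rbrakk> \<Longrightarrow> actA X \<alpha> \<omega> x = slice X \<omega> (\<alpha> x)"
  by (rule OD.induced_action_app) (simp_all add: Dop_sel)

lemma actB_app: "\<lbrakk>h \<in> carrier H; x \<in> carrier X\<rbrakk> \<Longrightarrow> actB X \<beta> h x = slice X (\<lambda>\<theta>. \<theta> h) (\<beta> x)"
  by (rule HD.induced_action_app)

lemma actD_app: "\<lbrakk>u \<in> carrier V; x \<in> carrier X\<rbrakk> \<Longrightarrow> actD X \<gamma> u x = slice X (pairing K u) (\<gamma> x)"
  by (rule DC.induced_action_app) (simp_all add: double_sel)

lemma Hop_tensor: "carrier (tensor K X Hop) = carrier (tensor K X H)" "linear_maps K Y (tensor K X Hop) = linear_maps K Y (tensor K X H)"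
  by (simp_all add: tensor_opp_sel linear_maps_tensor_opp)

lemma T_sep:
  assumes X: "module K X" and t: "t \<in> carrier (tensor K X T)" "t' \<in> carrier (tensor K X T)"
    and eq: "\<And>\<omega> h. \<lbrakk>\<omega> \<in> carrier Hd; h \<in> carrier H\<rbrakk> \<Longrightarrow>
      slice X (pairing K (pure K Hd H \<omega> h)) t = slice X (pairing K (pure K Hd H \<omega> h)) t'"
  shows "t = t'"
  by (rule frame_sep[OF TP.T.frame_A modT X t]) (use eq e_closed d_closed in \<open>auto simp flip: pairing_eq\<close>)

end

text \<open>
  Linear maps into \<open>X \<otimes> H\<^sup>o\<^sup>p\<close> and \<open>X \<otimes> dual H\<close> that need not be coactions. The compatibility condition
  is linear and can be analysed at this level, which the converse direction uses, where \<open>\<alpha>\<close> and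
  \<open>\<beta>\<close> are only later seen to be coactions.
\<close>

locale two_coactions = finite_hopf K H S n e d
  for K :: "('k, 'l) ring_scheme" and H :: "('k, 'h) bialgebra" and S n e d +
  fixes X :: "('k, 'x) module" and \<alpha> and \<beta>
  assumes mX: "module K X" and \<alpha>: "\<alpha> \<in> linear_maps K X (tensor K X Hop)" and \<beta>: "\<beta> \<in> linear_maps K X (tensor K X Hd)"
begin

interpretation OD: bialgebra_pairing K Dop Hop "\<lambda>\<theta> h. \<theta> h" "{..<n}" e d
  by (rule OA.dual_pairing)

interpretation X: module K X by (rule mX)

abbreviation "a \<equiv> actA X \<alpha>"
abbreviation "b \<equiv> actB X \<beta>"
abbreviation "J \<equiv> joint_coaction K H X \<alpha> \<beta>"

lemmas \<alpha>c = lin_closed[OF \<alpha>]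
lemmas \<beta>c = lin_closed[OF \<beta>]

lemma XHop: "module K (tensor K X Hop)" and XHd: "module K (tensor K X Hd)" and XT: "module K (tensor K X T)"
  using mX by simp_all

lemma a_lin: "\<omega> \<in> carrier Hd \<Longrightarrow> a \<omega> \<in> linear_maps K X X"
  using OD.induced_action_linear[OF mX \<alpha>] by (simp add: Dop_sel)
lemma b_lin: "h \<in> carrier H \<Longrightarrow> b h \<in> linear_maps K X X"
  using HD.induced_action_linear[OF mX \<beta>] by simp
lemma a_lin1: "x \<in> carrier X \<Longrightarrow> (\<lambda>\<omega>. a \<omega> x) \<in> linear_maps K Hd X"
  using OD.induced_action_linear1[OF mX \<alpha>] by (simp add: dual_tensor dual_alg_opp)
lemma b_lin1: "x \<in> carrier X \<Longrightarrow> (\<lambda>h. b h x) \<in> linear_maps K H X"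
  using HD.induced_action_linear1[OF mX \<beta>] .
lemmas a_closed = lin_closed[OF a_lin]
lemmas b_closed = lin_closed[OF b_lin]

lemma J_app: "x \<in> carrier X \<Longrightarrow> J x = tassoc K X Hop Hd (tmap K (tensor K X Hop) Hd \<alpha> id (\<beta> x))"
  by (simp add: joint_coaction_def)

lemma J_lin: "J \<in> linear_maps K X (tensor K X T)"
  by (rule linear_maps_congI[OF lin_comp[OF tassoc_linear[OF mX modHop modHd]
      lin_comp[OF tmap_linear[OF mX modHd XHop modHd \<alpha> id_linear] \<beta>]] mX J_app])

lemmas J_closed = lin_closed[OF J_lin]

text \<open>
  Slicing \<open>(\<alpha> \<otimes> id)\<beta>\<close> applies \<open>h\<close> first. With \<open>Z_slice\<close>, where the order is opposite, this shows that the
  compatibility condition is an exchange rule for the two actions.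
\<close>

lemma J_slice:
  assumes \<omega>: "\<omega> \<in> carrier Hd" and h: "h \<in> carrier H" and x: "x \<in> carrier X"
  shows "slice X (pairing K (pure K Hd H \<omega> h)) (J x) = a \<omega> (b h x)"
proof -
  have "slice X (pairing K (pure K Hd H \<omega> h)) (J x) = slice X (tens_fun K \<omega> (\<lambda>\<theta>. \<theta> h)) (J x)"
    by (rule slice_cong[OF mX modT pairing_lin J_closed[OF x]]) (use \<omega> h in \<open>auto simp: pairing_pure\<close>)
  also have "\<dots> = slice X \<omega> (\<alpha> (slice X (\<lambda>\<theta>. \<theta> h) (\<beta> x)))"
    unfolding J_app[OF x]
    by (rule slice_assoc[OF mX mX modHop modHd \<alpha> _ _ \<beta>c[OF x]]) (use Hd_functional[OF \<omega>] dual_eval_lin[OF h] in simp_all)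
  finally show ?thesis
    using \<omega> h x b_closed[OF h x] by (simp add: actA_app actB_app)
qed

lemma actD_J_pure: "\<lbrakk>\<omega> \<in> carrier Hd; h \<in> carrier H; x \<in> carrier X\<rbrakk> \<Longrightarrow> actD X J (pure K Hd H \<omega> h) x = a \<omega> (b h x)"
  by (simp add: actD_app J_slice)

text \<open>
  The element \<open>(id \<otimes> flip)(\<beta> \<otimes> id)\<alpha>(x)\<close> in the compatibility condition.
\<close>

definition "Z x = tmap K X T id (tflip K Hd Hop) (tassoc K X Hd Hop (tmap K (tensor K X Hd) Hop \<beta> id (\<alpha> x)))"

lemma Z_lin: "Z \<in> linear_maps K X (tensor K X T)"
  unfolding Z_def[abs_def]
  by (rule lin_comp[OF tmap_linear[OF mX _ mX modT id_linear tflip_linear[OF modHd modHop]]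
      lin_comp[OF tassoc_linear[OF mX modHd modHop] lin_comp[OF tmap_linear[OF mX modHop XHd modHop \<beta> id_linear] \<alpha>]]]) simp

lemmas Z_closed = lin_closed[OF Z_lin]

lemma Z_slice:
  assumes \<omega>: "\<omega> \<in> carrier Hd" and h: "h \<in> carrier H" and x: "x \<in> carrier X"
  shows "slice X (pairing K (pure K Hd H \<omega> h)) (Z x) = b h (a \<omega> x)"
proof -
  let ?u = "pure K Hd H \<omega> h" and ?s = "tassoc K X Hd Hop (tmap K (tensor K X Hd) Hop \<beta> id (\<alpha> x))"
  have u: "?u \<in> carrier V" using \<omega> h by simp
  have HdHop: "module K (tensor K Hd Hop)" by simp
  have s: "?s \<in> carrier (tensor K X (tensor K Hd Hop))"
    by (rule lin_closed[OF tassoc_linear[OF mX modHd modHop] lin_closed[OF tmap_linear[OF mX modHop XHd modHop \<beta> id_linear] \<alpha>c[OF x]]])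
  have \<omega>l: "\<omega> \<in> linear_maps K Hop (ground K)" using Hd_functional[OF \<omega>] by simp
  note hl = dual_eval_lin[OF h]
  note fl = lin_comp[OF pairing_lin[OF u] tflip_linear[OF modHd modHop]]
  have f: "pairing K ?u (tflip K Hd Hop r) = tens_fun K (\<lambda>\<theta>. \<theta> h) \<omega> r" if r: "r \<in> carrier (tensor K Hd Hop)" for r
    by (rule linear_ext[OF modHd modHop fl tens_fun_linear[OF modHd modHop hl \<omega>l] modK r])
      (use \<omega> h in \<open>simp add: tflip_pure pairing_pure_pure tens_fun_pure[OF modHd modHop hl \<omega>l] R.m_comm\<close>)
  have "slice X (pairing K ?u) (Z x) = slice X (\<lambda>r. pairing K ?u (tflip K Hd Hop r)) ?s"
    unfolding Z_def by (subst slice_tmap[OF mX HdHop mX modT id_linear tflip_linear[OF modHd modHop] pairing_lin[OF u] s]) simp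
  also have "\<dots> = slice X (tens_fun K (\<lambda>\<theta>. \<theta> h) \<omega>) ?s"
    by (rule slice_cong[OF mX HdHop fl s f])
  also have "\<dots> = slice X (\<lambda>\<theta>. \<theta> h) (\<beta> (slice X \<omega> (\<alpha> x)))"
    by (rule slice_assoc[OF mX mX modHd modHop \<beta> hl \<omega>l \<alpha>c[OF x]])
  finally show ?thesis
    using \<omega> h x a_closed[OF \<omega> x] by (simp add: actA_app actB_app)
qed

lemma J_lin_Co: "J \<in> linear_maps K X (tensor K X Co)"
  using J_lin by simp

lemma actD_lin1: "x \<in> carrier X \<Longrightarrow> (\<lambda>u. actD X J u x) \<in> linear_maps K V X"
  using DC.induced_action_linear1[OF mX J_lin_Co] by (simp add: Db_tensor)

lemma actD_lin: "u \<in> carrier V \<Longrightarrow> actD X J u \<in> linear_maps K X X"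
  using DC.induced_action_linear[OF mX J_lin_Co] by (simp add: double_sel)

lemmas actD_closed = lin_closed[OF actD_lin]

text \<open>
  The induced action of the double, written as in the fourth functor.
\<close>

lemma actD_eq_tlift:
  assumes u: "u \<in> carrier V" and x: "x \<in> carrier X"
  shows "actD X J u x = tlift X (\<lambda>\<omega> h. tlift X (\<lambda>y0 y1. \<omega> y1 \<odot>\<^bsub>X\<^esub> y0) (\<alpha> (b h x))) u"
proof -
  have bi: "bilin K Hd H X (\<lambda>\<omega> h. a \<omega> (b h x))"
    by (intro bilinI a_lin1 b_closed x lin_comp[OF a_lin b_lin1[OF x]])
  have "actD X J u x = tlift X (\<lambda>\<omega> h. a \<omega> (b h x)) u"
    by (rule linear_ext[OF modHd modH actD_lin1[OF x] tlift_linear[OF modHd modH bi mX] mX u])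
      (simp add: actD_J_pure x tlift_pure[OF modHd modH bi mX])
  also have "\<dots> = tlift X (\<lambda>\<omega> h. tlift X (\<lambda>y0 y1. \<omega> y1 \<odot>\<^bsub>X\<^esub> y0) (\<alpha> (b h x))) u"
    by (rule tlift_cong[OF modHd modH bi mX u]) (simp add: actA_app b_closed x)
  finally show ?thesis .
qed

lemma yd_rr_compatible_Z:
  "yd_rr_compatible K H X \<alpha> \<beta> \<longleftrightarrow> (\<forall>x\<in>carrier X. J x = tmap K X T id AdU' (Z x))"
  by (simp add: yd_rr_compatible_def Z_def)

lemma tmap_AdU_lin: "tmap K X T id AdU \<in> linear_maps K (tensor K X T) (tensor K X T)"
  "tmap K X T id AdU' \<in> linear_maps K (tensor K X T) (tensor K X T)"
  by (rule tmap_linear[OF mX modT mX modT id_linear AdU_lin] tmap_linear[OF mX modT mX modT id_linear AdU'_lin])+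

lemma tmap_id_inverse:
  assumes f: "f \<in> linear_maps K T T" and g: "g \<in> linear_maps K T T" and fg: "\<And>z. z \<in> carrier T \<Longrightarrow> f (g z) = z"
    and t: "t \<in> carrier (tensor K X T)"
  shows "tmap K X T id f (tmap K X T id g t) = t"
proof -
  have "tmap K X T id f (tmap K X T id g t) = tmap K X T (\<lambda>x. id (id x)) (\<lambda>z. f (g z)) t"
    by (rule tmap_comp[OF mX modT mX modT mX modT id_linear g id_linear f t])
  also have "\<dots> = tmap K X T id (\<lambda>z. z) t"
    by (rule tmap_cong[OF mX modT mX modT lin_comp[OF id_linear id_linear] lin_comp[OF f g] t]) (simp_all add: fg)
  also have "\<dots> = t" by (rule tmap_id[OF mX modT t])
  finally show ?thesis .
qed

lemma yd_rr_compatible_AdU: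
  "yd_rr_compatible K H X \<alpha> \<beta> \<longleftrightarrow> (\<forall>x\<in>carrier X. tmap K X T id AdU (J x) = Z x)"
  unfolding yd_rr_compatible_Z
  using tmap_id_inverse[OF AdU_lin AdU'_lin AdU_AdU' Z_closed] tmap_id_inverse[OF AdU'_lin AdU_lin AdU'_AdU J_closed]
  by metis

text \<open>
  With \<open>Ad(U)\<close> moved to the other side, slice both sides by \<open>\<omega> \<otimes> h\<close>. On the right this gives
  \<open>h\<close> applied to \<open>\<omega> \<rhd> x\<close>; on the left the functional \<open>(\<omega> \<otimes> h) \<circ> Ad(U)\<close> is represented by \<open>w\<close>, so this slice is
  the action of \<open>w\<close>. As \<open>w\<close> is the product \<open>(1 \<bowtie> h)(\<omega> \<bowtie> 1)\<close> in the double, the condition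
  says that this product acts as the composite.
\<close>

lemma yd_rr_compatible_action:
  "yd_rr_compatible K H X \<alpha> \<beta> \<longleftrightarrow> (\<forall>\<omega>\<in>carrier Hd. \<forall>h\<in>carrier H. \<forall>w\<in>carrier V. \<forall>x\<in>carrier X.
     (\<forall>t\<in>carrier T. pairing K w t = pairing K (pure K Hd H \<omega> h) (AdU t)) \<longrightarrow> actD X J w x = b h (a \<omega> x))" (is "_ \<longleftrightarrow> ?R")
proof -
  have e: "slice X (pairing K (pure K Hd H \<omega> h)) (tmap K X T id AdU (J x)) = actD X J w x"
    if \<omega>: "\<omega> \<in> carrier Hd" and h: "h \<in> carrier H" and w: "w \<in> carrier V" and x: "x \<in> carrier X"
      and wAd: "\<forall>t\<in>carrier T. pairing K w t = pairing K (pure K Hd H \<omega> h) (AdU t)" for \<omega> h w x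
  proof -
    have u: "pure K Hd H \<omega> h \<in> carrier V" using \<omega> h by simp
    have "slice X (pairing K (pure K Hd H \<omega> h)) (tmap K X T id AdU (J x)) = slice X (\<lambda>t. pairing K (pure K Hd H \<omega> h) (AdU t)) (J x)"
      by (subst slice_tmap[OF mX modT mX modT id_linear AdU_lin pairing_lin[OF u] J_closed[OF x]]) simp
    also have "\<dots> = slice X (pairing K w) (J x)"
      by (rule slice_cong[OF mX modT pairing_lin[OF w] J_closed[OF x], symmetric]) (use wAd in auto)
    finally show ?thesis using w x by (simp add: actD_app)
  qed
  show ?thesis
    unfolding yd_rr_compatible_AdU
  proof
    assume L: "\<forall>x\<in>carrier X. tmap K X T id AdU (J x) = Z x"
    show ?R
    proof (intro ballI impI)
      fix \<omega> h w x
      assume *: "\<omega> \<in> carrier Hd" "h \<in> carrier H" "w \<in> carrier V" "x \<in> carrier X"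
        "\<forall>t\<in>carrier T. pairing K w t = pairing K (pure K Hd H \<omega> h) (AdU t)"
      show "actD X J w x = b h (a \<omega> x)" using e[OF *] Z_slice[OF *(1,2,4)] L *(4) by simp
    qed
  next
    assume R: ?R
    show "\<forall>x\<in>carrier X. tmap K X T id AdU (J x) = Z x"
    proof
      fix x assume x: "x \<in> carrier X"
      show "tmap K X T id AdU (J x) = Z x"
      proof (rule T_sep[OF mX lin_closed[OF tmap_AdU_lin(1) J_closed[OF x]] Z_closed[OF x]])
        fix \<omega> h assume \<omega>: "\<omega> \<in> carrier Hd" and h: "h \<in> carrier H"
        have u: "pure K Hd H \<omega> h \<in> carrier V" using \<omega> h by simp
        obtain w where w: "w \<in> carrier V" "\<And>t. t \<in> carrier T \<Longrightarrow> pairing K w t = pairing K (pure K Hd H \<omega> h) (AdU t)"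
          using AdU_representable[OF u] by blast
        show "slice X (pairing K (pure K Hd H \<omega> h)) (tmap K X T id AdU (J x)) = slice X (pairing K (pure K Hd H \<omega> h)) (Z x)"
          using e[OF \<omega> h w(1) x] R \<omega> h w x Z_slice[OF \<omega> h x] by simp
      qed
    qed
  qed
qed

text \<open>
  The next lemmas treat the compatibility condition in the form \<open>U J(x) = Z(x) U\<close>, with \<open>U\<close> acting on the leg in \<open>T\<close>.
  The map \<open>M h\<close> slices the leg in \<open>dual H\<close> by \<open>h\<close> and retains the one in \<open>H\<close>.
\<close>

abbreviation "M h \<equiv> tmap K X H id (\<lambda>t. slice Hop (\<lambda>\<theta>. \<theta> h) t)"
abbreviation "LU \<equiv> tmap K X T id (\<lambda>t. U \<otimes>\<^bsub>T\<^esub> t)"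
abbreviation "RU \<equiv> tmap K X T id (\<lambda>t. t \<otimes>\<^bsub>T\<^esub> U)"

lemma slice_T_lin': "h \<in> carrier H \<Longrightarrow> (\<lambda>t. slice Hop (\<lambda>\<theta>. \<theta> h) t) \<in> linear_maps K T H"
  using slice_T_lin by simp

lemma XH: "module K (tensor K X H)" using mX by simp

lemma M_lin: "h \<in> carrier H \<Longrightarrow> M h \<in> linear_maps K (tensor K X T) (tensor K X H)"
  by (rule tmap_linear[OF mX modT mX modH id_linear slice_T_lin'])

lemma U_mult_lin: "(\<lambda>t. U \<otimes>\<^bsub>T\<^esub> t) \<in> linear_maps K T T" "(\<lambda>t. t \<otimes>\<^bsub>T\<^esub> U) \<in> linear_maps K T T"
  "(\<lambda>t. W \<otimes>\<^bsub>T\<^esub> t) \<in> linear_maps K T T"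
  by (rule lin_mult[OF algT lin_id] U_closed W_closed)+

lemma LU_lin: "LU \<in> linear_maps K (tensor K X T) (tensor K X T)" and RU_lin: "RU \<in> linear_maps K (tensor K X T) (tensor K X T)"
  by (rule tmap_linear[OF mX modT mX modT id_linear] U_mult_lin)+

lemma M_sep:
  assumes t: "t \<in> carrier (tensor K X T)" "t' \<in> carrier (tensor K X T)" and eq: "\<And>h. h \<in> carrier H \<Longrightarrow> M h t = M h t'"
  shows "t = t'"
proof (rule T_sep[OF mX t])
  fix \<omega> h assume \<omega>: "\<omega> \<in> carrier Hd" and h: "h \<in> carrier H"
  have "slice X (pairing K (pure K Hd H \<omega> h)) t = slice X \<omega> (M h t)" if t: "t \<in> carrier (tensor K X T)" for t
  proof -
    have "slice X \<omega> (M h t) = slice X (\<lambda>t. \<omega> (slice Hop (\<lambda>\<theta>. \<theta> h) t)) t"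
      by (subst slice_tmap[OF mX modT mX modH id_linear slice_T_lin'[OF h] Hd_functional[OF \<omega>] t]) simp
    also have "\<dots> = slice X (pairing K (pure K Hd H \<omega> h)) t"
      by (rule slice_cong[OF mX modT lin_comp[OF Hd_functional[OF \<omega>] slice_T_lin'[OF h]] t]) (simp add: pairing_pure_eq_slice \<omega> h)
    finally show ?thesis by simp
  qed
  then show "slice X (pairing K (pure K Hd H \<omega> h)) t = slice X (pairing K (pure K Hd H \<omega> h)) t'"
    using t eq[OF h] by simp
qed

lemma yd_rr_compatible_mult:
  "yd_rr_compatible K H X \<alpha> \<beta> \<longleftrightarrow> (\<forall>x\<in>carrier X. LU (J x) = RU (Z x))"
proof -
  interpret T: unital_algebra K T by (rule algT)
  note c = T.A.m_assoc U_closed W_closed U_W W_U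
  have 1: "LU (tmap K X T id AdU' t) = RU t" if t: "t \<in> carrier (tensor K X T)" for t
  proof -
    have "LU (tmap K X T id AdU' t) = tmap K X T (\<lambda>x. id (id x)) (\<lambda>z. U \<otimes>\<^bsub>T\<^esub> AdU' z) t"
      by (rule tmap_comp[OF mX modT mX modT mX modT id_linear AdU'_lin id_linear U_mult_lin(1) t])
    also have "\<dots> = RU t"
    proof (rule tmap_cong[OF mX modT mX modT lin_comp[OF id_linear id_linear] lin_comp[OF U_mult_lin(1) AdU'_lin] t])
      fix z assume z: "z \<in> carrier T"
      have "U \<otimes>\<^bsub>T\<^esub> AdU' z = (U \<otimes>\<^bsub>T\<^esub> W) \<otimes>\<^bsub>T\<^esub> (z \<otimes>\<^bsub>T\<^esub> U)"
        using z U_closed W_closed by (simp add: Ad_inv_def inv_U T.A.m_assoc)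
      then show "U \<otimes>\<^bsub>T\<^esub> AdU' z = z \<otimes>\<^bsub>T\<^esub> U" using z U_closed by (simp add: U_W)
    qed simp
    finally show ?thesis .
  qed
  have 2: "tmap K X T id (\<lambda>t. W \<otimes>\<^bsub>T\<^esub> t) (LU t) = t" if t: "t \<in> carrier (tensor K X T)" for t
  proof (rule tmap_id_inverse[OF U_mult_lin(3) U_mult_lin(1) _ t])
    fix z assume z: "z \<in> carrier T"
    have "W \<otimes>\<^bsub>T\<^esub> (U \<otimes>\<^bsub>T\<^esub> z) = (W \<otimes>\<^bsub>T\<^esub> U) \<otimes>\<^bsub>T\<^esub> z" using z U_closed W_closed by (simp add: T.A.m_assoc)
    then show "W \<otimes>\<^bsub>T\<^esub> (U \<otimes>\<^bsub>T\<^esub> z) = z" using z by (simp add: W_U)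
  qed
  note c' = lin_closed[OF tmap_AdU_lin(2) Z_closed]
  show ?thesis
    unfolding yd_rr_compatible_Z
  proof (intro ball_cong refl)
    fix x assume x: "x \<in> carrier X"
    show "J x = tmap K X T id AdU' (Z x) \<longleftrightarrow> LU (J x) = RU (Z x)"
      using 1[OF Z_closed[OF x]] 2[OF J_closed[OF x]] 2[OF c'[OF x]] by metis
  qed
qed

text \<open>
  Slicing \<open>U (g \<otimes> \<theta>)\<close> by \<open>h\<close> gives \<open>\<Sum> \<theta>(h\<^sub>(\<^sub>2\<^sub>)) g h\<^sub>(\<^sub>1\<^sub>)\<close>, the product of \<open>H\<^sup>o\<^sup>p\<close> putting \<open>U\<close> to the right of
  \<open>g\<close>. So \<open>h\<^sub>(\<^sub>2\<^sub>)\<close> is fed to \<open>\<beta>\<close>, and \<open>h\<^sub>(\<^sub>1\<^sub>)\<close> multiplies the output of \<open>\<alpha>\<close>. The identity is proved for an arbitrary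
  tensor in place of \<open>\<beta>(x)\<close> and of \<open>\<alpha>\<close> of its first leg, so that it may be checked on pure tensors.
\<close>

lemma M_LU:
  assumes h: "h \<in> carrier H" and x: "x \<in> carrier X"
  shows "M h (LU (J x)) = tlift (tensor K X H) (\<lambda>h1 h2.
     tlift (tensor K X H) (\<lambda>y0 y1. pure K X H y0 (y1 \<otimes>\<^bsub>H\<^esub> h1)) (\<alpha> (b h2 x))) (\<Delta> h)"
proof -
  note \<Delta>c = \<Delta>_closed[OF h]
  define N where "N g = tmap K X H id (\<lambda>y. y \<otimes>\<^bsub>H\<^esub> g)" for g
  have \<alpha>': "\<alpha> \<in> linear_maps K X (tensor K X H)" using \<alpha> by (simp add: Hop_tensor)
  note \<alpha>c' = lin_closed[OF \<alpha>']
  have N_lin: "N g \<in> linear_maps K (tensor K X H) (tensor K X H)" if "g \<in> carrier H" for g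
    unfolding N_def by (rule tmap_linear[OF mX modH mX modH id_linear lin_mult(1)[OF algH lin_id that]])
  note N_closed = lin_closed[OF N_lin]
  have N_pure: "N g (pure K X H y k) = pure K X H y (k \<otimes>\<^bsub>H\<^esub> g)" if "g \<in> carrier H" "y \<in> carrier X" "k \<in> carrier H" for g y k
    unfolding N_def using tmap_pure[OF mX modH mX modH id_linear lin_mult(1)[OF algH lin_id that(1)] that(2,3)] by simp
  have N_lin1: "(\<lambda>g. N g s) \<in> linear_maps K H (tensor K X H)" if s: "s \<in> carrier (tensor K X H)" for s
    unfolding N_def tmap_def
    by (rule lin_tlift2[OF mX modH s _ tmap_bilin[OF mX modH id_linear lin_mult(1)[OF algH lin_id]] XH modH])
      (simp_all add: lin_pure2[OF mX modH lin_mult(2)[OF algH lin_id]])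
  have bN: "bilin K H H (tensor K X H) (\<lambda>h1 h2. N h1 (f h2))" if f: "f \<in> linear_maps K H (tensor K X H)" for f
    by (intro bilinI N_lin1 lin_comp[OF N_lin f] lin_closed[OF f])
  let ?E = "\<lambda>s. M h (LU (tassoc K X Hop Hd s))"
  have E_lin: "?E \<in> linear_maps K (tensor K (tensor K X Hop) Hd) (tensor K X H)"
    by (rule lin_comp[OF M_lin[OF h] lin_comp[OF LU_lin tassoc_linear[OF mX modHop modHd]]])
  (* Here s takes the place of alpha applied to the first leg of beta x, and is reduced to a pure tensor. *)
  have E_pure: "?E (pure K (tensor K X Hop) Hd s \<theta>) = tlift (tensor K X H) (\<lambda>h1 h2. N h1 (\<theta> h2 \<odot>\<^bsub>tensor K X H\<^esub> s)) (\<Delta> h)"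
    if s: "s \<in> carrier (tensor K X Hop)" and \<theta>: "\<theta> \<in> carrier Hd" for s \<theta>
  proof -
    have s': "s \<in> carrier (tensor K X H)" using s by (simp add: Hop_tensor)
    have sm: "(\<lambda>h2. \<theta> h2 \<odot>\<^bsub>tensor K X H\<^esub> s) \<in> linear_maps K H (tensor K X H)" if "s \<in> carrier (tensor K X H)" for s
      by (rule lin_smult_scalar[OF XH that Hd_functional[OF \<theta>]])
    have R: "(\<lambda>s. tlift (tensor K X H) (\<lambda>h1 h2. N h1 (\<theta> h2 \<odot>\<^bsub>tensor K X H\<^esub> s)) (\<Delta> h)) \<in> linear_maps K (tensor K X Hop) (tensor K X H)"
      unfolding linear_maps_tensor_opp
      by (rule lin_tlift2[OF modH modH \<Delta>c lin_comp[OF N_lin lin_smult[OF XH Hd_eval_closed[OF \<theta>] lin_id]] bN[OF sm] XH XH])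
    show ?thesis
    proof (rule linear_ext[OF mX modHop lin_comp[OF E_lin lin_pure1[OF XHop modHd lin_id \<theta>]] R XH s])
      fix y g assume y: "y \<in> carrier X" and "g \<in> carrier Hop"
      then have g: "g \<in> carrier H" by simp
      have p: "pure K Hop Hd g \<theta> \<in> carrier T" using g \<theta> pure_closed[OF modHop modHd] by simp
      have up: "U \<otimes>\<^bsub>T\<^esub> pure K Hop Hd g \<theta> \<in> carrier T" by (rule lin_closed[OF U_mult_lin(1) p])
      have bi: "bilin K H H H (\<lambda>h1 h2. (\<theta> h2 \<odot>\<^bsub>H\<^esub> g) \<otimes>\<^bsub>H\<^esub> h1)"
        by (intro bilinI lin_mult[OF algH] lin_smult_scalar[OF modH] lin_id Hd_functional[OF \<theta>] smult_closed Hd_eval_closed[OF \<theta>] g)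
      have sl: "slice Hop (\<lambda>\<theta>. \<theta> h) (U \<otimes>\<^bsub>T\<^esub> pure K Hop Hd g \<theta>) = tlift H (\<lambda>h1 h2. (\<theta> h2 \<odot>\<^bsub>H\<^esub> g) \<otimes>\<^bsub>H\<^esub> h1) (\<Delta> h)"
        unfolding slice_T_mult[OF h U_closed p]
        by (rule tlift_cong[OF modH modH bi modH \<Delta>c, symmetric]) (simp add: slice_U slice_T_pure g \<theta>)
      have "?E (pure K (tensor K X Hop) Hd (pure K X Hop y g) \<theta>) = pure K X H y (slice Hop (\<lambda>\<theta>. \<theta> h) (U \<otimes>\<^bsub>T\<^esub> pure K Hop Hd g \<theta>))"
        using y p \<open>g \<in> carrier Hop\<close> \<theta> up
        by (simp add: tassoc_pure[OF mX modHop modHd] tmap_pure[OF mX modT mX modT id_linear U_mult_lin(1)]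
            tmap_pure[OF mX modT mX modH id_linear slice_T_lin'[OF h]])
      also have "\<dots> = tlift (tensor K X H) (\<lambda>h1 h2. pure K X H y ((\<theta> h2 \<odot>\<^bsub>H\<^esub> g) \<otimes>\<^bsub>H\<^esub> h1)) (\<Delta> h)"
        unfolding sl by (rule tlift_comp[OF modH modH lin_pure2[OF mX modH lin_id y] bi modH XH \<Delta>c])
      also have "\<dots> = tlift (tensor K X H) (\<lambda>h1 h2. N h1 (\<theta> h2 \<odot>\<^bsub>tensor K X H\<^esub> pure K X H y g)) (\<Delta> h)"
        by (rule tlift_cong[OF modH modH bN[OF sm] XH \<Delta>c, symmetric])
          (use y g \<theta> mX in \<open>simp_all add: N_pure flip: pure_smult_right\<close>)
      finally show "?E (pure K (tensor K X Hop) Hd (pure K X Hop y g) \<theta>) =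
         tlift (tensor K X H) (\<lambda>h1 h2. N h1 (\<theta> h2 \<odot>\<^bsub>tensor K X H\<^esub> pure K X Hop y g)) (\<Delta> h)"
        by (simp add: pure_opp)
    qed
  qed
  have G: "(\<lambda>h2. \<alpha> (slice X (\<lambda>\<theta>. \<theta> h2) t)) \<in> linear_maps K H (tensor K X H)" if t: "t \<in> carrier (tensor K X Hd)" for t
    by (rule lin_comp[OF \<alpha>' lin_tlift2[OF mX modHd t lin_smult_scalar[OF mX _ Hd_functional] slice_bilin[OF mX dual_eval_lin] mX modH]])
  have F: "?E (tmap K (tensor K X Hop) Hd \<alpha> id t) = tlift (tensor K X H) (\<lambda>h1 h2. N h1 (\<alpha> (slice X (\<lambda>\<theta>. \<theta> h2) t))) (\<Delta> h)"
    if t: "t \<in> carrier (tensor K X Hd)" for t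
  proof (rule linear_ext[OF mX modHd lin_comp[OF E_lin tmap_linear[OF mX modHd XHop modHd \<alpha> id_linear]] _ XH t])
    show "(\<lambda>t. tlift (tensor K X H) (\<lambda>h1 h2. N h1 (\<alpha> (slice X (\<lambda>\<theta>. \<theta> h2) t))) (\<Delta> h)) \<in> linear_maps K (tensor K X Hd) (tensor K X H)"
      by (rule lin_tlift2[OF modH modH \<Delta>c lin_comp[OF N_lin lin_comp[OF \<alpha>' slice_linear[OF mX modHd dual_eval_lin]]] bN[OF G] XH XHd])
    fix x \<theta> assume x: "x \<in> carrier X" and \<theta>: "\<theta> \<in> carrier Hd"
    have "?E (tmap K (tensor K X Hop) Hd \<alpha> id (pure K X Hd x \<theta>)) =
      tlift (tensor K X H) (\<lambda>h1 h2. N h1 (\<theta> h2 \<odot>\<^bsub>tensor K X H\<^esub> \<alpha> x)) (\<Delta> h)"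
      using E_pure[OF \<alpha>c[OF x] \<theta>] x \<theta> by (simp add: tmap_pure[OF mX modHd XHop modHd \<alpha> id_linear])
    also have "\<dots> = tlift (tensor K X H) (\<lambda>h1 h2. N h1 (\<alpha> (slice X (\<lambda>\<theta>. \<theta> h2) (pure K X Hd x \<theta>)))) (\<Delta> h)"
      by (rule tlift_cong[OF modH modH bN[OF lin_smult_scalar[OF XH \<alpha>c'[OF x] Hd_functional[OF \<theta>]]] XH \<Delta>c])
        (use x \<theta> linear_mapsD(3)[OF \<alpha>'] in \<open>simp add: slice_pure[OF mX modHd dual_eval_lin]\<close>)
    finally show "?E (tmap K (tensor K X Hop) Hd \<alpha> id (pure K X Hd x \<theta>)) =
      tlift (tensor K X H) (\<lambda>h1 h2. N h1 (\<alpha> (slice X (\<lambda>\<theta>. \<theta> h2) (pure K X Hd x \<theta>)))) (\<Delta> h)" .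
  qed
  show ?thesis
    unfolding J_app[OF x] F[OF \<beta>c[OF x]]
    by (rule tlift_cong[OF modH modH bN[OF G[OF \<beta>c[OF x]]] XH \<Delta>c]) (use x in \<open>simp add: actB_app N_def tmap_def\<close>)
qed

text \<open>
  Slicing \<open>(g \<otimes> \<theta>) U\<close> by \<open>h\<close> gives \<open>\<Sum> \<theta>(h\<^sub>(\<^sub>1\<^sub>)) h\<^sub>(\<^sub>2\<^sub>) g\<close>; now \<open>h\<^sub>(\<^sub>1\<^sub>)\<close> is fed to \<open>\<beta>\<close>.
\<close>

lemma M_RU:
  assumes h: "h \<in> carrier H" and x: "x \<in> carrier X"
  shows "M h (RU (Z x)) = tlift (tensor K X H) (\<lambda>h1 h2.
     tlift (tensor K X H) (\<lambda>x0 x1. pure K X H (b h1 x0) (h2 \<otimes>\<^bsub>H\<^esub> x1)) (\<alpha> x)) (\<Delta> h)"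
proof -
  note \<Delta>c = \<Delta>_closed[OF h]
  have HdHop: "module K (tensor K Hd Hop)" by simp
  let ?E = "\<lambda>s. M h (RU (tmap K X T id (tflip K Hd Hop) (tassoc K X Hd Hop s)))"
  have E_lin: "?E \<in> linear_maps K (tensor K (tensor K X Hd) Hop) (tensor K X H)"
    by (rule lin_comp[OF M_lin[OF h] lin_comp[OF RU_lin lin_comp[OF
        tmap_linear[OF mX HdHop mX modT id_linear tflip_linear[OF modHd modHop]] tassoc_linear[OF mX modHd modHop]]]])
  have sl1: "(\<lambda>h1. slice X (\<lambda>\<theta>. \<theta> h1) s) \<in> linear_maps K H X" if s: "s \<in> carrier (tensor K X Hd)" for s
    by (rule lin_tlift2[OF mX modHd s lin_smult_scalar[OF mX _ Hd_functional] slice_bilin[OF mX dual_eval_lin] mX modH])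
  have bi: "bilin K H H (tensor K X H) (\<lambda>h1 h2. pure K X H (f h1) (h2 \<otimes>\<^bsub>H\<^esub> g))"
    if f: "f \<in> linear_maps K H X" and g: "g \<in> carrier H" for f g
    by (intro bilinI lin_pure1[OF mX modH f] lin_pure2[OF mX modH] lin_mult(1)[OF algH lin_id g] lin_closed[OF f] ua_mult_closed[OF algH] g)
  have E_pure: "?E (pure K (tensor K X Hd) Hop s g) =
     tlift (tensor K X H) (\<lambda>h1 h2. pure K X H (slice X (\<lambda>\<theta>. \<theta> h1) s) (h2 \<otimes>\<^bsub>H\<^esub> g)) (\<Delta> h)"
    if s: "s \<in> carrier (tensor K X Hd)" and g: "g \<in> carrier H" for s g
  proof -
    have g': "g \<in> carrier Hop" using g by simp
    have R: "(\<lambda>s. tlift (tensor K X H) (\<lambda>h1 h2. pure K X H (slice X (\<lambda>\<theta>. \<theta> h1) s) (h2 \<otimes>\<^bsub>H\<^esub> g)) (\<Delta> h))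
       \<in> linear_maps K (tensor K X Hd) (tensor K X H)"
      by (rule lin_tlift2[OF modH modH \<Delta>c lin_pure1[OF mX modH slice_linear[OF mX modHd dual_eval_lin] ua_mult_closed[OF algH _ g]]
           bi[OF sl1 g] XH XHd])
    show ?thesis
    proof (rule linear_ext[OF mX modHd lin_comp[OF E_lin lin_pure1[OF XHd modHop lin_id g']] R XH s])
      fix y \<theta> assume y: "y \<in> carrier X" and \<theta>: "\<theta> \<in> carrier Hd"
      have p: "pure K Hop Hd g \<theta> \<in> carrier T" using g \<theta> pure_closed[OF modHop modHd] by simp
      have up: "pure K Hop Hd g \<theta> \<otimes>\<^bsub>T\<^esub> U \<in> carrier T" by (rule lin_closed[OF U_mult_lin(2) p])
      have bi': "bilin K H H H (\<lambda>h1 h2. h2 \<otimes>\<^bsub>H\<^esub> (\<theta> h1 \<odot>\<^bsub>H\<^esub> g))"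
        by (intro bilinI lin_mult[OF algH] lin_smult_scalar[OF modH] lin_id Hd_functional[OF \<theta>] smult_closed Hd_eval_closed[OF \<theta>] g)
      have sl: "slice Hop (\<lambda>\<theta>. \<theta> h) (pure K Hop Hd g \<theta> \<otimes>\<^bsub>T\<^esub> U) = tlift H (\<lambda>h1 h2. h2 \<otimes>\<^bsub>H\<^esub> (\<theta> h1 \<odot>\<^bsub>H\<^esub> g)) (\<Delta> h)"
        unfolding slice_T_mult[OF h p U_closed]
        by (rule tlift_cong[OF modH modH bi' modH \<Delta>c, symmetric]) (simp add: slice_U slice_T_pure g \<theta>)
      have "?E (pure K (tensor K X Hd) Hop (pure K X Hd y \<theta>) g) = pure K X H y (slice Hop (\<lambda>\<theta>. \<theta> h) (pure K Hop Hd g \<theta> \<otimes>\<^bsub>T\<^esub> U))"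
        using y p g' \<theta> up
        by (simp add: tassoc_pure[OF mX modHd modHop] tmap_pure[OF mX HdHop mX modT id_linear tflip_linear[OF modHd modHop]]
            tflip_pure[OF modHd modHop] tmap_pure[OF mX modT mX modT id_linear U_mult_lin(2)]
            tmap_pure[OF mX modT mX modH id_linear slice_T_lin'[OF h]])
      also have "\<dots> = tlift (tensor K X H) (\<lambda>h1 h2. pure K X H y (h2 \<otimes>\<^bsub>H\<^esub> (\<theta> h1 \<odot>\<^bsub>H\<^esub> g))) (\<Delta> h)"
        unfolding sl by (rule tlift_comp[OF modH modH lin_pure2[OF mX modH lin_id y] bi' modH XH \<Delta>c])
      also have "\<dots> = tlift (tensor K X H) (\<lambda>h1 h2. pure K X H (slice X (\<lambda>\<theta>. \<theta> h1) (pure K X Hd y \<theta>)) (h2 \<otimes>\<^bsub>H\<^esub> g)) (\<Delta> h)"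
        by (rule tlift_cong[OF modH modH bi[OF sl1 g] XH \<Delta>c, symmetric])
          (use y g \<theta> mX in \<open>simp_all add: slice_pure[OF mX modHd dual_eval_lin] pure_smult_middle smult_mult_right\<close>)
      finally show "?E (pure K (tensor K X Hd) Hop (pure K X Hd y \<theta>) g) =
         tlift (tensor K X H) (\<lambda>h1 h2. pure K X H (slice X (\<lambda>\<theta>. \<theta> h1) (pure K X Hd y \<theta>)) (h2 \<otimes>\<^bsub>H\<^esub> g)) (\<Delta> h)" .
    qed
  qed
  have in_b: "bilin K X H (tensor K X H) (\<lambda>x0 x1. pure K X H (b h1 x0) (h2 \<otimes>\<^bsub>H\<^esub> x1))" if "h1 \<in> carrier H" "h2 \<in> carrier H" for h1 h2
    by (rule tmap_bilin[OF mX modH b_lin lin_mult(2)[OF algH lin_id]]) (use that in auto)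
  have out_b: "bilin K H H (tensor K X H) (\<lambda>h1 h2. tlift (tensor K X H) (\<lambda>x0 x1. pure K X H (b h1 x0) (h2 \<otimes>\<^bsub>H\<^esub> x1)) t)"
    if t: "t \<in> carrier (tensor K X H)" for t
    by (rule bilinI; rule lin_tlift2[OF mX modH t _ in_b XH modH])
      (auto intro!: lin_pure1[OF mX modH] lin_pure2[OF mX modH] b_lin1 lin_mult(1)[OF algH lin_id] b_closed)
  have R: "(\<lambda>t. tlift (tensor K X H) (\<lambda>h1 h2. tlift (tensor K X H) (\<lambda>x0 x1. pure K X H (b h1 x0) (h2 \<otimes>\<^bsub>H\<^esub> x1)) t) (\<Delta> h))
     \<in> linear_maps K (tensor K X Hop) (tensor K X H)"
    unfolding linear_maps_tensor_opp
    by (rule lin_tlift2[OF modH modH \<Delta>c tlift_linear[OF mX modH in_b XH] out_b XH XH])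
  have F: "?E (tmap K (tensor K X Hd) Hop \<beta> id t) =
     tlift (tensor K X H) (\<lambda>h1 h2. tlift (tensor K X H) (\<lambda>x0 x1. pure K X H (b h1 x0) (h2 \<otimes>\<^bsub>H\<^esub> x1)) t) (\<Delta> h)"
    if t: "t \<in> carrier (tensor K X Hop)" for t
  proof (rule linear_ext[OF mX modHop lin_comp[OF E_lin tmap_linear[OF mX modHop XHd modHop \<beta> id_linear]] R XH t])
    fix x g assume x: "x \<in> carrier X" and g': "g \<in> carrier Hop"
    then have g: "g \<in> carrier H" by simp
    have p: "pure K X H x g \<in> carrier (tensor K X H)" using mX x g by simp
    have "?E (tmap K (tensor K X Hd) Hop \<beta> id (pure K X Hop x g)) =
      tlift (tensor K X H) (\<lambda>h1 h2. pure K X H (slice X (\<lambda>\<theta>. \<theta> h1) (\<beta> x)) (h2 \<otimes>\<^bsub>H\<^esub> g)) (\<Delta> h)"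
      using E_pure[OF \<beta>c[OF x] g] x g' by (simp add: tmap_pure[OF mX modHop XHd modHop \<beta> id_linear])
    also have "\<dots> = tlift (tensor K X H) (\<lambda>h1 h2. tlift (tensor K X H) (\<lambda>x0 x1. pure K X H (b h1 x0) (h2 \<otimes>\<^bsub>H\<^esub> x1)) (pure K X H x g)) (\<Delta> h)"
      by (rule tlift_cong[OF modH modH out_b[OF p] XH \<Delta>c, symmetric])
        (use x g in \<open>simp add: tlift_pure[OF mX modH in_b XH] actB_app\<close>)
    finally show "?E (tmap K (tensor K X Hd) Hop \<beta> id (pure K X Hop x g)) =
      tlift (tensor K X H) (\<lambda>h1 h2. tlift (tensor K X H) (\<lambda>x0 x1. pure K X H (b h1 x0) (h2 \<otimes>\<^bsub>H\<^esub> x1)) (pure K X Hop x g)) (\<Delta> h)"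
      by (simp add: pure_opp)
  qed
  show ?thesis
    unfolding Z_def F[OF \<alpha>c[OF x]] ..
qed

text \<open>
  The maps \<open>M h\<close> separate tensors, and the two preceding lemmas identify their values with the two sides
  of the Yetter-Drinfeld condition.
\<close>

theorem yd_rr_compatible_iff_yd_compatible:
  "yd_rr_compatible K H X \<alpha> \<beta> \<longleftrightarrow> yd_compatible K H X b \<alpha>"
  unfolding yd_rr_compatible_mult yd_compatible_def
proof
  assume L: "\<forall>x\<in>carrier X. LU (J x) = RU (Z x)"
  show "\<forall>h\<in>carrier H. \<forall>x\<in>carrier X.
     tlift (tensor K X H) (\<lambda>h1 h2. tlift (tensor K X H) (\<lambda>x0 x1. pure K X H (b h1 x0) (h2 \<otimes>\<^bsub>H\<^esub> x1)) (\<alpha> x)) (\<Delta> h) =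
     tlift (tensor K X H) (\<lambda>h1 h2. tlift (tensor K X H) (\<lambda>y0 y1. pure K X H y0 (y1 \<otimes>\<^bsub>H\<^esub> h1)) (\<alpha> (b h2 x))) (\<Delta> h)"
  proof (intro ballI)
    fix h x assume h: "h \<in> carrier H" and x: "x \<in> carrier X"
    show "tlift (tensor K X H) (\<lambda>h1 h2. tlift (tensor K X H) (\<lambda>x0 x1. pure K X H (b h1 x0) (h2 \<otimes>\<^bsub>H\<^esub> x1)) (\<alpha> x)) (\<Delta> h) =
     tlift (tensor K X H) (\<lambda>h1 h2. tlift (tensor K X H) (\<lambda>y0 y1. pure K X H y0 (y1 \<otimes>\<^bsub>H\<^esub> h1)) (\<alpha> (b h2 x))) (\<Delta> h)"
      unfolding M_LU[OF h x, symmetric] M_RU[OF h x, symmetric] using L x by simp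
  qed
next
  assume R: "\<forall>h\<in>carrier H. \<forall>x\<in>carrier X.
     tlift (tensor K X H) (\<lambda>h1 h2. tlift (tensor K X H) (\<lambda>x0 x1. pure K X H (b h1 x0) (h2 \<otimes>\<^bsub>H\<^esub> x1)) (\<alpha> x)) (\<Delta> h) =
     tlift (tensor K X H) (\<lambda>h1 h2. tlift (tensor K X H) (\<lambda>y0 y1. pure K X H y0 (y1 \<otimes>\<^bsub>H\<^esub> h1)) (\<alpha> (b h2 x))) (\<Delta> h)"
  show "\<forall>x\<in>carrier X. LU (J x) = RU (Z x)"
  proof
    fix x assume x: "x \<in> carrier X"
    show "LU (J x) = RU (Z x)"
    proof (rule M_sep[OF lin_closed[OF LU_lin J_closed[OF x]] lin_closed[OF RU_lin Z_closed[OF x]]])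
      fix h assume h: "h \<in> carrier H"
      show "M h (LU (J x)) = M h (RU (Z x))"
        unfolding M_LU[OF h x] M_RU[OF h x] by (rule R[rule_format, OF h x, symmetric])
    qed
  qed
qed

end

section \<open>Joint coactions of the codouble\<close>

locale coaction_pair = two_coactions K H S n e d X \<alpha> \<beta>
  for K :: "('k, 'l) ring_scheme" and H :: "('k, 'h) bialgebra" and S n e d
    and X :: "('k, 'x) module" and \<alpha> \<beta> +
  assumes algX: "unital_algebra K X" and coact_\<alpha>: "right_coaction K Hop X \<alpha>" and coact_\<beta>: "right_coaction K Hd X \<beta>"
begin

interpretation OD: bialgebra_pairing K Dop Hop "\<lambda>\<theta> h. \<theta> h" "{..<n}" e d
  by (rule OA.dual_pairing)
interpretation Hd: unital_algebra K Hd by (rule algHd)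

lemma a_mult: "\<lbrakk>\<omega> \<in> carrier Hd; \<omega>' \<in> carrier Hd; x \<in> carrier X\<rbrakk> \<Longrightarrow> a (\<omega> \<otimes>\<^bsub>Hd\<^esub> \<omega>') x = a \<omega> (a \<omega>' x)"
  using OD.coassociative_iff_action_mult[OF mX \<alpha>] right_coactionD(4)[OF coact_\<alpha>] by (simp add: Dop_sel)

lemma b_mult: "\<lbrakk>h \<in> carrier H; h' \<in> carrier H; x \<in> carrier X\<rbrakk> \<Longrightarrow> b (h \<otimes>\<^bsub>H\<^esub> h') x = b h (b h' x)"
  using HD.coassociative_iff_action_mult[OF mX \<beta>] right_coactionD(4)[OF coact_\<beta>] by simp

lemma a_one: "x \<in> carrier X \<Longrightarrow> a \<one>\<^bsub>Hd\<^esub> x = x"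
proof -
  assume x: "x \<in> carrier X"
  have "slice X \<epsilon> (\<alpha> x) = slice X \<one>\<^bsub>Hd\<^esub> (\<alpha> x)"
    by (rule slice_cong[OF mX modHop _ \<alpha>c[OF x]]) (use \<epsilon>_lin in \<open>simp_all add: Hd_one_eval\<close>)
  then show ?thesis using right_coactionD(5)[OF coact_\<alpha> x] x by (simp add: actA_app)
qed

lemma b_one: "x \<in> carrier X \<Longrightarrow> b \<one>\<^bsub>H\<^esub> x = x"
  using right_coactionD(5)[OF coact_\<beta>] by (simp add: actB_app)

lemma actD_left: "\<lbrakk>\<omega> \<in> carrier Hd; x \<in> carrier X\<rbrakk> \<Longrightarrow> actD X J (pure K Hd H \<omega> \<one>\<^bsub>H\<^esub>) x = a \<omega> x"
  by (simp add: actD_J_pure b_one)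

lemma actD_right: "\<lbrakk>h \<in> carrier H; x \<in> carrier X\<rbrakk> \<Longrightarrow> actD X J (pure K Hd H \<one>\<^bsub>Hd\<^esub> h) x = b h x"
  by (simp add: actD_J_pure a_one b_closed)

lemma actD_outer_mult:
  assumes \<omega>: "\<omega> \<in> carrier Hd" and h': "h' \<in> carrier H" and w: "w \<in> carrier V" and x: "x \<in> carrier X"
  shows "actD X J (outer_mult \<omega> h' w) x = a \<omega> (actD X J w (b h' x))"
  by (rule linear_ext[OF modHd modH lin_comp[OF actD_lin1[OF x] outer_mult_lin[OF \<omega> h']]
        lin_comp[OF a_lin[OF \<omega>] actD_lin1[OF b_closed[OF h' x]]] mX w])
    (use \<omega> h' x in \<open>simp add: outer_mult_pure actD_J_pure a_mult b_mult b_closed\<close>)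

lemma J_alg_hom: "J \<in> alg_hom K X (tensor K X T)"
proof -
  interpret X: unital_algebra K X by (rule algX)
  have g: "(\<lambda>x. tassoc K X Hop Hd (tmap K (tensor K X Hop) Hd \<alpha> id (\<beta> x))) \<in> alg_hom K X (tensor K X T)"
    using alg_hom_comp[OF alg_hom_comp[OF right_coactionD(3)[OF coact_\<beta>]
        tmap_alg_hom[OF algX algHd tensor_algebra[OF algX algHop] algHd right_coactionD(3)[OF coact_\<alpha>] id_alg_hom]]
        tassoc_alg_hom[OF algX algHop algHd]] .
  show ?thesis
    by (rule alg_homI[OF J_lin]) (use alg_homD(2,3)[OF g] in \<open>simp_all add: J_app\<close>)
qed

text \<open>
  \<open>J\<close> is a composite of algebra homomorphisms, and its counit law follows from those of \<open>\<alpha>\<close> and \<open>\<beta>\<close>. By duality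
  coassociativity means that the double acts multiplicatively:
  \<open>(\<omega> \<bowtie> h)(\<omega>' \<bowtie> h')\<close> acts as the composite of \<open>\<omega>\<close>, \<open>w\<close> and \<open>h'\<close>, where the exchange rule replaces \<open>w\<close> by the
  composite of \<open>h\<close> and \<open>\<omega>'\<close>.
\<close>

theorem joint_right_coaction:
  assumes compat: "yd_rr_compatible K H X \<alpha> \<beta>"
  shows "right_coaction K Co X J"
proof -
  have act_swap: "actD X J w x = b h (a \<omega> x)"
    if "\<omega> \<in> carrier Hd" "h \<in> carrier H" "w \<in> carrier V" "x \<in> carrier X"
      "\<And>t. t \<in> carrier T \<Longrightarrow> pairing K w t = pairing K (pure K Hd H \<omega> h) (AdU t)" for \<omega> h w x
    using compat that unfolding yd_rr_compatible_action by blast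
  have pp: "actD X J (pure K Hd H \<omega> h \<otimes>\<^bsub>Db\<^esub> pure K Hd H \<omega>' h') x = actD X J (pure K Hd H \<omega> h) (actD X J (pure K Hd H \<omega>' h') x)"
    if \<omega>: "\<omega> \<in> carrier Hd" "\<omega>' \<in> carrier Hd" and h: "h \<in> carrier H" "h' \<in> carrier H" and x: "x \<in> carrier X" for \<omega> \<omega>' h h' x
  proof -
    have u: "pure K Hd H \<omega>' h \<in> carrier V" using \<omega> h by simp
    obtain w where w: "w \<in> carrier V" "\<And>t. t \<in> carrier T \<Longrightarrow> pairing K w t = pairing K (pure K Hd H \<omega>' h) (AdU t)"
      using AdU_representable[OF u] by blast
    have dm: "pure K Hd H \<omega> h \<otimes>\<^bsub>Db\<^esub> pure K Hd H \<omega>' h' = outer_mult \<omega> h' w"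
      by (rule double_mult[OF \<omega>(1) h(1) \<omega>(2) h(2) w(1)]) (rule w(2))
    have "actD X J (pure K Hd H \<omega> h \<otimes>\<^bsub>Db\<^esub> pure K Hd H \<omega>' h') x = a \<omega> (actD X J w (b h' x))"
      unfolding dm by (rule actD_outer_mult[OF \<omega>(1) h(2) w(1) x])
    also have "\<dots> = a \<omega> (b h (a \<omega>' (b h' x)))"
      using act_swap[OF \<omega>(2) h(1) w(1) b_closed[OF h(2) x] w(2)] by simp
    finally show ?thesis using \<omega> h x by (simp add: actD_J_pure a_closed b_closed)
  qed
  have m1: "(\<lambda>u. u \<otimes>\<^bsub>Db\<^esub> v) \<in> linear_maps K V V" and m2: "(\<lambda>u. v \<otimes>\<^bsub>Db\<^esub> u) \<in> linear_maps K V V" if "v \<in> carrier V" for v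
    using DC.mult_D_linear[of v] that by (simp_all add: Db_tensor double_sel)
  have mult: "actD X J (u \<otimes>\<^bsub>Db\<^esub> v) x = actD X J u (actD X J v x)"
    if u: "u \<in> carrier V" and v: "v \<in> carrier V" and x: "x \<in> carrier X" for u v x
  proof (rule linear_ext[OF modHd modH lin_comp[OF actD_lin1[OF x] m1[OF v]] actD_lin1[OF actD_closed[OF v x]] mX u])
    fix \<omega> h assume \<omega>: "\<omega> \<in> carrier Hd" and h: "h \<in> carrier H"
    have u': "pure K Hd H \<omega> h \<in> carrier V" using \<omega> h by simp
    show "actD X J (pure K Hd H \<omega> h \<otimes>\<^bsub>Db\<^esub> v) x = actD X J (pure K Hd H \<omega> h) (actD X J v x)"
      by (rule linear_ext[OF modHd modH lin_comp[OF actD_lin1[OF x] m2[OF u']] lin_comp[OF actD_lin[OF u'] actD_lin1[OF x]] mX v])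
        (use pp \<omega> h x in simp)
  qed
  have coassoc: "\<forall>x\<in>carrier X. tassoc K X Co Co (tmap K (tensor K X Co) Co J id (J x)) = tmap K X (tensor K Co Co) id (comult Co) (J x)"
    unfolding DC.coassociative_iff_action_mult[OF mX J_lin_Co] using mult by (simp add: double_sel)
  have counit: "tlift X (\<lambda>y a. counit Co a \<odot>\<^bsub>X\<^esub> y) (J x) = x" if x: "x \<in> carrier X" for x
  proof -
    have "slice X (counit Co) (J x) = slice X (pairing K (pure K Hd H \<one>\<^bsub>Hd\<^esub> \<one>\<^bsub>H\<^esub>)) (J x)"
      by (rule slice_cong[OF mX modT counit_Co_lin J_closed[OF x] counit_Co_pairing])
    also have "\<dots> = x" using x by (simp add: J_slice a_one b_one)
    finally show ?thesis .
  qed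
  show ?thesis
    unfolding right_coaction_def using J_alg_hom coassoc counit by (simp add: joint_coaction_def)
qed

end

context finite_hopf
begin

interpretation OD: bialgebra_pairing K Dop Hop "\<lambda>\<theta> h. \<theta> h" "{..<n}" e d
  by (rule OA.dual_pairing)
interpretation Hd: unital_algebra K Hd by (rule algHd)

lemma coaction_pairI:
  assumes "unital_algebra K X" "right_coaction K Hop X \<alpha>" "right_coaction K Hd X \<beta>"
  shows "coaction_pair K H S n e d X \<alpha> \<beta>"
  by (intro coaction_pair.intro two_coactions.intro finite_hopf_axioms two_coactions_axioms.intro coaction_pair_axioms.intro
      unital_algebra_module right_coactionD(1) assms)

text \<open>
  The actions of \<open>\<omega> \<bowtie> 1\<close> and of \<open>1 \<bowtie> h\<close> recover \<open>\<alpha>\<close> and \<open>\<beta>\<close>.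
\<close>

lemma joint_coaction_inj:
  assumes X: "unital_algebra K X" and "right_coaction K Hop X \<alpha>" "right_coaction K Hd X \<beta>"
    and "right_coaction K Hop X \<alpha>'" "right_coaction K Hd X \<beta>'"
    and eq: "joint_coaction K H X \<alpha> \<beta> = joint_coaction K H X \<alpha>' \<beta>'"
  shows "\<alpha> = \<alpha>'" and "\<beta> = \<beta>'"
proof -
  interpret C: coaction_pair K H S n e d X \<alpha> \<beta> by (rule coaction_pairI) fact+
  interpret C': coaction_pair K H S n e d X \<alpha>' \<beta>' by (rule coaction_pairI) fact+
  show "\<alpha> = \<alpha>'"
  proof (rule extensionalityI)
    fix x assume x: "x \<in> carrier X"
    show "\<alpha> x = \<alpha>' x"
      by (rule OD.slice_sep[OF C.mX C.\<alpha>c[OF x] C'.\<alpha>c[OF x]])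
        (use C.actD_left[OF _ x] C'.actD_left[OF _ x] eq x in \<open>simp add: Dop_sel actA_app\<close>)
  qed (use right_coactionD(2) assms in blast)+
  show "\<beta> = \<beta>'"
  proof (rule extensionalityI)
    fix x assume x: "x \<in> carrier X"
    show "\<beta> x = \<beta>' x"
      by (rule HD.slice_sep[OF C.mX C.\<beta>c[OF x] C'.\<beta>c[OF x]])
        (use C.actD_right[OF _ x] C'.actD_right[OF _ x] eq x in \<open>simp add: actB_app\<close>)
  qed (use right_coactionD(2) assms in blast)+
qed

text \<open>
  Take \<open>\<alpha> = (id \<otimes> id \<otimes> counit)\<gamma>\<close> and \<open>\<beta> = (id \<otimes> counit \<otimes> id)\<gamma>\<close>; they are algebra homomorphisms, as \<open>\<gamma>\<close> is.
  The actions they induce are those of \<open>\<omega> \<bowtie> 1\<close> and \<open>1 \<bowtie> h\<close>, and the products of such elements in the double give the rest: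
  \<open>(\<omega> \<bowtie> 1)(\<omega>' \<bowtie> 1)\<close> and \<open>(1 \<bowtie> h)(1 \<bowtie> h')\<close> coassociativity, \<open>(\<omega> \<bowtie> 1)(1 \<bowtie> h)\<close> the equation \<open>(\<alpha> \<otimes> id)\<beta> = \<gamma>\<close>, and
  \<open>(1 \<bowtie> h)(\<omega> \<bowtie> 1)\<close> compatibility.
\<close>

theorem joint_coaction_surj:
  assumes X: "unital_algebra K X" and \<gamma>: "right_coaction K Co X \<gamma>"
  obtains \<alpha> \<beta> where "right_coaction K Hop X \<alpha>" "right_coaction K Hd X \<beta>" "yd_rr_compatible K H X \<alpha> \<beta>"
    "joint_coaction K H X \<alpha> \<beta> = \<gamma>"
proof -
  interpret X: unital_algebra K X by (rule X)
  note mX = X.module_axioms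
  have \<gamma>l: "\<gamma> \<in> linear_maps K X (tensor K X T)" and \<gamma>lCo: "\<gamma> \<in> linear_maps K X (tensor K X Co)"
    using right_coactionD(1)[OF \<gamma>] by simp_all
  have \<gamma>h: "\<gamma> \<in> alg_hom K X (tensor K X T)" using right_coactionD(3)[OF \<gamma>] by simp
  note \<gamma>c = lin_closed[OF \<gamma>l]
  let ?act = "actD X \<gamma>"
  have act_mult: "?act (u \<otimes>\<^bsub>Db\<^esub> v) x = ?act u (?act v x)" if "u \<in> carrier V" "v \<in> carrier V" "x \<in> carrier X" for u v x
    using DC.coassociative_iff_action_mult[OF mX \<gamma>lCo] right_coactionD(4)[OF \<gamma>] that by (simp add: double_sel)
  have act_closed: "?act u x \<in> carrier X" if "u \<in> carrier V" "x \<in> carrier X" for u x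
    using lin_closed[OF DC.induced_action_linear[OF mX \<gamma>lCo]] that by (simp add: double_sel)
  let ?\<pi>1 = "\<lambda>t. slice Hop (\<lambda>\<theta>. \<theta> \<one>\<^bsub>H\<^esub>) t" and ?\<pi>2 = "\<lambda>t. eps1 t"
  note \<pi>1 = alg_homD(1)[OF slice_one_hom] and \<pi>2 = alg_homD(1)[OF eps1_hom]
  define \<alpha>' where "\<alpha>' x = tmap K X Hop id ?\<pi>1 (\<gamma> x)" for x
  define \<beta>' where "\<beta>' x = tmap K X Hd id ?\<pi>2 (\<gamma> x)" for x
  define \<alpha> where "\<alpha> = restrict \<alpha>' (carrier X)"
  define \<beta> where "\<beta> = restrict \<beta>' (carrier X)"
  have \<alpha>'h: "\<alpha>' \<in> alg_hom K X (tensor K X Hop)"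
    unfolding \<alpha>'_def by (rule alg_hom_comp[OF \<gamma>h tmap_alg_hom[OF X algT X algHop id_alg_hom slice_one_hom]])
  have \<beta>'h: "\<beta>' \<in> alg_hom K X (tensor K X Hd)"
    unfolding \<beta>'_def by (rule alg_hom_comp[OF \<gamma>h tmap_alg_hom[OF X algT X algHd id_alg_hom eps1_hom]])
  have restrict_hom: "restrict f (carrier X) \<in> alg_hom K X Y" if f: "f \<in> alg_hom K X Y" for f and Y :: "('k, 'y) module"
    by (rule alg_homI[OF linear_maps_congI[OF alg_homD(1)[OF f] mX]]) (use alg_homD[OF f] in simp_all)
  note \<alpha>h = restrict_hom[OF \<alpha>'h, folded \<alpha>_def] and \<beta>h = restrict_hom[OF \<beta>'h, folded \<beta>_def]
  interpret C: two_coactions K H S n e d X \<alpha> \<beta>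
    by (intro two_coactions.intro finite_hopf_axioms two_coactions_axioms.intro mX alg_homD(1) \<alpha>h \<beta>h)
  have p1: "?act (pure K Hd H \<omega> \<one>\<^bsub>H\<^esub>) x = C.a \<omega> x" if \<omega>: "\<omega> \<in> carrier Hd" and x: "x \<in> carrier X" for \<omega> x
  proof -
    have \<omega>l: "\<omega> \<in> linear_maps K Hop (ground K)" using Hd_functional[OF \<omega>] by simp
    have "C.a \<omega> x = slice X (\<lambda>t. \<omega> (?\<pi>1 t)) (\<gamma> x)"
      using x slice_tmap[OF mX modT mX modHop id_linear \<pi>1 \<omega>l \<gamma>c[OF x]]
      by (simp add: actA_app \<omega> \<alpha>_def \<alpha>'_def)
    also have "\<dots> = slice X (pairing K (pure K Hd H \<omega> \<one>\<^bsub>H\<^esub>)) (\<gamma> x)"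
      by (rule slice_cong[OF mX modT lin_comp[OF \<omega>l \<pi>1] \<gamma>c[OF x]]) (simp add: pairing_pure_eq_slice \<omega>)
    finally show ?thesis using \<omega> x by (simp add: actD_app)
  qed
  have p2: "?act (pure K Hd H \<one>\<^bsub>Hd\<^esub> h) x = C.b h x" if h: "h \<in> carrier H" and x: "x \<in> carrier X" for h x
  proof -
    have "C.b h x = slice X (\<lambda>t. (?\<pi>2 t) h) (\<gamma> x)"
      using x slice_tmap[OF mX modT mX modHd id_linear \<pi>2 dual_eval_lin[OF h] \<gamma>c[OF x]]
      by (simp add: actB_app h \<beta>_def \<beta>'_def)
    also have "\<dots> = slice X (pairing K (pure K Hd H \<one>\<^bsub>Hd\<^esub> h)) (\<gamma> x)"
      by (rule slice_cong[OF mX modT lin_comp[OF dual_eval_lin[OF h] \<pi>2] \<gamma>c[OF x]]) (simp add: pairing_one_eq_eps1 h)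
    finally show ?thesis using h x by (simp add: actD_app)
  qed
  have one: "?act (pure K Hd H \<one>\<^bsub>Hd\<^esub> \<one>\<^bsub>H\<^esub>) x = x" if x: "x \<in> carrier X" for x
  proof -
    have "slice X (counit Co) (\<gamma> x) = slice X (pairing K (pure K Hd H \<one>\<^bsub>Hd\<^esub> \<one>\<^bsub>H\<^esub>)) (\<gamma> x)"
      by (rule slice_cong[OF mX modT counit_Co_lin \<gamma>c[OF x]])
        (use DC.p_one double_sel counit_Co_pairing in auto)
    then show ?thesis using right_coactionD(5)[OF \<gamma> x] x by (simp add: actD_app)
  qed
  have pure_mult: "C.a \<omega> (C.b h x) = ?act (pure K Hd H \<omega> h) x" if "\<omega> \<in> carrier Hd" "h \<in> carrier H" "x \<in> carrier X" for \<omega> h x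
    using that act_mult[of "pure K Hd H \<omega> \<one>\<^bsub>H\<^esub>" "pure K Hd H \<one>\<^bsub>Hd\<^esub> h" x] double_mult_left[of \<omega> "\<one>\<^bsub>Hd\<^esub>" h]
    by (simp add: p1 p2 C.b_closed)
  have J: "C.J = \<gamma>"
  proof (rule extensionalityI[OF _ right_coactionD(2)[OF \<gamma>]])
    show "C.J \<in> extensional (carrier X)" by (simp add: joint_coaction_def)
    fix x assume x: "x \<in> carrier X"
    show "C.J x = \<gamma> x"
      by (rule T_sep[OF mX C.J_closed[OF x] \<gamma>c[OF x]]) (use x pure_mult in \<open>simp add: C.J_slice actD_app\<close>)
  qed
  have "right_coaction K Hop X \<alpha>"
    unfolding right_coaction_def
  proof (intro conjI IntI \<alpha>h)
    show "\<alpha> \<in> extensional (carrier X)" by (simp add: \<alpha>_def)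
    have "C.a (\<omega> \<otimes>\<^bsub>Hd\<^esub> \<omega>') x = C.a \<omega> (C.a \<omega>' x)" if "\<omega> \<in> carrier Hd" "\<omega>' \<in> carrier Hd" "x \<in> carrier X" for \<omega> \<omega>' x
      using that act_mult[of "pure K Hd H \<omega> \<one>\<^bsub>H\<^esub>" "pure K Hd H \<omega>' \<one>\<^bsub>H\<^esub>" x] double_mult_left[of \<omega> \<omega>' "\<one>\<^bsub>H\<^esub>"]
      by (simp add: p1 C.a_closed)
    then show "\<forall>x\<in>carrier X. tassoc K X Hop Hop (tmap K (tensor K X Hop) Hop \<alpha> id (\<alpha> x)) = tmap K X (tensor K Hop Hop) id (comult Hop) (\<alpha> x)"
      unfolding OD.coassociative_iff_action_mult[OF mX alg_homD(1)[OF \<alpha>h]] by (simp add: Dop_sel)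
    show "\<forall>x\<in>carrier X. tlift X (\<lambda>y a. counit Hop a \<odot>\<^bsub>X\<^esub> y) (\<alpha> x) = x"
    proof
      fix x assume x: "x \<in> carrier X"
      have "slice X (counit Hop) (\<alpha> x) = slice X \<one>\<^bsub>Hd\<^esub> (\<alpha> x)"
        by (rule slice_cong[OF mX modHop _ C.\<alpha>c[OF x]]) (use \<epsilon>_lin in \<open>simp_all add: Hd_one_eval\<close>)
      then show "slice X (counit Hop) (\<alpha> x) = x" using p1[OF Hd.A.one_closed x] one[OF x] x by (simp add: actA_app)
    qed
  qed
  moreover have "right_coaction K Hd X \<beta>"
    unfolding right_coaction_def
  proof (intro conjI IntI \<beta>h)
    show "\<beta> \<in> extensional (carrier X)" by (simp add: \<beta>_def)
    have "C.b (h \<otimes>\<^bsub>H\<^esub> h') x = C.b h (C.b h' x)" if "h \<in> carrier H" "h' \<in> carrier H" "x \<in> carrier X" for h h' x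
      using that act_mult[of "pure K Hd H \<one>\<^bsub>Hd\<^esub> h" "pure K Hd H \<one>\<^bsub>Hd\<^esub> h'" x] double_mult_right[of "\<one>\<^bsub>Hd\<^esub>" h h']
      by (simp add: p2 C.b_closed)
    then show "\<forall>x\<in>carrier X. tassoc K X Hd Hd (tmap K (tensor K X Hd) Hd \<beta> id (\<beta> x)) = tmap K X (tensor K Hd Hd) id (comult Hd) (\<beta> x)"
      unfolding HD.coassociative_iff_action_mult[OF mX alg_homD(1)[OF \<beta>h]] by simp
    show "\<forall>x\<in>carrier X. tlift X (\<lambda>y a. counit Hd a \<odot>\<^bsub>X\<^esub> y) (\<beta> x) = x"
      using p2[OF A.one_closed] one by (simp add: actB_app)
  qed
  moreover have "yd_rr_compatible K H X \<alpha> \<beta>"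
    unfolding C.yd_rr_compatible_action J
  proof (intro ballI impI)
    fix \<omega> h w x assume \<omega>: "\<omega> \<in> carrier Hd" and h: "h \<in> carrier H" and w: "w \<in> carrier V" and x: "x \<in> carrier X"
      and wAd: "\<forall>t\<in>carrier T. pairing K w t = pairing K (pure K Hd H \<omega> h) (AdU t)"
    have "w = pure K Hd H \<one>\<^bsub>Hd\<^esub> h \<otimes>\<^bsub>Db\<^esub> pure K Hd H \<omega> \<one>\<^bsub>H\<^esub>"
      using double_mult_swapped[OF \<omega> h w] wAd by simp
    then show "?act w x = C.b h (C.a \<omega> x)"
      using act_mult[of "pure K Hd H \<one>\<^bsub>Hd\<^esub> h" "pure K Hd H \<omega> \<one>\<^bsub>H\<^esub>" x] \<omega> h x by (simp add: p1 p2 C.a_closed)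
  qed
  ultimately show ?thesis using that J by blast
qed

text \<open>
  In terms of actions: a map commutes with the double iff it commutes with the elements \<open>\<omega> \<bowtie> 1\<close> and \<open>1 \<bowtie> h\<close>,
  as these generate it.
\<close>

lemma coaction_hom_joint_iff:
  assumes X: "unital_algebra K X" "right_coaction K Hop X \<alpha>" "right_coaction K Hd X \<beta>"
    and Y: "unital_algebra K Y" "right_coaction K Hop Y \<alpha>'" "right_coaction K Hd Y \<beta>'"
    and f: "f \<in> linear_maps K X Y"
  shows "coaction_hom K Hop X \<alpha> Y \<alpha>' f \<and> coaction_hom K Hd X \<beta> Y \<beta>' f \<longleftrightarrow>
    coaction_hom K Co X (joint_coaction K H X \<alpha> \<beta>) Y (joint_coaction K H Y \<alpha>' \<beta>') f" (is "?L \<longleftrightarrow> ?R")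
proof -
  interpret C: coaction_pair K H S n e d X \<alpha> \<beta> by (rule coaction_pairI) fact+
  interpret C': coaction_pair K H S n e d Y \<alpha>' \<beta>' by (rule coaction_pairI) fact+
  note fc = lin_closed[OF f]
  have L: "?L \<longleftrightarrow> (\<forall>\<omega>\<in>carrier Hd. \<forall>x\<in>carrier X. f (C.a \<omega> x) = C'.a \<omega> (f x)) \<and>
     (\<forall>h\<in>carrier H. \<forall>x\<in>carrier X. f (C.b h x) = C'.b h (f x))"
    using OD.coaction_hom_iff[OF C.mX C'.mX C.\<alpha> C'.\<alpha> f] HD.coaction_hom_iff[OF C.mX C'.mX C.\<beta> C'.\<beta> f]
    by (simp add: action_hom_def Dop_sel)
  have R: "?R \<longleftrightarrow> (\<forall>u\<in>carrier V. \<forall>x\<in>carrier X. f (actD X C.J u x) = actD Y C'.J u (f x))"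
    using DC.coaction_hom_iff[OF C.mX C'.mX C.J_lin_Co C'.J_lin_Co f] by (simp add: action_hom_def double_sel)
  show ?thesis
    unfolding L R
  proof (intro iffI conjI ballI; (elim conjE)?)
    fix u x assume u: "u \<in> carrier V" and x: "x \<in> carrier X"
      and 1: "\<forall>\<omega>\<in>carrier Hd. \<forall>x\<in>carrier X. f (C.a \<omega> x) = C'.a \<omega> (f x)"
      and 2: "\<forall>h\<in>carrier H. \<forall>x\<in>carrier X. f (C.b h x) = C'.b h (f x)"
    show "f (actD X C.J u x) = actD Y C'.J u (f x)"
      by (rule linear_ext[OF modHd modH lin_comp[OF f C.actD_lin1[OF x]] C'.actD_lin1[OF fc[OF x]] C'.mX u])
        (use 1 2 x fc in \<open>simp add: C.actD_J_pure C'.actD_J_pure C.b_closed\<close>)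
  next
    fix \<omega> x assume \<omega>: "\<omega> \<in> carrier Hd" and x: "x \<in> carrier X"
      and R: "\<forall>u\<in>carrier V. \<forall>x\<in>carrier X. f (actD X C.J u x) = actD Y C'.J u (f x)"
    show "f (C.a \<omega> x) = C'.a \<omega> (f x)"
      using R[rule_format, of "pure K Hd H \<omega> \<one>\<^bsub>H\<^esub>" x] \<omega> x fc by (simp add: C.actD_left C'.actD_left)
  next
    fix h x assume h: "h \<in> carrier H" and x: "x \<in> carrier X"
      and R: "\<forall>u\<in>carrier V. \<forall>x\<in>carrier X. f (actD X C.J u x) = actD Y C'.J u (f x)"
    show "f (C.b h x) = C'.b h (f x)"
      using R[rule_format, of "pure K Hd H \<one>\<^bsub>Hd\<^esub> h" x] h x fc by (simp add: C.actD_right C'.actD_right)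
  qed
qed

section \<open>The square of functors\<close>

lemma rr_comod_iso:
  "category_iso (YD_rr K H :: (('k, 'x, 'h) yd_rr, 'x \<Rightarrow> 'x) category)
     (Alg_comod K Co :: (('k, 'x, ('h, 'h \<Rightarrow> 'k) tens) comod_alg, 'x \<Rightarrow> 'x) category)
     (\<lambda>(X, \<alpha>, \<beta>). (X, joint_coaction K H X \<alpha> \<beta>))"
  unfolding YD_rr_def Alg_comod_def
proof (rule category_of_algebras_iso)
  let ?F = "(\<lambda>(X, \<alpha>, \<beta>). (X, joint_coaction K H X \<alpha> \<beta>)) :: ('k, 'x, 'h) yd_rr \<Rightarrow> ('k, 'x, ('h, 'h \<Rightarrow> 'k) tens) comod_alg"
  show "bij_betw ?F {A \<in> {(X, \<alpha>, \<beta>). right_coaction K Hop X \<alpha> \<and> right_coaction K Hd X \<beta> \<and> yd_rr_compatible K H X \<alpha> \<beta>}.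
       unital_algebra K (fst A)} {A \<in> {(X, \<gamma>). right_coaction K Co X \<gamma>}. unital_algebra K (fst A)}" (is "bij_betw _ ?O1 ?O2")
    unfolding bij_betw_def
  proof (intro conjI inj_onI equalityI subsetI)
    fix a b assume "a \<in> ?O1" "b \<in> ?O1" "?F a = ?F b"
    then show "a = b" using joint_coaction_inj by (auto split: prod.splits)
  next
    fix a assume "a \<in> ?F ` ?O1"
    then show "a \<in> ?O2" using coaction_pair.joint_right_coaction[OF coaction_pairI] by auto
  next
    fix a assume "a \<in> ?O2"
    then obtain X \<gamma> where a: "a = (X, \<gamma>)" "unital_algebra K X" "right_coaction K Co X \<gamma>" by (cases a) auto
    then obtain \<alpha> \<beta> where "right_coaction K Hop X \<alpha>" "right_coaction K Hd X \<beta>" "yd_rr_compatible K H X \<alpha> \<beta>"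
      "joint_coaction K H X \<alpha> \<beta> = \<gamma>" using joint_coaction_surj by blast
    then show "a \<in> ?F ` ?O1" using a by (auto intro!: image_eqI[of _ _ "(X, \<alpha>, \<beta>)"])
  qed
qed (auto simp: coaction_hom_joint_iff[symmetric] alg_homD(1))

text \<open>
  \<open>\<alpha>\<close> is kept, and \<open>\<beta>\<close> is traded for its induced action by the duality of \<open>H\<close> and \<open>dual H\<close>.
\<close>

lemma rr_YD_iso:
  "category_iso (YD_rr K H :: (('k, 'x, 'h) yd_rr, 'x \<Rightarrow> 'x) category)
     (YD K H :: (('k, 'x, 'h) yd, 'x \<Rightarrow> 'x) category)
     (\<lambda>(X, \<alpha>, \<beta>). (X, actB X \<beta>, \<alpha>))"
  unfolding YD_rr_def YD_def
proof (rule category_of_algebras_iso)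
  let ?F = "(\<lambda>(X, \<alpha>, \<beta>). (X, actB X \<beta>, \<alpha>)) :: ('k, 'x, 'h) yd_rr \<Rightarrow> ('k, 'x, 'h) yd"
  have compat: "yd_rr_compatible K H X \<alpha> \<beta> \<longleftrightarrow> yd_compatible K H X (actB X \<beta>) \<alpha>"
    if "unital_algebra K X" "right_coaction K Hop X \<alpha>" "right_coaction K Hd X \<beta>" for X :: "('k, 'x) module" and \<alpha> \<beta>
  proof -
    interpret C: coaction_pair K H S n e d X \<alpha> \<beta> by (rule coaction_pairI) fact+
    show ?thesis by (rule C.yd_rr_compatible_iff_yd_compatible)
  qed
  show "bij_betw ?F {A \<in> {(X, \<alpha>, \<beta>). right_coaction K Hop X \<alpha> \<and> right_coaction K Hd X \<beta> \<and> yd_rr_compatible K H X \<alpha> \<beta>}.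
       unital_algebra K (fst A)}
     {A \<in> {(X, act, \<alpha>). left_action K H X act \<and> right_coaction K Hop X \<alpha> \<and> yd_compatible K H X act \<alpha>}. unital_algebra K (fst A)}"
     (is "bij_betw _ ?O1 ?O2")
    unfolding bij_betw_def
  proof (intro conjI inj_onI equalityI subsetI)
    fix a b assume "a \<in> ?O1" "b \<in> ?O1" "?F a = ?F b"
    then show "a = b" by (auto intro!: HD.induced_action_inj dest: right_coactionD)
  next
    fix a assume "a \<in> ?F ` ?O1"
    then show "a \<in> ?O2"
      using HD.right_coaction_iff_left_action right_coactionD(1,2)[of K Hd] compat by fastforce
  next
    fix a assume "a \<in> ?O2"
    then obtain X act \<alpha> where a: "a = (X, act, \<alpha>)" "unital_algebra K X" "left_action K H X act" "right_coaction K Hop X \<alpha>"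
      "yd_compatible K H X act \<alpha>" by (cases a) auto
    then obtain \<beta> where "right_coaction K Hd X \<beta>" "actB X \<beta> = act" using HD.coaction_exists by blast
    then show "a \<in> ?F ` ?O1" using a compat[of X \<alpha> \<beta>] by (auto intro!: image_eqI[of _ _ "(X, \<alpha>, \<beta>)"])
  qed
qed (auto simp: HD.coaction_hom_iff right_coactionD alg_homD(1))

lemma square_commutes:
  assumes A: "A \<in> Ob (YD_rr K H :: (('k, 'x, 'h) yd_rr, 'x \<Rightarrow> 'x) category)"
  shows "fst (functor_comod_to_mod K H) (fst (functor_E K H) A) = fst (functor_YD_to_mod K H) (fst (functor_rr_to_YD H) A)"
proof -
  obtain X \<alpha> \<beta> where A': "A = (X, \<alpha>, \<beta>)" "unital_algebra K X" "right_coaction K Hop X \<alpha>" "right_coaction K Hd X \<beta>"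
    using A by (cases A) (auto simp: YD_rr_def category_of_algebras_sel)
  interpret C: coaction_pair K H S n e d X \<alpha> \<beta> by (rule coaction_pairI) fact+
  have "actD X C.J = (\<lambda>u\<in>carrier Db. \<lambda>x\<in>carrier X.
      tlift X (\<lambda>\<omega> h. tlift X (\<lambda>y0 y1. \<omega> y1 \<odot>\<^bsub>X\<^esub> y0) (\<alpha> (actB X \<beta> h x))) u)"
  proof (rule extensionalityI)
    fix u assume u: "u \<in> carrier Db"
    show "actD X C.J u = (\<lambda>u\<in>carrier Db. \<lambda>x\<in>carrier X.
      tlift X (\<lambda>\<omega> h. tlift X (\<lambda>y0 y1. \<omega> y1 \<odot>\<^bsub>X\<^esub> y0) (\<alpha> (actB X \<beta> h x))) u) u"
      by (rule extensionalityI[of _ "carrier X"])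
        (use u C.actD_eq_tlift in \<open>simp_all add: induced_action_def double_sel\<close>)
  qed (simp_all add: induced_action_def)
  then show ?thesis
    by (simp add: A' functor_comod_to_mod_def functor_E_def functor_YD_to_mod_def functor_rr_to_YD_def)
qed

end

text \<open>
  The choice in \<open>canU\<close> is made among sums over dual bases, so that some dual bases realise it.
\<close>

lemma finite_hopf_exists:
  assumes "hopf_algebra K H S" and "finite_dimensional K H"
  obtains n e d where "finite_hopf K H S n e d"
proof -
  interpret hopf_algebra K H S by fact
  obtain n e where "is_basis K H n e" using assms(2) by (auto simp: finite_dimensional_def)
  then obtain d where "dual_bases K H n e d"
    using dual_bases_exist[OF unital_algebra_module[OF unital_algebra_axioms]] by blast
  then have "\<exists>u n e d. dual_bases K H n e d \<and>
     u = (\<Oplus>\<^bsub>op_dual K H\<^esub>i\<in>{..<n}. pure K (opp H) (dual K H) (e i) (d i))" by blast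
  then have "\<exists>n e d. dual_bases K H n e d \<and>
     canU K H = (\<Oplus>\<^bsub>op_dual K H\<^esub>i\<in>{..<n}. pure K (opp H) (dual K H) (e i) (d i))"
    unfolding canU_def by (rule someI_ex)
  then show ?thesis
    using that assms(1) by (blast intro: finite_hopf.intro finite_hopf_axioms.intro)
qed

theorem proposition5p7:
  fixes K :: "('k, 'l) ring_scheme" and H :: "('k, 'h) bialgebra" and S :: "'h \<Rightarrow> 'h"
  assumes "field K" and "hopf_algebra K H S" and "finite_dimensional K H"
  shows
    "is_equivalence
       (YD_rr K H :: (('k, 'x, 'h) yd_rr, 'x \<Rightarrow> 'x) category)
       (Alg_comod K (codouble K H) :: (('k, 'x, ('h, 'h \<Rightarrow> 'k) tens) comod_alg, 'x \<Rightarrow> 'x) category)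
       (functor_E K H) \<and>
     is_equivalence
       (Alg_comod K (codouble K H) :: (('k, 'x, ('h, 'h \<Rightarrow> 'k) tens) comod_alg, 'x \<Rightarrow> 'x) category)
       (Alg_mod K (double K H) :: (('k, 'x, ('h \<Rightarrow> 'k, 'h) tens) mod_alg, 'x \<Rightarrow> 'x) category)
       (functor_comod_to_mod K H) \<and>
     is_equivalence
       (YD_rr K H :: (('k, 'x, 'h) yd_rr, 'x \<Rightarrow> 'x) category)
       (YD K H :: (('k, 'x, 'h) yd, 'x \<Rightarrow> 'x) category)
       (functor_rr_to_YD H) \<and>
     is_equivalence
       (YD K H :: (('k, 'x, 'h) yd, 'x \<Rightarrow> 'x) category)
       (Alg_mod K (double K H) :: (('k, 'x, ('h \<Rightarrow> 'k, 'h) tens) mod_alg, 'x \<Rightarrow> 'x) category)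
       (functor_YD_to_mod K H) \<and>
     equal_functors
       (YD_rr K H :: (('k, 'x, 'h) yd_rr, 'x \<Rightarrow> 'x) category)
       (comp_functor (functor_comod_to_mod K H) (functor_E K H))
       (comp_functor (functor_YD_to_mod K H) (functor_rr_to_YD H))"
proof -
  obtain n e d where "finite_hopf K H S n e d" using finite_hopf_exists[OF assms(2,3)] by blast
  then interpret finite_hopf K H S n e d .
  let ?R = "YD_rr K H :: (('k, 'x, 'h) yd_rr, 'x \<Rightarrow> 'x) category"
  let ?C = "Alg_comod K (codouble K H) :: (('k, 'x, ('h, 'h \<Rightarrow> 'k) tens) comod_alg, 'x \<Rightarrow> 'x) category"
  let ?M = "Alg_mod K (double K H) :: (('k, 'x, ('h \<Rightarrow> 'k, 'h) tens) mod_alg, 'x \<Rightarrow> 'x) category"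
  let ?Y = "YD K H :: (('k, 'x, 'h) yd, 'x \<Rightarrow> 'x) category"
  have E: "category_iso ?R ?C (fst (functor_E K H))"
    using rr_comod_iso by (simp add: functor_E_def)
  have M: "category_iso ?C ?M (fst (functor_comod_to_mod K H))"
    using DC.comod_mod_iso by (simp add: functor_comod_to_mod_def)
  have Y: "category_iso ?R ?Y (fst (functor_rr_to_YD H))"
    using rr_YD_iso by (simp add: functor_rr_to_YD_def)
  have YM: "category_iso ?Y ?M (fst (functor_YD_to_mod K H))"
    by (rule category_iso_cancel[OF Y category_iso_comp[OF E M]]) (simp add: square_commutes)
  (* The category laws are verified where the objects are simplest and transported along the isomorphisms. *)
  have cat: "is_category ?M" by (rule Alg_mod_category)
  then have "is_category ?C" "is_category ?Y"
    using category_iso_category[OF M] category_iso_category[OF YM] by simp_all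
  moreover from this have "is_category ?R" using category_iso_category[OF E] by simp
  moreover have "F = (fst F, \<lambda>A B f. f)" if "snd F = (\<lambda>A B f. f)" for F :: "('o, 'm, 'p, 'm) funct"
    using that by (cases F) simp
  ultimately show ?thesis
    using category_iso_equivalence[OF E] category_iso_equivalence[OF M] category_iso_equivalence[OF Y] category_iso_equivalence[OF YM]
    by (simp add: equal_functors_def comp_functor_def square_commutes)
      (simp add: functor_E_def functor_comod_to_mod_def functor_rr_to_YD_def functor_YD_to_mod_def)
qed

end
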